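(* Let $\mathcal{M}$ be a bicomplete abelian category with enough projectives and enough injectives in which every coproduct of monomorphisms is a monomorphism and every product of epimorphisms is an epimorphism, and let $Q$ be a left rooted quiver. Let $(\mathcal{C},\mathcal{W})$ be a hereditary projective cotorsion pair in $\mathcal{M}$ with $\mathcal{W}$ closed under small coproducts. Then there exists a projective model structure on the category of representations $\mathrm{Rep}_Q\mathcal{M}$ with hereditary Hovey triple $$(\Phi(\mathcal{C}),\ \mathrm{Rep}_Q\mathcal{W},\ \mathrm{Rep}_Q\mathcal{M}).$$
   Context: **Cotorsion pairs.** For a class $\mathcal{S}$ of objects in an abelian category $\mathcal{A}$, $\mathcal{S}^{\perp}$ is the class of $M$ with $\mathrm{Ext}^1_{\mathcal{A}}(S,M)=0$ for all $S\in\mathcal{S}$, and ${}^{\perp}\mathcal{S}$ is the class of $M$ with $\mathrm{Ext}^1_{\mathcal{A}}(M,S)=0$ for all $S\in\mathcal{S}$. A pair $(\mathcal{X},\mathcal{Y})$ of classes is a cotorsion pair if $\mathcal{X}={}^{\perp}\mathcal{Y}$ and $\mathcal{Y}=\mathcal{X}^{\perp}$. It is complete if for every object $M$ there are short exact sequences $0\to Y\to X\to M\to 0$ and $0\to M\to Y'\to X'\to 0$ with $X,X'\in\mathcal{X}$ and $Y,Y'\in\mathcal{Y}$. It is hereditary if $\mathrm{Ext}^i_{\mathcal{A}}(X,Y)=0$ for all $X\in\mathcal{X}$, $Y\in\mathcal{Y}$, $i\ge 1$. **Hovey triples and model structures.** A class $\mathcal{W}$ is thick if it is closed under direct summands and whenever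 two of the three terms in a short exact sequence are in $\mathcal{W}$, so is the third. A Hovey triple on $\mathcal{A}$ is a triple $(\mathcal{C},\mathcal{W},\mathcal{F})$ of classes of objects with $\mathcal{W}$ thick such that $(\mathcal{C}\cap\mathcal{W},\mathcal{F})$ and $(\mathcal{C},\mathcal{W}\cap\mathcal{F})$ are complete cotorsion pairs; it is hereditary if both of these cotorsion pairs are hereditary. By Hovey's correspondence, a Hovey triple is the same as an abelian model structure on $\mathcal{A}$ with $\mathcal{C}$, $\mathcal{W}$, $\mathcal{F}$ the classes of cofibrant, trivial and fibrant objects: the (trivial) cofibrations are the monomorphisms with cokernel in $\mathcal{C}$ (resp. $\mathcal{C}\cap\mathcal{W}$) and the (trivial) fibrations are the epimorphisms with kernel in $\mathcal{F}$ (resp. $\mathcal{F}\cap\mathcal{W}$). If $\mathcal{A}$ has enough projectives, a complete cotorsion pair $(\mathcal{C},\mathcal{W})$ in $\mathcal{A}$ is called projective if $\mathcal{C}\cap\mathcal{W}=\mathrm{Proj}\,\mathcal{A}$ (the class of projective objects) and $\mathcal{W}$ is thick; then $(\mathcal{C},\mathcal{W},\mathcal{A})$ is a Hovey triple. An abelian model structure is called projective if its Hovey triple is of the form $(\mathcal{C},\mathcal{W},\mathcal{A})$ for a projective cotorsion pair $(\mathcal{C},\mathcal{W})$ in $\mathcal{A}$. **Quivers.** A quiver $Q$ is a directed graph with vertex set $Q_0$ and arrow set $Q_1$; $s(\alpha)$ and $t(\alpha)$ denote the source and target of $\alpha\in Q_1$. Put $V_0=\emptyset$, $V_{\beta+1}=\{i\in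 Q_0 \mid i$ is not the target of any arrow with source outside $V_\beta\}$, and $V_\alpha=\bigcup_{\beta<\alpha}V_\beta$ for limit ordinals $\alpha$. $Q$ is left rooted if $V_\lambda=Q_0$ for some ordinal $\lambda$ (equivalently, $Q$ has no infinite path of the form $\cdots\to\bullet\to\bullet\to\bullet$). $\mathrm{Rep}_Q\mathcal{M}$ is the category of $\mathcal{M}$-valued representations of $Q$, i.e. functors to $\mathcal{M}$ from the category freely generated by $Q$. For a class $\mathcal{X}$ of objects of $\mathcal{M}$, $\mathrm{Rep}_Q\mathcal{X}$ is the class of $X\in\mathrm{Rep}_Q\mathcal{M}$ with $X(i)\in\mathcal{X}$ for all $i\in Q_0$. For a representation $X$ and $i\in Q_0$ let $\phi_i^X:\bigoplus_{\alpha:j\to i}X(j)\to X(i)$ be the natural map, the coproduct being over all arrows with target $i$. For a class $\mathcal{A}$ of objects of $\mathcal{M}$, $$\Phi(\mathcal{A})=\{X\in\mathrm{Rep}_Q\mathcal{M}\mid \forall i\in Q_0:\ \phi_i^X \text{ is monic},\ X(i)\in\mathcal{A},\ \mathrm{coker}\,\phi_i^X\in\mathcal{A}\}.$$ *)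

theory Defs
  imports "HOL-Algebra.Group"
begin

section \<open>Categories\<close>

text \<open>
  \<open>g \<cdot>\<^bsub>A\<^esub> f\<close> is ``\<open>g\<close> after \<open>f\<close>''. The operations are only meaningful on the carriers
  \<open>Ob A\<close>, \<open>Ar A\<close>.
\<close>

record ('o, 'm) precat =
  Ob :: "'o set"
  Ar :: "'m set"
  Dom :: "'m \<Rightarrow> 'o"
  Cod :: "'m \<Rightarrow> 'o"
  Ident :: "'o \<Rightarrow> 'm"
  Comp :: "'m \<Rightarrow> 'm \<Rightarrow> 'm"  (infixl "\<cdot>\<index>" 70)

definition Hom :: "('o, 'm, 'z) precat_scheme \<Rightarrow> 'o \<Rightarrow> 'o \<Rightarrow> 'm set" where
  "Hom A X Y = {f \<in> Ar A. Dom A f = X \<and> Cod A f = Y}"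

definition category :: "('o, 'm, 'z) precat_scheme \<Rightarrow> bool" where
  "category A \<longleftrightarrow>
     (\<forall>f \<in> Ar A. Dom A f \<in> Ob A \<and> Cod A f \<in> Ob A) \<and>
     (\<forall>X \<in> Ob A. Ident A X \<in> Hom A X X) \<and>
     (\<forall>f \<in> Ar A. \<forall>g \<in> Ar A. Cod A f = Dom A g \<longrightarrow> g \<cdot>\<^bsub>A\<^esub> f \<in> Hom A (Dom A f) (Cod A g)) \<and>
     (\<forall>f \<in> Ar A. f \<cdot>\<^bsub>A\<^esub> Ident A (Dom A f) = f \<and> Ident A (Cod A f) \<cdot>\<^bsub>A\<^esub> f = f) \<and>
     (\<forall>f \<in> Ar A. \<forall>g \<in> Ar A. \<forall>h \<in> Ar A. Cod A f = Dom A g \<and> Cod A g = Dom A h \<longrightarrow>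
        h \<cdot>\<^bsub>A\<^esub> (g \<cdot>\<^bsub>A\<^esub> f) = (h \<cdot>\<^bsub>A\<^esub> g) \<cdot>\<^bsub>A\<^esub> f)"

definition monic :: "('o, 'm, 'z) precat_scheme \<Rightarrow> 'm \<Rightarrow> bool" where
  "monic A f \<longleftrightarrow> f \<in> Ar A \<and>
     (\<forall>g \<in> Ar A. \<forall>h \<in> Ar A. Dom A g = Dom A h \<and> Cod A g = Dom A f \<and> Cod A h = Dom A f \<and>
        f \<cdot>\<^bsub>A\<^esub> g = f \<cdot>\<^bsub>A\<^esub> h \<longrightarrow> g = h)"

definition epic :: "('o, 'm, 'z) precat_scheme \<Rightarrow> 'm \<Rightarrow> bool" where
  "epic A f \<longleftrightarrow> f \<in> Ar A \<and>
     (\<forall>g \<in> Ar A. \<forall>h \<in> Ar A. Cod A g = Cod A h \<and> Dom A g = Cod A f \<and> Dom A h = Cod A f \<and>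
        g \<cdot>\<^bsub>A\<^esub> f = h \<cdot>\<^bsub>A\<^esub> f \<longrightarrow> g = h)"

definition zero_object :: "('o, 'm, 'z) precat_scheme \<Rightarrow> 'o \<Rightarrow> bool" where
  "zero_object A Z \<longleftrightarrow> Z \<in> Ob A \<and>
     (\<forall>X \<in> Ob A. (\<exists>!f. f \<in> Hom A Z X) \<and> (\<exists>!f. f \<in> Hom A X Z))"

definition is_coproduct ::
  "('o, 'm, 'z) precat_scheme \<Rightarrow> 'i set \<Rightarrow> ('i \<Rightarrow> 'o) \<Rightarrow> 'o \<Rightarrow> ('i \<Rightarrow> 'm) \<Rightarrow> bool" where
  "is_coproduct A I X S \<iota> \<longleftrightarrow> S \<in> Ob A \<and> (\<forall>i \<in> I. X i \<in> Ob A \<and> \<iota> i \<in> Hom A (X i) S) \<and>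
     (\<forall>T \<in> Ob A. \<forall>t. (\<forall>i \<in> I. t i \<in> Hom A (X i) T) \<longrightarrow>
        (\<exists>!u. u \<in> Hom A S T \<and> (\<forall>i \<in> I. u \<cdot>\<^bsub>A\<^esub> \<iota> i = t i)))"

definition is_product ::
  "('o, 'm, 'z) precat_scheme \<Rightarrow> 'i set \<Rightarrow> ('i \<Rightarrow> 'o) \<Rightarrow> 'o \<Rightarrow> ('i \<Rightarrow> 'm) \<Rightarrow> bool" where
  "is_product A I X P \<pi> \<longleftrightarrow> P \<in> Ob A \<and> (\<forall>i \<in> I. X i \<in> Ob A \<and> \<pi> i \<in> Hom A P (X i)) \<and>
     (\<forall>T \<in> Ob A. \<forall>t. (\<forall>i \<in> I. t i \<in> Hom A T (X i)) \<longrightarrow>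
        (\<exists>!u. u \<in> Hom A T P \<and> (\<forall>i \<in> I. \<pi> i \<cdot>\<^bsub>A\<^esub> u = t i)))"

definition projective :: "('o, 'm, 'z) precat_scheme \<Rightarrow> 'o \<Rightarrow> bool" where
  "projective A P \<longleftrightarrow> P \<in> Ob A \<and>
     (\<forall>e f. epic A e \<and> f \<in> Hom A P (Cod A e) \<longrightarrow> (\<exists>g \<in> Hom A P (Dom A e). e \<cdot>\<^bsub>A\<^esub> g = f))"

definition injective :: "('o, 'm, 'z) precat_scheme \<Rightarrow> 'o \<Rightarrow> bool" where
  "injective A E \<longleftrightarrow> E \<in> Ob A \<and>
     (\<forall>m f. monic A m \<and> f \<in> Hom A (Dom A m) E \<longrightarrow> (\<exists>g \<in> Hom A (Cod A m) E. g \<cdot>\<^bsub>A\<^esub> m = f))"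

definition Proj :: "('o, 'm, 'z) precat_scheme \<Rightarrow> 'o set" where
  "Proj A = {P. projective A P}"

definition enough_projectives :: "('o, 'm, 'z) precat_scheme \<Rightarrow> bool" where
  "enough_projectives A \<longleftrightarrow> (\<forall>X \<in> Ob A. \<exists>e. projective A (Dom A e) \<and> epic A e \<and> Cod A e = X)"

definition enough_injectives :: "('o, 'm, 'z) precat_scheme \<Rightarrow> bool" where
  "enough_injectives A \<longleftrightarrow> (\<forall>X \<in> Ob A. \<exists>m. injective A (Cod A m) \<and> monic A m \<and> Dom A m = X)"

section \<open>Functors and (co)limits\<close>

record ('a, 'b, 'o, 'm) diagram =
  obj_map :: "'a \<Rightarrow> 'o"
  arr_map :: "'b \<Rightarrow> 'm"

text \<open>
  Functors and natural transformations are extensional (\<open>\<rightarrow>\<^sub>E\<close>): they are \<^const>\<open>undefined\<close> off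
  their domains, so that HOL equality is equality of functors and of transformations.
\<close>

definition is_functor ::
  "('a, 'b, 'y) precat_scheme \<Rightarrow> ('o, 'm, 'z) precat_scheme \<Rightarrow> ('a, 'b, 'o, 'm) diagram \<Rightarrow> bool" where
  "is_functor J A F \<longleftrightarrow>
     obj_map F \<in> Ob J \<rightarrow>\<^sub>E Ob A \<and> arr_map F \<in> Ar J \<rightarrow>\<^sub>E Ar A \<and>
     (\<forall>f \<in> Ar J. arr_map F f \<in> Hom A (obj_map F (Dom J f)) (obj_map F (Cod J f))) \<and>
     (\<forall>j \<in> Ob J. arr_map F (Ident J j) = Ident A (obj_map F j)) \<and>
     (\<forall>f \<in> Ar J. \<forall>g \<in> Ar J. Cod J f = Dom J g \<longrightarrow>
        arr_map F (g \<cdot>\<^bsub>J\<^esub> f) = arr_map F g \<cdot>\<^bsub>A\<^esub> arr_map F f)"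

definition is_nat_trans ::
  "('a, 'b, 'y) precat_scheme \<Rightarrow> ('o, 'm, 'z) precat_scheme \<Rightarrow> ('a, 'b, 'o, 'm) diagram \<Rightarrow>
    ('a \<Rightarrow> 'm) \<Rightarrow> ('a, 'b, 'o, 'm) diagram \<Rightarrow> bool" where
  "is_nat_trans J A F \<tau> G \<longleftrightarrow> is_functor J A F \<and> is_functor J A G \<and>
     \<tau> \<in> extensional (Ob J) \<and>
     (\<forall>j \<in> Ob J. \<tau> j \<in> Hom A (obj_map F j) (obj_map G j)) \<and>
     (\<forall>f \<in> Ar J. \<tau> (Cod J f) \<cdot>\<^bsub>A\<^esub> arr_map F f = arr_map G f \<cdot>\<^bsub>A\<^esub> \<tau> (Dom J f))"

definition is_cone ::
  "('a, 'b, 'y) precat_scheme \<Rightarrow> ('o, 'm, 'z) precat_scheme \<Rightarrow> ('a, 'b, 'o, 'm) diagram \<Rightarrow>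
    'o \<Rightarrow> ('a \<Rightarrow> 'm) \<Rightarrow> bool" where
  "is_cone J A F T t \<longleftrightarrow> T \<in> Ob A \<and> (\<forall>j \<in> Ob J. t j \<in> Hom A T (obj_map F j)) \<and>
     (\<forall>f \<in> Ar J. arr_map F f \<cdot>\<^bsub>A\<^esub> t (Dom J f) = t (Cod J f))"

definition is_cocone ::
  "('a, 'b, 'y) precat_scheme \<Rightarrow> ('o, 'm, 'z) precat_scheme \<Rightarrow> ('a, 'b, 'o, 'm) diagram \<Rightarrow>
    'o \<Rightarrow> ('a \<Rightarrow> 'm) \<Rightarrow> bool" where
  "is_cocone J A F T t \<longleftrightarrow> T \<in> Ob A \<and> (\<forall>j \<in> Ob J. t j \<in> Hom A (obj_map F j) T) \<and>
     (\<forall>f \<in> Ar J. t (Cod J f) \<cdot>\<^bsub>A\<^esub> arr_map F f = t (Dom J f))"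

definition is_limit ::
  "('a, 'b, 'y) precat_scheme \<Rightarrow> ('o, 'm, 'z) precat_scheme \<Rightarrow> ('a, 'b, 'o, 'm) diagram \<Rightarrow>
    'o \<Rightarrow> ('a \<Rightarrow> 'm) \<Rightarrow> bool" where
  "is_limit J A F L \<pi> \<longleftrightarrow> is_cone J A F L \<pi> \<and>
     (\<forall>T t. is_cone J A F T t \<longrightarrow>
        (\<exists>!u. u \<in> Hom A T L \<and> (\<forall>j \<in> Ob J. \<pi> j \<cdot>\<^bsub>A\<^esub> u = t j)))"

definition is_colimit ::
  "('a, 'b, 'y) precat_scheme \<Rightarrow> ('o, 'm, 'z) precat_scheme \<Rightarrow> ('a, 'b, 'o, 'm) diagram \<Rightarrow>
    'o \<Rightarrow> ('a \<Rightarrow> 'm) \<Rightarrow> bool" where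
  "is_colimit J A F L \<iota> \<longleftrightarrow> is_cocone J A F L \<iota> \<and>
     (\<forall>T t. is_cocone J A F T t \<longrightarrow>
        (\<exists>!u. u \<in> Hom A L T \<and> (\<forall>j \<in> Ob J. u \<cdot>\<^bsub>A\<^esub> \<iota> j = t j)))"

text \<open>
  Smallness is relative to a type \<open>'k\<close>: a set or category is small if its elements (objects and
  morphisms) are drawn from \<open>'k\<close>. As \<open>'k\<close> is a free type variable, the bound on the size is
  arbitrary; only \<^prop>\<open>infinite (UNIV :: 'k set)\<close> will be required of it.
\<close>

definition bicomplete :: "'k itself \<Rightarrow> ('o, 'm, 'z) precat_scheme \<Rightarrow> bool" where
  "bicomplete _ A \<longleftrightarrow>
     (\<forall>(J :: ('k, 'k) precat) F. category J \<and> is_functor J A F \<longrightarrow>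
        (\<exists>L \<pi>. is_limit J A F L \<pi>) \<and> (\<exists>L \<iota>. is_colimit J A F L \<iota>))"

definition coproducts_of_monics_monic :: "'k itself \<Rightarrow> ('o, 'm, 'z) precat_scheme \<Rightarrow> bool" where
  "coproducts_of_monics_monic _ A \<longleftrightarrow>
     (\<forall>(I :: 'k set) X Y S \<iota> T \<kappa> f h.
        is_coproduct A I X S \<iota> \<and> is_coproduct A I Y T \<kappa> \<and>
        (\<forall>i \<in> I. f i \<in> Hom A (X i) (Y i) \<and> monic A (f i)) \<and>
        h \<in> Hom A S T \<and> (\<forall>i \<in> I. h \<cdot>\<^bsub>A\<^esub> \<iota> i = \<kappa> i \<cdot>\<^bsub>A\<^esub> f i) \<longrightarrow> monic A h)"

definition products_of_epics_epic :: "'k itself \<Rightarrow> ('o, 'm, 'z) precat_scheme \<Rightarrow> bool" where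
  "products_of_epics_epic _ A \<longleftrightarrow>
     (\<forall>(I :: 'k set) X Y P \<pi> R \<rho> f h.
        is_product A I X P \<pi> \<and> is_product A I Y R \<rho> \<and>
        (\<forall>i \<in> I. f i \<in> Hom A (X i) (Y i) \<and> epic A (f i)) \<and>
        h \<in> Hom A P R \<and> (\<forall>i \<in> I. \<rho> i \<cdot>\<^bsub>A\<^esub> h = f i \<cdot>\<^bsub>A\<^esub> \<pi> i) \<longrightarrow> epic A h)"

definition closed_under_small_coproducts ::
  "'k itself \<Rightarrow> ('o, 'm, 'z) precat_scheme \<Rightarrow> 'o set \<Rightarrow> bool" where
  "closed_under_small_coproducts _ A W \<longleftrightarrow>
     (\<forall>(I :: 'k set) X S \<iota>. is_coproduct A I X S \<iota> \<and> (\<forall>i \<in> I. X i \<in> W) \<longrightarrow> S \<in> W)"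

section \<open>Abelian categories\<close>

record ('o, 'm) preadd = "('o, 'm) precat" +
  Plus :: "'m \<Rightarrow> 'm \<Rightarrow> 'm"  (infixl "\<oplus>\<index>" 65)
  Zero :: "'o \<Rightarrow> 'o \<Rightarrow> 'm"

definition Hom_group :: "('o, 'm, 'z) preadd_scheme \<Rightarrow> 'o \<Rightarrow> 'o \<Rightarrow> 'm monoid" where
  "Hom_group A X Y = \<lparr>carrier = Hom A X Y, mult = Plus A, one = Zero A X Y\<rparr>"

definition preadditive_category :: "('o, 'm, 'z) preadd_scheme \<Rightarrow> bool" where
  "preadditive_category A \<longleftrightarrow> category A \<and>
     (\<forall>X \<in> Ob A. \<forall>Y \<in> Ob A. comm_group (Hom_group A X Y)) \<and>
     (\<forall>X \<in> Ob A. \<forall>Y \<in> Ob A. \<forall>Z \<in> Ob A.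
        \<forall>f \<in> Hom A X Y. \<forall>f' \<in> Hom A X Y. \<forall>g \<in> Hom A Y Z. \<forall>g' \<in> Hom A Y Z.
          g \<cdot>\<^bsub>A\<^esub> (f \<oplus>\<^bsub>A\<^esub> f') = (g \<cdot>\<^bsub>A\<^esub> f) \<oplus>\<^bsub>A\<^esub> (g \<cdot>\<^bsub>A\<^esub> f') \<and>
          (g \<oplus>\<^bsub>A\<^esub> g') \<cdot>\<^bsub>A\<^esub> f = (g \<cdot>\<^bsub>A\<^esub> f) \<oplus>\<^bsub>A\<^esub> (g' \<cdot>\<^bsub>A\<^esub> f))"

definition is_biproduct ::
  "('o, 'm, 'z) preadd_scheme \<Rightarrow> 'o \<Rightarrow> 'o \<Rightarrow> 'o \<Rightarrow> 'm \<Rightarrow> 'm \<Rightarrow> 'm \<Rightarrow> 'm \<Rightarrow> bool" where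
  "is_biproduct A X Y S i j p q \<longleftrightarrow> X \<in> Ob A \<and> Y \<in> Ob A \<and> S \<in> Ob A \<and>
     i \<in> Hom A X S \<and> j \<in> Hom A Y S \<and> p \<in> Hom A S X \<and> q \<in> Hom A S Y \<and>
     p \<cdot>\<^bsub>A\<^esub> i = Ident A X \<and> q \<cdot>\<^bsub>A\<^esub> j = Ident A Y \<and> q \<cdot>\<^bsub>A\<^esub> i = Zero A X Y \<and> p \<cdot>\<^bsub>A\<^esub> j = Zero A Y X \<and>
     (i \<cdot>\<^bsub>A\<^esub> p) \<oplus>\<^bsub>A\<^esub> (j \<cdot>\<^bsub>A\<^esub> q) = Ident A S"

definition direct_summand :: "('o, 'm, 'z) preadd_scheme \<Rightarrow> 'o \<Rightarrow> 'o \<Rightarrow> bool" where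
  "direct_summand A X S \<longleftrightarrow> (\<exists>Y i j p q. is_biproduct A X Y S i j p q)"

definition is_kernel :: "('o, 'm, 'z) preadd_scheme \<Rightarrow> 'm \<Rightarrow> 'm \<Rightarrow> bool" where
  "is_kernel A k f \<longleftrightarrow> k \<in> Ar A \<and> f \<in> Ar A \<and> Cod A k = Dom A f \<and>
     f \<cdot>\<^bsub>A\<^esub> k = Zero A (Dom A k) (Cod A f) \<and>
     (\<forall>h \<in> Ar A. Cod A h = Dom A f \<and> f \<cdot>\<^bsub>A\<^esub> h = Zero A (Dom A h) (Cod A f) \<longrightarrow>
        (\<exists>!u. u \<in> Hom A (Dom A h) (Dom A k) \<and> k \<cdot>\<^bsub>A\<^esub> u = h))"

definition is_cokernel :: "('o, 'm, 'z) preadd_scheme \<Rightarrow> 'm \<Rightarrow> 'm \<Rightarrow> bool" where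
  "is_cokernel A p f \<longleftrightarrow> p \<in> Ar A \<and> f \<in> Ar A \<and> Dom A p = Cod A f \<and>
     p \<cdot>\<^bsub>A\<^esub> f = Zero A (Dom A f) (Cod A p) \<and>
     (\<forall>h \<in> Ar A. Dom A h = Cod A f \<and> h \<cdot>\<^bsub>A\<^esub> f = Zero A (Dom A f) (Cod A h) \<longrightarrow>
        (\<exists>!u. u \<in> Hom A (Cod A p) (Cod A h) \<and> u \<cdot>\<^bsub>A\<^esub> p = h))"

definition abelian_category :: "('o, 'm, 'z) preadd_scheme \<Rightarrow> bool" where
  "abelian_category A \<longleftrightarrow> preadditive_category A \<and>
     (\<exists>Z. zero_object A Z) \<and>
     (\<forall>X \<in> Ob A. \<forall>Y \<in> Ob A. \<exists>S i j p q. is_biproduct A X Y S i j p q) \<and>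
     (\<forall>f \<in> Ar A. (\<exists>k. is_kernel A k f) \<and> (\<exists>p. is_cokernel A p f)) \<and>
     (\<forall>f. monic A f \<longrightarrow> (\<exists>g. is_kernel A f g)) \<and>
     (\<forall>f. epic A f \<longrightarrow> (\<exists>g. is_cokernel A f g))"

text \<open>\<open>X \<rightarrow>\<^sup>f Y \<rightarrow>\<^sup>g Z\<close> is exact at \<open>Y\<close>: \<open>f\<close> maps epimorphically onto the kernel of \<open>g\<close>.\<close>

definition exact_at :: "('o, 'm, 'z) preadd_scheme \<Rightarrow> 'm \<Rightarrow> 'm \<Rightarrow> bool" where
  "exact_at A f g \<longleftrightarrow>
     (\<exists>k e. is_kernel A k g \<and> epic A e \<and> Cod A e = Dom A k \<and> f = k \<cdot>\<^bsub>A\<^esub> e)"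

definition short_exact :: "('o, 'm, 'z) preadd_scheme \<Rightarrow> 'm \<Rightarrow> 'm \<Rightarrow> bool" where
  "short_exact A f g \<longleftrightarrow> monic A f \<and> exact_at A f g \<and> epic A g"

section \<open>Ext\<close>

text \<open>
  Ext is Yoneda's, so that no projectives or injectives are needed. An \<open>n\<close>-extension of \<open>X\<close> by
  \<open>Y\<close>, an exact sequence \<open>0 \<rightarrow> Y = E\<^sub>n\<^sub>+\<^sub>1 \<rightarrow> E\<^sub>n \<rightarrow> \<dots> \<rightarrow> E\<^sub>1 \<rightarrow> E\<^sub>0 = X \<rightarrow> 0\<close> with differentials
  \<open>d\<^sub>i : E\<^sub>i\<^sub>+\<^sub>1 \<rightarrow> E\<^sub>i\<close>, is a pair \<open>(E, d)\<close>. The values of \<open>E\<close> and \<open>d\<close> at larger indices are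
  irrelevant; extensions differing only there have the same class.
\<close>

type_synonym ('o, 'm) ext_seq = "(nat \<Rightarrow> 'o) \<times> (nat \<Rightarrow> 'm)"

definition extensions ::
  "('o, 'm, 'z) preadd_scheme \<Rightarrow> nat \<Rightarrow> 'o \<Rightarrow> 'o \<Rightarrow> ('o, 'm) ext_seq set" where
  "extensions A n X Y = {(E, d).
     E 0 = X \<and> E (Suc n) = Y \<and>
     (\<forall>i \<le> Suc n. E i \<in> Ob A) \<and> (\<forall>i \<le> n. d i \<in> Hom A (E (Suc i)) (E i)) \<and>
     monic A (d n) \<and> (\<forall>i < n. exact_at A (d (Suc i)) (d i)) \<and> epic A (d 0)}"

definition extension_morphism ::
  "('o, 'm, 'z) preadd_scheme \<Rightarrow> nat \<Rightarrow> 'o \<Rightarrow> 'o \<Rightarrow> ('o, 'm) ext_seq \<Rightarrow> ('o, 'm) ext_seq \<Rightarrow> bool" where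
  "extension_morphism A n X Y = (\<lambda>(E, d) (E', d').
     (E, d) \<in> extensions A n X Y \<and> (E', d') \<in> extensions A n X Y \<and>
     (\<exists>h. h 0 = Ident A X \<and> h (Suc n) = Ident A Y \<and>
        (\<forall>i \<le> Suc n. h i \<in> Hom A (E i) (E' i)) \<and>
        (\<forall>i \<le> n. h i \<cdot>\<^bsub>A\<^esub> d i = d' i \<cdot>\<^bsub>A\<^esub> h (Suc i))))"

text \<open>The set of classes for the equivalence relation generated by morphisms of extensions.\<close>

definition Ext ::
  "('o, 'm, 'z) preadd_scheme \<Rightarrow> nat \<Rightarrow> 'o \<Rightarrow> 'o \<Rightarrow> ('o, 'm) ext_seq set set" where
  "Ext A n X Y = extensions A n X Y // {(e, e'). equivclp (extension_morphism A n X Y) e e'}"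

text \<open>
  For \<open>n \<ge> 1\<close> the set \<^const>\<open>Ext\<close> underlies an abelian group (Baer sum), which vanishes iff it
  has exactly one element.
\<close>

definition Ext_vanishes :: "('o, 'm, 'z) preadd_scheme \<Rightarrow> nat \<Rightarrow> 'o \<Rightarrow> 'o \<Rightarrow> bool" where
  "Ext_vanishes A n X Y \<longleftrightarrow> is_singleton (Ext A n X Y)"

section \<open>Cotorsion pairs\<close>

definition right_perp :: "('o, 'm, 'z) preadd_scheme \<Rightarrow> 'o set \<Rightarrow> 'o set" where
  "right_perp A S = {M \<in> Ob A. \<forall>X \<in> S. Ext_vanishes A 1 X M}"

definition left_perp :: "('o, 'm, 'z) preadd_scheme \<Rightarrow> 'o set \<Rightarrow> 'o set" where
  "left_perp A S = {M \<in> Ob A. \<forall>Y \<in> S. Ext_vanishes A 1 M Y}"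

definition cotorsion_pair :: "('o, 'm, 'z) preadd_scheme \<Rightarrow> 'o set \<Rightarrow> 'o set \<Rightarrow> bool" where
  "cotorsion_pair A \<X> \<Y> \<longleftrightarrow> \<X> = left_perp A \<Y> \<and> \<Y> = right_perp A \<X>"

definition complete_cotorsion_pair :: "('o, 'm, 'z) preadd_scheme \<Rightarrow> 'o set \<Rightarrow> 'o set \<Rightarrow> bool" where
  "complete_cotorsion_pair A \<X> \<Y> \<longleftrightarrow> cotorsion_pair A \<X> \<Y> \<and>
     (\<forall>M \<in> Ob A.
        (\<exists>f g. short_exact A f g \<and> Dom A f \<in> \<Y> \<and> Cod A f \<in> \<X> \<and> Cod A g = M) \<and>
        (\<exists>f g. short_exact A f g \<and> Dom A f = M \<and> Cod A f \<in> \<Y> \<and> Cod A g \<in> \<X>))"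

definition hereditary :: "('o, 'm, 'z) preadd_scheme \<Rightarrow> 'o set \<Rightarrow> 'o set \<Rightarrow> bool" where
  "hereditary A \<X> \<Y> \<longleftrightarrow> (\<forall>X \<in> \<X>. \<forall>Y \<in> \<Y>. \<forall>i \<ge> 1. Ext_vanishes A i X Y)"

definition thick :: "('o, 'm, 'z) preadd_scheme \<Rightarrow> 'o set \<Rightarrow> bool" where
  "thick A W \<longleftrightarrow> W \<subseteq> Ob A \<and>
     (\<forall>X S. S \<in> W \<and> direct_summand A X S \<longrightarrow> X \<in> W) \<and>
     (\<forall>f g. short_exact A f g \<longrightarrow>
        (Dom A f \<in> W \<and> Cod A f \<in> W \<longrightarrow> Cod A g \<in> W) \<and>
        (Dom A f \<in> W \<and> Cod A g \<in> W \<longrightarrow> Cod A f \<in> W) \<and>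
        (Cod A f \<in> W \<and> Cod A g \<in> W \<longrightarrow> Dom A f \<in> W))"

definition projective_cotorsion_pair :: "('o, 'm, 'z) preadd_scheme \<Rightarrow> 'o set \<Rightarrow> 'o set \<Rightarrow> bool" where
  "projective_cotorsion_pair A C W \<longleftrightarrow> enough_projectives A \<and>
     complete_cotorsion_pair A C W \<and> C \<inter> W = Proj A \<and> thick A W"

section \<open>Hovey triples and model structures\<close>

definition Hovey_triple :: "('o, 'm, 'z) preadd_scheme \<Rightarrow> 'o set \<times> 'o set \<times> 'o set \<Rightarrow> bool" where
  "Hovey_triple A = (\<lambda>(C, W, F). thick A W \<and>
     complete_cotorsion_pair A (C \<inter> W) F \<and> complete_cotorsion_pair A C (W \<inter> F))"

definition hereditary_Hovey_triple ::
  "('o, 'm, 'z) preadd_scheme \<Rightarrow> 'o set \<times> 'o set \<times> 'o set \<Rightarrow> bool" where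
  "hereditary_Hovey_triple A = (\<lambda>(C, W, F). Hovey_triple A (C, W, F) \<and>
     hereditary A (C \<inter> W) F \<and> hereditary A C (W \<inter> F))"

record 'm model_str =
  cofibrations :: "'m set"
  weak_equivs :: "'m set"
  fibrations :: "'m set"

definition retract_of :: "('o, 'm, 'z) precat_scheme \<Rightarrow> 'm \<Rightarrow> 'm \<Rightarrow> bool" where
  "retract_of A f g \<longleftrightarrow> f \<in> Ar A \<and> g \<in> Ar A \<and>
     (\<exists>i r i' r'. i \<in> Hom A (Dom A f) (Dom A g) \<and> r \<in> Hom A (Dom A g) (Dom A f) \<and>
        i' \<in> Hom A (Cod A f) (Cod A g) \<and> r' \<in> Hom A (Cod A g) (Cod A f) \<and>
        r \<cdot>\<^bsub>A\<^esub> i = Ident A (Dom A f) \<and> r' \<cdot>\<^bsub>A\<^esub> i' = Ident A (Cod A f) \<and>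
        g \<cdot>\<^bsub>A\<^esub> i = i' \<cdot>\<^bsub>A\<^esub> f \<and> f \<cdot>\<^bsub>A\<^esub> r = r' \<cdot>\<^bsub>A\<^esub> g)"

definition has_lift :: "('o, 'm, 'z) precat_scheme \<Rightarrow> 'm \<Rightarrow> 'm \<Rightarrow> bool" where
  "has_lift A i p \<longleftrightarrow>
     (\<forall>u \<in> Hom A (Dom A i) (Dom A p). \<forall>v \<in> Hom A (Cod A i) (Cod A p).
        p \<cdot>\<^bsub>A\<^esub> u = v \<cdot>\<^bsub>A\<^esub> i \<longrightarrow>
        (\<exists>h \<in> Hom A (Cod A i) (Dom A p). h \<cdot>\<^bsub>A\<^esub> i = u \<and> p \<cdot>\<^bsub>A\<^esub> h = v))"

text \<open>Quillen's axioms; factorizations are not required to be functorial.\<close>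

definition model_structure :: "('o, 'm, 'z) precat_scheme \<Rightarrow> 'm model_str \<Rightarrow> bool" where
  "model_structure A S \<longleftrightarrow>
     cofibrations S \<subseteq> Ar A \<and> weak_equivs S \<subseteq> Ar A \<and> fibrations S \<subseteq> Ar A \<and>
     (\<forall>f \<in> Ar A. \<forall>g \<in> Ar A. Cod A f = Dom A g \<longrightarrow>
        (f \<in> weak_equivs S \<and> g \<in> weak_equivs S \<longrightarrow> g \<cdot>\<^bsub>A\<^esub> f \<in> weak_equivs S) \<and>
        (f \<in> weak_equivs S \<and> g \<cdot>\<^bsub>A\<^esub> f \<in> weak_equivs S \<longrightarrow> g \<in> weak_equivs S) \<and>
        (g \<in> weak_equivs S \<and> g \<cdot>\<^bsub>A\<^esub> f \<in> weak_equivs S \<longrightarrow> f \<in> weak_equivs S)) \<and>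
     (\<forall>f g. retract_of A f g \<longrightarrow>
        (g \<in> cofibrations S \<longrightarrow> f \<in> cofibrations S) \<and>
        (g \<in> weak_equivs S \<longrightarrow> f \<in> weak_equivs S) \<and>
        (g \<in> fibrations S \<longrightarrow> f \<in> fibrations S)) \<and>
     (\<forall>i \<in> cofibrations S \<inter> weak_equivs S. \<forall>p \<in> fibrations S. has_lift A i p) \<and>
     (\<forall>i \<in> cofibrations S. \<forall>p \<in> fibrations S \<inter> weak_equivs S. has_lift A i p) \<and>
     (\<forall>f \<in> Ar A. \<exists>i \<in> cofibrations S \<inter> weak_equivs S. \<exists>p \<in> fibrations S.
        Cod A i = Dom A p \<and> f = p \<cdot>\<^bsub>A\<^esub> i) \<and>
     (\<forall>f \<in> Ar A. \<exists>i \<in> cofibrations S. \<exists>p \<in> fibrations S \<inter> weak_equivs S.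
        Cod A i = Dom A p \<and> f = p \<cdot>\<^bsub>A\<^esub> i)"

definition cofibrant_objects :: "('o, 'm, 'z) precat_scheme \<Rightarrow> 'm model_str \<Rightarrow> 'o set" where
  "cofibrant_objects A S =
     {X \<in> Ob A. \<exists>Z. zero_object A Z \<and> (\<exists>f \<in> Hom A Z X. f \<in> cofibrations S)}"

definition trivial_objects :: "('o, 'm, 'z) precat_scheme \<Rightarrow> 'm model_str \<Rightarrow> 'o set" where
  "trivial_objects A S =
     {X \<in> Ob A. \<exists>Z. zero_object A Z \<and> (\<exists>f \<in> Hom A Z X. f \<in> weak_equivs S)}"

definition fibrant_objects :: "('o, 'm, 'z) precat_scheme \<Rightarrow> 'm model_str \<Rightarrow> 'o set" where
  "fibrant_objects A S =
     {X \<in> Ob A. \<exists>Z. zero_object A Z \<and> (\<exists>f \<in> Hom A X Z. f \<in> fibrations S)}"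

definition Hovey_triple_of ::
  "('o, 'm, 'z) precat_scheme \<Rightarrow> 'm model_str \<Rightarrow> 'o set \<times> 'o set \<times> 'o set" where
  "Hovey_triple_of A S = (cofibrant_objects A S, trivial_objects A S, fibrant_objects A S)"

definition monics_with_cokernel_in :: "('o, 'm, 'z) preadd_scheme \<Rightarrow> 'o set \<Rightarrow> 'm set" where
  "monics_with_cokernel_in A C = {f. monic A f \<and> (\<exists>p. is_cokernel A p f \<and> Cod A p \<in> C)}"

definition epics_with_kernel_in :: "('o, 'm, 'z) preadd_scheme \<Rightarrow> 'o set \<Rightarrow> 'm set" where
  "epics_with_kernel_in A F = {f. epic A f \<and> (\<exists>k. is_kernel A k f \<and> Dom A k \<in> F)}"

definition abelian_model_structure :: "('o, 'm, 'z) preadd_scheme \<Rightarrow> 'm model_str \<Rightarrow> bool" where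
  "abelian_model_structure A S \<longleftrightarrow> abelian_category A \<and> model_structure A S \<and>
     cofibrations S = monics_with_cokernel_in A (cofibrant_objects A S) \<and>
     cofibrations S \<inter> weak_equivs S =
       monics_with_cokernel_in A (cofibrant_objects A S \<inter> trivial_objects A S) \<and>
     fibrations S = epics_with_kernel_in A (fibrant_objects A S) \<and>
     fibrations S \<inter> weak_equivs S =
       epics_with_kernel_in A (fibrant_objects A S \<inter> trivial_objects A S)"

definition projective_model_structure :: "('o, 'm, 'z) preadd_scheme \<Rightarrow> 'm model_str \<Rightarrow> bool" where
  "projective_model_structure A S \<longleftrightarrow> abelian_model_structure A S \<and>
     (\<exists>C W. projective_cotorsion_pair A C W \<and> Hovey_triple_of A S = (C, W, Ob A))"

section \<open>Quivers and their representations\<close>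

record ('v, 'e) quiver =
  verts :: "'v set"
  arrows :: "'e set"
  source :: "'e \<Rightarrow> 'v"
  target :: "'e \<Rightarrow> 'v"

definition is_quiver :: "('v, 'e) quiver \<Rightarrow> bool" where
  "is_quiver Q \<longleftrightarrow> (\<forall>a \<in> arrows Q. source Q a \<in> verts Q \<and> target Q a \<in> verts Q)"

definition V_step :: "('v, 'e) quiver \<Rightarrow> 'v set \<Rightarrow> 'v set" where
  "V_step Q V = {i \<in> verts Q. \<not> (\<exists>a \<in> arrows Q. target Q a = i \<and> source Q a \<notin> V)}"

text \<open>
  The ordinals are the elements of a well-order \<open>r\<close>, with \<open>b < a\<close> iff \<open>b \<in> underS r a\<close>; the three
  clauses are the cases zero, \<open>a = b + 1\<close> and limit.
\<close>

definition V_sequence :: "('v, 'e) quiver \<Rightarrow> 'w rel \<Rightarrow> ('w \<Rightarrow> 'v set) \<Rightarrow> bool" where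
  "V_sequence Q r V \<longleftrightarrow> (\<forall>a \<in> Field r.
     (underS r a = {} \<longrightarrow> V a = {}) \<and>
     (\<forall>b \<in> Field r. underS r a = under r b \<longrightarrow> V a = V_step Q (V b)) \<and>
     (underS r a \<noteq> {} \<and> (\<nexists>b. b \<in> Field r \<and> underS r a = under r b) \<longrightarrow>
        V a = (\<Union>b \<in> underS r a. V b)))"

text \<open>
  The sequence increases strictly until it is constant, so any \<open>\<lambda>\<close> with \<open>V\<^sub>\<lambda> = Q\<^sub>0\<close> may be taken
  of cardinality at most that of \<open>Q\<^sub>0\<close>. For infinite \<open>'v\<close> the well-orders on subsets of \<open>'v\<close>
  therefore provide enough ordinals.
\<close>

definition left_rooted :: "('v, 'e) quiver \<Rightarrow> bool" where
  "left_rooted Q \<longleftrightarrow> (\<exists>(r :: 'v rel) V l. Well_order r \<and> V_sequence Q r V \<and>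
     l \<in> Field r \<and> V l = verts Q)"

text \<open>A path from \<open>i\<close> to \<open>j\<close>, its arrows listed in the order of traversal.\<close>

fun is_path :: "('v, 'e) quiver \<Rightarrow> 'v \<Rightarrow> 'e list \<Rightarrow> 'v \<Rightarrow> bool" where
  "is_path Q i [] j \<longleftrightarrow> i \<in> verts Q \<and> i = j"
| "is_path Q i (a # p) j \<longleftrightarrow> a \<in> arrows Q \<and> source Q a = i \<and> is_path Q (target Q a) p j"

definition free_category :: "('v, 'e) quiver \<Rightarrow> ('v, 'v \<times> 'e list \<times> 'v) precat" where
  "free_category Q =
     \<lparr>Ob = verts Q,
      Ar = {(i, p, j). is_path Q i p j},
      Dom = (\<lambda>(i, p, j). i),
      Cod = (\<lambda>(i, p, j). j),
      Ident = (\<lambda>i. (i, [], i)),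
      Comp = (\<lambda>(j, q, k) (i, p, j'). (i, p @ q, k))\<rparr>"

type_synonym ('a, 'b, 'o, 'm) transf =
  "('a, 'b, 'o, 'm) diagram \<times> ('a \<Rightarrow> 'm) \<times> ('a, 'b, 'o, 'm) diagram"

definition functor_category ::
  "('a, 'b, 'y) precat_scheme \<Rightarrow> ('o, 'm, 'z) preadd_scheme \<Rightarrow>
    (('a, 'b, 'o, 'm) diagram, ('a, 'b, 'o, 'm) transf) preadd" where
  "functor_category J A =
     \<lparr>Ob = {F. is_functor J A F},
      Ar = {(F, \<tau>, G). is_nat_trans J A F \<tau> G},
      Dom = (\<lambda>(F, \<tau>, G). F),
      Cod = (\<lambda>(F, \<tau>, G). G),
      Ident = (\<lambda>F. (F, \<lambda>j \<in> Ob J. Ident A (obj_map F j), F)),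
      Comp = (\<lambda>(G', \<sigma>, H) (F, \<tau>, G). (F, \<lambda>j \<in> Ob J. \<sigma> j \<cdot>\<^bsub>A\<^esub> \<tau> j, H)),
      Plus = (\<lambda>(F, \<sigma>, G) (F', \<tau>, G'). (F, \<lambda>j \<in> Ob J. \<sigma> j \<oplus>\<^bsub>A\<^esub> \<tau> j, G)),
      Zero = (\<lambda>F G. (F, \<lambda>j \<in> Ob J. Zero A (obj_map F j) (obj_map G j), G))\<rparr>"

type_synonym ('v, 'e, 'o, 'm) rep = "('v, 'v \<times> 'e list \<times> 'v, 'o, 'm) diagram"

definition Rep ::
  "('v, 'e) quiver \<Rightarrow> ('o, 'm, 'z) preadd_scheme \<Rightarrow>
    (('v, 'e, 'o, 'm) rep, ('v, 'v \<times> 'e list \<times> 'v, 'o, 'm) transf) preadd" where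
  "Rep Q M = functor_category (free_category Q) M"

definition Rep_class ::
  "('v, 'e) quiver \<Rightarrow> ('o, 'm, 'z) preadd_scheme \<Rightarrow> 'o set \<Rightarrow> ('v, 'e, 'o, 'm) rep set" where
  "Rep_class Q M \<X> = {X \<in> Ob (Rep Q M). \<forall>i \<in> verts Q. obj_map X i \<in> \<X>}"

definition arrow_map :: "('v, 'e) quiver \<Rightarrow> ('v, 'e, 'o, 'm) rep \<Rightarrow> 'e \<Rightarrow> 'm" where
  "arrow_map Q X a = arr_map X (source Q a, [a], target Q a)"

text \<open>
  \<open>is_phi Q M X i f\<close>: with respect to some choice of the coproduct of the \<open>X(j)\<close> over all arrows
  \<open>j \<rightarrow> i\<close>, the natural map \<open>\<phi>\<^sub>i\<^sup>X\<close> from this coproduct to \<open>X(i)\<close> is \<open>f\<close>.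
\<close>

definition is_phi ::
  "('v, 'e) quiver \<Rightarrow> ('o, 'm, 'z) preadd_scheme \<Rightarrow> ('v, 'e, 'o, 'm) rep \<Rightarrow> 'v \<Rightarrow> 'm \<Rightarrow> bool" where
  "is_phi Q M X i f \<longleftrightarrow>
     (\<exists>S \<iota>. is_coproduct M {a \<in> arrows Q. target Q a = i} (\<lambda>a. obj_map X (source Q a)) S \<iota> \<and>
        f \<in> Hom M S (obj_map X i) \<and>
        (\<forall>a \<in> arrows Q. target Q a = i \<longrightarrow> f \<cdot>\<^bsub>M\<^esub> \<iota> a = arrow_map Q X a))"

definition Phi ::
  "('v, 'e) quiver \<Rightarrow> ('o, 'm, 'z) preadd_scheme \<Rightarrow> 'o set \<Rightarrow> ('v, 'e, 'o, 'm) rep set" where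
  "Phi Q M \<A> = {X \<in> Ob (Rep Q M). \<forall>i \<in> verts Q.
     obj_map X i \<in> \<A> \<and>
     (\<exists>f p. is_phi Q M X i f \<and> monic M f \<and> is_cokernel M p f \<and> Cod M p \<in> \<A>)}"

end

theory Submission
  imports Defs
begin

text \<open>
  The theorem splits into two independent halves.

  The first half holds in every abelian category with enough projectives: a projective cotorsion
  pair \<open>(C, W)\<close> is the cofibrant and trivial part of an abelian model structure in which every
  object is fibrant. Call a map null if it factors through a projective object. The weak
  equivalences are the maps \<open>f\<close> for which composition with \<open>f\<close> is bijective on maps from objects of
  \<open>C\<close> modulo null maps (\<open>weq\<close>); with this description two-out-of-three and closure under retracts
  are formal. What has to be proved is that the epimorphic weak equivalences are the epimorphisms
  with kernel in \<open>W\<close> (\<open>tfib_weq\<close>, \<open>epic_weq_tfib\<close>) and that the weak equivalences among the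
  cofibrations are the monomorphisms with projective cokernel (\<open>tcof_weq\<close>, \<open>cof_weq_tcof\<close>). Heredity
  comes from thickness: \<open>W\<close> is closed under cokernels of monomorphisms, so \<open>C\<close> is closed under
  syzygies (\<open>C_kernel\<close>), and then every \<open>n\<close>-extension of \<open>X \<in> C\<close> by \<open>Y \<in> W\<close> receives a morphism from
  one fixed extension (\<open>universal_extension\<close>), which makes the Yoneda Ext trivial.

  Throughout, the class \<open>C\<close> is controlled by lifting properties: a monomorphism has its cokernel in
  \<open>C\<close> iff it lifts against all epimorphisms with kernel in \<open>W\<close> (\<open>cof_has_lift\<close>, \<open>cokernel_in_C\<close>).
  This replaces most diagram chases, because left lifting properties pass formally to composites,
  retracts, pushouts and coproducts.

  The second half shows that every complete cotorsion pair \<open>(C, W)\<close> of \<open>M\<close> induces the complete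
  cotorsion pair \<open>(\<Phi>(C), Rep W)\<close> of representations (\<open>complete_cotorsion_pair_R\<close>). Left rootedness
  makes the relation ``there is an arrow from \<open>j\<close> to \<open>i\<close>'' well-founded, so that maps and
  representations can be constructed vertex by vertex. Lifts out of \<open>X \<in> \<Phi>(C)\<close> exist because at each
  vertex one lifts \<open>\<phi>\<^sub>i\<^sup>X\<close> against an epimorphism with kernel in \<open>W\<close> (\<open>RC_lift\<close>). Approximations come
  from factoring a map \<open>X \<rightarrow> Y\<close> of representations as \<open>X \<rightarrow> Z \<rightarrow> Y\<close>: at the vertex \<open>i\<close> one factors the
  map to \<open>Y(i)\<close> from the pushout of \<open>X(i)\<close> and \<open>\<Oplus> Z(j)\<close> over \<open>\<Oplus> X(j)\<close> (\<open>factorization_step\<close>,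
  \<open>factorization_R\<close>).

  The halves meet as follows. The pair \<open>(Proj M, M)\<close> induces \<open>(\<Phi>(Proj M), Rep M)\<close>, hence \<open>Rep M\<close> has
  enough projectives and \<open>\<Phi>(Proj M)\<close> is the class of its projective objects. If \<open>X \<in> \<Phi>(C)\<close> has all
  \<open>X(i)\<close> in \<open>W\<close>, then \<open>\<Oplus> X(j)\<close> lies in \<open>W\<close>, which is closed under coproducts, and the cokernel of
  \<open>\<phi>\<^sub>i\<^sup>X\<close> lies in \<open>C \<inter> W = Proj M\<close>. Thus \<open>\<Phi>(C) \<inter> Rep W = \<Phi>(Proj M)\<close>, and \<open>(\<Phi>(C), Rep W)\<close> is a
  projective cotorsion pair, to which the first half applies.
\<close>

section \<open>Abelian categories and duality\<close>

locale abelian =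
  fixes A :: "('o, 'm) preadd" (structure)
  assumes abelian: "abelian_category A"

text \<open>
  Each statement that is proved for all abelian categories is applied to \<open>op_cat A\<close> when its dual is
  needed.
\<close>

definition op_cat :: "('o, 'm) preadd \<Rightarrow> ('o, 'm) preadd" where
  "op_cat A = \<lparr>Ob = Ob A, Ar = Ar A, Dom = Cod A, Cod = Dom A, Ident = Ident A,
     Comp = (\<lambda>g f. Comp A f g), Plus = Plus A, Zero = (\<lambda>X Y. Zero A Y X)\<rparr>"

lemma op_cat_simps [simp]:
  "Ob (op_cat A) = Ob A" "Ar (op_cat A) = Ar A" "Dom (op_cat A) = Cod A" "Cod (op_cat A) = Dom A"
  "Ident (op_cat A) = Ident A" "Comp (op_cat A) g f = Comp A f g" "Plus (op_cat A) = Plus A"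
  "Zero (op_cat A) X Y = Zero A Y X"
  by (simp_all add: op_cat_def)

lemma Hom_op [simp]: "Hom (op_cat A) X Y = Hom A Y X"
  by (auto simp: Hom_def)

lemma op_op_cat [simp]: "op_cat (op_cat A) = A"
  by (simp add: op_cat_def)

lemma Hom_iff: "f \<in> Hom A X Y \<longleftrightarrow> f \<in> Ar A \<and> Dom A f = X \<and> Cod A f = Y"
  by (auto simp: Hom_def)

lemma category_op: assumes "category A" shows "category (op_cat A)"
proof -
  have a: "\<And>f. f \<in> Ar A \<Longrightarrow> Dom A f \<in> Ob A \<and> Cod A f \<in> Ob A"
    "\<And>X. X \<in> Ob A \<Longrightarrow> Ident A X \<in> Hom A X X"
    "\<And>f g. f \<in> Ar A \<Longrightarrow> g \<in> Ar A \<Longrightarrow> Cod A f = Dom A g \<Longrightarrow> g \<cdot>\<^bsub>A\<^esub> f \<in> Hom A (Dom A f) (Cod A g)"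
    "\<And>f. f \<in> Ar A \<Longrightarrow> f \<cdot>\<^bsub>A\<^esub> Ident A (Dom A f) = f \<and> Ident A (Cod A f) \<cdot>\<^bsub>A\<^esub> f = f"
    "\<And>f g h. f \<in> Ar A \<Longrightarrow> g \<in> Ar A \<Longrightarrow> h \<in> Ar A \<Longrightarrow> Cod A f = Dom A g \<Longrightarrow> Cod A g = Dom A h
      \<Longrightarrow> h \<cdot>\<^bsub>A\<^esub> (g \<cdot>\<^bsub>A\<^esub> f) = (h \<cdot>\<^bsub>A\<^esub> g) \<cdot>\<^bsub>A\<^esub> f"
    using assms unfolding category_def by auto
  show ?thesis
    unfolding category_def by (auto simp: a)
qed

lemma monic_op [simp]: "monic (op_cat A) f = epic A f"
  unfolding monic_def epic_def by auto

lemma epic_op [simp]: "epic (op_cat A) f = monic A f"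
  unfolding monic_def epic_def by auto

lemma is_kernel_op [simp]: "is_kernel (op_cat A) = is_cokernel A"
  by (intro ext) (auto simp: is_kernel_def is_cokernel_def)

lemma is_cokernel_op [simp]: "is_cokernel (op_cat A) = is_kernel A"
  by (intro ext) (auto simp: is_kernel_def is_cokernel_def)

lemma zero_object_op [simp]: "zero_object (op_cat A) Z = zero_object A Z"
  unfolding zero_object_def by auto

lemma Hom_group_op: "Hom_group (op_cat A) X Y = Hom_group A Y X"
  by (simp add: Hom_group_def)

lemma is_biproduct_op [simp]: "is_biproduct (op_cat A) X Y S i j p q = is_biproduct A X Y S p q i j"
  unfolding is_biproduct_def by auto

lemma preadditive_category_op: 
  assumes "preadditive_category A" shows "preadditive_category (op_cat A)"
proof -
  have "category A"
    and grp: "\<And>X Y. X \<in> Ob A \<Longrightarrow> Y \<in> Ob A \<Longrightarrow> comm_group (Hom_group A X Y)"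
    and dist: "\<And>X Y Z f f' g g'. X \<in> Ob A \<Longrightarrow> Y \<in> Ob A \<Longrightarrow> Z \<in> Ob A \<Longrightarrow> 
          f \<in> Hom A X Y \<Longrightarrow> f' \<in> Hom A X Y \<Longrightarrow> g \<in> Hom A Y Z \<Longrightarrow> g' \<in> Hom A Y Z \<Longrightarrow>
          g \<cdot>\<^bsub>A\<^esub> (f \<oplus>\<^bsub>A\<^esub> f') = (g \<cdot>\<^bsub>A\<^esub> f) \<oplus>\<^bsub>A\<^esub> (g \<cdot>\<^bsub>A\<^esub> f') \<and>
          (g \<oplus>\<^bsub>A\<^esub> g') \<cdot>\<^bsub>A\<^esub> f = (g \<cdot>\<^bsub>A\<^esub> f) \<oplus>\<^bsub>A\<^esub> (g' \<cdot>\<^bsub>A\<^esub> f)"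
    using assms unfolding preadditive_category_def by auto
  then show ?thesis
    unfolding preadditive_category_def 
    by (simp add: category_op Hom_group_op)
qed

lemma abelian_category_op: 
  assumes "abelian_category A" shows "abelian_category (op_cat A)"
proof -
  have 1: "preadditive_category A" and 2: "\<exists>Z. zero_object A Z"
    and 3: "\<And>X Y. X \<in> Ob A \<Longrightarrow> Y \<in> Ob A \<Longrightarrow> \<exists>S i j p q. is_biproduct A X Y S i j p q"
    and 4: "\<And>f. f \<in> Ar A \<Longrightarrow> (\<exists>k. is_kernel A k f) \<and> (\<exists>p. is_cokernel A p f)"
    and 5: "\<And>f. monic A f \<Longrightarrow> \<exists>g. is_kernel A f g" "\<And>f. epic A f \<Longrightarrow> \<exists>g. is_cokernel A f g"
    using assms unfolding abelian_category_def by auto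
  show ?thesis
    unfolding abelian_category_def
    apply (intro conjI)
    subgoal by (rule preadditive_category_op [OF 1])
    subgoal using 2 by auto
    subgoal
    proof (intro ballI)
      fix X Y assume "X \<in> Ob (op_cat A)" "Y \<in> Ob (op_cat A)"
      then obtain S i j p q where "is_biproduct A X Y S i j p q" using 3 [of X Y] by auto
      then have "is_biproduct (op_cat A) X Y S p q i j" by simp
      then show "\<exists>S i j p q. is_biproduct (op_cat A) X Y S i j p q" by blast
    qed
    subgoal using 4 by simp
    subgoal using 5 by simp
    subgoal using 5 by simp
    done
qed

lemma abelian_op: "abelian A \<Longrightarrow> abelian (op_cat A)"
  by (simp add: abelian_def abelian_category_op)

context abelian
begin

lemma category: "category A" and preadditive: "preadditive_category A"
  using abelian unfolding abelian_category_def preadditive_category_def by auto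

lemma Dom_Ob [simp, intro]: "f \<in> Ar A \<Longrightarrow> Dom A f \<in> Ob A"
  and Cod_Ob [simp, intro]: "f \<in> Ar A \<Longrightarrow> Cod A f \<in> Ob A"
  using category unfolding category_def by auto

lemma Ident_simps [simp]:
  assumes "X \<in> Ob A"
  shows "Ident A X \<in> Ar A" "Dom A (Ident A X) = X" "Cod A (Ident A X) = X"
  using category assms unfolding category_def by (auto simp: Hom_iff)

lemma comp_simps [simp]:
  assumes "f \<in> Ar A" "g \<in> Ar A" "Cod A f = Dom A g"
  shows "g \<cdot> f \<in> Ar A" "Dom A (g \<cdot> f) = Dom A f" "Cod A (g \<cdot> f) = Cod A g"
  using category assms unfolding category_def by (auto simp: Hom_iff)

lemma comp_assoc [simp]:
  assumes "f \<in> Ar A" "g \<in> Ar A" "h \<in> Ar A" "Cod A f = Dom A g" "Cod A g = Dom A h"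
  shows "(h \<cdot> g) \<cdot> f = h \<cdot> (g \<cdot> f)"
  using category assms unfolding category_def by auto

lemma comp_Ident [simp]:
  shows "f \<in> Ar A \<Longrightarrow> Dom A f = X \<Longrightarrow> f \<cdot> Ident A X = f" 
    and "f \<in> Ar A \<Longrightarrow> Cod A f = X \<Longrightarrow> Ident A X \<cdot> f = f"
  using category unfolding category_def by auto

text \<open>
  Composites are normalised with brackets to the right. This form of an equation \<open>g \<cdot> f = k\<close> rewrites
  inside the normal form.
\<close>

lemma reassoc:
  assumes "g \<cdot> f = k" "f \<in> Ar A" "g \<in> Ar A" "x \<in> Ar A" "Cod A f = Dom A g" "Cod A x = Dom A f"
  shows "g \<cdot> (f \<cdot> x) = k \<cdot> x"
  using comp_assoc [of x f g] assms by simp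

lemma Hom_group: "X \<in> Ob A \<Longrightarrow> Y \<in> Ob A \<Longrightarrow> comm_group (Hom_group A X Y)"
  using preadditive unfolding preadditive_category_def by auto

lemma Zero_simps [simp]:
  assumes "X \<in> Ob A" "Y \<in> Ob A"
  shows "Zero A X Y \<in> Ar A" "Dom A (Zero A X Y) = X" "Cod A (Zero A X Y) = Y"
proof -
  interpret comm_group "Hom_group A X Y" using assms by (rule Hom_group)
  have "Zero A X Y \<in> Hom A X Y" using one_closed by (simp add: Hom_group_def)
  then show "Zero A X Y \<in> Ar A" "Dom A (Zero A X Y) = X" "Cod A (Zero A X Y) = Y"
    by (auto simp: Hom_iff)
qed

lemma Plus_simps [simp]:
  assumes "f \<in> Ar A" "g \<in> Ar A" "Dom A f = Dom A g" "Cod A f = Cod A g"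
  shows "f \<oplus> g \<in> Ar A" "Dom A (f \<oplus> g) = Dom A g" "Cod A (f \<oplus> g) = Cod A g"
proof -
  interpret comm_group "Hom_group A (Dom A g) (Cod A g)" using assms by (simp add: Hom_group)
  have "f \<oplus> g \<in> Hom A (Dom A g) (Cod A g)" 
    using m_closed [of f g] assms by (simp add: Hom_group_def Hom_iff)
  then show "f \<oplus> g \<in> Ar A" "Dom A (f \<oplus> g) = Dom A g" "Cod A (f \<oplus> g) = Cod A g"
    by (auto simp: Hom_iff)
qed

lemma Plus_assoc:
  assumes "f \<in> Ar A" "g \<in> Ar A" "h \<in> Ar A" "Dom A f = Dom A h" "Cod A f = Cod A h"
    "Dom A g = Dom A h" "Cod A g = Cod A h"
  shows "(f \<oplus> g) \<oplus> h = f \<oplus> (g \<oplus> h)"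
proof -
  interpret comm_group "Hom_group A (Dom A h) (Cod A h)" using assms by (simp add: Hom_group)
  show ?thesis
    using m_assoc [of f g h] assms by (simp add: Hom_group_def Hom_iff)
qed

lemma Plus_comm:
  assumes "f \<in> Ar A" "g \<in> Ar A" "Dom A f = Dom A g" "Cod A f = Cod A g"
  shows "f \<oplus> g = g \<oplus> f"
proof -
  interpret comm_group "Hom_group A (Dom A g) (Cod A g)" using assms by (simp add: Hom_group)
  show ?thesis
    using m_comm [of f g] assms by (simp add: Hom_group_def Hom_iff)
qed

lemma Plus_Zero [simp]:
  assumes "f \<in> Ar A" "Dom A f = X" "Cod A f = Y"
  shows "f \<oplus> Zero A X Y = f" "Zero A X Y \<oplus> f = f"
proof -
  interpret comm_group "Hom_group A X Y" using assms Hom_group by auto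
  show "f \<oplus> Zero A X Y = f" "Zero A X Y \<oplus> f = f"
    using r_one [of f] l_one [of f] assms by (simp_all add: Hom_group_def Hom_iff)
qed

definition minus :: "'m \<Rightarrow> 'm \<Rightarrow> 'm" (infixl "\<ominus>" 65) where
  "f \<ominus> g = f \<oplus> inv\<^bsub>Hom_group A (Dom A g) (Cod A g)\<^esub> g"

lemma minus_facts:
  assumes "f \<in> Ar A" "g \<in> Ar A" "Dom A f = Dom A g" "Cod A f = Cod A g"
  shows "f \<ominus> g \<in> Ar A \<and> Dom A (f \<ominus> g) = Dom A g \<and> Cod A (f \<ominus> g) = Cod A g \<and> (f \<ominus> g) \<oplus> g = f"
proof -
  interpret comm_group "Hom_group A (Dom A g) (Cod A g)" using assms by (simp add: Hom_group)
  let ?G = "Hom_group A (Dom A g) (Cod A g)"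
  have c: "f \<in> carrier ?G" "g \<in> carrier ?G" using assms by (auto simp: Hom_group_def Hom_iff)
  then have "f \<otimes>\<^bsub>?G\<^esub> inv\<^bsub>?G\<^esub> g \<in> carrier ?G" "(f \<otimes>\<^bsub>?G\<^esub> inv\<^bsub>?G\<^esub> g) \<otimes>\<^bsub>?G\<^esub> g = f"
    using assms by (simp_all add: m_assoc)
  then show ?thesis by (auto simp: Hom_group_def Hom_iff minus_def)
qed

lemma minus_simps [simp]:
  assumes "f \<in> Ar A" "g \<in> Ar A" "Dom A f = Dom A g" "Cod A f = Cod A g"
  shows "f \<ominus> g \<in> Ar A" "Dom A (f \<ominus> g) = Dom A g" "Cod A (f \<ominus> g) = Cod A g" "(f \<ominus> g) \<oplus> g = f"
  using minus_facts [OF assms] by auto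

lemma Plus_cancel:
  assumes "f \<oplus> h = g \<oplus> h" "f \<in> Ar A" "g \<in> Ar A" "h \<in> Ar A" "Dom A f = Dom A h" "Cod A f = Cod A h"
    "Dom A g = Dom A h" "Cod A g = Cod A h"
  shows "f = g"
proof -
  interpret comm_group "Hom_group A (Dom A h) (Cod A h)" using assms by (simp add: Hom_group)
  show ?thesis
    using right_cancel [of h f g] assms by (simp add: Hom_group_def Hom_iff)
qed

lemma minus_eqI:
  assumes "d \<oplus> g = f" "d \<in> Ar A" "g \<in> Ar A" "Dom A d = Dom A g" "Cod A d = Cod A g"
  shows "f \<ominus> g = d"
  by (rule Plus_cancel [of _ g]) (use assms in auto)

lemma minus_eq_Zero_iff:
  assumes "f \<in> Ar A" "g \<in> Ar A" "Dom A f = Dom A g" "Cod A f = Cod A g"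
  shows "f \<ominus> g = Zero A (Dom A g) (Cod A g) \<longleftrightarrow> f = g"
proof 
  assume "f \<ominus> g = Zero A (Dom A g) (Cod A g)"
  then show "f = g" using minus_simps(4) [OF assms] assms by simp
next
  assume fg: "f = g" show "f \<ominus> g = Zero A (Dom A g) (Cod A g)"
    by (rule minus_eqI) (use assms fg in auto)
qed

lemma minus_eqD:
  assumes "f \<ominus> g = Zero A X Y" "f \<in> Ar A" "g \<in> Ar A" "Dom A f = Dom A g" "Cod A f = Cod A g" "Dom A g = X" "Cod A g = Y"
  shows "f = g"
  using minus_eq_Zero_iff [of f g] assms by simp

lemma minus_self [simp]: "f \<in> Ar A \<Longrightarrow> f \<ominus> f = Zero A (Dom A f) (Cod A f)"
  using minus_eq_Zero_iff by blast

lemma minus_Zero [simp]: "f \<in> Ar A \<Longrightarrow> Dom A f = X \<Longrightarrow> Cod A f = Y \<Longrightarrow> f \<ominus> Zero A X Y = f"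
  by (rule minus_eqI) auto

lemma Plus_minus [simp]:
  assumes "f \<in> Ar A" "g \<in> Ar A" "Dom A f = Dom A g" "Cod A f = Cod A g"
  shows "f \<oplus> (g \<ominus> f) = g" "(f \<oplus> g) \<ominus> g = f"
proof -
  show "f \<oplus> (g \<ominus> f) = g" using assms by (subst Plus_comm) auto
  show "(f \<oplus> g) \<ominus> g = f" by (rule minus_eqI) (use assms in auto)
qed

lemma comp_Plus:
  assumes "f \<in> Ar A" "f' \<in> Ar A" "g \<in> Ar A" "Dom A f = Dom A f'" "Cod A f = Cod A f'" "Cod A f' = Dom A g"
  shows "g \<cdot> (f \<oplus> f') = (g \<cdot> f) \<oplus> (g \<cdot> f')"
proof -
  have "f \<in> Hom A (Dom A f') (Dom A g)" "f' \<in> Hom A (Dom A f') (Dom A g)" "g \<in> Hom A (Dom A g) (Cod A g)"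
    using assms by (auto simp: Hom_iff)
  moreover have "Dom A f' \<in> Ob A" "Dom A g \<in> Ob A" "Cod A g \<in> Ob A" using assms by auto
  ultimately show ?thesis
    using preadditive unfolding preadditive_category_def by blast
qed

lemma Plus_comp:
  assumes "f \<in> Ar A" "g' \<in> Ar A" "g \<in> Ar A" "Dom A g = Dom A g'" "Cod A g = Cod A g'" "Cod A f = Dom A g'"
  shows "(g \<oplus> g') \<cdot> f = (g \<cdot> f) \<oplus> (g' \<cdot> f)"
proof -
  have "f \<in> Hom A (Dom A f) (Dom A g')" "g \<in> Hom A (Dom A g') (Cod A g')" "g' \<in> Hom A (Dom A g') (Cod A g')"
    using assms by (auto simp: Hom_iff)
  moreover have "Dom A f \<in> Ob A" "Dom A g' \<in> Ob A" "Cod A g' \<in> Ob A" using assms by auto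
  ultimately show ?thesis
    using preadditive unfolding preadditive_category_def by blast
qed

lemma comp_minus:
  assumes "f \<in> Ar A" "f' \<in> Ar A" "g \<in> Ar A" "Dom A f = Dom A f'" "Cod A f = Cod A f'" "Cod A f' = Dom A g"
  shows "g \<cdot> (f \<ominus> f') = (g \<cdot> f) \<ominus> (g \<cdot> f')"
  by (rule minus_eqI [symmetric]) (use assms in \<open>simp_all add: comp_Plus [symmetric]\<close>)

lemma minus_comp:
  assumes "f \<in> Ar A" "g' \<in> Ar A" "g \<in> Ar A" "Dom A g = Dom A g'" "Cod A g = Cod A g'" "Cod A f = Dom A g'"
  shows "(g \<ominus> g') \<cdot> f = (g \<cdot> f) \<ominus> (g' \<cdot> f)"
  by (rule minus_eqI [symmetric]) (use assms in \<open>simp_all add: Plus_comp [symmetric]\<close>)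

lemmas additive = comp_Plus Plus_comp comp_minus minus_comp

lemma comp_Zero [simp]:
  shows "f \<in> Ar A \<Longrightarrow> Dom A f = Y \<Longrightarrow> X \<in> Ob A \<Longrightarrow> f \<cdot> Zero A X Y = Zero A X (Cod A f)" (is "_ \<Longrightarrow> _ \<Longrightarrow> _ \<Longrightarrow> ?P")
    and "f \<in> Ar A \<Longrightarrow> Cod A f = Y \<Longrightarrow> Z \<in> Ob A \<Longrightarrow> Zero A Y Z \<cdot> f = Zero A (Dom A f) Z" (is "_ \<Longrightarrow> _ \<Longrightarrow> _ \<Longrightarrow> ?Q")
proof -
  assume a: "f \<in> Ar A" "Dom A f = Y" "X \<in> Ob A"
  then have "Y \<in> Ob A" by auto
  show ?P
    by (rule Plus_cancel [of _ "f \<cdot> Zero A X Y"]) (use \<open>Y \<in> Ob A\<close> a comp_Plus [of "Zero A X Y" "Zero A X Y" f] in auto)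
next
  assume a: "f \<in> Ar A" "Cod A f = Y" "Z \<in> Ob A"
  then have "Y \<in> Ob A" by auto
  show ?Q
    by (rule Plus_cancel [of _ "Zero A Y Z \<cdot> f"]) (use \<open>Y \<in> Ob A\<close> a Plus_comp [of f "Zero A Y Z" "Zero A Y Z"] in auto)
qed

lemma monicD:
  assumes "monic A f" "g \<in> Ar A" "h \<in> Ar A" "Dom A g = Dom A h" "Cod A g = Dom A f" "Cod A h = Dom A f" "f \<cdot> g = f \<cdot> h"
  shows "g = h"
  using assms unfolding monic_def by blast

lemma epicD:
  assumes "epic A f" "g \<in> Ar A" "h \<in> Ar A" "Cod A g = Cod A h" "Dom A g = Cod A f" "Dom A h = Cod A f" "g \<cdot> f = h \<cdot> f"
  shows "g = h"
  using assms unfolding epic_def by blast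

lemma monic_Ar [simp]: "monic A f \<Longrightarrow> f \<in> Ar A" and epic_Ar [simp]: "epic A f \<Longrightarrow> f \<in> Ar A"
  by (auto simp: monic_def epic_def)

lemma monicI:
  assumes "f \<in> Ar A" 
    and z: "\<And>h. h \<in> Ar A \<Longrightarrow> Cod A h = Dom A f \<Longrightarrow> f \<cdot> h = Zero A (Dom A h) (Cod A f) \<Longrightarrow> h = Zero A (Dom A h) (Dom A f)"
  shows "monic A f"
  unfolding monic_def
proof (intro conjI ballI impI)
  show "f \<in> Ar A" by fact
  fix g h assume "g \<in> Ar A" "h \<in> Ar A" "Dom A g = Dom A h \<and> Cod A g = Dom A f \<and> Cod A h = Dom A f \<and> f \<cdot> g = f \<cdot> h"
  then have gh: "g \<in> Ar A" "h \<in> Ar A" "Dom A g = Dom A h" "Cod A g = Dom A f" "Cod A h = Dom A f"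
       "f \<cdot> g = f \<cdot> h" by auto
  then have "f \<cdot> (g \<ominus> h) = Zero A (Dom A h) (Cod A f)" using assms by (simp add: additive)
  then have "g \<ominus> h = Zero A (Dom A h) (Dom A f)" using z [of "g \<ominus> h"] gh by simp
  then show "g = h" by (rule minus_eqD) (use gh in auto)
qed

lemma monic_Zero:
  assumes "monic A f" "h \<in> Ar A" "Cod A h = Dom A f" "f \<cdot> h = Zero A X (Cod A f)" "Dom A h = X"
  shows "h = Zero A X (Dom A f)"
  by (rule monicD [of f]) (use assms in auto)

lemma epicI:
  assumes "f \<in> Ar A" 
    and z: "\<And>h. h \<in> Ar A \<Longrightarrow> Dom A h = Cod A f \<Longrightarrow> h \<cdot> f = Zero A (Dom A f) (Cod A h) \<Longrightarrow> h = Zero A (Cod A f) (Cod A h)"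
  shows "epic A f"
proof -
  interpret op: abelian "op_cat A" by (rule abelian_op) unfold_locales
  show ?thesis using op.monicI [of f] assms by simp
qed

lemma epic_Zero:
  assumes "epic A f" "h \<in> Ar A" "Dom A h = Cod A f" "h \<cdot> f = Zero A (Dom A f) Y" "Cod A h = Y"
  shows "h = Zero A (Cod A f) Y"
  by (rule epicD [of f]) (use assms in auto)

lemma monic_comp: "monic A f \<Longrightarrow> monic A g \<Longrightarrow> Cod A f = Dom A g \<Longrightarrow> monic A (g \<cdot> f)"
proof (rule monicI)
  fix h assume a: "monic A f" "monic A g" "Cod A f = Dom A g" "h \<in> Ar A" "Cod A h = Dom A (g \<cdot> f)"
    "(g \<cdot> f) \<cdot> h = Zero A (Dom A h) (Cod A (g \<cdot> f))"
  then have "f \<cdot> h = Zero A (Dom A h) (Dom A g)" using monic_Zero [of g "f \<cdot> h"] by simp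
  then show "h = Zero A (Dom A h) (Dom A (g \<cdot> f))" using monic_Zero [of f h] a by simp
qed auto

lemma epic_comp: "epic A f \<Longrightarrow> epic A g \<Longrightarrow> Cod A f = Dom A g \<Longrightarrow> epic A (g \<cdot> f)"
proof (rule epicI)
  fix h assume a: "epic A f" "epic A g" "Cod A f = Dom A g" "h \<in> Ar A" "Dom A h = Cod A (g \<cdot> f)"
    "h \<cdot> (g \<cdot> f) = Zero A (Dom A (g \<cdot> f)) (Cod A h)"
  then have "(h \<cdot> g) \<cdot> f = Zero A (Dom A f) (Cod A h)" by simp
  then have "h \<cdot> g = Zero A (Dom A g) (Cod A h)" using epic_Zero [of f "h \<cdot> g"] a by simp
  then show "h = Zero A (Cod A (g \<cdot> f)) (Cod A h)" using epic_Zero [of g h] a by simp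
qed auto

lemma monic_of_comp: "monic A (g \<cdot> f) \<Longrightarrow> f \<in> Ar A \<Longrightarrow> g \<in> Ar A \<Longrightarrow> Cod A f = Dom A g \<Longrightarrow> monic A f"
proof (rule monicI, assumption)
  fix h assume a: "monic A (g \<cdot> f)" "f \<in> Ar A" "g \<in> Ar A" "Cod A f = Dom A g" "h \<in> Ar A" "Cod A h = Dom A f"
    "f \<cdot> h = Zero A (Dom A h) (Cod A f)"
  then show "h = Zero A (Dom A h) (Dom A f)" using monic_Zero [of "g \<cdot> f" h] by simp
qed

lemma epic_of_comp: "epic A (g \<cdot> f) \<Longrightarrow> f \<in> Ar A \<Longrightarrow> g \<in> Ar A \<Longrightarrow> Cod A f = Dom A g \<Longrightarrow> epic A g"
proof (rule epicI, assumption)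
  fix h assume a: "epic A (g \<cdot> f)" "f \<in> Ar A" "g \<in> Ar A" "Cod A f = Dom A g" "h \<in> Ar A" "Dom A h = Cod A g"
    "h \<cdot> g = Zero A (Dom A g) (Cod A h)"
  then have "h \<cdot> (g \<cdot> f) = Zero A (Dom A f) (Cod A h)" by (simp flip: comp_assoc)
  then show "h = Zero A (Cod A g) (Cod A h)" using a epic_Zero [of "g \<cdot> f" h] by simp
qed

lemma monic_Ident: "X \<in> Ob A \<Longrightarrow> monic A (Ident A X)"
  by (rule monicI) auto
lemma epic_Ident: "X \<in> Ob A \<Longrightarrow> epic A (Ident A X)"
  by (rule epicI) auto

lemma split_monic: "r \<cdot> f = Ident A (Dom A f) \<Longrightarrow> f \<in> Ar A \<Longrightarrow> r \<in> Ar A \<Longrightarrow> Cod A f = Dom A r \<Longrightarrow> monic A f"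
  using monic_of_comp [of r f] monic_Ident by simp
lemma split_epic: "f \<cdot> s = Ident A (Cod A f) \<Longrightarrow> f \<in> Ar A \<Longrightarrow> s \<in> Ar A \<Longrightarrow> Cod A s = Dom A f \<Longrightarrow> epic A f"
  using epic_of_comp [of f s] epic_Ident by simp

lemma zero_ex: "\<exists>Z. zero_object A Z" 
  and biproduct_ex: "X \<in> Ob A \<Longrightarrow> Y \<in> Ob A \<Longrightarrow> \<exists>S i j p q. is_biproduct A X Y S i j p q"
  and kernel_ex: "f \<in> Ar A \<Longrightarrow> \<exists>k. is_kernel A k f" and cokernel_ex: "f \<in> Ar A \<Longrightarrow> \<exists>p. is_cokernel A p f"
  and monic_kernel_ex: "monic A f \<Longrightarrow> \<exists>g. is_kernel A f g"
  and epic_cokernel_ex: "epic A f \<Longrightarrow> \<exists>g. is_cokernel A f g"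
  using abelian unfolding abelian_category_def by auto

lemma zero_object_Ob: "zero_object A Z \<Longrightarrow> Z \<in> Ob A" by (simp add: zero_object_def)

lemma from_zero: "zero_object A Z \<Longrightarrow> f \<in> Ar A \<Longrightarrow> Dom A f = Z \<Longrightarrow> f = Zero A Z (Cod A f)"
  and to_zero: "zero_object A Z \<Longrightarrow> f \<in> Ar A \<Longrightarrow> Cod A f = Z \<Longrightarrow> f = Zero A (Dom A f) Z"
proof -
  assume Z: "zero_object A Z" and f: "f \<in> Ar A"
  { assume "Dom A f = Z"
    then have "f \<in> Hom A Z (Cod A f)" "Zero A Z (Cod A f) \<in> Hom A Z (Cod A f)"
      using f zero_object_Ob [OF Z] by (auto simp: Hom_iff)
    then show "f = Zero A Z (Cod A f)" using Z f unfolding zero_object_def by blast }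
  { assume "Cod A f = Z"
    then have "f \<in> Hom A (Dom A f) Z" "Zero A (Dom A f) Z \<in> Hom A (Dom A f) Z"
      using f zero_object_Ob [OF Z] by (auto simp: Hom_iff)
    then show "f = Zero A (Dom A f) Z" using Z f unfolding zero_object_def by blast }
qed

lemma kernelD:
  assumes "is_kernel A k f"
  shows "k \<in> Ar A" "f \<in> Ar A" "Cod A k = Dom A f" "f \<cdot> k = Zero A (Dom A k) (Cod A f)"
  using assms unfolding is_kernel_def by auto

lemma kernel_ex1:
  assumes "is_kernel A k f" "h \<in> Ar A" "Cod A h = Dom A f" "f \<cdot> h = Zero A (Dom A h) (Cod A f)"
  shows "\<exists>!u. u \<in> Hom A (Dom A h) (Dom A k) \<and> k \<cdot> u = h"
proof -
  have "\<forall>h \<in> Ar A. Cod A h = Dom A f \<and> f \<cdot> h = Zero A (Dom A h) (Cod A f) \<longrightarrow>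
        (\<exists>!u. u \<in> Hom A (Dom A h) (Dom A k) \<and> k \<cdot> u = h)"
    using assms(1) unfolding is_kernel_def by (elim conjE)
  then show ?thesis using assms by simp
qed

lemma kernel_lift:
  assumes "is_kernel A k f" "h \<in> Ar A" "Cod A h = Dom A f" "f \<cdot> h = Zero A X (Cod A f)" "Dom A h = X"
  obtains u where "u \<in> Ar A" "Dom A u = X" "Cod A u = Dom A k" "k \<cdot> u = h"
proof -
  have "\<exists>!u. u \<in> Hom A (Dom A h) (Dom A k) \<and> k \<cdot> u = h"
    using assms by (intro kernel_ex1) simp_all
  then obtain u where "u \<in> Hom A (Dom A h) (Dom A k)" "k \<cdot> u = h" by (blast dest: ex1_implies_ex)
  then show thesis using that [of u] assms(5) by (simp add: Hom_iff)
qed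

lemma kernel_monic: assumes "is_kernel A k f" shows "monic A k"
proof (rule monicI)
  show "k \<in> Ar A" using kernelD [OF assms] by simp
  fix h assume h: "h \<in> Ar A" "Cod A h = Dom A k" "k \<cdot> h = Zero A (Dom A h) (Cod A k)"
  note k = kernelD [OF assms]
  have "\<exists>!u. u \<in> Hom A (Dom A h) (Dom A k) \<and> k \<cdot> u = Zero A (Dom A h) (Cod A k)"
    using kernel_ex1 [OF assms, of "Zero A (Dom A h) (Cod A k)"] h k by simp
  moreover have "h \<in> Hom A (Dom A h) (Dom A k)" "Zero A (Dom A h) (Dom A k) \<in> Hom A (Dom A h) (Dom A k)"
    "k \<cdot> Zero A (Dom A h) (Dom A k) = Zero A (Dom A h) (Cod A k)"
    using h k by (auto simp: Hom_iff)
  ultimately show "h = Zero A (Dom A h) (Dom A k)" using h by blast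
qed

lemma is_kernelI:
  assumes "monic A k" "f \<in> Ar A" "Cod A k = Dom A f" "f \<cdot> k = Zero A (Dom A k) (Cod A f)"
    and "\<And>h. h \<in> Ar A \<Longrightarrow> Cod A h = Dom A f \<Longrightarrow> f \<cdot> h = Zero A (Dom A h) (Cod A f) \<Longrightarrow>
      \<exists>u. u \<in> Hom A (Dom A h) (Dom A k) \<and> k \<cdot> u = h"
  shows "is_kernel A k f"
  unfolding is_kernel_def
proof (intro conjI ballI impI)
  fix h assume "h \<in> Ar A" "Cod A h = Dom A f \<and> f \<cdot> h = Zero A (Dom A h) (Cod A f)"
  then obtain u where u: "u \<in> Hom A (Dom A h) (Dom A k)" "k \<cdot> u = h" using assms by blast
  show "\<exists>!u. u \<in> Hom A (Dom A h) (Dom A k) \<and> k \<cdot> u = h"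
  proof (rule ex1I [of _ u])
    show "u \<in> Hom A (Dom A h) (Dom A k) \<and> k \<cdot> u = h" using u by simp
    fix v assume "v \<in> Hom A (Dom A h) (Dom A k) \<and> k \<cdot> v = h"
    then have "k \<cdot> v = k \<cdot> u" "v \<in> Hom A (Dom A h) (Dom A k)" using u by auto
    then show "v = u" using u assms(1) monicD [of k v u] by (auto simp: Hom_iff)
  qed
qed (use assms in auto)

lemma cokernelD:
  assumes "is_cokernel A p f"
  shows "p \<in> Ar A" "f \<in> Ar A" "Dom A p = Cod A f" "p \<cdot> f = Zero A (Dom A f) (Cod A p)"
  using assms unfolding is_cokernel_def by auto

lemma cokernel_ex1:
  assumes "is_cokernel A p f" "h \<in> Ar A" "Dom A h = Cod A f" "h \<cdot> f = Zero A (Dom A f) (Cod A h)"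
  shows "\<exists>!u. u \<in> Hom A (Cod A p) (Cod A h) \<and> u \<cdot> p = h"
proof -
  interpret op: abelian "op_cat A" by (rule abelian_op) unfold_locales
  show ?thesis using op.kernel_ex1 [of p f h] assms by simp
qed

lemma cokernel_lift:
  assumes "is_cokernel A p f" "h \<in> Ar A" "Dom A h = Cod A f" "h \<cdot> f = Zero A (Dom A f) Y" "Cod A h = Y"
  obtains u where "u \<in> Ar A" "Cod A u = Y" "Dom A u = Cod A p" "u \<cdot> p = h"
proof -
  have "\<exists>!u. u \<in> Hom A (Cod A p) (Cod A h) \<and> u \<cdot> p = h"
    using assms by (intro cokernel_ex1) simp_all
  then obtain u where "u \<in> Hom A (Cod A p) (Cod A h)" "u \<cdot> p = h" by (blast dest: ex1_implies_ex)
  then show thesis using that [of u] assms(5) by (simp add: Hom_iff)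
qed

lemma cokernel_epic: assumes "is_cokernel A p f" shows "epic A p"
proof -
  interpret op: abelian "op_cat A" by (rule abelian_op) unfold_locales
  show ?thesis using op.kernel_monic [of p f] assms by simp
qed

lemma is_cokernelI:
  assumes "epic A p" "f \<in> Ar A" "Cod A f = Dom A p" "p \<cdot> f = Zero A (Dom A f) (Cod A p)"
    and "\<And>h. h \<in> Ar A \<Longrightarrow> Dom A h = Cod A f \<Longrightarrow> h \<cdot> f = Zero A (Dom A f) (Cod A h) \<Longrightarrow>
      \<exists>u. u \<in> Hom A (Cod A p) (Cod A h) \<and> u \<cdot> p = h"
  shows "is_cokernel A p f"
proof -
  interpret op: abelian "op_cat A" by (rule abelian_op) unfold_locales
  show ?thesis using op.is_kernelI [of p f] assms by simp
qed

text \<open>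
  By the axioms \<open>f\<close> is a kernel of some \<open>g\<close>, and \<open>g\<close> factors through the cokernel of \<open>f\<close>; hence whatever
  the cokernel kills is killed by \<open>g\<close> as well.
\<close>

lemma monic_is_kernel: assumes "monic A f" "is_cokernel A p f" shows "is_kernel A f p"
proof (rule is_kernelI)
  note p = cokernelD [OF assms(2)]
  show "monic A f" "p \<in> Ar A" "Cod A f = Dom A p" "p \<cdot> f = Zero A (Dom A f) (Cod A p)" using assms p by auto
  fix h assume h: "h \<in> Ar A" "Cod A h = Dom A p" "p \<cdot> h = Zero A (Dom A h) (Cod A p)"
  obtain g where g: "is_kernel A f g" using monic_kernel_ex assms by blast
  note g' = kernelD [OF g]
  obtain t where t: "t \<in> Ar A" "Cod A t = Cod A g" "Dom A t = Cod A p" "t \<cdot> p = g"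
    using cokernel_lift [OF assms(2), of g] g' by auto
  have "g \<cdot> h = (t \<cdot> p) \<cdot> h" by (simp only: t(4))
  also have "\<dots> = Zero A (Dom A h) (Cod A g)" using h t(1-3) p by simp
  finally obtain u where "u \<in> Ar A" "Dom A u = Dom A h" "Cod A u = Dom A f" "f \<cdot> u = h"
    using kernel_lift [OF g, of h] h g' p by auto
  then show "\<exists>u. u \<in> Hom A (Dom A h) (Dom A f) \<and> f \<cdot> u = h" by (auto simp: Hom_iff)
qed

lemma epic_is_cokernel: assumes "epic A p" "is_kernel A f p" shows "is_cokernel A p f"
proof -
  interpret op: abelian "op_cat A" by (rule abelian_op) unfold_locales
  show ?thesis using op.monic_is_kernel [of p f] assms by simp
qed

lemma monic_epic_iso:
  assumes "monic A f" "epic A f"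
  obtains g where "g \<in> Ar A" "Dom A g = Cod A f" "Cod A g = Dom A f" "g \<cdot> f = Ident A (Dom A f)" "f \<cdot> g = Ident A (Cod A f)"
proof -
  obtain p where p: "is_cokernel A p f" using cokernel_ex assms by fastforce
  note p' = cokernelD [OF p]
  have "p = Zero A (Cod A f) (Cod A p)" using epic_Zero [OF assms(2), of p "Cod A p"] p' by simp
  then have "p \<cdot> Ident A (Cod A f) = Zero A (Cod A f) (Cod A p)" using p' by simp
  then obtain g where g: "g \<in> Ar A" "Dom A g = Cod A f" "Cod A g = Dom A f" "f \<cdot> g = Ident A (Cod A f)"
    using kernel_lift [OF monic_is_kernel [OF assms(1) p], of "Ident A (Cod A f)" "Cod A f"] assms p' by auto
  have "f \<cdot> (g \<cdot> f) = f \<cdot> Ident A (Dom A f)" using g assms reassoc [OF g(4), of f] by simp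
  then have "g \<cdot> f = Ident A (Dom A f)" using monicD [OF assms(1), of "g \<cdot> f" "Ident A (Dom A f)"] g assms by simp
  with g that show thesis by blast
qed

text \<open>The kernel of \<open>g\<close> is unique up to isomorphism, so the epimorphism in the definition of
  exactness is invertible when \<open>f\<close> is a monomorphism.\<close>

lemma short_exact_kernel: "short_exact A f g \<longleftrightarrow> is_kernel A f g \<and> epic A g"
proof
  assume a: "short_exact A f g"
  then obtain k e where k: "is_kernel A k g" "epic A e" "Cod A e = Dom A k" "f = k \<cdot> e" and f: "monic A f"
    and g: "epic A g"
    unfolding short_exact_def exact_at_def by blast
  note k' = kernelD [OF k(1)]
  have "monic A e" using monic_of_comp [of k e] f k k' by auto
  then obtain e' where e': "e' \<in> Ar A" "Dom A e' = Cod A e" "Cod A e' = Dom A e" "e \<cdot> e' = Ident A (Cod A e)"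
    using monic_epic_iso [of e] k(2) by metis
  have "is_kernel A f g"
  proof (rule is_kernelI [OF f])
    show "g \<in> Ar A" "Cod A f = Dom A g" using k k' by auto
    show "g \<cdot> f = Zero A (Dom A f) (Cod A g)" using k k' reassoc [OF k'(4), of e] by simp
    fix h assume h: "h \<in> Ar A" "Cod A h = Dom A g" "g \<cdot> h = Zero A (Dom A h) (Cod A g)"
    then obtain u where u: "u \<in> Ar A" "Dom A u = Dom A h" "Cod A u = Dom A k" "k \<cdot> u = h"
      using kernel_lift [OF k(1)] by metis
    have "f \<cdot> (e' \<cdot> u) = h" using u k k' e' reassoc [OF e'(4), of u] by simp
    then show "\<exists>u. u \<in> Hom A (Dom A h) (Dom A f) \<and> f \<cdot> u = h"
      using u k k' e' by (intro exI [of _ "e' \<cdot> u"]) (auto simp: Hom_iff)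
  qed
  with g show "is_kernel A f g \<and> epic A g" by simp
next
  assume a: "is_kernel A f g \<and> epic A g"
  note f = kernelD [OF conjunct1 [OF a]]
  then have "exact_at A f g" unfolding exact_at_def
    using a epic_Ident [of "Dom A f"] by (intro exI [of _ f] exI [of _ "Ident A (Dom A f)"]) auto
  then show "short_exact A f g" using a kernel_monic by (auto simp: short_exact_def)
qed

lemma short_exact_cokernel: "short_exact A f g \<longleftrightarrow> is_cokernel A g f \<and> monic A f"
  by (metis short_exact_kernel cokernel_epic epic_is_cokernel kernel_monic monic_is_kernel)

lemma short_exact_op [simp]: "short_exact (op_cat A) f g = short_exact A g f"
proof -
  interpret op: abelian "op_cat A" by (rule abelian_op) unfold_locales
  show ?thesis by (simp add: op.short_exact_kernel short_exact_cokernel)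
qed

lemma short_exactD:
  assumes "short_exact A f g"
  shows "f \<in> Ar A" "g \<in> Ar A" "Cod A f = Dom A g" "monic A f" "epic A g" "g \<cdot> f = Zero A (Dom A f) (Cod A g)"
    "is_kernel A f g" "is_cokernel A g f"
proof -
  show k: "is_kernel A f g" and "epic A g" using assms short_exact_kernel by auto
  show "monic A f" "is_cokernel A g f" using assms short_exact_cokernel by auto
  show "f \<in> Ar A" "g \<in> Ar A" "Cod A f = Dom A g" "g \<cdot> f = Zero A (Dom A f) (Cod A g)"
    using kernelD [OF k] by auto
qed

section \<open>Biproducts, splittings and pushouts\<close>

lemma biproductD:
  assumes "is_biproduct A X Y S i j p q"
  shows "X \<in> Ob A" "Y \<in> Ob A" "S \<in> Ob A"
    "i \<in> Ar A" "Dom A i = X" "Cod A i = S" "j \<in> Ar A" "Dom A j = Y" "Cod A j = S"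
    "p \<in> Ar A" "Dom A p = S" "Cod A p = X" "q \<in> Ar A" "Dom A q = S" "Cod A q = Y"
    "p \<cdot> i = Ident A X" "q \<cdot> j = Ident A Y" "q \<cdot> i = Zero A X Y" "p \<cdot> j = Zero A Y X"
    "(i \<cdot> p) \<oplus> (j \<cdot> q) = Ident A S"
  using assms unfolding is_biproduct_def Hom_iff by auto

lemma biproduct_ext:
  assumes b: "is_biproduct A X Y S i j p q"
    and w: "w \<in> Ar A" "w' \<in> Ar A" "Dom A w = S" "Dom A w' = S" "Cod A w = Cod A w'"
    and eq: "w \<cdot> i = w' \<cdot> i" "w \<cdot> j = w' \<cdot> j"
  shows "w = w'"
proof -
  note b' = biproductD [OF b]
  have *: "v = ((v \<cdot> i) \<cdot> p) \<oplus> ((v \<cdot> j) \<cdot> q)" if "v \<in> Ar A" "Dom A v = S" for v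
  proof -
    have "v = v \<cdot> ((i \<cdot> p) \<oplus> (j \<cdot> q))" unfolding b'(20) using that by simp
    also have "\<dots> = ((v \<cdot> i) \<cdot> p) \<oplus> ((v \<cdot> j) \<cdot> q)" using that b'(1-15) by (simp add: additive)
    finally show ?thesis .
  qed
  show ?thesis using * [of w] * [of w'] w eq by simp
qed

lemma biproduct_copair:
  assumes b: "is_biproduct A X Y S i j p q"
    and u: "u \<in> Ar A" "v \<in> Ar A" "Dom A u = X" "Dom A v = Y" "Cod A u = Cod A v"
  obtains w where "w \<in> Ar A" "Dom A w = S" "Cod A w = Cod A v" "w \<cdot> i = u" "w \<cdot> j = v"
proof 
  note b' = biproductD [OF b]
  let ?w = "(u \<cdot> p) \<oplus> (v \<cdot> q)"
  show "?w \<in> Ar A" "Dom A ?w = S" "Cod A ?w = Cod A v" using b'(1-15) u by auto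
  show "?w \<cdot> i = u" "?w \<cdot> j = v" using b'(1-19) u by (simp_all add: additive)
qed

lemma biproduct_swap: "is_biproduct A X Y S i j p q \<Longrightarrow> is_biproduct A Y X S j i q p"
  unfolding is_biproduct_def Hom_iff using Plus_comm [of "i \<cdot> p" "j \<cdot> q"] by simp

lemma biproduct_short_exact: assumes b: "is_biproduct A X Y S i j p q" shows "short_exact A i q"
proof -
  note b' = biproductD [OF b]
  have q: "epic A q" using b' split_epic [of q j] by simp
  have "is_cokernel A q i"
  proof (rule is_cokernelI [OF q])
    fix h assume h: "h \<in> Ar A" "Dom A h = Cod A i" "h \<cdot> i = Zero A (Dom A i) (Cod A h)"
    have "(h \<cdot> j) \<cdot> q = h" 
      by (rule biproduct_ext [OF b]) (use h b' in simp_all)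
    then show "\<exists>u. u \<in> Hom A (Cod A q) (Cod A h) \<and> u \<cdot> q = h" using h b' 
      by (intro exI [of _ "h \<cdot> j"]) (simp add: Hom_iff)
  qed (use b' in auto)
  moreover have "monic A i" using b' split_monic [of p i] by simp
  ultimately show ?thesis using short_exact_cokernel by simp
qed

text \<open>
  The map \<open>1 - s g\<close> is killed by \<open>g\<close>, so it equals \<open>f r\<close>; this \<open>r\<close> is the missing projection.
\<close>

lemma section_biproduct:
  assumes fg: "short_exact A f g" and s: "s \<in> Ar A" "Dom A s = Cod A g" "Cod A s = Cod A f" "g \<cdot> s = Ident A (Cod A g)"
  obtains r where "is_biproduct A (Dom A f) (Cod A g) (Cod A f) f s r g"
proof -
  note e = short_exactD [OF fg]
  let ?d = "Ident A (Cod A f) \<ominus> (s \<cdot> g)"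
  have "g \<cdot> ?d = Zero A (Cod A f) (Cod A g)"
    using e s reassoc [OF s(4), of g] by (simp add: additive)
  then obtain r where r: "r \<in> Ar A" "Dom A r = Cod A f" "Cod A r = Dom A f" "f \<cdot> r = ?d"
    using kernel_lift [OF e(7), of ?d "Cod A f"] e s by auto
  have "f \<cdot> (r \<cdot> f) = ?d \<cdot> f" using reassoc [OF r(4), of f] r e by simp
  also have "\<dots> = f \<cdot> Ident A (Dom A f)" using e s by (simp add: additive)
  finally have rf: "r \<cdot> f = Ident A (Dom A f)" using monicD [OF e(4), of "r \<cdot> f" "Ident A (Dom A f)"] r e by simp
  have "f \<cdot> (r \<cdot> s) = ?d \<cdot> s" using reassoc [OF r(4), of s] r s e by simp
  also have "\<dots> = Zero A (Dom A s) (Cod A f)" using e s by (simp add: additive)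
  finally have rs: "r \<cdot> s = Zero A (Dom A s) (Dom A f)" using monic_Zero [OF e(4), of "r \<cdot> s"] r s e by simp
  have "is_biproduct A (Dom A f) (Cod A g) (Cod A f) f s r g"
    unfolding is_biproduct_def Hom_iff using r s e rf rs by simp
  with that show thesis .
qed

lemma retraction_biproduct:
  assumes fg: "short_exact A f g" and r: "r \<in> Ar A" "Cod A r = Dom A f" "Dom A r = Cod A f" "r \<cdot> f = Ident A (Dom A f)"
  obtains s where "is_biproduct A (Dom A f) (Cod A g) (Cod A f) f s r g"
proof -
  interpret op: abelian "op_cat A" by (rule abelian_op) unfold_locales
  have c: "Cod A f = Dom A g" using short_exactD [OF fg] by simp
  obtain s where "is_biproduct (op_cat A) (Cod A g) (Dom A f) (Dom A g) g r s f"
    using op.section_biproduct [of g f r] fg r c by auto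
  then have "is_biproduct A (Cod A g) (Dom A f) (Cod A f) s f g r" using c by simp
  from that [OF biproduct_swap [OF this]] show thesis .
qed

text \<open>
  The pushout \<open>E\<close> is the cokernel of \<open>(k, -m) : Dom m \<rightarrow> Cod k \<oplus> Cod m\<close>, and this map is the kernel of
  the projection to \<open>E\<close> because \<open>m\<close> is a monomorphism. So a map into \<open>Cod k\<close> that dies in \<open>E\<close> comes from a
  map \<open>y\<close> into \<open>Dom m\<close> with \<open>m y = 0\<close>, and pushouts preserve monomorphisms and their cokernels.
\<close>

lemma pushout_short_exact:
  assumes mc: "short_exact A m c" and k: "k \<in> Ar A" "Dom A k = Dom A m"
  obtains E j w \<gamma> where "short_exact A j \<gamma>" "Dom A j = Cod A k" "Cod A j = E" "Cod A \<gamma> = Cod A c"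
    "w \<in> Ar A" "Dom A w = Cod A m" "Cod A w = E" "j \<cdot> k = w \<cdot> m" "\<gamma> \<cdot> w = c"
    "\<And>s t. s \<in> Ar A \<Longrightarrow> t \<in> Ar A \<Longrightarrow> Dom A s = Cod A k \<Longrightarrow> Dom A t = Cod A m \<Longrightarrow> Cod A s = Cod A t \<Longrightarrow>
       s \<cdot> k = t \<cdot> m \<Longrightarrow> \<exists>h. h \<in> Ar A \<and> Dom A h = E \<and> Cod A h = Cod A t \<and> h \<cdot> j = s \<and> h \<cdot> w = t"
    "\<And>h h'. h \<in> Ar A \<Longrightarrow> h' \<in> Ar A \<Longrightarrow> Dom A h = E \<Longrightarrow> Dom A h' = E \<Longrightarrow> Cod A h = Cod A h' \<Longrightarrow>
       h \<cdot> j = h' \<cdot> j \<Longrightarrow> h \<cdot> w = h' \<cdot> w \<Longrightarrow> h = h'"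
proof -
  note m = short_exactD [OF mc]
  obtain B i l p q where b: "is_biproduct A (Cod A k) (Cod A m) B i l p q"
    using biproduct_ex [of "Cod A k" "Cod A m"] k m by auto
  note b' = biproductD [OF b]
  define d where "d = (i \<cdot> k) \<ominus> (l \<cdot> m)"
  have d: "d \<in> Ar A" "Dom A d = Dom A m" "Cod A d = B" using b' k m by (auto simp: d_def)
  have "q \<cdot> d = Zero A (Dom A m) (Cod A m) \<ominus> m"
    unfolding d_def using b' k m reassoc [OF b'(17), of m] reassoc [OF b'(18), of k] by (simp add: additive)
  then have qd: "q \<cdot> (d \<cdot> y) = Zero A (Dom A y) (Cod A m) \<ominus> (m \<cdot> y)" if "y \<in> Ar A" "Cod A y = Dom A m" for y
    using reassoc [of q d _ y] that b' k m d by (simp add: additive)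
  have qd0: "y = Zero A (Dom A y) (Dom A m)" if "y \<in> Ar A" "Cod A y = Dom A m" 
      "Zero A (Dom A y) (Cod A m) \<ominus> (m \<cdot> y) = Zero A (Dom A y) (Cod A m)" for y
  proof -
    have "Zero A (Dom A y) (Cod A m) = m \<cdot> y" by (rule minus_eqD [OF that(3)]) (use that m in auto)
    then show ?thesis using monic_Zero [OF m(4), of y] that by simp
  qed
  have d_monic: "monic A d"
  proof (rule monicI [OF d(1)])
    fix y assume y: "y \<in> Ar A" "Cod A y = Dom A d" "d \<cdot> y = Zero A (Dom A y) (Cod A d)"
    show "y = Zero A (Dom A y) (Dom A d)"
      using qd [of y] qd0 [of y] y d b' by simp
  qed
  obtain e where e: "is_cokernel A e d" using cokernel_ex d by blast
  note e' = cokernelD [OF e] and ee = cokernel_epic [OF e]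
  define j where "j = e \<cdot> i"
  define w where "w = e \<cdot> l"
  have j: "j \<in> Ar A" "Dom A j = Cod A k" "Cod A j = Cod A e" and w: "w \<in> Ar A" "Dom A w = Cod A m" "Cod A w = Cod A e"
    using e' d b' by (auto simp: j_def w_def)
  have "(e \<cdot> (i \<cdot> k)) \<ominus> (e \<cdot> (l \<cdot> m)) = Zero A (Dom A m) (Cod A e)"
    using e' d b' k m by (simp add: d_def additive)
  then have "e \<cdot> (i \<cdot> k) = e \<cdot> (l \<cdot> m)" by (rule minus_eqD) (use e' d b' k m in auto)
  then have jk: "j \<cdot> k = w \<cdot> m" unfolding j_def w_def using e' d b' k m by simp
  have ex: "\<exists>h. h \<in> Ar A \<and> Dom A h = Cod A e \<and> Cod A h = Cod A t \<and> h \<cdot> j = s \<and> h \<cdot> w = t"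
    if st: "s \<in> Ar A" "t \<in> Ar A" "Dom A s = Cod A k" "Dom A t = Cod A m" "Cod A s = Cod A t" "s \<cdot> k = t \<cdot> m" for s t
  proof -
    obtain v where v: "v \<in> Ar A" "Dom A v = B" "Cod A v = Cod A t" "v \<cdot> i = s" "v \<cdot> l = t"
      using biproduct_copair [OF b, of s t] st by auto
    have "v \<cdot> d = Zero A (Dom A d) (Cod A t)"
      unfolding d_def using v b' k m st reassoc [OF v(4), of k] reassoc [OF v(5), of m] by (simp add: additive)
    then obtain h where h: "h \<in> Ar A" "Cod A h = Cod A t" "Dom A h = Cod A e" "h \<cdot> e = v"
      using cokernel_lift [OF e, of v] v d by auto
    then have "h \<cdot> j = s" "h \<cdot> w = t" 
      unfolding j_def w_def using reassoc [OF h(4), of i] reassoc [OF h(4), of l] 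
        comp_assoc [of i e h] comp_assoc [of l e h] e' b' d v by auto
    with h show ?thesis by blast
  qed
  have uniq: "h = h'" if h: "h \<in> Ar A" "h' \<in> Ar A" "Dom A h = Cod A e" "Dom A h' = Cod A e" "Cod A h = Cod A h'"
       "h \<cdot> j = h' \<cdot> j" "h \<cdot> w = h' \<cdot> w" for h h'
  proof -
    have "h \<cdot> e = h' \<cdot> e"
      by (rule biproduct_ext [OF b]) (use h e' d b' in \<open>simp_all add: j_def w_def\<close>)
    then show ?thesis by (rule epicD [OF ee, rotated -1]) (use h in auto)
  qed
  obtain \<gamma> where \<gamma>: "\<gamma> \<in> Ar A" "Dom A \<gamma> = Cod A e" "Cod A \<gamma> = Cod A c" "\<gamma> \<cdot> j = Zero A (Cod A k) (Cod A c)" "\<gamma> \<cdot> w = c"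
    using ex [of "Zero A (Cod A k) (Cod A c)" c] m k by auto
  have "monic A j"
  proof (rule monicI [OF j(1)])
    fix x assume x: "x \<in> Ar A" "Cod A x = Dom A j" "j \<cdot> x = Zero A (Dom A x) (Cod A j)"
    then have "e \<cdot> (i \<cdot> x) = Zero A (Dom A x) (Cod A e)" using e' d b' j by (simp add: j_def)
    then obtain y where y: "y \<in> Ar A" "Dom A y = Dom A x" "Cod A y = Dom A d" "d \<cdot> y = i \<cdot> x"
      using kernel_lift [OF monic_is_kernel [OF d_monic e], of "i \<cdot> x" "Dom A x"] x j b' e' d by auto
    have "q \<cdot> (d \<cdot> y) = Zero A (Dom A x) (Cod A m)" using y(4) x j b' reassoc [OF b'(18), of x] by simp
    then have "y = Zero A (Dom A y) (Dom A m)" using qd [of y] qd0 [of y] y d by simp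
    then have "d \<cdot> y = Zero A (Dom A x) (Cod A d)" using comp_Zero(1) [of d "Dom A m" "Dom A x"] y(1-3) x d by simp
    then have "p \<cdot> (i \<cdot> x) = Zero A (Dom A x) (Cod A k)" using y x d b' by simp
    then show "x = Zero A (Dom A x) (Dom A j)" using reassoc [OF b'(16), of x] x j b' by simp
  qed
  moreover have "is_cokernel A \<gamma> j"
  proof (rule is_cokernelI)
    show "epic A \<gamma>" using epic_of_comp [of \<gamma> w] \<gamma> w m by simp
    fix t assume t: "t \<in> Ar A" "Dom A t = Cod A j" "t \<cdot> j = Zero A (Dom A j) (Cod A t)"
    have "t \<cdot> (w \<cdot> m) = Zero A (Dom A m) (Cod A t)" 
      using jk [symmetric] reassoc [OF t(3), of k] t j k m by simp
    then obtain u where u: "u \<in> Ar A" "Cod A u = Cod A t" "Dom A u = Cod A c" "u \<cdot> c = t \<cdot> w"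
      using cokernel_lift [OF m(8), of "t \<cdot> w"] t w j m by auto
    have "u \<cdot> \<gamma> = t"
      by (rule uniq) (use u \<gamma> t j w k in auto)
    then show "\<exists>u. u \<in> Hom A (Cod A \<gamma>) (Cod A t) \<and> u \<cdot> \<gamma> = t" using u \<gamma> by (auto simp: Hom_iff)
  qed (use \<gamma> j in auto)
  ultimately have "short_exact A j \<gamma>" using short_exact_cokernel by simp
  then show thesis
    using that [of j \<gamma> "Cod A e" w] j \<gamma> w jk ex uniq by blast
qed

lemma pullback_short_exact:
  assumes mc: "short_exact A m c" and k: "k \<in> Ar A" "Cod A k = Cod A c"
  obtains E j w \<gamma> where "short_exact A \<gamma> j" "Cod A j = Dom A k" "Dom A j = E" "Dom A \<gamma> = Dom A m"
    "w \<in> Ar A" "Cod A w = Dom A c" "Dom A w = E" "k \<cdot> j = c \<cdot> w" "w \<cdot> \<gamma> = m"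
proof -
  interpret op: abelian "op_cat A" by (rule abelian_op) unfold_locales
  show thesis
    using op.pushout_short_exact [of c m k] mc k that by (simp) metis
qed

end

section \<open>Split extensions and lifting\<close>

text \<open>
  This is \<open>Ext\<^sup>1(X, Y) = 0\<close>, see \<open>Ext_vanishes_1_iff_splits\<close> below.
\<close>

definition splits :: "('o, 'm) preadd \<Rightarrow> 'o \<Rightarrow> 'o \<Rightarrow> bool" where
  "splits A X Y \<longleftrightarrow> (\<forall>f g. short_exact A f g \<and> Dom A f = Y \<and> Cod A g = X \<longrightarrow>
     (\<exists>s \<in> Hom A X (Cod A f). g \<cdot>\<^bsub>A\<^esub> s = Ident A X))"

lemma splitsE:
  assumes "splits A X Y" "short_exact A f g" "Dom A f = Y" "Cod A g = X"
  obtains s where "s \<in> Ar A" "Dom A s = X" "Cod A s = Cod A f" "g \<cdot>\<^bsub>A\<^esub> s = Ident A X"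
proof -
  have "\<exists>s \<in> Hom A X (Cod A f). g \<cdot>\<^bsub>A\<^esub> s = Ident A X"
    using assms unfolding splits_def by simp
  then show thesis using that by (auto simp: Hom_iff)
qed

context abelian
begin

lemma splits_opI: assumes "splits A X Y" shows "splits (op_cat A) Y X"
  unfolding splits_def
proof (intro allI impI)
  fix f g assume "short_exact (op_cat A) f g \<and> Dom (op_cat A) f = X \<and> Cod (op_cat A) g = Y"
  then have fg: "short_exact A g f" "Dom A g = Y" "Cod A f = X" by auto
  obtain s where s: "s \<in> Ar A" "Dom A s = X" "Cod A s = Cod A g" "f \<cdot> s = Ident A X"
    using splitsE [OF assms fg] by metis
  obtain r where "is_biproduct A (Dom A g) (Cod A f) (Cod A g) g s r f"
    using section_biproduct [OF fg(1) s(1)] s fg by auto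
  note r = biproductD [OF this]
  have "r \<in> Hom A (Cod A g) Y" "r \<cdot> g = Ident A Y" using r(10-12,16) fg(2) by (auto simp: Hom_iff)
  then show "\<exists>s\<in>Hom (op_cat A) Y (Cod (op_cat A) f). g \<cdot>\<^bsub>op_cat A\<^esub> s = Ident (op_cat A) Y"
    using short_exactD(3) [OF fg(1)] by (intro bexI [of _ r]) simp_all
qed

lemma splits_op: "splits (op_cat A) Y X = splits A X Y"
proof -
  interpret op: abelian "op_cat A" by (rule abelian_op) unfold_locales
  show ?thesis using splits_opI [of X Y] op.splits_opI [of Y X] by auto
qed

lemma splits_lift:
  assumes "splits A X Y" and fg: "short_exact A f g" "Dom A f = Y" and u: "u \<in> Ar A" "Dom A u = X" "Cod A u = Cod A g"
  obtains v where "v \<in> Ar A" "Dom A v = X" "Cod A v = Cod A f" "g \<cdot> v = u"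
proof -
  note e = short_exactD [OF fg(1)]
  obtain E j w \<gamma> where p: "short_exact A \<gamma> j" "Cod A j = Dom A u" "Dom A j = E" "Dom A \<gamma> = Dom A f"
    "w \<in> Ar A" "Cod A w = Dom A g" "Dom A w = E" "u \<cdot> j = g \<cdot> w" "w \<cdot> \<gamma> = f"
    using pullback_short_exact [OF fg(1), of u] u by metis
  note p' = short_exactD [OF p(1)]
  obtain s where s: "s \<in> Ar A" "Dom A s = X" "Cod A s = Cod A \<gamma>" "j \<cdot> s = Ident A X"
    using splitsE [OF assms(1) p(1)] p fg u by metis
  have "g \<cdot> (w \<cdot> s) = (u \<cdot> j) \<cdot> s" unfolding p(8) using p p' s e by simp
  also have "\<dots> = u" using p(1-7) p' s e u by simp
  finally show thesis using that [of "w \<cdot> s"] p p' s e by simp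
qed

lemma splits_extend:
  assumes "splits A X Y" and fg: "short_exact A f g" "Cod A g = X" and u: "u \<in> Ar A" "Cod A u = Y" "Dom A u = Dom A f"
  obtains v where "v \<in> Ar A" "Cod A v = Y" "Dom A v = Cod A f" "v \<cdot> f = u"
proof -
  interpret op: abelian "op_cat A" by (rule abelian_op) unfold_locales
  show thesis using op.splits_lift [of Y X g f u] splits_op assms that short_exactD [OF fg(1)] by auto
qed

lemma has_liftI:
  assumes "\<And>u v. u \<in> Ar A \<Longrightarrow> v \<in> Ar A \<Longrightarrow> Dom A u = Dom A i \<Longrightarrow> Cod A u = Dom A p \<Longrightarrow>
      Dom A v = Cod A i \<Longrightarrow> Cod A v = Cod A p \<Longrightarrow> p \<cdot> u = v \<cdot> i \<Longrightarrow>
      \<exists>h. h \<in> Ar A \<and> Dom A h = Cod A i \<and> Cod A h = Dom A p \<and> h \<cdot> i = u \<and> p \<cdot> h = v"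
  shows "has_lift A i p"
  unfolding has_lift_def 
proof (intro ballI impI)
  fix u v assume "u \<in> Hom A (Dom A i) (Dom A p)" "v \<in> Hom A (Cod A i) (Cod A p)" "p \<cdot> u = v \<cdot> i"
  then have "\<exists>h. h \<in> Ar A \<and> Dom A h = Cod A i \<and> Cod A h = Dom A p \<and> h \<cdot> i = u \<and> p \<cdot> h = v"
    by (intro assms) (auto simp: Hom_iff)
  then show "\<exists>h\<in>Hom A (Cod A i) (Dom A p). h \<cdot> i = u \<and> p \<cdot> h = v"
    by (auto simp: Hom_iff)
qed

lemma has_liftE:
  assumes "has_lift A i p" "u \<in> Ar A" "v \<in> Ar A" "Dom A u = Dom A i" "Cod A u = Dom A p"
    "Dom A v = Cod A i" "Cod A v = Cod A p" "p \<cdot> u = v \<cdot> i"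
  obtains h where "h \<in> Ar A" "Dom A h = Cod A i" "Cod A h = Dom A p" "h \<cdot> i = u" "p \<cdot> h = v"
proof -
  have "u \<in> Hom A (Dom A i) (Dom A p)" "v \<in> Hom A (Cod A i) (Cod A p)" using assms by (auto simp: Hom_iff)
  then have "\<exists>h\<in>Hom A (Cod A i) (Dom A p). h \<cdot> i = u \<and> p \<cdot> h = v"
    using assms unfolding has_lift_def by blast
  then show thesis using that by (auto simp: Hom_iff)
qed

text \<open>
  For a square \<open>u, v\<close> from \<open>i\<close> to \<open>p\<close>, let \<open>D\<close> be the pushout of \<open>i\<close> along \<open>u\<close>, with \<open>b : Cod i \<rightarrow> D\<close>, and let \<open>N\<close> be the kernel of
  the induced map \<open>\<theta>\<close> from \<open>D\<close> to \<open>Cod p\<close>. Then \<open>N\<close> is an extension of \<open>Cod c\<close> by \<open>Dom k\<close>. A section of it is also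
  a section of \<open>D \<rightarrow> Cod c\<close>, with values in the kernel of \<open>\<theta>\<close>; the complementary retraction
  \<open>r : D \<rightarrow> Dom p\<close> satisfies \<open>p r = \<theta>\<close>, and \<open>r b\<close> is a lift.
\<close>

lemma has_lift_of_splits:
  assumes ic: "short_exact A i c" and kp: "short_exact A k p" and "splits A (Cod A c) (Dom A k)"
  shows "has_lift A i p"
proof (rule has_liftI)
  note I = short_exactD [OF ic] and P = short_exactD [OF kp]
  fix u v assume u: "u \<in> Ar A" "Dom A u = Dom A i" "Cod A u = Dom A p" 
    and v: "v \<in> Ar A" "Dom A v = Cod A i" "Cod A v = Cod A p" and sq: "p \<cdot> u = v \<cdot> i"
  obtain D x b \<gamma> where D: "short_exact A x \<gamma>" "Dom A x = Cod A u" "Cod A x = D" "Cod A \<gamma> = Cod A c"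
    "b \<in> Ar A" "Dom A b = Cod A i" "Cod A b = D" "x \<cdot> u = b \<cdot> i" "\<gamma> \<cdot> b = c"
    and ex: "\<And>s t. s \<in> Ar A \<Longrightarrow> t \<in> Ar A \<Longrightarrow> Dom A s = Cod A u \<Longrightarrow> Dom A t = Cod A i \<Longrightarrow> Cod A s = Cod A t \<Longrightarrow>
       s \<cdot> u = t \<cdot> i \<Longrightarrow> \<exists>h. h \<in> Ar A \<and> Dom A h = D \<and> Cod A h = Cod A t \<and> h \<cdot> x = s \<and> h \<cdot> b = t"
    using pushout_short_exact [OF ic u(1,2)] by metis
  note X = short_exactD [OF D(1)]
  obtain \<theta> where \<theta>: "\<theta> \<in> Ar A" "Dom A \<theta> = D" "Cod A \<theta> = Cod A p" "\<theta> \<cdot> x = p" "\<theta> \<cdot> b = v"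
    using ex [of p v] u v sq P by auto
  have theta_epic: "epic A \<theta>" using epic_of_comp [of \<theta> x] \<theta> X P D by simp
  obtain n where n: "is_kernel A n \<theta>" using kernel_ex \<theta> by blast
  note n' = kernelD [OF n] and nm = kernel_monic [OF n]
  have xk: "\<theta> \<cdot> (x \<cdot> k) = Zero A (Dom A k) (Cod A p)"
    using reassoc [OF \<theta>(4), of k] X P D u \<theta> by simp
  then obtain k' where k': "k' \<in> Ar A" "Dom A k' = Dom A k" "Cod A k' = Dom A n" "n \<cdot> k' = x \<cdot> k"
    using kernel_lift [OF n, of "x \<cdot> k" "Dom A k"] \<theta> X P D u by auto
  have ty: "Cod A n = D" "Cod A x = D" "Dom A x = Dom A p" "Dom A \<gamma> = D" "n \<in> Ar A" "x \<in> Ar A" "\<gamma> \<in> Ar A"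
     "k \<in> Ar A" "Cod A k = Dom A p" "p \<in> Ar A" "Cod A \<gamma> = Cod A c" "c \<in> Ar A" "Dom A c = Cod A i"
    using n' \<theta> X D P u I by auto
  have "short_exact A k' (\<gamma> \<cdot> n)"
    unfolding short_exact_kernel
  proof
    show "is_kernel A k' (\<gamma> \<cdot> n)"
    proof (rule is_kernelI)
      have "monic A (x \<cdot> k)" using monic_comp X P D u by simp
      then show "monic A k'" using monic_of_comp [of n k'] k' n' by simp
      show "\<gamma> \<cdot> n \<in> Ar A" "Cod A k' = Dom A (\<gamma> \<cdot> n)" using ty k' by auto
      show "(\<gamma> \<cdot> n) \<cdot> k' = Zero A (Dom A k') (Cod A (\<gamma> \<cdot> n))" 
        using ty k' reassoc [OF X(6), of k] by simp
      fix h assume h: "h \<in> Ar A" "Cod A h = Dom A (\<gamma> \<cdot> n)" "(\<gamma> \<cdot> n) \<cdot> h = Zero A (Dom A h) (Cod A (\<gamma> \<cdot> n))"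
      then have h': "h \<in> Ar A" "Cod A h = Dom A n" using ty by auto
      have "\<gamma> \<cdot> (n \<cdot> h) = Zero A (Dom A h) (Cod A \<gamma>)" using h h' ty by simp
      then obtain z where z: "z \<in> Ar A" "Dom A z = Dom A h" "Cod A z = Dom A x" "x \<cdot> z = n \<cdot> h"
        using kernel_lift [OF X(7), of "n \<cdot> h" "Dom A h"] ty h' by auto
      have "p \<cdot> z = \<theta> \<cdot> (n \<cdot> h)" using reassoc [OF \<theta>(4), of z] ty \<theta> z(1-3) z(4) [symmetric] by simp
      also have "\<dots> = Zero A (Dom A h) (Cod A p)" using reassoc [OF n'(4), of h] h' ty \<theta> by simp
      finally obtain y where y: "y \<in> Ar A" "Dom A y = Dom A h" "Cod A y = Dom A k" "k \<cdot> y = z"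
        using kernel_lift [OF P(7), of z "Dom A h"] ty z by auto
      have "n \<cdot> (k' \<cdot> y) = n \<cdot> h" using reassoc [OF k'(4), of y] y ty k' z by simp
      then have "k' \<cdot> y = h" using monicD [OF nm, of "k' \<cdot> y" h] y ty k' h' by simp
      then show "\<exists>u. u \<in> Hom A (Dom A h) (Dom A k') \<and> k' \<cdot> u = h" using y k' by (auto simp: Hom_iff)
    qed
    \<comment> \<open>A map that kills \<open>\<gamma> n\<close> factors through \<open>\<theta>\<close>; restricting it to \<open>Dom p\<close>, where \<open>\<theta>\<close> is the epimorphism \<open>p\<close>
      and \<open>\<gamma>\<close> vanishes, shows that it is zero.\<close>
    show "epic A (\<gamma> \<cdot> n)"
    proof (rule epicI)
      show "\<gamma> \<cdot> n \<in> Ar A" using ty by auto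
      fix t assume t: "t \<in> Ar A" "Dom A t = Cod A (\<gamma> \<cdot> n)" "t \<cdot> (\<gamma> \<cdot> n) = Zero A (Dom A (\<gamma> \<cdot> n)) (Cod A t)"
      then have t': "Dom A t = Cod A c" using ty by auto
      have "(t \<cdot> \<gamma>) \<cdot> n = Zero A (Dom A n) (Cod A t)" using t t' ty by simp
      then obtain t2 where t2: "t2 \<in> Ar A" "Cod A t2 = Cod A t" "Dom A t2 = Cod A p" "t2 \<cdot> \<theta> = t \<cdot> \<gamma>"
        using cokernel_lift [OF epic_is_cokernel [OF theta_epic n], of "t \<cdot> \<gamma>"] t t' ty \<theta> by auto
      have "t2 \<cdot> p = (t2 \<cdot> \<theta>) \<cdot> x" using t2(1-3) \<theta> ty by simp
      also have "\<dots> = Zero A (Dom A p) (Cod A t)" unfolding t2(4) using t t' ty X by simp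
      finally have "t2 = Zero A (Cod A p) (Cod A t)" using epic_Zero [OF P(5), of t2] t2 by simp
      then have "t \<cdot> \<gamma> = Zero A D (Cod A t)" using t2 \<theta> P t by simp
      then show "t = Zero A (Cod A (\<gamma> \<cdot> n)) (Cod A t)" using epic_Zero [OF X(5), of t] t t' ty by simp
    qed
  qed
  then obtain \<sigma> where \<sigma>: "\<sigma> \<in> Ar A" "Dom A \<sigma> = Cod A c" "Cod A \<sigma> = Dom A n" "(\<gamma> \<cdot> n) \<cdot> \<sigma> = Ident A (Cod A c)"
    using splitsE [OF assms(3), of k' "\<gamma> \<cdot> n"] k' ty by auto
  obtain r where "is_biproduct A (Dom A x) (Cod A \<gamma>) (Cod A x) x (n \<cdot> \<sigma>) r \<gamma>"
    using section_biproduct [OF D(1), of "n \<cdot> \<sigma>"] \<sigma> ty by auto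
  then have bp: "is_biproduct A (Dom A p) (Cod A c) D x (n \<cdot> \<sigma>) r \<gamma>" using ty by simp
  note b' = biproductD [OF bp]
  have pr: "p \<cdot> r = \<theta>"
  proof (rule biproduct_ext [OF bp])
    show "(p \<cdot> r) \<cdot> x = \<theta> \<cdot> x" using b'(1-19) \<theta> ty by simp
    show "(p \<cdot> r) \<cdot> (n \<cdot> \<sigma>) = \<theta> \<cdot> (n \<cdot> \<sigma>)" 
      using b'(1-15) b'(19) \<theta> ty \<sigma>(1-3) reassoc [OF n'(4), of \<sigma>] by simp
  qed (use b' \<theta> ty in auto)
  have "(r \<cdot> b) \<cdot> i = r \<cdot> (x \<cdot> u)" using b' D I by simp
  also have "\<dots> = u" using reassoc [OF b'(16), of u] b' u ty by simp
  finally have 1: "(r \<cdot> b) \<cdot> i = u" .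
  have "p \<cdot> (r \<cdot> b) = \<theta> \<cdot> b" using reassoc [OF pr, of b] b' D ty by simp
  then have 2: "p \<cdot> (r \<cdot> b) = v" using \<theta> by simp
  show "\<exists>h. h \<in> Ar A \<and> Dom A h = Cod A i \<and> Cod A h = Dom A p \<and> h \<cdot> i = u \<and> p \<cdot> h = v"
    using 1 2 b' D by (intro exI [of _ "r \<cdot> b"]) auto
qed

section \<open>Yoneda Ext\<close>

lemma projectiveE:
  assumes "projective A P" "epic A e" "f \<in> Ar A" "Dom A f = P" "Cod A f = Cod A e"
  obtains g where "g \<in> Ar A" "Dom A g = P" "Cod A g = Dom A e" "e \<cdot> g = f"
proof -
  have "f \<in> Hom A P (Cod A e)" using assms by (simp add: Hom_iff)
  then have "\<exists>g \<in> Hom A P (Dom A e). e \<cdot> g = f" using assms unfolding projective_def by blast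
  then show thesis using that by (auto simp: Hom_iff)
qed

text \<open>
  Postcomposition with a monomorphism does not change the kernel.
\<close>

lemma exact_at_monic_comp:
  assumes "monic A m" "g \<in> Ar A" "Cod A g = Dom A m"
  shows "exact_at A f (m \<cdot> g) \<longleftrightarrow> exact_at A f g"
proof -
  have "m \<cdot> (g \<cdot> h) = Zero A (Dom A h) (Cod A m) \<longleftrightarrow> g \<cdot> h = Zero A (Dom A h) (Cod A g)"
    if "h \<in> Ar A" "Cod A h = Dom A g" for h
    using monic_Zero [OF assms(1), of "g \<cdot> h" "Dom A h"] that assms by auto
  then have *: "(m \<cdot> g) \<cdot> h = Zero A (Dom A h) (Cod A m) \<longleftrightarrow> g \<cdot> h = Zero A (Dom A h) (Cod A g)"
    if "h \<in> Ar A" "Cod A h = Dom A g" for h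
    using that assms by simp
  have "is_kernel A k (m \<cdot> g) = is_kernel A k g" for k
  proof
    assume k: "is_kernel A k (m \<cdot> g)"
    show "is_kernel A k g"
      by (rule is_kernelI [OF kernel_monic [OF k]]) 
        (use kernelD [OF k] assms * ex1_implies_ex [OF kernel_ex1 [OF k]] in auto)
  next
    assume k: "is_kernel A k g"
    show "is_kernel A k (m \<cdot> g)"
      by (rule is_kernelI [OF kernel_monic [OF k]]) 
        (use kernelD [OF k] assms * ex1_implies_ex [OF kernel_ex1 [OF k]] in auto)
  qed
  then show ?thesis unfolding exact_at_def by simp
qed

lemma extensions_1_iff:
  "(E, d) \<in> extensions A (Suc 0) X Y \<longleftrightarrow> E 0 = X \<and> E (Suc (Suc 0)) = Y \<and> short_exact A (d (Suc 0)) (d 0) \<and>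
     Dom A (d (Suc 0)) = Y \<and> Cod A (d (Suc 0)) = E (Suc 0) \<and> Dom A (d 0) = E (Suc 0) \<and> Cod A (d 0) = X"
  (is "?l = ?r")
proof
  assume l: ?l
  then have "E 0 = X" "E (Suc (Suc 0)) = Y" "d 0 \<in> Hom A (E (Suc 0)) (E 0)" 
    "d (Suc 0) \<in> Hom A (E (Suc (Suc 0))) (E (Suc 0))"
    "monic A (d (Suc 0))" "exact_at A (d (Suc 0)) (d 0)" "epic A (d 0)"
    unfolding extensions_def by auto
  then show ?r unfolding short_exact_def by (simp add: Hom_iff)
next
  assume r: ?r
  note e = short_exactD [of "d (Suc 0)" "d 0"]
  have "E 0 \<in> Ob A" "E (Suc 0) \<in> Ob A" "E (Suc (Suc 0)) \<in> Ob A"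
    using r e(1,2) Dom_Ob [of "d 0"] Cod_Ob [of "d 0"] Dom_Ob [of "d (Suc 0)"] by simp_all
  then have "\<forall>i \<le> Suc (Suc 0). E i \<in> Ob A" by (auto simp: le_Suc_eq)
  moreover have "\<forall>i \<le> Suc 0. d i \<in> Hom A (E (Suc i)) (E i)" using r e by (auto simp: le_Suc_eq Hom_iff)
  ultimately show ?l using r unfolding extensions_def short_exact_def by simp
qed

lemma Ext_vanishesI:
  assumes e0: "e0 \<in> extensions A n X Y" and *: "\<And>e. e \<in> extensions A n X Y \<Longrightarrow> extension_morphism A n X Y e0 e"
  shows "Ext_vanishes A n X Y"
proof -
  let ?r = "{(e, e'). equivclp (extension_morphism A n X Y) e e'}"
  have "?r `` {e} = ?r `` {e0}" if e: "e \<in> extensions A n X Y" for e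
  proof -
    have "equivclp (extension_morphism A n X Y) e0 e" using * [OF e] by (rule r_into_equivclp)
    then have "equivclp (extension_morphism A n X Y) e e' \<longleftrightarrow> equivclp (extension_morphism A n X Y) e0 e'" for e'
      by (meson equivclp_sym equivclp_trans)
    then show ?thesis by auto
  qed
  then have "Ext A n X Y = {?r `` {e0}}" unfolding Ext_def quotient_def using e0 by blast
  then show ?thesis unfolding Ext_vanishes_def by simp
qed

lemma Ext_vanishesD:
  assumes "Ext_vanishes A n X Y" "e \<in> extensions A n X Y" "e' \<in> extensions A n X Y"
  shows "equivclp (extension_morphism A n X Y) e e'"
proof -
  let ?r = "{(e, e'). equivclp (extension_morphism A n X Y) e e'}"
  have "?r `` {e} \<in> Ext A n X Y" "?r `` {e'} \<in> Ext A n X Y" unfolding Ext_def by (rule quotientI [OF assms(2)], rule quotientI [OF assms(3)])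
  moreover obtain x where x: "Ext A n X Y = {x}" using assms(1) unfolding Ext_vanishes_def is_singleton_def by (elim exE)
  ultimately have "?r `` {e} = ?r `` {e'}" unfolding x by (elim singletonE) (simp only:)
  moreover have "e' \<in> ?r `` {e'}" by simp
  ultimately have "e' \<in> ?r `` {e}" by (simp only:)
  then show ?thesis by simp
qed

definition extension_is_split where
  "extension_is_split X e \<longleftrightarrow> (\<exists>s \<in> Hom A X (fst e (Suc 0)). snd e 0 \<cdot> s = Ident A X)"

text \<open>
  Sections are transported forwards along a morphism of extensions and retractions backwards, so
  splitting is an invariant of the Yoneda class.
\<close>

lemma extension_morphism_split:
  assumes "extension_morphism A (Suc 0) X Y e e'"
  shows "extension_is_split X e \<longleftrightarrow> extension_is_split X e'"
proof -
  obtain E d E' d' where e: "e = (E, d)" "e' = (E', d')" by (cases e, cases e')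
  obtain h where 1: "(E, d) \<in> extensions A (Suc 0) X Y" "(E', d') \<in> extensions A (Suc 0) X Y"
    and h: "h 0 = Ident A X" "h (Suc (Suc 0)) = Ident A Y" "\<forall>i \<le> Suc (Suc 0). h i \<in> Hom A (E i) (E' i)"
        "\<forall>i \<le> Suc 0. h i \<cdot> d i = d' i \<cdot> h (Suc i)"
    using assms unfolding extension_morphism_def e by auto
  have h1: "h (Suc 0) \<in> Ar A" "Dom A (h (Suc 0)) = E (Suc 0)" "Cod A (h (Suc 0)) = E' (Suc 0)"
    using h(3) by (auto simp: Hom_iff)
  have s: "short_exact A (d (Suc 0)) (d 0)" "short_exact A (d' (Suc 0)) (d' 0)" 
    "Dom A (d (Suc 0)) = Y" "Dom A (d' (Suc 0)) = Y" "Cod A (d (Suc 0)) = E (Suc 0)" "Dom A (d 0) = E (Suc 0)"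
    "Cod A (d 0) = X" "Cod A (d' (Suc 0)) = E' (Suc 0)" "Dom A (d' 0) = E' (Suc 0)" "Cod A (d' 0) = X"
    using 1 unfolding extensions_1_iff by auto
  note s1 = short_exactD [OF s(1)] and s2 = short_exactD [OF s(2)]
  have h0: "d' 0 \<cdot> h (Suc 0) = d 0" using h(4) [rule_format, of 0] h(1) s s1 by simp
  have h2: "h (Suc 0) \<cdot> d (Suc 0) = d' (Suc 0)" using h(4) [rule_format, of "Suc 0"] h(2) s s2 by simp
  show ?thesis
  proof
    assume "extension_is_split X e"
    then obtain t where t: "t \<in> Ar A" "Dom A t = X" "Cod A t = E (Suc 0)" "d 0 \<cdot> t = Ident A X"
      unfolding extension_is_split_def e by (auto simp: Hom_iff)
    then show "extension_is_split X e'" 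
      unfolding extension_is_split_def e using h1 reassoc [OF h0, of t] s s2
      by (intro bexI [of _ "h (Suc 0) \<cdot> t"]) (auto simp: Hom_iff)
  next
    assume "extension_is_split X e'"
    then obtain t where t: "t \<in> Ar A" "Dom A t = X" "Cod A t = E' (Suc 0)" "d' 0 \<cdot> t = Ident A X"
      unfolding extension_is_split_def e by (auto simp: Hom_iff)
    obtain r where "is_biproduct A Y X (E' (Suc 0)) (d' (Suc 0)) t r (d' 0)"
      using section_biproduct [OF s(2), of t] t s by auto
    note b = biproductD [OF this]
    have "(r \<cdot> h (Suc 0)) \<cdot> d (Suc 0) = Ident A Y" using b(10-12,16) h1 h2 s s1 by simp
    then obtain t' where "is_biproduct A Y X (E (Suc 0)) (d (Suc 0)) t' (r \<cdot> h (Suc 0)) (d 0)"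
      using retraction_biproduct [OF s(1), of "r \<cdot> h (Suc 0)"] b(10-12) h1 s by auto
    note b' = biproductD [OF this]
    show "extension_is_split X e" 
      unfolding extension_is_split_def e using b'(7-9,17) by (intro bexI [of _ t']) (auto simp: Hom_iff)
  qed
qed

lemma split_extension_ex:
  assumes b: "is_biproduct A Y X S i j p q"
  defines "E \<equiv> (\<lambda>n::nat. if n = 0 then X else if n = Suc 0 then S else Y)"
    and "d \<equiv> (\<lambda>n::nat. if n = 0 then q else i)"
  shows "(E, d) \<in> extensions A (Suc 0) X Y"
  using biproduct_short_exact [OF b] biproductD [OF b] unfolding extensions_1_iff by (simp add: E_def d_def)

lemma Ext_vanishes_1_iff_splits:
  assumes "X \<in> Ob A" "Y \<in> Ob A"
  shows "Ext_vanishes A 1 X Y \<longleftrightarrow> splits A X Y"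
proof
  obtain S i j p q where b: "is_biproduct A Y X S i j p q" using biproduct_ex assms by blast
  note b' = biproductD [OF b]
  define E where "E = (\<lambda>n::nat. if n = 0 then X else if n = Suc 0 then S else Y)"
  define d where "d = (\<lambda>n::nat. if n = 0 then q else i)"
  have e0: "(E, d) \<in> extensions A (Suc 0) X Y" unfolding E_def d_def by (rule split_extension_ex [OF b])
  { assume ev: "Ext_vanishes A 1 X Y"
    show "splits A X Y" unfolding splits_def
    proof (intro allI impI)
      fix f g assume "short_exact A f g \<and> Dom A f = Y \<and> Cod A g = X"
      then have fg: "short_exact A f g" "Dom A f = Y" "Cod A g = X" by auto
      define E' where "E' = (\<lambda>n::nat. if n = 0 then X else if n = Suc 0 then Cod A f else Y)"
      define d' where "d' = (\<lambda>n::nat. if n = 0 then g else f)"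
      have e1: "(E', d') \<in> extensions A (Suc 0) X Y" unfolding extensions_1_iff E'_def d'_def
        using fg short_exactD [OF fg(1)] by simp
      have "equivclp (extension_morphism A (Suc 0) X Y) (E, d) (E', d')" using Ext_vanishesD [OF ev] e0 e1 by simp
      then have "extension_is_split X (E, d) = extension_is_split X (E', d')"
        by (induction rule: equivclp_induct) (auto simp: extension_morphism_split)
      moreover have "extension_is_split X (E, d)" unfolding extension_is_split_def
        using b' by (intro bexI [of _ j]) (auto simp: Hom_iff E_def d_def)
      ultimately show "\<exists>s\<in>Hom A X (Cod A f). g \<cdot> s = Ident A X"
        unfolding extension_is_split_def E'_def d'_def by simp
    qed }
  { assume sp: "splits A X Y"
    show "Ext_vanishes A 1 X Y" unfolding One_nat_def
    proof (rule Ext_vanishesI [OF e0])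
      fix e assume "e \<in> extensions A (Suc 0) X Y"
      then obtain E' d' where e': "e = (E', d')" "(E', d') \<in> extensions A (Suc 0) X Y" by (cases e) auto
      then have s: "short_exact A (d' (Suc 0)) (d' 0)" "E' 0 = X" "E' (Suc (Suc 0)) = Y"
        "Dom A (d' (Suc 0)) = Y" "Cod A (d' (Suc 0)) = E' (Suc 0)" "Dom A (d' 0) = E' (Suc 0)" "Cod A (d' 0) = X"
        unfolding extensions_1_iff by auto
      note s' = short_exactD [OF s(1)]
      obtain t where t: "t \<in> Ar A" "Dom A t = X" "Cod A t = E' (Suc 0)" "d' 0 \<cdot> t = Ident A X"
        using splitsE [OF sp s(1)] s by metis
      obtain w where w: "w \<in> Ar A" "Dom A w = S" "Cod A w = E' (Suc 0)" "w \<cdot> i = d' (Suc 0)" "w \<cdot> j = t"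
        using biproduct_copair [OF b, of "d' (Suc 0)" t] t s s' by auto
      have q: "d' 0 \<cdot> w = q"
        by (rule biproduct_ext [OF b]) (use b' w s s' t in simp_all)
      define h where "h = (\<lambda>n::nat. if n = 0 then Ident A X else if n = Suc 0 then w else Ident A Y)"
      have "\<forall>i \<le> Suc (Suc 0). h i \<in> Hom A (E i) (E' i)" "\<forall>i \<le> Suc 0. h i \<cdot> d i = d' i \<cdot> h (Suc i)"
        using assms w q b' s s' by (auto simp: le_Suc_eq h_def E_def d_def Hom_iff)
      then show "extension_morphism A (Suc 0) X Y (E, d) e"
        unfolding extension_morphism_def e' using e0 e' by (auto simp: h_def intro!: exI [of _ h])
    qed }
qed

text \<open>
  For \<open>u\<close> the identity, this says that all \<open>n\<close>-extensions of \<open>X\<close> by \<open>Y\<close> are connected to a single one.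
  Arbitrary maps \<open>u\<close> are admitted because the inductive step produces a map between the syzygies
  that is not an identity, and pulling extensions back is thereby avoided.
\<close>

definition universal_extension :: "nat \<Rightarrow> 'o \<Rightarrow> 'o \<Rightarrow> ('o, 'm) ext_seq \<Rightarrow> bool" where
  "universal_extension n X Y = (\<lambda>(E, d). (E, d) \<in> extensions A n X Y \<and>
     (\<forall>K u E' d'. u \<in> Hom A X K \<longrightarrow> (E', d') \<in> extensions A n K Y \<longrightarrow>
       (\<exists>h. h 0 = u \<and> h (Suc n) = Ident A Y \<and> (\<forall>i \<le> Suc n. h i \<in> Hom A (E i) (E' i)) \<and>
         (\<forall>i \<le> n. h i \<cdot> d i = d' i \<cdot> h (Suc i)))))"

lemma universal_extension_Suc_0:
  assumes "X \<in> Ob A" "Y \<in> Ob A" "splits A X Y"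
  shows "\<exists>e. universal_extension (Suc 0) X Y e"
proof -
  obtain S i j p q where b: "is_biproduct A Y X S i j p q" using biproduct_ex assms by blast
  note b' = biproductD [OF b]
  define E where "E = (\<lambda>n::nat. if n = 0 then X else if n = Suc 0 then S else Y)"
  define d where "d = (\<lambda>n::nat. if n = 0 then q else i)"
  have e0: "(E, d) \<in> extensions A (Suc 0) X Y" unfolding E_def d_def by (rule split_extension_ex [OF b])
  have "\<exists>h. h 0 = u \<and> h (Suc (Suc 0)) = Ident A Y \<and> (\<forall>i \<le> Suc (Suc 0). h i \<in> Hom A (E i) (E' i)) \<and>
         (\<forall>i \<le> Suc 0. h i \<cdot> d i = d' i \<cdot> h (Suc i))"
    if u: "u \<in> Hom A X K" and e': "(E', d') \<in> extensions A (Suc 0) K Y" for K u E' d'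
  proof -
    have s: "short_exact A (d' (Suc 0)) (d' 0)" "E' 0 = K" "E' (Suc (Suc 0)) = Y"
      "Dom A (d' (Suc 0)) = Y" "Cod A (d' (Suc 0)) = E' (Suc 0)" "Dom A (d' 0) = E' (Suc 0)" "Cod A (d' 0) = K"
      using e' unfolding extensions_1_iff by auto
    note s' = short_exactD [OF s(1)]
    have u': "u \<in> Ar A" "Dom A u = X" "Cod A u = K" using u by (auto simp: Hom_iff)
    obtain t where t: "t \<in> Ar A" "Dom A t = X" "Cod A t = E' (Suc 0)" "d' 0 \<cdot> t = u"
      using splits_lift [OF assms(3) s(1,4), of u] u' s by metis
    obtain w where w: "w \<in> Ar A" "Dom A w = S" "Cod A w = E' (Suc 0)" "w \<cdot> i = d' (Suc 0)" "w \<cdot> j = t"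
      using biproduct_copair [OF b, of "d' (Suc 0)" t] t s s' by auto
    have q: "d' 0 \<cdot> w = u \<cdot> q"
      by (rule biproduct_ext [OF b]) (use b' w s s' t u' in simp_all)
    define h where "h = (\<lambda>n::nat. if n = 0 then u else if n = Suc 0 then w else Ident A Y)"
    have "\<forall>i \<le> Suc (Suc 0). h i \<in> Hom A (E i) (E' i)" "\<forall>i \<le> Suc 0. h i \<cdot> d i = d' i \<cdot> h (Suc i)"
      using assms w q b' s s' u' by (auto simp: le_Suc_eq h_def E_def d_def Hom_iff)
    then show ?thesis by (auto simp: h_def intro!: exI [of _ h])
  qed
  then show ?thesis unfolding universal_extension_def using e0 by (intro exI [of _ "(E, d)"]) auto
qed

lemma extensionsD:
  assumes "(E, d) \<in> extensions A n X Y"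
  shows "E 0 = X" "E (Suc n) = Y" "\<And>i. i \<le> Suc n \<Longrightarrow> E i \<in> Ob A" "\<And>i. i \<le> n \<Longrightarrow> d i \<in> Ar A"
    "\<And>i. i \<le> n \<Longrightarrow> Dom A (d i) = E (Suc i)" "\<And>i. i \<le> n \<Longrightarrow> Cod A (d i) = E i"
    "monic A (d n)" "\<And>i. i < n \<Longrightarrow> exact_at A (d (Suc i)) (d i)" "epic A (d 0)"
  using assms unfolding extensions_def by (auto simp: Hom_iff)

text \<open>
  The universal \<open>(n+1)\<close>-extension of the syzygy \<open>Dom m\<close> is spliced with \<open>m, c\<close>. For an \<open>(n+2)\<close>-extension
  \<open>F\<close>, the map \<open>u c\<close> lifts to \<open>F\<^sub>1\<close> because \<open>Cod m\<close> is projective; the lift induces a map from \<open>Dom m\<close> to the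
  image of \<open>F\<^sub>2\<close> in \<open>F\<^sub>1\<close>, to which universality applies.
\<close>

lemma universal_extension_Suc:
  assumes mc: "short_exact A m c" "projective A (Cod A m)" and e: "universal_extension (Suc n) (Dom A m) Y e"
  shows "\<exists>e. universal_extension (Suc (Suc n)) (Cod A c) Y e"
proof -
  note s = short_exactD [OF mc(1)]
  obtain E' d' where e': "e = (E', d')" by (cases e)
  have ext: "(E', d') \<in> extensions A (Suc n) (Dom A m) Y"
    and univ: "\<And>K u F \<delta>. u \<in> Hom A (Dom A m) K \<Longrightarrow> (F, \<delta>) \<in> extensions A (Suc n) K Y \<Longrightarrow>
       (\<exists>h. h 0 = u \<and> h (Suc (Suc n)) = Ident A Y \<and> (\<forall>i \<le> Suc (Suc n). h i \<in> Hom A (E' i) (F i)) \<and>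
         (\<forall>i \<le> Suc n. h i \<cdot> d' i = \<delta> i \<cdot> h (Suc i)))"
    using e unfolding universal_extension_def e' by auto
  note x = extensionsD [OF ext]
  define E where "E = (\<lambda>i. case i of 0 \<Rightarrow> Cod A c | Suc k \<Rightarrow> if k = 0 then Cod A m else E' k)"
  define d where "d = (\<lambda>i. case i of 0 \<Rightarrow> c | Suc k \<Rightarrow> if k = 0 then m \<cdot> d' 0 else d' k)"
  have E_simps [simp]: "E 0 = Cod A c" "E (Suc 0) = Cod A m" "E (Suc (Suc k)) = E' (Suc k)" 
    and d_simps [simp]: "d 0 = c" "d (Suc 0) = m \<cdot> d' 0" "d (Suc (Suc k)) = d' (Suc k)" for k
    by (auto simp: E_def d_def)
  have d0: "d' 0 \<in> Ar A" "Dom A (d' 0) = E' (Suc 0)" "Cod A (d' 0) = Dom A m" using x by auto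
  have "(E, d) \<in> extensions A (Suc (Suc n)) (Cod A c) Y"
    unfolding extensions_def
  proof (clarsimp, intro conjI allI impI)
    show "E' (Suc (Suc n)) = Y" by (rule x)
    show "E i \<in> Ob A" if "i \<le> Suc (Suc (Suc n))" for i
      using that s x(3) by (auto simp: E_def split: nat.split)
    show "d i \<in> Hom A (E (Suc i)) (E i)" if "i \<le> Suc (Suc n)" for i
    proof (cases i)
      case 0 then show ?thesis using s by (simp add: Hom_iff)
    next
      case (Suc k)
      then show ?thesis using s that x(4-6) d0 by (cases k) (auto simp: Hom_iff)
    qed
    show "monic A (d' (Suc n))" by (rule x)
    show "exact_at A (d (Suc i)) (d i)" if "i < Suc (Suc n)" for i
    proof (cases i)
      case 0 then show ?thesis unfolding exact_at_def using s d0 x(9) by auto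
    next
      case (Suc k)
      show ?thesis
      proof (cases k)
        case 0 then show ?thesis using x(8) [of 0] exact_at_monic_comp [OF s(4), of "d' 0"] d0 Suc by simp
      next
        case (Suc l) then show ?thesis using x(8) [of k] that \<open>i = Suc k\<close> by simp
      qed
    qed
    show "epic A c" by (rule s)
  qed
  moreover have "\<exists>h. h 0 = u \<and> h (Suc (Suc (Suc n))) = Ident A Y \<and>
        (\<forall>i \<le> Suc (Suc (Suc n)). h i \<in> Hom A (E i) (F i)) \<and>
        (\<forall>i \<le> Suc (Suc n). h i \<cdot> d i = \<delta> i \<cdot> h (Suc i))"
    if u: "u \<in> Hom A (Cod A c) K" and e': "(F, \<delta>) \<in> extensions A (Suc (Suc n)) K Y" for K u F \<delta>
  proof -
    note y = extensionsD [OF e']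
    have u': "u \<in> Ar A" "Dom A u = Cod A c" "Cod A u = K" using u by (auto simp: Hom_iff)
    obtain k a where ka: "is_kernel A k (\<delta> 0)" "epic A a" "Cod A a = Dom A k" "\<delta> (Suc 0) = k \<cdot> a"
      using y(8) [of 0] unfolding exact_at_def by auto
    note k = kernelD [OF ka(1)] and km = kernel_monic [OF ka(1)]
    have ty: "\<delta> 0 \<in> Ar A" "Dom A (\<delta> 0) = F (Suc 0)" "Cod A (\<delta> 0) = K" "\<delta> (Suc 0) \<in> Ar A" 
      "Dom A (\<delta> (Suc 0)) = F (Suc (Suc 0))" "Cod A (\<delta> (Suc 0)) = F (Suc 0)" "a \<in> Ar A" "Cod A k = F (Suc 0)" "k \<in> Ar A"
      using y(1) y(4-6) [of 0] y(4-6) [of "Suc 0"] ka k by auto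
    have a: "Dom A a = F (Suc (Suc 0))" using ty ka(3,4) by (metis comp_simps(2))
    \<comment> \<open>The part of the extension to the left of the kernel of its last map, spliced off.\<close>
    define F' where "F' = (\<lambda>i. case i of 0 \<Rightarrow> Dom A k | Suc j \<Rightarrow> F (Suc (Suc j)))"
    define \<delta>' where "\<delta>' = (\<lambda>i. case i of 0 \<Rightarrow> a | Suc j \<Rightarrow> \<delta> (Suc (Suc j)))"
    have [simp]: "F' 0 = Dom A k" "F' (Suc j) = F (Suc (Suc j))" "\<delta>' 0 = a" "\<delta>' (Suc j) = \<delta> (Suc (Suc j))" for j
      by (auto simp: F'_def \<delta>'_def)
    have F': "(F', \<delta>') \<in> extensions A (Suc n) (Dom A k) Y"
      unfolding extensions_def
    proof (clarsimp, intro conjI allI impI)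
      show "F (Suc (Suc (Suc n))) = Y" by (rule y)
      show "F' i \<in> Ob A" if "i \<le> Suc (Suc n)" for i
        using that ty y(3) by (auto simp: F'_def split: nat.split)
      show "\<delta>' i \<in> Hom A (F (Suc (Suc i))) (F' i)" if "i \<le> Suc n" for i
        using that a ty y(4-6) ka by (cases i) (auto simp: Hom_iff)
      show "monic A (\<delta> (Suc (Suc n)))" by (rule y)
      show "exact_at A (\<delta> (Suc (Suc i))) (\<delta>' i)" if "i < Suc n" for i
      proof (cases i)
        case 0 then show ?thesis using y(8) [of "Suc 0"] exact_at_monic_comp [OF km, of a] ty ka by simp
      next
        case (Suc j) then show ?thesis using y(8) [of "Suc i"] that by simp
      qed
      show "epic A a" by (rule ka)
    qed
    obtain v where v: "v \<in> Ar A" "Dom A v = Cod A m" "Cod A v = F (Suc 0)" "\<delta> 0 \<cdot> v = u \<cdot> c"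
      using projectiveE [OF mc(2) y(9), of "u \<cdot> c"] ty u' s by auto
    have "\<delta> 0 \<cdot> (v \<cdot> m) = Zero A (Dom A m) K" using reassoc [OF v(4), of m] v s ty u' by simp
    then obtain u2 where u2: "u2 \<in> Ar A" "Dom A u2 = Dom A m" "Cod A u2 = Dom A k" "k \<cdot> u2 = v \<cdot> m"
      using kernel_lift [OF ka(1), of "v \<cdot> m" "Dom A m"] v s ty by auto
    obtain h' where h': "h' 0 = u2" "h' (Suc (Suc n)) = Ident A Y" "\<And>i. i \<le> Suc (Suc n) \<Longrightarrow> h' i \<in> Hom A (E' i) (F' i)"
      "\<And>i. i \<le> Suc n \<Longrightarrow> h' i \<cdot> d' i = \<delta>' i \<cdot> h' (Suc i)"
      using univ [of u2 "Dom A k", OF _ F'] u2 by (auto simp: Hom_iff)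
    define h where "h = (\<lambda>i. case i of 0 \<Rightarrow> u | Suc j \<Rightarrow> if j = 0 then v else h' j)"
    have [simp]: "h 0 = u" "h (Suc 0) = v" "h (Suc (Suc k)) = h' (Suc k)" for k by (auto simp: h_def)
    have h1: "h' (Suc 0) \<in> Ar A" "Dom A (h' (Suc 0)) = E' (Suc 0)" "Cod A (h' (Suc 0)) = F (Suc (Suc 0))"
      using h'(3) [of "Suc 0"] by (auto simp: Hom_iff)
    have "h i \<in> Hom A (E i) (F i)" if "i \<le> Suc (Suc (Suc n))" for i
    proof (cases i)
      case 0 then show ?thesis using u y(1) by simp
    next
      case (Suc k) then show ?thesis using h'(3) [of k] that v by (cases k) (auto simp: Hom_iff)
    qed
    moreover have "h i \<cdot> d i = \<delta> i \<cdot> h (Suc i)" if "i \<le> Suc (Suc n)" for i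
    proof (cases i)
      case 0 then show ?thesis using v by simp
    next
      case (Suc j)
      show ?thesis
      proof (cases j)
        case 0
        have "v \<cdot> (m \<cdot> d' 0) = k \<cdot> (u2 \<cdot> d' 0)" using reassoc [OF u2(4), of "d' 0"] u2(1-3) v s d0 ty by simp
        also have "\<dots> = k \<cdot> (a \<cdot> h' (Suc 0))" using h'(4) [of 0] h'(1) by simp
        also have "\<dots> = \<delta> (Suc 0) \<cdot> h' (Suc 0)" using ka(3,4) h1 a ty by simp
        finally show ?thesis using Suc 0 by simp
      next
        case (Suc l) then show ?thesis using h'(4) [of j] that \<open>i = Suc j\<close> by simp
      qed
    qed
    ultimately show ?thesis using h'(2) by (intro exI [of _ h]) auto
  qed
  ultimately show ?thesis unfolding universal_extension_def by (intro exI [of _ "(E, d)"]) auto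
qed

lemma universal_extension_vanishes:
  assumes "X \<in> Ob A" "universal_extension n X Y e"
  shows "Ext_vanishes A n X Y"
proof -
  obtain E d where e: "e = (E, d)" by (cases e)
  show ?thesis
  proof (rule Ext_vanishesI)
    show ext: "(E, d) \<in> extensions A n X Y" using assms(2) unfolding e universal_extension_def by simp
    fix e' assume "e' \<in> extensions A n X Y"
    then obtain E' d' where e': "e' = (E', d')" "(E', d') \<in> extensions A n X Y" by (cases e') auto
    have "Ident A X \<in> Hom A X X" using assms by (simp add: Hom_iff)
    then have "\<exists>h. h 0 = Ident A X \<and> h (Suc n) = Ident A Y \<and> (\<forall>i \<le> Suc n. h i \<in> Hom A (E i) (E' i)) \<and>
         (\<forall>i \<le> n. h i \<cdot> d i = d' i \<cdot> h (Suc i))" 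
      using assms(2) e'(2) unfolding universal_extension_def e by blast
    then show "extension_morphism A n X Y (E, d) e'" unfolding extension_morphism_def e' using ext e'(2) by auto
  qed
qed

lemma hereditary_of_syzygies:
  assumes ob: "C \<subseteq> Ob A" "W \<subseteq> Ob A" and sp: "\<And>X Y. X \<in> C \<Longrightarrow> Y \<in> W \<Longrightarrow> splits A X Y"
    and syz: "\<And>X. X \<in> C \<Longrightarrow> \<exists>m c. short_exact A m c \<and> projective A (Cod A m) \<and> Dom A m \<in> C \<and> Cod A c = X"
  shows "hereditary A C W"
  unfolding hereditary_def
proof (intro ballI allI impI)
  fix X Y and i :: nat assume "X \<in> C" "Y \<in> W" "1 \<le> i"
  have "\<exists>e. universal_extension (Suc n) X Y e" for n using \<open>X \<in> C\<close>
  proof (induction n arbitrary: X)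
    case 0 then show ?case using universal_extension_Suc_0 sp \<open>Y \<in> W\<close> ob by blast
  next
    case (Suc n)
    obtain m c where mc: "short_exact A m c" "projective A (Cod A m)" "Dom A m \<in> C" "Cod A c = X"
      using syz [OF Suc.prems] by auto
    then show ?case using universal_extension_Suc [OF mc(1,2)] Suc.IH [OF mc(3)] by auto
  qed
  then show "Ext_vanishes A i X Y" 
    using universal_extension_vanishes \<open>X \<in> C\<close> ob \<open>1 \<le> i\<close> by (metis Suc_le_D One_nat_def subsetD)
qed

end

section \<open>Complete cotorsion pairs\<close>

locale cotorsion = abelian A for A :: "('o, 'm) preadd" (structure) +
  fixes C W :: "'o set"
  assumes complete: "complete_cotorsion_pair A C W"

context abelian
begin

lemma splits_retract:
  assumes "splits A S Y" "i \<in> Ar A" "Dom A i = X" "Cod A i = S" "r \<in> Ar A" "Dom A r = S" "Cod A r = X" "r \<cdot> i = Ident A X"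
  shows "splits A X Y"
  unfolding splits_def
proof (intro allI impI)
  fix f g assume "short_exact A f g \<and> Dom A f = Y \<and> Cod A g = X"
  then have fg: "short_exact A f g" "Dom A f = Y" "Cod A g = X" by auto
  note s = short_exactD [OF fg(1)]
  obtain v where v: "v \<in> Ar A" "Dom A v = S" "Cod A v = Cod A f" "g \<cdot> v = r"
    using splits_lift [OF assms(1) fg(1,2), of r] assms fg by auto
  show "\<exists>s\<in>Hom A X (Cod A f). g \<cdot> s = Ident A X"
    using reassoc [OF v(4), of i] v assms s fg by (intro bexI [of _ "v \<cdot> i"]) (auto simp: Hom_iff)
qed

lemma splits_retract_right:
  assumes "splits A X S" "i \<in> Ar A" "Dom A i = Y" "Cod A i = S" "r \<in> Ar A" "Dom A r = S" "Cod A r = Y" "r \<cdot> i = Ident A Y"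
  shows "splits A X Y"
proof -
  interpret op: abelian "op_cat A" by (rule abelian_op) unfold_locales
  show ?thesis using op.splits_retract [of S X r Y i] assms by (simp add: splits_op)
qed

lemma splits_coproduct:
  assumes cp: "is_coproduct A I X S \<iota>" and sp: "\<And>i. i \<in> I \<Longrightarrow> splits A (X i) Y"
  shows "splits A S Y"
  unfolding splits_def
proof (intro allI impI)
  fix f g assume "short_exact A f g \<and> Dom A f = Y \<and> Cod A g = S"
  then have fg: "short_exact A f g" "Dom A f = Y" "Cod A g = S" by auto
  note s = short_exactD [OF fg(1)]
  have cp1: "S \<in> Ob A" "\<And>i. i \<in> I \<Longrightarrow> \<iota> i \<in> Hom A (X i) S" 
    and cp2: "\<And>T t. T \<in> Ob A \<Longrightarrow> (\<And>i. i \<in> I \<Longrightarrow> t i \<in> Hom A (X i) T) \<Longrightarrow>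
        \<exists>!u. u \<in> Hom A S T \<and> (\<forall>i \<in> I. u \<cdot> \<iota> i = t i)"
    using cp unfolding is_coproduct_def by auto
  have "\<exists>v. v \<in> Hom A (X i) (Cod A f) \<and> g \<cdot> v = \<iota> i" if "i \<in> I" for i
    using splits_lift [OF sp [OF that] fg(1,2), of "\<iota> i"] cp1(2) [OF that] fg(3) by (auto simp: Hom_iff)
  then obtain t where t: "\<And>i. i \<in> I \<Longrightarrow> t i \<in> Hom A (X i) (Cod A f) \<and> g \<cdot> t i = \<iota> i" by metis
  have "\<exists>!u. u \<in> Hom A S (Cod A f) \<and> (\<forall>i \<in> I. u \<cdot> \<iota> i = t i)" using t s by (intro cp2) auto
  then obtain u where u: "u \<in> Hom A S (Cod A f)" "\<And>i. i \<in> I \<Longrightarrow> u \<cdot> \<iota> i = t i" by (blast dest: ex1_implies_ex)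
  have "\<exists>!u. u \<in> Hom A S S \<and> (\<forall>i \<in> I. u \<cdot> \<iota> i = \<iota> i)" using cp1 by (intro cp2) auto
  moreover have "g \<cdot> u \<in> Hom A S S \<and> (\<forall>i \<in> I. (g \<cdot> u) \<cdot> \<iota> i = \<iota> i)"
    using u t cp1 s fg by (auto simp: Hom_iff)
  moreover have "Ident A S \<in> Hom A S S \<and> (\<forall>i \<in> I. Ident A S \<cdot> \<iota> i = \<iota> i)"
    using cp1 by (auto simp: Hom_iff)
  ultimately have "g \<cdot> u = Ident A S" by blast
  with u show "\<exists>s\<in>Hom A S (Cod A f). g \<cdot> s = Ident A S" by blast
qed

lemma cokernel_from_zero:
  assumes "zero_object A Z" "X \<in> Ob A"
  shows "is_cokernel A (Ident A X) (Zero A Z X)" "monic A (Zero A Z X)"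
proof -
  note Z = zero_object_Ob [OF assms(1)]
  show "monic A (Zero A Z X)"
    by (rule monicI) (use Z assms to_zero [OF assms(1)] in auto)
  show "is_cokernel A (Ident A X) (Zero A Z X)"
    by (rule is_cokernelI [OF epic_Ident]) (use Z assms in \<open>auto simp: Hom_iff\<close>)
qed

lemma kernel_to_zero:
  assumes "zero_object A Z" "X \<in> Ob A"
  shows "is_kernel A (Ident A X) (Zero A X Z)" "epic A (Zero A X Z)"
proof -
  interpret op: abelian "op_cat A" by (rule abelian_op) unfold_locales
  show "is_kernel A (Ident A X) (Zero A X Z)" "epic A (Zero A X Z)" 
    using op.cokernel_from_zero [of Z X] assms by auto
qed

text \<open>
  A projective \<open>P\<close> with an epimorphism onto \<open>Y = Cod f\<close> is added to \<open>X = Dom f\<close>: \<open>X \<rightarrow> X \<oplus> P \<rightarrow> Y\<close>.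
\<close>

lemma split_factorization:
  assumes ep: "enough_projectives A" and f: "f \<in> Ar A"
  shows "\<exists>i e q. short_exact A i q \<and> projective A (Cod A q) \<and> epic A e \<and> Cod A i = Dom A e \<and> f = e \<cdot> i"
proof -
  obtain \<pi> where \<pi>: "projective A (Dom A \<pi>)" "epic A \<pi>" "Cod A \<pi> = Cod A f"
    using ep f unfolding enough_projectives_def by auto
  obtain S i j p q where b: "is_biproduct A (Dom A f) (Dom A \<pi>) S i j p q" using biproduct_ex f \<pi> by fastforce
  note b' = biproductD [OF b]
  obtain e where e: "e \<in> Ar A" "Dom A e = S" "Cod A e = Cod A f" "e \<cdot> i = f" "e \<cdot> j = \<pi>"
    using biproduct_copair [OF b, of f \<pi>] f \<pi> by auto
  have "epic A e" using epic_of_comp [of e j] e \<pi> b' by simp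
  then show ?thesis using biproduct_short_exact [OF b] b'(6,15) \<pi>(1) e by metis
qed

lemma has_lift_comp:
  assumes i: "i \<in> Ar A" "j \<in> Ar A" "Cod A i = Dom A j" "p \<in> Ar A" and l: "has_lift A i p" "has_lift A j p"
  shows "has_lift A (j \<cdot> i) p"
proof (rule has_liftI)
  fix u v assume a: "u \<in> Ar A" "v \<in> Ar A" "Dom A u = Dom A (j \<cdot> i)" "Cod A u = Dom A p"
     "Dom A v = Cod A (j \<cdot> i)" "Cod A v = Cod A p" "p \<cdot> u = v \<cdot> (j \<cdot> i)"
  then obtain h where h: "h \<in> Ar A" "Dom A h = Cod A i" "Cod A h = Dom A p" "h \<cdot> i = u" "p \<cdot> h = v \<cdot> j"
    using has_liftE [OF l(1), of u "v \<cdot> j"] i by auto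
  obtain h' where h': "h' \<in> Ar A" "Dom A h' = Cod A j" "Cod A h' = Dom A p" "h' \<cdot> j = h" "p \<cdot> h' = v"
    using has_liftE [OF l(2), of h v] h i a by auto
  have "h' \<cdot> (j \<cdot> i) = u" using reassoc [OF h'(4), of i] h' i h by simp
  then show "\<exists>h. h \<in> Ar A \<and> Dom A h = Cod A (j \<cdot> i) \<and> Cod A h = Dom A p \<and> h \<cdot> (j \<cdot> i) = u \<and> p \<cdot> h = v"
    using h' i by auto
qed

end

context cotorsion
begin

lemma cotorsion_pair: "cotorsion_pair A C W"
  using complete unfolding complete_cotorsion_pair_def by simp

lemma C_iff: "X \<in> C \<longleftrightarrow> X \<in> Ob A \<and> (\<forall>Y \<in> W. Ext_vanishes A 1 X Y)"
  and W_iff: "Y \<in> W \<longleftrightarrow> Y \<in> Ob A \<and> (\<forall>X \<in> C. Ext_vanishes A 1 X Y)"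
proof -
  have 1: "C = left_perp A W" and 2: "W = right_perp A C"
    using cotorsion_pair unfolding cotorsion_pair_def by blast+
  show "X \<in> C \<longleftrightarrow> X \<in> Ob A \<and> (\<forall>Y \<in> W. Ext_vanishes A 1 X Y)"
    by (subst 1) (simp add: left_perp_def)
  show "Y \<in> W \<longleftrightarrow> Y \<in> Ob A \<and> (\<forall>X \<in> C. Ext_vanishes A 1 X Y)"
    by (subst 2) (simp add: right_perp_def)
qed

lemma C_Ob [simp]: "X \<in> C \<Longrightarrow> X \<in> Ob A" and W_Ob [simp]: "Y \<in> W \<Longrightarrow> Y \<in> Ob A"
  by (blast dest: C_iff [THEN iffD1] W_iff [THEN iffD1])+

lemma C_splits: "X \<in> C \<Longrightarrow> Y \<in> W \<Longrightarrow> splits A X Y"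
  using C_iff W_iff Ext_vanishes_1_iff_splits by blast

lemma C_memI: "X \<in> Ob A \<Longrightarrow> (\<And>Y. Y \<in> W \<Longrightarrow> splits A X Y) \<Longrightarrow> X \<in> C"
  using C_iff Ext_vanishes_1_iff_splits W_Ob by blast

lemma W_memI: "Y \<in> Ob A \<Longrightarrow> (\<And>X. X \<in> C \<Longrightarrow> splits A X Y) \<Longrightarrow> Y \<in> W"
  using W_iff Ext_vanishes_1_iff_splits C_Ob by blast

lemma precover:
  assumes "X \<in> Ob A" obtains f g where "short_exact A f g" "Dom A f \<in> W" "Cod A f \<in> C" "Cod A g = X"
  using assms complete unfolding complete_cotorsion_pair_def by blast

lemma preenvelope:
  assumes "X \<in> Ob A" obtains f g where "short_exact A f g" "Dom A f = X" "Cod A f \<in> W" "Cod A g \<in> C"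
  using assms complete unfolding complete_cotorsion_pair_def by blast

lemma C_retract:
  assumes "S \<in> C" "i \<in> Hom A X S" "r \<in> Hom A S X" "r \<cdot> i = Ident A X" shows "X \<in> C"
proof (rule C_memI)
  show "X \<in> Ob A" using assms by (auto simp: Hom_iff)
  show "splits A X Y" if "Y \<in> W" for Y
    by (rule splits_retract [OF C_splits [OF assms(1) that], of i _ r]) (use assms in \<open>auto simp: Hom_iff\<close>)
qed

lemma W_retract:
  assumes "S \<in> W" "i \<in> Hom A X S" "r \<in> Hom A S X" "r \<cdot> i = Ident A X" shows "X \<in> W"
proof (rule W_memI)
  show "X \<in> Ob A" using assms by (auto simp: Hom_iff)
  show "splits A Y X" if "Y \<in> C" for Y
    by (rule splits_retract_right [OF C_splits [OF that assms(1)], of i _ r]) (use assms in \<open>auto simp: Hom_iff\<close>)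
qed

lemma C_coproduct:
  assumes "is_coproduct A I X S \<iota>" "\<And>i. i \<in> I \<Longrightarrow> X i \<in> C" shows "S \<in> C"
  using assms C_splits by (intro C_memI splits_coproduct [OF assms(1)]) (auto simp: is_coproduct_def)

abbreviation "cof \<equiv> monics_with_cokernel_in A C"
abbreviation "tfib \<equiv> epics_with_kernel_in A W"

lemma tfib_epic: "p \<in> tfib \<Longrightarrow> epic A p" by (simp add: epics_with_kernel_in_def)
lemma cof_monic: "p \<in> cof \<Longrightarrow> monic A p" by (simp add: monics_with_cokernel_in_def)

lemma cof_has_lift: assumes "i \<in> cof" "p \<in> tfib" shows "has_lift A i p"
proof -
  obtain c where c: "monic A i" "is_cokernel A c i" "Cod A c \<in> C" 
    using assms unfolding monics_with_cokernel_in_def by auto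
  obtain k where k: "epic A p" "is_kernel A k p" "Dom A k \<in> W" 
    using assms unfolding epics_with_kernel_in_def by auto
  show ?thesis
    by (rule has_lift_of_splits [of i c k p]) 
      (use c k C_splits in \<open>auto simp: short_exact_kernel intro: monic_is_kernel cokernel_epic\<close>)
qed

text \<open>
  Lift the projection to the cokernel against \<open>g\<close>: the lift vanishes on \<open>i\<close>, so it factors through the
  cokernel and splits \<open>g\<close>.
\<close>

lemma cokernel_in_C:
  assumes c: "is_cokernel A c i" and l: "\<And>p. p \<in> tfib \<Longrightarrow> has_lift A i p"
  shows "Cod A c \<in> C"
proof (rule C_memI)
  note c' = cokernelD [OF c]
  show "Cod A c \<in> Ob A" using c' by auto
  fix Y assume Y: "Y \<in> W"
  show "splits A (Cod A c) Y" unfolding splits_def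
  proof (intro allI impI)
    fix f g assume "short_exact A f g \<and> Dom A f = Y \<and> Cod A g = Cod A c"
    then have fg: "short_exact A f g" "Dom A f = Y" "Cod A g = Cod A c" by auto
    note s = short_exactD [OF fg(1)]
    have "g \<in> tfib" using fg s Y unfolding epics_with_kernel_in_def by auto
    then obtain h where h: "h \<in> Ar A" "Dom A h = Cod A i" "Cod A h = Cod A f" 
        "h \<cdot> i = Zero A (Dom A i) (Cod A f)" "g \<cdot> h = c"
      using has_liftE [OF l, of g "Zero A (Dom A i) (Cod A f)" c] s fg c' by auto
    obtain t where t: "t \<in> Ar A" "Cod A t = Cod A f" "Dom A t = Cod A c" "t \<cdot> c = h"
      using cokernel_lift [OF c, of h] h by auto
    have "(g \<cdot> t) \<cdot> c = Ident A (Cod A c) \<cdot> c" using t h c' s by simp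
    then have "g \<cdot> t = Ident A (Cod A c)" 
      using epicD [OF cokernel_epic [OF c], of "g \<cdot> t" "Ident A (Cod A c)"] t c' s fg by simp
    then show "\<exists>s\<in>Hom A (Cod A c) (Cod A f). g \<cdot> s = Ident A (Cod A c)" using t by (auto simp: Hom_iff)
  qed
qed

lemma cofI: 
  assumes "monic A i" "\<And>p. p \<in> tfib \<Longrightarrow> has_lift A i p" shows "i \<in> cof"
proof -
  obtain c where "is_cokernel A c i" using cokernel_ex assms(1) by fastforce
  with cokernel_in_C [OF this assms(2)] assms(1) show ?thesis unfolding monics_with_cokernel_in_def by auto
qed

lemma cof_cokernel: "i \<in> cof \<Longrightarrow> is_cokernel A c i \<Longrightarrow> Cod A c \<in> C"
  using cokernel_in_C cof_has_lift by blast

lemma cof_comp: "i \<in> cof \<Longrightarrow> j \<in> cof \<Longrightarrow> Cod A i = Dom A j \<Longrightarrow> j \<cdot> i \<in> cof"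
proof (rule cofI)
  assume ij: "i \<in> cof" "j \<in> cof" "Cod A i = Dom A j"
  note m = cof_monic [OF ij(1)] cof_monic [OF ij(2)]
  show "monic A (j \<cdot> i)" by (rule monic_comp [OF m ij(3)])
  show "has_lift A (j \<cdot> i) p" if "p \<in> tfib" for p
    using has_lift_comp [OF monic_Ar [OF m(1)] monic_Ar [OF m(2)] ij(3)] tfib_epic [OF that] that cof_has_lift ij by simp
qed

lemma C_iff_cof:
  assumes "zero_object A Z" "X \<in> Ob A" shows "X \<in> C \<longleftrightarrow> Zero A Z X \<in> cof"
proof
  show "X \<in> C \<Longrightarrow> Zero A Z X \<in> cof"
    unfolding monics_with_cokernel_in_def using cokernel_from_zero [OF assms] assms by (auto intro!: exI [of _ "Ident A X"])
  show "Zero A Z X \<in> cof \<Longrightarrow> X \<in> C"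
    using cof_cokernel [OF _ cokernel_from_zero(1) [OF assms]] assms by auto
qed

text \<open>
  The map \<open>0 \<rightarrow> Cod i\<close> is a composite of two cofibrations.
\<close>

lemma C_of_cof:
  assumes "i \<in> cof" "Dom A i \<in> C" shows "Cod A i \<in> C"
proof -
  obtain Z where Z: "zero_object A Z" using zero_ex by blast
  have m: "i \<in> Ar A" using cof_monic assms by auto
  have "i \<cdot> Zero A Z (Dom A i) = Zero A Z (Cod A i)" using m zero_object_Ob [OF Z] by simp
  moreover have "i \<cdot> Zero A Z (Dom A i) \<in> cof"
    using assms C_iff_cof [OF Z] m zero_object_Ob [OF Z] by (intro cof_comp) auto
  ultimately show ?thesis using C_iff_cof [OF Z, of "Cod A i"] m by auto
qed

lemma tfib_kernel: assumes "p \<in> tfib" "is_kernel A k p" shows "Dom A k \<in> W"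
proof -
  obtain k' where k': "is_kernel A k' p" "Dom A k' \<in> W" using assms unfolding epics_with_kernel_in_def by auto
  note a = kernelD [OF assms(2)] and b = kernelD [OF k'(1)]
  obtain u where u: "u \<in> Ar A" "Dom A u = Dom A k" "Cod A u = Dom A k'" "k' \<cdot> u = k"
    using kernel_lift [OF k'(1), of k] a by metis
  obtain v where v: "v \<in> Ar A" "Dom A v = Dom A k'" "Cod A v = Dom A k" "k \<cdot> v = k'"
    using kernel_lift [OF assms(2), of k'] b by metis
  have "k \<cdot> (v \<cdot> u) = k \<cdot> Ident A (Dom A k)" using reassoc [OF v(4), of u] u v a by simp
  then have "v \<cdot> u = Ident A (Dom A k)" 
    using monicD [OF kernel_monic [OF assms(2)], of "v \<cdot> u" "Ident A (Dom A k)"] u v a by simp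
  then show ?thesis using W_retract [OF k'(2), of u _ v] u v by (auto simp: Hom_iff)
qed

lemma Proj_subset: "Proj A \<subseteq> C"
proof
  fix P assume P: "P \<in> Proj A"
  show "P \<in> C"
  proof (rule C_memI)
    show "P \<in> Ob A" using P by (auto simp: Proj_def projective_def)
    then show "splits A P Y" for Y
      unfolding splits_def
    proof (intro allI impI)
      fix f g assume "short_exact A f g \<and> Dom A f = Y \<and> Cod A g = P"
      then have fg: "short_exact A f g" "Dom A f = Y" "Cod A g = P" by auto
      note s = short_exactD [OF fg(1)]
      obtain t where "t \<in> Ar A" "Dom A t = P" "Cod A t = Cod A f" "g \<cdot> t = Ident A P"
        using projectiveE [of P g "Ident A P"] P s fg \<open>P \<in> Ob A\<close> by (auto simp: Proj_def)
      then show "\<exists>s\<in>Hom A P (Cod A f). g \<cdot> s = Ident A P" by (auto simp: Hom_iff)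
    qed
  qed
qed

text \<open>
  Starting from \<open>X \<rightarrow> X \<oplus> P \<rightarrow> Y\<close>, the kernel \<open>K\<close> of the second map is embedded by \<open>m\<close> into an object of \<open>W\<close>
  with cokernel in \<open>C\<close>. Pushing out along \<open>m\<close> replaces the kernel by that object and adds a pushout of
  \<open>m\<close> to the first map.
\<close>

lemma factorization:
  assumes ep: "enough_projectives A" and f: "f \<in> Ar A"
  shows "\<exists>i \<in> cof. \<exists>p \<in> tfib. Cod A i = Dom A p \<and> f = p \<cdot> i"
proof -
  obtain i e q where ie: "short_exact A i q" "projective A (Cod A q)" "epic A e" "Cod A i = Dom A e" "f = e \<cdot> i"
    using split_factorization [OF ep f] by metis
  note i' = short_exactD [OF ie(1)]
  have e: "e \<in> Ar A" "Cod A e = Cod A f" using ie i' by auto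
  obtain k where k: "is_kernel A k e" using kernel_ex e by blast
  note k' = kernelD [OF k]
  have ke: "short_exact A k e" using k ie(3) short_exact_kernel by simp
  obtain m c where mc: "short_exact A m c" "Dom A m = Dom A k" "Cod A m \<in> W" "Cod A c \<in> C"
    using preenvelope [of "Dom A k"] k' by auto
  note m = short_exactD [OF mc(1)]
  obtain E j' w' \<theta> where E: "short_exact A j' \<theta>" "Dom A j' = Cod A m" "Cod A j' = E" "Cod A \<theta> = Cod A e"
    "w' \<in> Ar A" "Dom A w' = Cod A k" "Cod A w' = E" "j' \<cdot> m = w' \<cdot> k" "\<theta> \<cdot> w' = e"
    and ex: "\<And>s t. s \<in> Ar A \<Longrightarrow> t \<in> Ar A \<Longrightarrow> Dom A s = Cod A m \<Longrightarrow> Dom A t = Cod A k \<Longrightarrow> Cod A s = Cod A t \<Longrightarrow>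
       s \<cdot> m = t \<cdot> k \<Longrightarrow> \<exists>h. h \<in> Ar A \<and> Dom A h = E \<and> Cod A h = Cod A t \<and> h \<cdot> j' = s \<and> h \<cdot> w' = t"
    and uq: "\<And>h h'. h \<in> Ar A \<Longrightarrow> h' \<in> Ar A \<Longrightarrow> Dom A h = E \<Longrightarrow> Dom A h' = E \<Longrightarrow> Cod A h = Cod A h' \<Longrightarrow>
       h \<cdot> j' = h' \<cdot> j' \<Longrightarrow> h \<cdot> w' = h' \<cdot> w' \<Longrightarrow> h = h'"
    by (rule pushout_short_exact [OF ke m(1) mc(2)]) (rule that, (assumption | blast)+)
  note E' = short_exactD [OF E(1)]
  \<comment> \<open>The same pushout, formed with the roles of \<open>m\<close> and \<open>k\<close> exchanged, shows that \<open>w'\<close> is monic too.\<close>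
  obtain F j2 w2 \<gamma> where F: "short_exact A j2 \<gamma>" "Dom A j2 = Cod A k" "Cod A j2 = F" 
    "w2 \<in> Ar A" "Dom A w2 = Cod A m" "Cod A w2 = F" "j2 \<cdot> k = w2 \<cdot> m"
    using pushout_short_exact [OF mc(1), of k] k' mc(2) by metis
  note F' = short_exactD [OF F(1)]
  obtain h where h: "h \<in> Ar A" "Dom A h = E" "Cod A h = F" "h \<cdot> w' = j2"
    using ex [of w2 j2] F F' by auto
  have wm: "monic A w'" using monic_of_comp [of h w'] h F' E by simp
  have "m \<in> cof" using m mc unfolding monics_with_cokernel_in_def by auto
  have w: "w' \<in> cof"
  proof (rule cofI [OF wm])
    fix p assume p: "p \<in> tfib"
    show "has_lift A w' p"
    proof (rule has_liftI)
      fix u v assume u: "u \<in> Ar A" "v \<in> Ar A" "Dom A u = Dom A w'" "Cod A u = Dom A p" 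
          "Dom A v = Cod A w'" "Cod A v = Cod A p" "p \<cdot> u = v \<cdot> w'"
      have pe: "p \<in> Ar A" using tfib_epic [OF p] by simp
      have "p \<cdot> (u \<cdot> k) = (v \<cdot> j') \<cdot> m" using reassoc [OF u(7), of k] u E E' k' m pe by simp
      then obtain l where l: "l \<in> Ar A" "Dom A l = Cod A m" "Cod A l = Dom A p" "l \<cdot> m = u \<cdot> k" "p \<cdot> l = v \<cdot> j'"
        using has_liftE [OF cof_has_lift [OF \<open>m \<in> cof\<close> p], of "u \<cdot> k" "v \<cdot> j'"] u E E' k' m mc(2) by auto
      obtain h where h: "h \<in> Ar A" "Dom A h = E" "Cod A h = Dom A p" "h \<cdot> j' = l" "h \<cdot> w' = u"
        using ex [of l u] l u E by auto
      have "p \<cdot> h = v"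
        by (rule uq) (use h u pe l E E' in auto)
      then show "\<exists>h. h \<in> Ar A \<and> Dom A h = Cod A w' \<and> Cod A h = Dom A p \<and> h \<cdot> w' = u \<and> p \<cdot> h = v"
        using h E by auto
    qed
  qed
  have i: "i \<in> cof" 
    using i' ie(2) Proj_subset unfolding monics_with_cokernel_in_def Proj_def by auto
  have "w' \<cdot> i \<in> cof" using i w E k' ie(4) by (intro cof_comp) auto
  moreover have "\<theta> \<in> tfib" using E E' mc unfolding epics_with_kernel_in_def by auto
  moreover have "f = \<theta> \<cdot> (w' \<cdot> i)" using reassoc [OF E(9), of i] E E' i' k' ie by simp
  moreover have "Cod A (w' \<cdot> i) = Dom A \<theta>" using E E' i' k' ie by simp
  ultimately show ?thesis by blast
qed

text \<open>
  Put \<open>X' = Dom f\<close> and let \<open>0 \<rightarrow> Y \<rightarrow> E \<rightarrow> X' \<rightarrow> 0\<close> be an extension with \<open>Y \<in> W\<close>. Embed \<open>E\<close> into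
  some \<open>W\<^sub>0 \<in> W\<close>; the quotient \<open>W\<^sub>1 = W\<^sub>0 / Y\<close> lies in \<open>W\<close>. The induced map \<open>X' \<rightarrow> W\<^sub>1\<close> extends to \<open>Cod f\<close>, since
  \<open>Cod g \<in> C\<close>, and then lifts to \<open>W\<^sub>0\<close>, since \<open>Cod f \<in> C\<close>. Comparing the lift with the embedding of \<open>E\<close>
  gives a retraction of \<open>E\<close> onto \<open>Y\<close>.
\<close>

lemma C_kernel:
  assumes W: "\<And>f g. short_exact A f g \<Longrightarrow> Dom A f \<in> W \<Longrightarrow> Cod A f \<in> W \<Longrightarrow> Cod A g \<in> W"
    and fg: "short_exact A f g" "Cod A f \<in> C" "Cod A g \<in> C"
  shows "Dom A f \<in> C"
proof (rule C_memI)
  note s = short_exactD [OF fg(1)]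
  show "Dom A f \<in> Ob A" using s by auto
  fix Y assume Y: "Y \<in> W"
  show "splits A (Dom A f) Y" unfolding splits_def
  proof (intro allI impI)
    fix a b assume "short_exact A a b \<and> Dom A a = Y \<and> Cod A b = Dom A f"
    then have ab: "short_exact A a b" "Dom A a = Y" "Cod A b = Dom A f" by auto
    note t = short_exactD [OF ab(1)]
    obtain m c where mc: "short_exact A m c" "Dom A m = Cod A a" "Cod A m \<in> W"
      using preenvelope [OF Cod_Ob [OF t(1)]] by metis
    note m = short_exactD [OF mc(1)]
    define n where "n = m \<cdot> a"
    have n: "n \<in> Ar A" "Dom A n = Y" "Cod A n = Cod A m" and nm: "monic A n" 
      using monic_comp [of a m] t m mc ab by (auto simp: n_def)
    obtain q where q: "is_cokernel A q n" using cokernel_ex n by blast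
    note q' = cokernelD [OF q]
    have nq: "short_exact A n q" using nm q short_exact_cokernel by simp
    have W1: "Cod A q \<in> W" using W [OF nq] n Y mc by simp
    have "(q \<cdot> m) \<cdot> a = Zero A (Dom A a) (Cod A q)" using q' n m t mc ab by (simp add: n_def)
    then obtain u where u: "u \<in> Ar A" "Cod A u = Cod A q" "Dom A u = Cod A b" "u \<cdot> b = q \<cdot> m"
      using cokernel_lift [OF t(8), of "q \<cdot> m"] q' n m mc by auto
    obtain u2 where u2: "u2 \<in> Ar A" "Cod A u2 = Cod A q" "Dom A u2 = Cod A f" "u2 \<cdot> f = u"
      using splits_extend [OF C_splits [OF fg(3) W1] fg(1), of u] u ab by auto
    obtain l where l: "l \<in> Ar A" "Dom A l = Cod A f" "Cod A l = Cod A n" "q \<cdot> l = u2"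
      using splits_lift [OF C_splits [OF fg(2) Y] nq, of u2] n u2 by auto
    define w where "w = (l \<cdot> f) \<cdot> b"
    have w: "w \<in> Ar A" "Dom A w = Cod A a" "Cod A w = Cod A m" using l s t ab n by (auto simp: w_def)
    have "q \<cdot> w = q \<cdot> m"
      unfolding w_def using l(1-3) s t ab q' n reassoc [OF l(4), of "f \<cdot> b"] reassoc [OF u2(4), of b] u u2(1-3) by simp
    then have "q \<cdot> (m \<ominus> w) = Zero A (Cod A a) (Cod A q)" using w m mc q' n by (simp add: additive)
    then obtain r where r: "r \<in> Ar A" "Dom A r = Cod A a" "Cod A r = Y" "n \<cdot> r = m \<ominus> w"
      using kernel_lift [OF monic_is_kernel [OF nm q], of "m \<ominus> w"] w m mc q' n by auto
    have wa: "w \<cdot> a = Zero A Y (Cod A m)" unfolding w_def using l s t ab n Y by simp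
    have "n \<cdot> (r \<cdot> a) = (m \<ominus> w) \<cdot> a" using reassoc [OF r(4), of a] r n t ab by simp
    also have "\<dots> = n \<cdot> Ident A Y" using wa w m mc t n ab by (simp add: additive n_def)
    finally have "r \<cdot> a = Ident A Y" using monicD [OF nm, of "r \<cdot> a" "Ident A Y"] r n t ab Y by simp
    then obtain z where "is_biproduct A (Dom A a) (Cod A b) (Cod A a) a z r b"
      using retraction_biproduct [OF ab(1), of r] r ab by auto
    from biproductD [OF this] show "\<exists>s\<in>Hom A (Dom A f) (Cod A a). b \<cdot> s = Ident A (Dom A f)"
      unfolding ab(3) by (intro bexI [of _ z]) (simp_all add: Hom_iff)
  qed
qed

lemma hereditaryI:
  assumes ep: "enough_projectives A"
    and W: "\<And>f g. short_exact A f g \<Longrightarrow> Dom A f \<in> W \<Longrightarrow> Cod A f \<in> W \<Longrightarrow> Cod A g \<in> W"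
  shows "hereditary A C W"
proof (rule hereditary_of_syzygies)
  show "C \<subseteq> Ob A" "W \<subseteq> Ob A" by auto
  show "splits A X Y" if "X \<in> C" "Y \<in> W" for X Y using C_splits that .
  fix X assume X: "X \<in> C"
  then obtain e where e: "projective A (Dom A e)" "epic A e" "Cod A e = X"
    using ep C_Ob unfolding enough_projectives_def by blast
  obtain k where k: "is_kernel A k e" using kernel_ex e by fastforce
  have s: "short_exact A k e" using k e short_exact_kernel by simp
  have "Cod A k = Dom A e" using kernelD [OF k] by simp
  then have "Cod A k \<in> C" using e Proj_subset by (auto simp: Proj_def)
  then have "Dom A k \<in> C" using C_kernel [OF W s] X e by simp
  then show "\<exists>m c. short_exact A m c \<and> projective A (Cod A m) \<and> Dom A m \<in> C \<and> Cod A c = X"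
    using s e \<open>Cod A k = Dom A e\<close> by (intro exI [of _ k] exI [of _ e]) simp
qed

end

context abelian
begin

text \<open>
  Together with \<open>Proj_complete\<close>: the projective objects form the left half of a complete cotorsion
  pair whose right half is everything, so all lemmas on cotorsion pairs apply to them.
\<close>

lemma projective_iff_splits: 
  assumes "X \<in> Ob A" shows "projective A X \<longleftrightarrow> (\<forall>Y \<in> Ob A. splits A X Y)"
proof
  assume P: "projective A X"
  show "\<forall>Y \<in> Ob A. splits A X Y"
    unfolding splits_def
  proof (intro allI impI ballI)
    fix Y f g assume "short_exact A f g \<and> Dom A f = Y \<and> Cod A g = X"
    then have fg: "short_exact A f g" "Dom A f = Y" "Cod A g = X" by auto
    note s = short_exactD [OF fg(1)]
    obtain t where "t \<in> Ar A" "Dom A t = X" "Cod A t = Cod A f" "g \<cdot> t = Ident A X"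
      using projectiveE [of X g "Ident A X"] P s fg assms by auto
    then show "\<exists>s\<in>Hom A X (Cod A f). g \<cdot> s = Ident A X" by (auto simp: Hom_iff)
  qed
next
  assume *: "\<forall>Y \<in> Ob A. splits A X Y"
  show "projective A X" unfolding projective_def
  proof (intro conjI allI impI assms)
    fix e f assume e: "epic A e \<and> f \<in> Hom A X (Cod A e)"
    obtain k where k: "is_kernel A k e" using kernel_ex e by fastforce
    have s: "short_exact A k e" using k e short_exact_kernel by simp
    note k' = kernelD [OF k]
    obtain v where "v \<in> Ar A" "Dom A v = X" "Cod A v = Cod A k" "e \<cdot> v = f"
      using splits_lift [OF _ s, of X "Dom A k" f] * k' e by (auto simp: Hom_iff)
    then show "\<exists>g\<in>Hom A X (Dom A e). e \<cdot> g = f" using k' by (auto simp: Hom_iff)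
  qed
qed

lemma zero_projective: "zero_object A Z \<Longrightarrow> projective A Z"
  unfolding projective_def
proof (intro conjI allI impI zero_object_Ob)
  fix e f assume Z: "zero_object A Z" and e: "epic A e \<and> f \<in> Hom A Z (Cod A e)"
  then show "\<exists>g\<in>Hom A Z (Dom A e). e \<cdot> g = f"
    using zero_object_Ob [OF Z] from_zero [OF Z, of f] by (intro bexI [of _ "Zero A Z (Dom A e)"]) (auto simp: Hom_iff)
qed

lemma Proj_complete:
  assumes ep: "enough_projectives A"
  shows "complete_cotorsion_pair A (Proj A) (Ob A)"
proof -
  have "P \<in> Proj A \<longleftrightarrow> P \<in> Ob A \<and> (\<forall>Y \<in> Ob A. Ext_vanishes A 1 P Y)" for P
    using projective_iff_splits [of P] Ext_vanishes_1_iff_splits [of P] unfolding Proj_def projective_def by auto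
  then have "cotorsion_pair A (Proj A) (Ob A)"
    unfolding cotorsion_pair_def left_perp_def right_perp_def by auto
  moreover have "\<exists>f g. short_exact A f g \<and> Dom A f \<in> Ob A \<and> Cod A f \<in> Proj A \<and> Cod A g = X" if X: "X \<in> Ob A" for X
  proof -
    obtain e where e: "projective A (Dom A e)" "epic A e" "Cod A e = X"
      using ep X unfolding enough_projectives_def by auto
    obtain k where k: "is_kernel A k e" using kernel_ex e by fastforce
    show ?thesis using k e short_exact_kernel kernelD [OF k] by (intro exI [of _ k] exI [of _ e]) (auto simp: Proj_def)
  qed
  moreover have "\<exists>f g. short_exact A f g \<and> Dom A f = X \<and> Cod A f \<in> Ob A \<and> Cod A g \<in> Proj A" if X: "X \<in> Ob A" for X
  proof -
    obtain Z where Z: "zero_object A Z" using zero_ex by blast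
    have "short_exact A (Ident A X) (Zero A X Z)" using kernel_to_zero [OF Z X] short_exact_kernel by simp
    then show ?thesis using zero_projective [OF Z] X zero_object_Ob [OF Z]
      by (intro exI [of _ "Ident A X"] exI [of _ "Zero A X Z"]) (auto simp: Proj_def)
  qed
  ultimately show ?thesis unfolding complete_cotorsion_pair_def by simp
qed

section \<open>The model structure of a projective cotorsion pair\<close>

text \<open>
  Null maps form an ideal; the maps modulo null maps are the stable category, in which the homotopy
  category of the model structure is found as the full subcategory on \<open>C\<close>.
\<close>

definition null :: "'m \<Rightarrow> bool" where
  "null h \<longleftrightarrow> (\<exists>a b. a \<in> Ar A \<and> b \<in> Ar A \<and> Cod A a = Dom A b \<and> projective A (Dom A b) \<and> h = b \<cdot> a)"

lemma null_Ar: "null h \<Longrightarrow> h \<in> Ar A" by (auto simp: null_def)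

lemma null_Zero:
  assumes "X \<in> Ob A" "Y \<in> Ob A" shows "null (Zero A X Y)"
proof -
  obtain Z where Z: "zero_object A Z" using zero_ex by blast
  note Z' = zero_object_Ob [OF Z]
  show ?thesis unfolding null_def
    by (rule exI [of _ "Zero A X Z"], rule exI [of _ "Zero A Z Y"]) (use Z' zero_projective [OF Z] assms in simp)
qed

lemma null_comp_left:
  assumes "null h" "g \<in> Ar A" "Dom A g = Cod A h" shows "null (g \<cdot> h)"
proof -
  obtain a b where ab: "a \<in> Ar A" "b \<in> Ar A" "Cod A a = Dom A b" "projective A (Dom A b)" "h = b \<cdot> a"
    using assms(1) unfolding null_def by blast
  show ?thesis unfolding null_def
    by (rule exI [of _ a], rule exI [of _ "g \<cdot> b"]) (use ab assms in simp)
qed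

lemma projective_biproduct:
  assumes b: "is_biproduct A X Y S i j p q" and P: "projective A X" "projective A Y"
  shows "projective A S"
  unfolding projective_def
proof (intro conjI allI impI)
  note b' = biproductD [OF b]
  show "S \<in> Ob A" by (rule b')
  fix e f assume "epic A e \<and> f \<in> Hom A S (Cod A e)"
  then have e: "epic A e" "f \<in> Ar A" "Dom A f = S" "Cod A f = Cod A e" by (auto simp: Hom_iff)
  obtain u where u: "u \<in> Ar A" "Dom A u = X" "Cod A u = Dom A e" "e \<cdot> u = f \<cdot> i"
    using projectiveE [OF P(1) e(1), of "f \<cdot> i"] e b' by auto
  obtain v where v: "v \<in> Ar A" "Dom A v = Y" "Cod A v = Dom A e" "e \<cdot> v = f \<cdot> j"
    using projectiveE [OF P(2) e(1), of "f \<cdot> j"] e b' by auto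
  obtain w where w: "w \<in> Ar A" "Dom A w = S" "Cod A w = Dom A e" "w \<cdot> i = u" "w \<cdot> j = v"
    using biproduct_copair [OF b, of u v] u v by auto
  have "e \<cdot> w = f"
    by (rule biproduct_ext [OF b]) (use w b' e u v in simp_all)
  then show "\<exists>g\<in>Hom A S (Dom A e). e \<cdot> g = f" using w by (auto simp: Hom_iff)
qed

lemma minus_as_Plus:
  assumes "f \<in> Ar A" "g \<in> Ar A" "Dom A f = Dom A g" "Cod A f = Cod A g"
  shows "f \<ominus> g = f \<oplus> (Zero A (Dom A g) (Cod A g) \<ominus> g)"
  by (rule minus_eqI) (use assms in \<open>simp_all add: Plus_assoc\<close>)

lemma null_Plus:
  assumes "null h" "null h'" "Dom A h = Dom A h'" "Cod A h = Cod A h'"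
  shows "null (h \<oplus> h')"
proof -
  obtain a b where ab: "a \<in> Ar A" "b \<in> Ar A" "Cod A a = Dom A b" "projective A (Dom A b)" "h = b \<cdot> a"
    using assms(1) unfolding null_def by blast
  obtain a' b' where ab': "a' \<in> Ar A" "b' \<in> Ar A" "Cod A a' = Dom A b'" "projective A (Dom A b')" "h' = b' \<cdot> a'"
    using assms(2) unfolding null_def by blast
  obtain S i j p q where B: "is_biproduct A (Dom A b) (Dom A b') S i j p q"
    using biproduct_ex [of "Dom A b" "Dom A b'"] ab ab' by auto
  note B' = biproductD [OF B]
  obtain w where w: "w \<in> Ar A" "Dom A w = S" "Cod A w = Cod A b'" "w \<cdot> i = b" "w \<cdot> j = b'"
    using biproduct_copair [OF B, of b b'] ab ab' assms by auto
  have "h \<oplus> h' = w \<cdot> ((i \<cdot> a) \<oplus> (j \<cdot> a'))"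
    using w(1-3) B' ab ab' assms reassoc [OF w(4), of a] reassoc [OF w(5), of a'] by (simp add: additive)
  moreover have "projective A S" by (rule projective_biproduct [OF B ab(4) ab'(4)])
  ultimately show ?thesis unfolding null_def
    using w(1,2) B' ab(1-3) ab'(1-3) ab(5) ab'(5) assms by (intro exI [of _ "(i \<cdot> a) \<oplus> (j \<cdot> a')"] exI [of _ w]) simp
qed

lemma null_uminus: 
  assumes "null h" shows "null (Zero A (Dom A h) (Cod A h) \<ominus> h)"
proof -
  have h: "h \<in> Ar A" by (rule null_Ar [OF assms])
  have "Zero A (Dom A h) (Cod A h) \<ominus> h = (Zero A (Cod A h) (Cod A h) \<ominus> Ident A (Cod A h)) \<cdot> h"
    using h by (simp add: additive)
  then show ?thesis using null_comp_left [OF assms] h by simp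
qed

lemma null_minus:
  assumes "null h" "null h'" "Dom A h = Dom A h'" "Cod A h = Cod A h'"
  shows "null (h \<ominus> h')"
  using minus_as_Plus [of h h'] null_Plus [OF assms(1) null_uminus [OF assms(2)]] null_Ar [OF assms(1)] null_Ar [OF assms(2)] assms
  by simp

lemma null_of_minus_left:
  assumes "null (a \<ominus> b)" "null b" "a \<in> Ar A" "Dom A a = Dom A b" "Cod A a = Cod A b"
  shows "null a"
proof -
  have "b \<in> Ar A" by (rule null_Ar [OF assms(2)])
  then show ?thesis using null_Plus [OF assms(1,2)] assms(3-) by simp
qed

lemma null_of_minus_right:
  assumes "null (a \<ominus> b)" "null a" "b \<in> Ar A" "Dom A a = Dom A b" "Cod A a = Cod A b"
  shows "null b"
proof -
  have a: "a \<in> Ar A" by (rule null_Ar [OF assms(2)])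
  have "a \<ominus> (a \<ominus> b) = b" by (rule minus_eqI) (use a assms in simp_all)
  then show ?thesis using null_minus [OF assms(2,1)] a assms(3-) by simp
qed

lemma null_minus_trans:
  assumes "null (a \<ominus> b)" "null (b \<ominus> c)" "a \<in> Ar A" "b \<in> Ar A" "c \<in> Ar A" 
    "Dom A a = Dom A c" "Cod A a = Cod A c" "Dom A b = Dom A c" "Cod A b = Cod A c"
  shows "null (a \<ominus> c)"
proof -
  have "a \<ominus> c = (a \<ominus> b) \<oplus> (b \<ominus> c)"
    by (rule minus_eqI) (use assms in \<open>simp_all add: Plus_assoc\<close>)
  then show ?thesis using null_Plus [OF assms(1,2)] assms(3-) by simp
qed

end

lemma thick_cokernel: "thick A W \<Longrightarrow> short_exact A f g \<Longrightarrow> Dom A f \<in> W \<Longrightarrow> Cod A f \<in> W \<Longrightarrow> Cod A g \<in> W"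
  unfolding thick_def by blast

locale projective_cotorsion = cotorsion A C W for A :: "('o, 'm) preadd" (structure) and C W :: "'o set" +
  assumes enough: "enough_projectives A"
    and Proj_eq: "C \<inter> W = Proj A"
    and thick: "thick A W"

context cotorsion
begin

text \<open>
  Weak equivalences should be the maps that become invertible in the homotopy category; this is tested by
  the stable maps out of the cofibrant objects.
\<close>

definition weq :: "'m \<Rightarrow> bool" where
  "weq f \<longleftrightarrow> f \<in> Ar A \<and>
     (\<forall>h \<in> Ar A. Dom A h \<in> C \<and> Cod A h = Cod A f \<longrightarrow> (\<exists>h' \<in> Hom A (Dom A h) (Dom A f). null (h \<ominus> (f \<cdot> h')))) \<and>
     (\<forall>h \<in> Ar A. Dom A h \<in> C \<and> Cod A h = Dom A f \<and> null (f \<cdot> h) \<longrightarrow> null h)"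

lemma weqI:
  assumes "f \<in> Ar A"
    and "\<And>h. h \<in> Ar A \<Longrightarrow> Dom A h \<in> C \<Longrightarrow> Cod A h = Cod A f \<Longrightarrow> \<exists>h' \<in> Hom A (Dom A h) (Dom A f). null (h \<ominus> (f \<cdot> h'))"
    and "\<And>h. h \<in> Ar A \<Longrightarrow> Dom A h \<in> C \<Longrightarrow> Cod A h = Dom A f \<Longrightarrow> null (f \<cdot> h) \<Longrightarrow> null h"
  shows "weq f"
  using assms unfolding weq_def by blast

lemma weq_Ar: "weq f \<Longrightarrow> f \<in> Ar A" by (simp add: weq_def)

lemma weq_surj:
  assumes "weq f" "h \<in> Ar A" "Dom A h \<in> C" "Cod A h = Cod A f"
  obtains h' where "h' \<in> Ar A" "Dom A h' = Dom A h" "Cod A h' = Dom A f" "null (h \<ominus> (f \<cdot> h'))"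
proof -
  have "\<exists>h' \<in> Hom A (Dom A h) (Dom A f). null (h \<ominus> (f \<cdot> h'))" using assms unfolding weq_def by blast
  then show thesis using that by (auto simp: Hom_iff)
qed

lemma weq_inj:
  assumes "weq f" "h \<in> Ar A" "Dom A h \<in> C" "Cod A h = Dom A f" "null (f \<cdot> h)" shows "null h"
  using assms unfolding weq_def by blast

lemma weq_comp:
  assumes f: "weq f" and g: "weq g" and fg: "Cod A f = Dom A g" shows "weq (g \<cdot> f)"
proof (rule weqI)
  note f' = weq_Ar [OF f] and g' = weq_Ar [OF g]
  show "g \<cdot> f \<in> Ar A" using f' g' fg by simp
  fix h assume h: "h \<in> Ar A" "Dom A h \<in> C"
  { assume c: "Cod A h = Cod A (g \<cdot> f)"
    obtain a where a: "a \<in> Ar A" "Dom A a = Dom A h" "Cod A a = Dom A g" "null (h \<ominus> (g \<cdot> a))"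
      using weq_surj [OF g h] c f' g' fg by auto
    obtain b where b: "b \<in> Ar A" "Dom A b = Dom A h" "Cod A b = Dom A f" "null (a \<ominus> (f \<cdot> b))"
      using weq_surj [OF f a(1)] a h fg by auto
    have "null (g \<cdot> (a \<ominus> (f \<cdot> b)))" by (rule null_comp_left) (use a b f' g' fg in simp_all)
    then have "null ((g \<cdot> a) \<ominus> (g \<cdot> (f \<cdot> b)))" using a b f' g' fg by (simp add: additive)
    then have "null (h \<ominus> (g \<cdot> (f \<cdot> b)))" by (rule null_minus_trans [OF a(4)]) (use a b h c f' g' fg in simp_all)
    then show "\<exists>h' \<in> Hom A (Dom A h) (Dom A (g \<cdot> f)). null (h \<ominus> ((g \<cdot> f) \<cdot> h'))"
      using b f' g' fg by (intro bexI [of _ b]) (simp_all add: Hom_iff) }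
  { assume c: "Cod A h = Dom A (g \<cdot> f)" "null ((g \<cdot> f) \<cdot> h)"
    then have "null (g \<cdot> (f \<cdot> h))" using f' g' fg h by simp
    then have "null (f \<cdot> h)" by (rule weq_inj [OF g, rotated -1]) (use f' g' fg h c in simp_all)
    then show "null h" by (rule weq_inj [OF f, rotated -1]) (use f' g' fg h c in simp_all) }
qed

lemma weq_cancel_right:
  assumes f: "weq f" and gf: "weq (g \<cdot> f)" and g': "g \<in> Ar A" and fg: "Cod A f = Dom A g" shows "weq g"
proof (rule weqI [OF g'])
  note f' = weq_Ar [OF f]
  fix h assume h: "h \<in> Ar A" "Dom A h \<in> C"
  { assume c: "Cod A h = Cod A g"
    obtain a where a: "a \<in> Ar A" "Dom A a = Dom A h" "Cod A a = Dom A f" "null (h \<ominus> ((g \<cdot> f) \<cdot> a))"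
      using weq_surj [OF gf h] c f' g' fg by auto
    then show "\<exists>h' \<in> Hom A (Dom A h) (Dom A g). null (h \<ominus> (g \<cdot> h'))"
      using f' g' fg by (intro bexI [of _ "f \<cdot> a"]) (simp_all add: Hom_iff) }
  { assume c: "Cod A h = Dom A g" "null (g \<cdot> h)"
    obtain a where a: "a \<in> Ar A" "Dom A a = Dom A h" "Cod A a = Dom A f" "null (h \<ominus> (f \<cdot> a))"
      using weq_surj [OF f h] c fg by auto
    have "null (g \<cdot> (h \<ominus> (f \<cdot> a)))" by (rule null_comp_left) (use a h c f' g' fg in simp_all)
    then have "null ((g \<cdot> h) \<ominus> (g \<cdot> (f \<cdot> a)))" using a h c f' g' fg by (simp add: additive)
    then have "null (g \<cdot> (f \<cdot> a))" by (rule null_of_minus_right [OF _ c(2)]) (use a h c f' g' fg in simp_all)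
    then have "null ((g \<cdot> f) \<cdot> a)" using a f' g' fg by simp
    then have "null a" by (rule weq_inj [OF gf, rotated -1]) (use a h f' g' fg in simp_all)
    then have "null (f \<cdot> a)" by (rule null_comp_left) (use a f' in simp_all)
    then show "null h" by (rule null_of_minus_left [OF a(4)]) (use a h c f' fg in simp_all) }
qed

lemma weq_cancel_left:
  assumes g: "weq g" and gf: "weq (g \<cdot> f)" and f': "f \<in> Ar A" and fg: "Cod A f = Dom A g" shows "weq f"
proof (rule weqI [OF f'])
  note g' = weq_Ar [OF g]
  fix h assume h: "h \<in> Ar A" "Dom A h \<in> C"
  { assume c: "Cod A h = Cod A f"
    obtain a where a: "a \<in> Ar A" "Dom A a = Dom A h" "Cod A a = Dom A f" "null ((g \<cdot> h) \<ominus> ((g \<cdot> f) \<cdot> a))"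
      using weq_surj [OF gf, of "g \<cdot> h"] h c f' g' fg by auto
    then have "null (g \<cdot> (h \<ominus> (f \<cdot> a)))" using h c f' g' fg by (simp add: additive)
    then have "null (h \<ominus> (f \<cdot> a))" by (rule weq_inj [OF g, rotated -1]) (use a h c f' g' fg in simp_all)
    then show "\<exists>h' \<in> Hom A (Dom A h) (Dom A f). null (h \<ominus> (f \<cdot> h'))"
      using a by (intro bexI [of _ a]) (simp_all add: Hom_iff) }
  { assume c: "Cod A h = Dom A f" "null (f \<cdot> h)"
    from c(2) have "null (g \<cdot> (f \<cdot> h))" by (rule null_comp_left) (use h c f' g' fg in simp_all)
    then have "null ((g \<cdot> f) \<cdot> h)" using f' g' fg h c by simp
    then show "null h" by (rule weq_inj [OF gf, rotated -1]) (use f' g' fg h c in simp_all) }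
qed

lemma weq_Ident: "X \<in> Ob A \<Longrightarrow> weq (Ident A X)"
proof (rule weqI)
  fix h assume "X \<in> Ob A" "h \<in> Ar A" "Dom A h \<in> C" "Cod A h = Cod A (Ident A X)"
  then show "\<exists>h' \<in> Hom A (Dom A h) (Dom A (Ident A X)). null (h \<ominus> (Ident A X \<cdot> h'))"
    by (intro bexI [of _ h]) (simp_all add: Hom_iff null_Zero)
qed auto

lemma retract_ofE:
  assumes "retract_of A f g"
  obtains i r i' r' where "f \<in> Ar A" "g \<in> Ar A" "i \<in> Ar A" "Dom A i = Dom A f" "Cod A i = Dom A g"
    "r \<in> Ar A" "Dom A r = Dom A g" "Cod A r = Dom A f" "i' \<in> Ar A" "Dom A i' = Cod A f" "Cod A i' = Cod A g"
    "r' \<in> Ar A" "Dom A r' = Cod A g" "Cod A r' = Cod A f"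
    "r \<cdot> i = Ident A (Dom A f)" "r' \<cdot> i' = Ident A (Cod A f)" "g \<cdot> i = i' \<cdot> f" "f \<cdot> r = r' \<cdot> g"
  using assms unfolding retract_of_def Hom_iff by blast

lemma weq_retract:
  assumes "retract_of A f g" "weq g" shows "weq f"
  using assms(1)
proof (rule retract_ofE)
  fix i r i' r'
  assume fg: "f \<in> Ar A" "g \<in> Ar A" and i: "i \<in> Ar A" "Dom A i = Dom A f" "Cod A i = Dom A g"
    and r: "r \<in> Ar A" "Dom A r = Dom A g" "Cod A r = Dom A f" 
    and i': "i' \<in> Ar A" "Dom A i' = Cod A f" "Cod A i' = Cod A g"
    and r': "r' \<in> Ar A" "Dom A r' = Cod A g" "Cod A r' = Cod A f"
    and e: "r \<cdot> i = Ident A (Dom A f)" "r' \<cdot> i' = Ident A (Cod A f)" "g \<cdot> i = i' \<cdot> f" "f \<cdot> r = r' \<cdot> g"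
  show "weq f"
  proof (rule weqI [OF fg(1)])
    fix h assume h: "h \<in> Ar A" "Dom A h \<in> C"
    { assume c: "Cod A h = Cod A f"
      obtain a where a: "a \<in> Ar A" "Dom A a = Dom A h" "Cod A a = Dom A g" "null ((i' \<cdot> h) \<ominus> (g \<cdot> a))"
        using weq_surj [OF assms(2), of "i' \<cdot> h"] h c i' by auto
      from a(4) have "null (r' \<cdot> ((i' \<cdot> h) \<ominus> (g \<cdot> a)))" by (rule null_comp_left) (use a(1-3) h c i' r' fg in simp_all)
      moreover have "r' \<cdot> ((i' \<cdot> h) \<ominus> (g \<cdot> a)) = h \<ominus> (f \<cdot> (r \<cdot> a))"
        using reassoc [OF e(2), of h] reassoc [OF e(4), of a] a(1-3) h c i' r r' fg by (simp add: additive)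
      ultimately show "\<exists>h' \<in> Hom A (Dom A h) (Dom A f). null (h \<ominus> (f \<cdot> h'))"
        using a r by (intro bexI [of _ "r \<cdot> a"]) (simp_all add: Hom_iff) }
    { assume c: "Cod A h = Dom A f" "null (f \<cdot> h)"
      from c(2) have "null (i' \<cdot> (f \<cdot> h))" by (rule null_comp_left) (use h c i' fg in simp_all)
      then have "null (g \<cdot> (i \<cdot> h))" using reassoc [OF e(3), of h] h c i i' fg by simp
      then have "null (i \<cdot> h)" by (rule weq_inj [OF assms(2), rotated -1]) (use h c i fg in simp_all)
      then have "null (r \<cdot> (i \<cdot> h))" by (rule null_comp_left) (use h c r i fg in simp_all)
      then show "null h" using reassoc [OF e(1), of h] h c r i by simp }
  qed
qed

lemma retract_monic: assumes "retract_of A f g" "monic A g" shows "monic A f"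
  using assms(1)
proof (rule retract_ofE)
  fix i r i' r'
  assume fg: "f \<in> Ar A" "g \<in> Ar A" and i: "i \<in> Ar A" "Dom A i = Dom A f" "Cod A i = Dom A g"
    and r: "r \<in> Ar A" "Dom A r = Dom A g" "Cod A r = Dom A f" 
    and i': "i' \<in> Ar A" "Dom A i' = Cod A f" "Cod A i' = Cod A g"
    and e: "r \<cdot> i = Ident A (Dom A f)" "g \<cdot> i = i' \<cdot> f"
  have "monic A i" using split_monic [of r i] i r e by simp
  then have "monic A (g \<cdot> i)" using monic_comp assms(2) i by simp
  then show "monic A f" using monic_of_comp [of i' f] e i' fg by simp
qed

lemma retract_epic: assumes "retract_of A f g" "epic A g" shows "epic A f"
  using assms(1)
proof (rule retract_ofE)
  fix i r i' r'
  assume fg: "f \<in> Ar A" "g \<in> Ar A" 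
    and r: "r \<in> Ar A" "Dom A r = Dom A g" "Cod A r = Dom A f" 
    and i': "i' \<in> Ar A" "Dom A i' = Cod A f" "Cod A i' = Cod A g"
    and r': "r' \<in> Ar A" "Dom A r' = Cod A g" "Cod A r' = Cod A f"
    and e: "r' \<cdot> i' = Ident A (Cod A f)" "f \<cdot> r = r' \<cdot> g"
  have "epic A r'" using split_epic [of r' i'] i' r' e by simp
  then have "epic A (r' \<cdot> g)" using epic_comp assms(2) r' by simp
  then have "epic A (f \<cdot> r)" using e by simp
  then show "epic A f" using epic_of_comp [of f r] r fg by simp
qed

lemma retract_has_lift: assumes "retract_of A f g" "has_lift A g p" "p \<in> Ar A" shows "has_lift A f p"
  using assms(1)
proof (rule retract_ofE)
  fix i r i' r'
  assume fg: "f \<in> Ar A" "g \<in> Ar A" and i: "i \<in> Ar A" "Dom A i = Dom A f" "Cod A i = Dom A g"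
    and r: "r \<in> Ar A" "Dom A r = Dom A g" "Cod A r = Dom A f" 
    and i': "i' \<in> Ar A" "Dom A i' = Cod A f" "Cod A i' = Cod A g"
    and r': "r' \<in> Ar A" "Dom A r' = Cod A g" "Cod A r' = Cod A f"
    and e: "r \<cdot> i = Ident A (Dom A f)" "r' \<cdot> i' = Ident A (Cod A f)" "g \<cdot> i = i' \<cdot> f" "f \<cdot> r = r' \<cdot> g"
  show "has_lift A f p"
  proof (rule has_liftI)
    fix u v assume u: "u \<in> Ar A" "v \<in> Ar A" "Dom A u = Dom A f" "Cod A u = Dom A p" "Dom A v = Cod A f" "Cod A v = Cod A p"
      and sq: "p \<cdot> u = v \<cdot> f"
    have "p \<cdot> (u \<cdot> r) = (v \<cdot> r') \<cdot> g" using reassoc [OF sq, of r] e(4) u r r' fg assms(3) by simp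
    then obtain h where h: "h \<in> Ar A" "Dom A h = Cod A g" "Cod A h = Dom A p" "h \<cdot> g = u \<cdot> r" "p \<cdot> h = v \<cdot> r'"
      using has_liftE [OF assms(2), of "u \<cdot> r" "v \<cdot> r'"] u r r' by auto
    have "(h \<cdot> i') \<cdot> f = h \<cdot> (g \<cdot> i)" using h(1-3) i' fg e(3) by simp
    also have "\<dots> = u" using reassoc [OF h(4), of i] h(1-3) i r u e(1) fg by simp
    finally have 1: "(h \<cdot> i') \<cdot> f = u" .
    have 2: "p \<cdot> (h \<cdot> i') = v" using reassoc [OF h(5), of i'] h(1-3) i' r' u e(2) assms(3) by simp
    show "\<exists>h. h \<in> Ar A \<and> Dom A h = Cod A f \<and> Cod A h = Dom A p \<and> h \<cdot> f = u \<and> p \<cdot> h = v"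
      using 1 2 h i' by (intro exI [of _ "h \<cdot> i'"]) simp
  qed
qed

lemma cof_retract: "retract_of A f g \<Longrightarrow> g \<in> cof \<Longrightarrow> f \<in> cof"
proof (rule cofI)
  assume r: "retract_of A f g" and g: "g \<in> cof"
  show "monic A f" by (rule retract_monic [OF r cof_monic [OF g]])
  show "has_lift A f p" if "p \<in> tfib" for p
    by (rule retract_has_lift [OF r cof_has_lift [OF g that] epic_Ar [OF tfib_epic [OF that]]])
qed

end

context projective_cotorsion
begin

text \<open>
  Embed the source into an object of \<open>W\<close> with cokernel in \<open>C\<close>. That object lies in \<open>C\<close> and in \<open>W\<close>, so it is
  projective, and \<open>t\<close> extends to it because its target is in \<open>W\<close>.
\<close>

lemma null_from_C_to_W:
  assumes t: "t \<in> Ar A" "Dom A t \<in> C" "Cod A t \<in> W" shows "null t"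
proof -
  obtain m c where mc: "short_exact A m c" "Dom A m = Dom A t" "Cod A m \<in> W" "Cod A c \<in> C"
    using preenvelope [OF C_Ob [OF t(2)]] by metis
  note m = short_exactD [OF mc(1)]
  have "m \<in> cof" using m mc unfolding monics_with_cokernel_in_def by auto
  then have "Cod A m \<in> C" using C_of_cof mc t by simp
  then have "projective A (Cod A m)" using Proj_eq mc unfolding Proj_def by blast
  moreover obtain v where "v \<in> Ar A" "Cod A v = Cod A t" "Dom A v = Cod A m" "v \<cdot> m = t"
    using splits_extend [OF C_splits [OF mc(4) t(3)] mc(1), of t] mc t by auto
  ultimately show ?thesis unfolding null_def using m by (intro exI [of _ m] exI [of _ v]) simp
qed

text \<open>
  Maps from objects of \<open>C\<close> lift along \<open>f\<close>. If \<open>f h\<close> is null, then it lifts to a null map; the difference of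
  \<open>h\<close> and this map has values in the kernel of \<open>f\<close>, so it is null by \<open>null_from_C_to_W\<close>.
\<close>

lemma tfib_weq: assumes "f \<in> tfib" shows "weq f"
proof -
  obtain k where k: "is_kernel A k f" "Dom A k \<in> W" and e: "epic A f" 
    using assms unfolding epics_with_kernel_in_def by auto
  have kf: "short_exact A k f" using k e short_exact_kernel by simp
  note s = short_exactD [OF kf]
  show ?thesis
  proof (rule weqI)
    show "f \<in> Ar A" by (rule s)
    fix h assume h: "h \<in> Ar A" "Dom A h \<in> C"
    { assume c: "Cod A h = Cod A f"
      obtain v where v: "v \<in> Ar A" "Dom A v = Dom A h" "Cod A v = Cod A k" "f \<cdot> v = h"
        using splits_lift [OF C_splits [OF h(2) k(2)] kf, of h] h c by auto
      then show "\<exists>h' \<in> Hom A (Dom A h) (Dom A f). null (h \<ominus> (f \<cdot> h'))"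
        using h c s by (intro bexI [of _ v]) (simp_all add: Hom_iff null_Zero) }
    { assume c: "Cod A h = Dom A f" "null (f \<cdot> h)"
      then obtain a b where ab: "a \<in> Ar A" "b \<in> Ar A" "Cod A a = Dom A b" "projective A (Dom A b)" "f \<cdot> h = b \<cdot> a"
        unfolding null_def by blast
      have db: "Dom A a = Dom A h" "Cod A b = Cod A f" 
        using ab(1-3) h c(1) s(2) arg_cong [OF ab(5), of "Dom A"] arg_cong [OF ab(5), of "Cod A"] by simp_all
      obtain b' where b': "b' \<in> Ar A" "Dom A b' = Dom A b" "Cod A b' = Dom A f" "f \<cdot> b' = b"
        using projectiveE [OF ab(4) e, of b] ab db by auto
      have "f \<cdot> (h \<ominus> (b' \<cdot> a)) = Zero A (Dom A h) (Cod A f)"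
        using reassoc [OF b'(4), of a] ab db b'(1-3) h c(1) s(2) by (simp add: additive)
      then obtain t where t: "t \<in> Ar A" "Dom A t = Dom A h" "Cod A t = Dom A k" "k \<cdot> t = h \<ominus> (b' \<cdot> a)"
        using kernel_lift [OF k(1), of "h \<ominus> (b' \<cdot> a)" "Dom A h"] ab db b' h c s by auto
      have "null t" by (rule null_from_C_to_W) (use t h k in simp_all)
      then have "null (h \<ominus> (b' \<cdot> a))" using null_comp_left [of t k] t s by simp
      moreover have "null (b' \<cdot> a)" unfolding null_def using ab b' by (intro exI [of _ a] exI [of _ b']) simp
      ultimately show "null h" by (rule null_of_minus_left) (use h c ab db b' in simp_all) }
  qed
qed

text \<open>
  Let \<open>0 \<rightarrow> K \<rightarrow> E \<rightarrow> X \<rightarrow> 0\<close> be an extension with \<open>X \<in> C\<close>, where \<open>K\<close> is the kernel of \<open>f\<close>. A projective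
  presentation \<open>0 \<rightarrow> \<Omega> \<rightarrow> P \<rightarrow> X \<rightarrow> 0\<close> represents it by a map \<open>u : \<Omega> \<rightarrow> K\<close>, and the extension splits iff \<open>u\<close>
  extends to \<open>P\<close>. Now \<open>k u\<close> is killed by \<open>f\<close>, so it is null by injectivity and extends to \<open>v : P \<rightarrow> Dom f\<close>.
  The composite \<open>f v\<close> descends to a map \<open>X \<rightarrow> Cod f\<close>, which lifts to \<open>Dom f\<close> by surjectivity, since null
  maps lift along the epimorphism \<open>f\<close>. Subtracting this lift moves \<open>v\<close> into \<open>K\<close>.
\<close>

lemma epic_weq_tfib: assumes e: "epic A f" and w: "weq f" shows "f \<in> tfib"
proof -
  have f: "f \<in> Ar A" using e by simp
  obtain k where k: "is_kernel A k f" using kernel_ex f by blast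
  note k' = kernelD [OF k]
  have "Dom A k \<in> W"
  proof (rule W_memI)
    show "Dom A k \<in> Ob A" using k' by auto
    fix X assume X: "X \<in> C"
    show "splits A X (Dom A k)" unfolding splits_def
    proof (intro allI impI)
      fix a b assume "short_exact A a b \<and> Dom A a = Dom A k \<and> Cod A b = X"
      then have ab: "short_exact A a b" "Dom A a = Dom A k" "Cod A b = X" by auto
      note s = short_exactD [OF ab(1)]
      obtain c where c: "projective A (Dom A c)" "epic A c" "Cod A c = X"
        using enough X C_Ob unfolding enough_projectives_def by blast
      obtain m where m: "is_kernel A m c" using kernel_ex c by fastforce
      note m' = kernelD [OF m]
      have mc: "short_exact A m c" using m c short_exact_kernel by simp
      note m2 = short_exactD [OF mc]
      have PC: "Dom A c \<in> C" using c Proj_subset by (auto simp: Proj_def)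
      have \<Omega>: "Dom A m \<in> C"
        by (rule C_kernel [OF thick_cokernel [OF thick] mc]) (use PC m' c X in auto)
      obtain l where l: "l \<in> Ar A" "Dom A l = Dom A c" "Cod A l = Dom A b" "b \<cdot> l = c"
        using projectiveE [OF c(1) s(5), of c] c ab by auto
      have "b \<cdot> (l \<cdot> m) = Zero A (Dom A m) (Cod A b)" using reassoc [OF l(4), of m] l m' s ab c by simp
      then obtain u where u: "u \<in> Ar A" "Dom A u = Dom A m" "Cod A u = Dom A a" "a \<cdot> u = l \<cdot> m"
        using kernel_lift [OF s(7), of "l \<cdot> m" "Dom A m"] l m' by auto
      have "f \<cdot> (k \<cdot> u) = Zero A (Dom A m) (Cod A f)" using reassoc [OF k'(4), of u] k' u ab by simp
      then have "null (f \<cdot> (k \<cdot> u))" using null_Zero m' f by simp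
      then have "null (k \<cdot> u)" by (rule weq_inj [OF w, rotated -1]) (use k' u ab \<Omega> in simp_all)
      then obtain \<alpha> \<beta> where \<alpha>: "\<alpha> \<in> Ar A" "\<beta> \<in> Ar A" "Cod A \<alpha> = Dom A \<beta>" "projective A (Dom A \<beta>)" "k \<cdot> u = \<beta> \<cdot> \<alpha>"
        unfolding null_def by blast
      have d\<alpha>: "Dom A \<alpha> = Dom A m" "Cod A \<beta> = Dom A f" 
        using \<alpha>(1-3) u k' ab arg_cong [OF \<alpha>(5), of "Dom A"] arg_cong [OF \<alpha>(5), of "Cod A"] by simp_all
      have "Dom A \<beta> \<in> W" using Proj_eq \<alpha>(4) by (auto simp: Proj_def)
      then obtain \<alpha>' where \<alpha>': "\<alpha>' \<in> Ar A" "Cod A \<alpha>' = Dom A \<beta>" "Dom A \<alpha>' = Cod A m" "\<alpha>' \<cdot> m = \<alpha>"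
        using splits_extend [OF C_splits [OF X] mc c(3), of "Dom A \<beta>" \<alpha>] \<alpha> d\<alpha> by auto
      \<comment> \<open>\<open>v\<close> extends \<open>k u\<close> from the syzygy \<open>Dom m\<close> to \<open>Dom c\<close>.\<close>
      define v where "v = \<beta> \<cdot> \<alpha>'"
      have v: "v \<in> Ar A" "Dom A v = Dom A c" "Cod A v = Dom A f" using \<alpha> \<alpha>' d\<alpha> m' by (auto simp: v_def)
      have vm: "v \<cdot> m = k \<cdot> u" unfolding v_def using \<alpha>(1-3) \<alpha>(5) \<alpha>' m' by simp
      have "(f \<cdot> v) \<cdot> m = Zero A (Dom A m) (Cod A f)" using v vm m' f \<open>f \<cdot> (k \<cdot> u) = Zero A (Dom A m) (Cod A f)\<close> by simp
      then obtain y where y: "y \<in> Ar A" "Cod A y = Cod A f" "Dom A y = X" "y \<cdot> c = f \<cdot> v"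
        using cokernel_lift [OF m2(8), of "f \<cdot> v"] v m' f c by auto
      obtain y1 where y1: "y1 \<in> Ar A" "Dom A y1 = X" "Cod A y1 = Dom A f" "null (y \<ominus> (f \<cdot> y1))"
        using weq_surj [OF w y(1)] X y by auto
      obtain \<gamma> \<delta> where \<gamma>: "\<gamma> \<in> Ar A" "\<delta> \<in> Ar A" "Cod A \<gamma> = Dom A \<delta>" "projective A (Dom A \<delta>)" "y \<ominus> (f \<cdot> y1) = \<delta> \<cdot> \<gamma>"
        using y1(4) unfolding null_def by blast
      have d\<gamma>: "Dom A \<gamma> = X" "Cod A \<delta> = Cod A f" 
        using \<gamma>(1-3) y y1(1-3) f arg_cong [OF \<gamma>(5), of "Dom A"] arg_cong [OF \<gamma>(5), of "Cod A"] by simp_all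
      obtain \<delta>' where \<delta>': "\<delta>' \<in> Ar A" "Dom A \<delta>' = Dom A \<delta>" "Cod A \<delta>' = Dom A f" "f \<cdot> \<delta>' = \<delta>"
        using projectiveE [OF \<gamma>(4) e, of \<delta>] \<gamma> d\<gamma> by auto
      \<comment> \<open>\<open>y2\<close> lifts \<open>y\<close> along \<open>f\<close> strictly, not just up to null maps.\<close>
      define y2 where "y2 = (\<delta>' \<cdot> \<gamma>) \<oplus> y1"
      have y2: "y2 \<in> Ar A" "Dom A y2 = X" "Cod A y2 = Dom A f" using \<delta>' \<gamma> d\<gamma> y1 by (auto simp: y2_def)
      have "f \<cdot> y2 = (y \<ominus> (f \<cdot> y1)) \<oplus> (f \<cdot> y1)" 
        unfolding y2_def \<gamma>(5) using \<delta>'(1-3) \<gamma>(1-3) d\<gamma> y1 f reassoc [OF \<delta>'(4), of \<gamma>] by (simp add: additive)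
      then have fy2: "f \<cdot> y2 = y" using y y1 f by simp
      have "f \<cdot> (v \<ominus> (y2 \<cdot> c)) = Zero A (Dom A c) (Cod A f)"
        using reassoc [OF fy2, of c] y2 v y(1-3) y(4) [symmetric] c f by (simp add: additive)
      then obtain x where x: "x \<in> Ar A" "Dom A x = Dom A c" "Cod A x = Dom A k" "k \<cdot> x = v \<ominus> (y2 \<cdot> c)"
        using kernel_lift [OF k, of "v \<ominus> (y2 \<cdot> c)" "Dom A c"] v y2 c by auto
      have "k \<cdot> (x \<cdot> m) = (v \<ominus> (y2 \<cdot> c)) \<cdot> m" using reassoc [OF x(4), of m] x k' m' by simp
      also have "\<dots> = k \<cdot> u" using v y2 c m' vm u k' ab by (simp add: additive)
      finally have xm: "x \<cdot> m = u" using monicD [OF kernel_monic [OF k], of "x \<cdot> m" u] x k' m' u ab by simp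
      have "(l \<ominus> (a \<cdot> x)) \<cdot> m = Zero A (Dom A m) (Dom A b)" using l x xm s m' ab u by (simp add: additive)
      then obtain t where t: "t \<in> Ar A" "Cod A t = Dom A b" "Dom A t = X" "t \<cdot> c = l \<ominus> (a \<cdot> x)"
        using cokernel_lift [OF m2(8), of "l \<ominus> (a \<cdot> x)"] l x s m' c ab by auto
      have "(b \<cdot> t) \<cdot> c = b \<cdot> (l \<ominus> (a \<cdot> x))" using t s c ab by simp
      also have "\<dots> = Ident A X \<cdot> c" using l x s c ab X reassoc [OF s(6), of x] by (simp add: additive)
      finally have "b \<cdot> t = Ident A X" using epicD [OF c(2), of "b \<cdot> t" "Ident A X"] t s c ab X by simp
      then show "\<exists>s\<in>Hom A X (Cod A a). b \<cdot> s = Ident A X" using t s by (intro bexI [of _ t]) (auto simp: Hom_iff)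
    qed
  qed
  then show ?thesis using e k unfolding epics_with_kernel_in_def by auto
qed

abbreviation "tcof \<equiv> monics_with_cokernel_in A (C \<inter> W)"

lemma tcof_weq: assumes "i \<in> tcof" shows "weq i"
proof -
  obtain c where c: "monic A i" "is_cokernel A c i" "Cod A c \<in> Proj A"
    using assms Proj_eq unfolding monics_with_cokernel_in_def by auto
  have ic: "short_exact A i c" using c short_exact_cokernel by simp
  note s = short_exactD [OF ic]
  have P: "projective A (Cod A c)" using c by (simp add: Proj_def)
  obtain t where t: "t \<in> Ar A" "Dom A t = Cod A c" "Cod A t = Cod A i" "c \<cdot> t = Ident A (Cod A c)"
    using projectiveE [OF P s(5), of "Ident A (Cod A c)"] s by auto
  obtain r where b: "is_biproduct A (Dom A i) (Cod A c) (Cod A i) i t r c" using section_biproduct [OF ic t] by blast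
  note b' = biproductD [OF b]
  show ?thesis
  proof (rule weqI)
    show "i \<in> Ar A" by (rule s)
    fix h assume h: "h \<in> Ar A" "Dom A h \<in> C"
    { assume cd: "Cod A h = Cod A i"
      have "h = ((i \<cdot> r) \<oplus> (t \<cdot> c)) \<cdot> h" unfolding b'(20) using h cd s by simp
      then have "h = (t \<cdot> (c \<cdot> h)) \<oplus> (i \<cdot> (r \<cdot> h))" 
        using Plus_comm [of "t \<cdot> (c \<cdot> h)" "i \<cdot> (r \<cdot> h)"] h cd b'(1-15) by (simp add: additive)
      then have "h \<ominus> (i \<cdot> (r \<cdot> h)) = t \<cdot> (c \<cdot> h)" 
        using Plus_minus(2) [of "t \<cdot> (c \<cdot> h)" "i \<cdot> (r \<cdot> h)"] h cd b'(1-15) by simp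
      moreover have "null (t \<cdot> (c \<cdot> h))" unfolding null_def 
        using P h cd b'(1-15) by (intro exI [of _ "c \<cdot> h"] exI [of _ t]) simp
      ultimately show "\<exists>h' \<in> Hom A (Dom A h) (Dom A i). null (h \<ominus> (i \<cdot> h'))"
        using h cd b'(1-15) by (intro bexI [of _ "r \<cdot> h"]) (simp_all add: Hom_iff) }
    { assume cd: "Cod A h = Dom A i" "null (i \<cdot> h)"
      from cd(2) have "null (r \<cdot> (i \<cdot> h))" by (rule null_comp_left) (use h cd b'(1-15) in simp_all)
      then show "null h" using reassoc [OF b'(16), of h] h cd b'(1-15) by simp }
  qed
qed

interpretation triv: cotorsion A "Proj A" "Ob A"
  by unfold_locales (rule Proj_complete [OF enough])

lemma epics_with_kernel_Ob: "epics_with_kernel_in A (Ob A) = {f. epic A f}"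
proof -
  have "\<exists>k. is_kernel A k f \<and> Dom A k \<in> Ob A" if "epic A f" for f
    using kernel_ex [OF epic_Ar [OF that]] kernelD(1) by blast
  then show ?thesis unfolding epics_with_kernel_in_def by blast
qed

lemma tcof_has_lift: "i \<in> tcof \<Longrightarrow> epic A p \<Longrightarrow> has_lift A i p"
  using triv.cof_has_lift [of i p] by (simp add: Proj_eq epics_with_kernel_Ob)

lemma tcof_cof: "tcof \<subseteq> cof"
  unfolding monics_with_cokernel_in_def by auto

lemma tcof_factorization:
  assumes "f \<in> Ar A" shows "\<exists>i \<in> tcof. \<exists>e. epic A e \<and> Cod A i = Dom A e \<and> f = e \<cdot> i"
proof -
  obtain i e q where ie: "short_exact A i q" "projective A (Cod A q)" "epic A e" "Cod A i = Dom A e" "f = e \<cdot> i"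
    using split_factorization [OF enough assms] by metis
  have "i \<in> tcof" unfolding Proj_eq monics_with_cokernel_in_def Proj_def 
    using ie(2) short_exactD(4,8) [OF ie(1)] by blast
  then show ?thesis using ie by blast
qed

text \<open>
  The retract argument: factor \<open>f = e i\<close> with \<open>i\<close> a monomorphism with projective cokernel. Then \<open>e\<close> is an
  epimorphism with kernel in \<open>W\<close>, so \<open>f\<close> lifts against it and its cokernel is a retract of that of \<open>i\<close>.
\<close>

lemma cof_weq_tcof: assumes f: "f \<in> cof" and w: "weq f" shows "f \<in> tcof"
proof -
  have fm: "monic A f" and f': "f \<in> Ar A" using cof_monic [OF f] by auto
  obtain i e where i: "i \<in> tcof" and e: "epic A e" "Cod A i = Dom A e" "f = e \<cdot> i"
    using tcof_factorization [OF f'] by blast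
  have "weq e" using weq_cancel_right [OF tcof_weq [OF i]] w e by simp
  then have et: "e \<in> tfib" using epic_weq_tfib e by simp
  obtain p where p: "monic A i" "is_cokernel A p i" "Cod A p \<in> C \<inter> W" 
    using i unfolding monics_with_cokernel_in_def by auto
  note p' = cokernelD [OF p(2)]
  obtain c where c: "is_cokernel A c f" using cokernel_ex f' by blast
  note c' = cokernelD [OF c]
  have "e \<in> Ar A" "i \<in> Ar A" using e(1) p' by auto
  then have ty: "e \<in> Ar A" "Cod A e = Cod A f" "Dom A i = Dom A f" "i \<in> Ar A"
    using e(2) arg_cong [OF e(3), of "Dom A"] arg_cong [OF e(3), of "Cod A"] by simp_all
  obtain h where h: "h \<in> Ar A" "Dom A h = Cod A f" "Cod A h = Dom A e" "h \<cdot> f = i" "e \<cdot> h = Ident A (Cod A f)"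
    using has_liftE [OF cof_has_lift [OF f et], of i "Ident A (Cod A f)"] ty e(2) e(3) [symmetric] f' by auto
  have "(p \<cdot> h) \<cdot> f = Zero A (Dom A f) (Cod A p)" using h p' f' e(2) ty by simp
  then obtain x where x: "x \<in> Ar A" "Cod A x = Cod A p" "Dom A x = Cod A c" "x \<cdot> c = p \<cdot> h"
    using cokernel_lift [OF c, of "p \<cdot> h"] h p' e(2) by auto
  have "(c \<cdot> e) \<cdot> i = Zero A (Dom A i) (Cod A c)" using e(2) e(3) [symmetric] c' ty p' by simp
  then obtain y where y: "y \<in> Ar A" "Cod A y = Cod A c" "Dom A y = Cod A p" "y \<cdot> p = c \<cdot> e"
    using cokernel_lift [OF p(2), of "c \<cdot> e"] c' ty e(2) by auto
  have "(y \<cdot> x) \<cdot> c = (y \<cdot> p) \<cdot> h" using x y(1-3) p' h c' e(2) by simp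
  also have "\<dots> = Ident A (Cod A c) \<cdot> c" unfolding y(4) using c' ty h by simp
  finally have yx: "y \<cdot> x = Ident A (Cod A c)" 
    using epicD [OF cokernel_epic [OF c], of "y \<cdot> x" "Ident A (Cod A c)"] x y c' by simp
  have "Cod A c \<in> C" using C_retract [of "Cod A p" x "Cod A c" y] p yx x y by (auto simp: Hom_iff)
  moreover have "Cod A c \<in> W" using W_retract [of "Cod A p" x "Cod A c" y] p yx x y by (auto simp: Hom_iff)
  ultimately show ?thesis unfolding monics_with_cokernel_in_def using fm c by auto
qed

definition stable_model where "stable_model = \<lparr>cofibrations = cof, weak_equivs = {f. weq f}, fibrations = {f. epic A f}\<rparr>"

lemma stable_model_simps [simp]: "cofibrations stable_model = cof" "weak_equivs stable_model = {f. weq f}" "fibrations stable_model = {f. epic A f}"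
  by (simp_all add: stable_model_def)

lemma cof_Int_weq: "cof \<inter> {f. weq f} = tcof"
  using cof_weq_tcof tcof_weq tcof_cof by auto

lemma epic_Int_weq: "{f. epic A f} \<inter> {f. weq f} = tfib"
  using epic_weq_tfib tfib_weq tfib_epic by auto

lemma model_structure: "model_structure A stable_model"
  unfolding model_structure_def stable_model_simps cof_Int_weq epic_Int_weq
proof (intro conjI ballI allI impI; (elim conjE)?)
  show "cof \<subseteq> Ar A" using cof_monic by auto
  show "{f. weq f} \<subseteq> Ar A" using weq_Ar by auto
  show "{f. epic A f} \<subseteq> Ar A" by auto
  show "has_lift A i p" if "i \<in> tcof" "p \<in> {f. epic A f}" for i p using that tcof_has_lift by simp
  show "has_lift A i p" if "i \<in> cof" "p \<in> tfib" for i p using that cof_has_lift by simp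
  show "\<exists>i\<in>tcof. \<exists>p\<in>{f. epic A f}. Cod A i = Dom A p \<and> f = p \<cdot> i" if "f \<in> Ar A" for f
    using tcof_factorization [OF that] by blast
  show "\<exists>i\<in>cof. \<exists>p\<in>tfib. Cod A i = Dom A p \<and> f = p \<cdot> i" if "f \<in> Ar A" for f
    using factorization [OF enough that] .
  show "g \<cdot> f \<in> {f. weq f}" if "Cod A f = Dom A g" "f \<in> {f. weq f}" "g \<in> {f. weq f}" for f g
    using that weq_comp by simp
  show "g \<in> {f. weq f}" if "g \<in> Ar A" "Cod A f = Dom A g" "f \<in> {f. weq f}" "g \<cdot> f \<in> {f. weq f}" for f g
    using that weq_cancel_right by blast
  show "f \<in> {f. weq f}" if "f \<in> Ar A" "Cod A f = Dom A g" "g \<in> {f. weq f}" "g \<cdot> f \<in> {f. weq f}" for f g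
    using that weq_cancel_left by blast
  show "f \<in> cof" if "retract_of A f g" "g \<in> cof" for f g using that cof_retract by simp
  show "f \<in> {f. weq f}" if "retract_of A f g" "g \<in> {f. weq f}" for f g using that weq_retract by simp
  show "f \<in> {f. epic A f}" if "retract_of A f g" "g \<in> {f. epic A f}" for f g using that retract_epic by simp
qed

lemma cofibrant: "cofibrant_objects A stable_model = C"
proof -
  have "(\<exists>f \<in> Hom A Z X. f \<in> cof) \<longleftrightarrow> X \<in> C" if "zero_object A Z" "X \<in> Ob A" for X Z
    using from_zero [OF that(1)] C_iff_cof [OF that] zero_object_Ob [OF that(1)] that(2) 
    by (metis (no_types, lifting) Hom_iff Zero_simps)
  then show ?thesis unfolding cofibrant_objects_def stable_model_simps using zero_ex by auto
qed

lemma fibrant: "fibrant_objects A stable_model = Ob A"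
proof -
  obtain Z where Z: "zero_object A Z" using zero_ex by blast
  have "\<exists>f \<in> Hom A X Z. epic A f" if "X \<in> Ob A" for X
    using kernel_to_zero(2) [OF Z that] zero_object_Ob [OF Z] that by (intro bexI [of _ "Zero A X Z"]) (simp_all add: Hom_iff)
  then show ?thesis unfolding fibrant_objects_def stable_model_simps using Z by blast
qed

lemma trivial: "trivial_objects A stable_model = W"
proof -
  have "weq (Zero A Z X) \<longleftrightarrow> X \<in> W" if Z: "zero_object A Z" and X: "X \<in> Ob A" for X Z
  proof -
    note Z' = zero_object_Ob [OF Z]
    have "Ident A Z = Zero A Z Z" using from_zero [OF Z, of "Ident A Z"] Z' by simp
    then have c: "weq (Zero A X Z \<cdot> Zero A Z X)" using weq_Ident [OF Z'] Z' X by simp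
    have "weq (Zero A Z X) \<longleftrightarrow> weq (Zero A X Z)"
      using weq_cancel_left [OF _ c] weq_cancel_right [OF _ c] Z' X by auto
    also have "\<dots> \<longleftrightarrow> Zero A X Z \<in> tfib"
      using epic_weq_tfib tfib_weq kernel_to_zero(2) [OF Z X] by blast
    also have "\<dots> \<longleftrightarrow> X \<in> W"
      using tfib_kernel [OF _ kernel_to_zero(1) [OF Z X]] kernel_to_zero [OF Z X] X
      unfolding epics_with_kernel_in_def by auto
    finally show ?thesis .
  qed
  then have "(\<exists>f \<in> Hom A Z X. weq f) \<longleftrightarrow> X \<in> W" if "zero_object A Z" "X \<in> Ob A" for X Z
    using from_zero [OF that(1)] zero_object_Ob [OF that(1)] that
    by (metis (no_types, lifting) Hom_iff Zero_simps)
  then show ?thesis unfolding trivial_objects_def stable_model_simps using zero_ex by auto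
qed

theorem projective_model_structure_exists:
  "\<exists>S. projective_model_structure A S \<and> Hovey_triple_of A S = (C, W, Ob A) \<and>
     hereditary_Hovey_triple A (Hovey_triple_of A S)"
proof (intro exI conjI)
  show H: "Hovey_triple_of A stable_model = (C, W, Ob A)"
    unfolding Hovey_triple_of_def cofibrant trivial fibrant ..
  have WO: "W \<inter> Ob A = W" "Ob A \<inter> W = W" by auto
  have "abelian_model_structure A stable_model"
    unfolding abelian_model_structure_def cofibrant trivial fibrant stable_model_simps cof_Int_weq epic_Int_weq WO
    using abelian model_structure epics_with_kernel_Ob by auto
  moreover have "projective_cotorsion_pair A C W"
    unfolding projective_cotorsion_pair_def using enough complete Proj_eq thick by simp
  ultimately show "projective_model_structure A stable_model"
    unfolding projective_model_structure_def using H by blast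
  have "hereditary A C W" by (rule hereditaryI [OF enough thick_cokernel [OF thick]])
  moreover have "hereditary A (Proj A) (Ob A)" by (rule triv.hereditaryI [OF enough]) (auto dest: short_exactD)
  ultimately show "hereditary_Hovey_triple A (Hovey_triple_of A stable_model)"
    unfolding H hereditary_Hovey_triple_def Hovey_triple_def
    using thick complete Proj_complete [OF enough] by (simp add: Proj_eq WO)
qed

end

section \<open>Functor categories are abelian\<close>

text \<open>
  Functors from the opposite index category to \<open>op_cat A\<close> are the functors to \<open>A\<close>, and natural
  transformations are reversed; this turns statements on pointwise kernels into ones on cokernels.
\<close>

definition op_index :: "('a, 'b) precat \<Rightarrow> ('a, 'b) precat" where
  "op_index J = \<lparr>Ob = Ob J, Ar = Ar J, Dom = Cod J, Cod = Dom J, Ident = Ident J, Comp = (\<lambda>g f. Comp J f g)\<rparr>"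

lemma op_index_simps [simp]:
  "Ob (op_index J) = Ob J" "Ar (op_index J) = Ar J" "Dom (op_index J) = Cod J" "Cod (op_index J) = Dom J"
  "Ident (op_index J) = Ident J" "Comp (op_index J) g f = Comp J f g"
  by (simp_all add: op_index_def)

lemma is_functor_op: "is_functor (op_index J) (op_cat A) F \<longleftrightarrow> is_functor J A F"
  unfolding is_functor_def by (simp add: eq_commute [of "Dom J _" "Cod J _"]) blast

lemma is_nat_trans_op: "is_nat_trans (op_index J) (op_cat A) G \<tau> F \<longleftrightarrow> is_nat_trans J A F \<tau> G"
  unfolding is_nat_trans_def by (auto simp: is_functor_op)

lemma category_op_index: assumes "category J" shows "category (op_index J)"
proof -
  have a: "\<And>f. f \<in> Ar J \<Longrightarrow> Dom J f \<in> Ob J \<and> Cod J f \<in> Ob J"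
    "\<And>X. X \<in> Ob J \<Longrightarrow> Ident J X \<in> Ar J \<and> Dom J (Ident J X) = X \<and> Cod J (Ident J X) = X"
    "\<And>f g. f \<in> Ar J \<Longrightarrow> g \<in> Ar J \<Longrightarrow> Cod J f = Dom J g \<Longrightarrow> 
       g \<cdot>\<^bsub>J\<^esub> f \<in> Ar J \<and> Dom J (g \<cdot>\<^bsub>J\<^esub> f) = Dom J f \<and> Cod J (g \<cdot>\<^bsub>J\<^esub> f) = Cod J g"
    "\<And>f. f \<in> Ar J \<Longrightarrow> f \<cdot>\<^bsub>J\<^esub> Ident J (Dom J f) = f \<and> Ident J (Cod J f) \<cdot>\<^bsub>J\<^esub> f = f"
    "\<And>f g h. f \<in> Ar J \<Longrightarrow> g \<in> Ar J \<Longrightarrow> h \<in> Ar J \<Longrightarrow> Cod J f = Dom J g \<Longrightarrow> Cod J g = Dom J h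
      \<Longrightarrow> h \<cdot>\<^bsub>J\<^esub> (g \<cdot>\<^bsub>J\<^esub> f) = (h \<cdot>\<^bsub>J\<^esub> g) \<cdot>\<^bsub>J\<^esub> f"
    using assms unfolding category_def Hom_iff by auto
  show ?thesis
    unfolding category_def by (auto simp: a Hom_iff)
qed

locale functor_cat = abelian A for A :: "('o, 'm) preadd" (structure) + 
  fixes J :: "('a, 'b) precat"
  assumes J: "category J"
begin

abbreviation R where "R \<equiv> functor_category J A"

lemma op: "functor_cat (op_cat A) (op_index J)"
  by (intro functor_cat.intro functor_cat_axioms.intro abelian_op category_op_index J) unfold_locales

lemma J_simps [simp]:
  "\<phi> \<in> Ar J \<Longrightarrow> Dom J \<phi> \<in> Ob J" "\<phi> \<in> Ar J \<Longrightarrow> Cod J \<phi> \<in> Ob J"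
  "j \<in> Ob J \<Longrightarrow> Ident J j \<in> Ar J" "j \<in> Ob J \<Longrightarrow> Dom J (Ident J j) = j" "j \<in> Ob J \<Longrightarrow> Cod J (Ident J j) = j"
  "\<phi> \<in> Ar J \<Longrightarrow> \<psi> \<in> Ar J \<Longrightarrow> Cod J \<phi> = Dom J \<psi> \<Longrightarrow> \<psi> \<cdot>\<^bsub>J\<^esub> \<phi> \<in> Ar J"
  "\<phi> \<in> Ar J \<Longrightarrow> \<psi> \<in> Ar J \<Longrightarrow> Cod J \<phi> = Dom J \<psi> \<Longrightarrow> Dom J (\<psi> \<cdot>\<^bsub>J\<^esub> \<phi>) = Dom J \<phi>"
  "\<phi> \<in> Ar J \<Longrightarrow> \<psi> \<in> Ar J \<Longrightarrow> Cod J \<phi> = Dom J \<psi> \<Longrightarrow> Cod J (\<psi> \<cdot>\<^bsub>J\<^esub> \<phi>) = Cod J \<psi>"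
  using J unfolding category_def Hom_iff by auto

lemma functor_simps [simp]:
  assumes "is_functor J A F"
  shows "j \<in> Ob J \<Longrightarrow> obj_map F j \<in> Ob A" 
    "\<phi> \<in> Ar J \<Longrightarrow> arr_map F \<phi> \<in> Ar A"
    "\<phi> \<in> Ar J \<Longrightarrow> Dom A (arr_map F \<phi>) = obj_map F (Dom J \<phi>)"
    "\<phi> \<in> Ar J \<Longrightarrow> Cod A (arr_map F \<phi>) = obj_map F (Cod J \<phi>)"
    "j \<in> Ob J \<Longrightarrow> arr_map F (Ident J j) = Ident A (obj_map F j)"
    "\<phi> \<in> Ar J \<Longrightarrow> \<psi> \<in> Ar J \<Longrightarrow> Cod J \<phi> = Dom J \<psi> \<Longrightarrow> arr_map F (\<psi> \<cdot>\<^bsub>J\<^esub> \<phi>) = arr_map F \<psi> \<cdot> arr_map F \<phi>"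
  using assms unfolding is_functor_def by (auto simp: Hom_iff)

definition mk_functor where
  "mk_functor ob ar = \<lparr>obj_map = restrict ob (Ob J), arr_map = restrict ar (Ar J)\<rparr>"

lemma mk_functor_simps [simp]:
  "j \<in> Ob J \<Longrightarrow> obj_map (mk_functor ob ar) j = ob j" "\<phi> \<in> Ar J \<Longrightarrow> arr_map (mk_functor ob ar) \<phi> = ar \<phi>"
  by (auto simp: mk_functor_def)

lemma mk_functor:
  assumes "\<And>j. j \<in> Ob J \<Longrightarrow> ob j \<in> Ob A"
    and "\<And>\<phi>. \<phi> \<in> Ar J \<Longrightarrow> ar \<phi> \<in> Ar A \<and> Dom A (ar \<phi>) = ob (Dom J \<phi>) \<and> Cod A (ar \<phi>) = ob (Cod J \<phi>)"
    and "\<And>j. j \<in> Ob J \<Longrightarrow> ar (Ident J j) = Ident A (ob j)"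
    and "\<And>\<phi> \<psi>. \<phi> \<in> Ar J \<Longrightarrow> \<psi> \<in> Ar J \<Longrightarrow> Cod J \<phi> = Dom J \<psi> \<Longrightarrow> ar (\<psi> \<cdot>\<^bsub>J\<^esub> \<phi>) = ar \<psi> \<cdot> ar \<phi>"
  shows "is_functor J A (mk_functor ob ar)"
  unfolding is_functor_def using assms by (auto simp: mk_functor_def Hom_iff)

definition cpt where "cpt f j = fst (snd f) j"

definition mk_nat where "mk_nat F \<tau> G = (F, restrict \<tau> (Ob J), G)"

lemma Ob_R [simp]: "F \<in> Ob R \<longleftrightarrow> is_functor J A F"
  by (simp add: functor_category_def)

lemma mk_nat_simps [simp]:
  "Dom R (mk_nat F \<tau> G) = F" "Cod R (mk_nat F \<tau> G) = G" "j \<in> Ob J \<Longrightarrow> cpt (mk_nat F \<tau> G) j = \<tau> j"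
  by (auto simp: mk_nat_def functor_category_def cpt_def)

lemma Ar_R: "f \<in> Ar R \<longleftrightarrow> is_nat_trans J A (Dom R f) (cpt f) (Cod R f)"
  by (cases f) (simp add: functor_category_def cpt_def [abs_def])

lemma is_nat_trans_cong:
  "is_nat_trans J A F (restrict \<tau> (Ob J)) G \<longleftrightarrow> is_functor J A F \<and> is_functor J A G \<and>
     (\<forall>j \<in> Ob J. \<tau> j \<in> Ar A \<and> Dom A (\<tau> j) = obj_map F j \<and> Cod A (\<tau> j) = obj_map G j) \<and>
     (\<forall>\<phi> \<in> Ar J. \<tau> (Cod J \<phi>) \<cdot> arr_map F \<phi> = arr_map G \<phi> \<cdot> \<tau> (Dom J \<phi>))"
  unfolding is_nat_trans_def by (auto simp: Hom_iff)

lemma mk_nat_Ar: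
  assumes "is_functor J A F" "is_functor J A G"
    and "\<And>j. j \<in> Ob J \<Longrightarrow> \<tau> j \<in> Ar A \<and> Dom A (\<tau> j) = obj_map F j \<and> Cod A (\<tau> j) = obj_map G j"
    and "\<And>\<phi>. \<phi> \<in> Ar J \<Longrightarrow> \<tau> (Cod J \<phi>) \<cdot> arr_map F \<phi> = arr_map G \<phi> \<cdot> \<tau> (Dom J \<phi>)"
  shows "mk_nat F \<tau> G \<in> Ar R"
proof -
  have "is_nat_trans J A F (restrict \<tau> (Ob J)) G" unfolding is_nat_trans_cong using assms by blast
  then show ?thesis by (simp add: mk_nat_def functor_category_def)
qed

lemma Ar_simps [simp]:
  assumes "f \<in> Ar R"
  shows "is_functor J A (Dom R f)" "is_functor J A (Cod R f)"
    "j \<in> Ob J \<Longrightarrow> cpt f j \<in> Ar A" "j \<in> Ob J \<Longrightarrow> Dom A (cpt f j) = obj_map (Dom R f) j" 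
    "j \<in> Ob J \<Longrightarrow> Cod A (cpt f j) = obj_map (Cod R f) j"
  using assms unfolding Ar_R is_nat_trans_def by (auto simp: Hom_iff)

lemma natural:
  assumes "f \<in> Ar R" "\<phi> \<in> Ar J"
  shows "cpt f (Cod J \<phi>) \<cdot> arr_map (Dom R f) \<phi> = arr_map (Cod R f) \<phi> \<cdot> cpt f (Dom J \<phi>)"
  using assms unfolding Ar_R is_nat_trans_def by auto

lemma Ar_eqI:
  assumes "f \<in> Ar R" "g \<in> Ar R" "Dom R f = Dom R g" "Cod R f = Cod R g" "\<And>j. j \<in> Ob J \<Longrightarrow> cpt f j = cpt g j"
  shows "f = g"
proof -
  have "cpt f = cpt g"
    using assms unfolding Ar_R is_nat_trans_def by (auto intro!: extensionalityI)
  then show ?thesis using assms(3,4)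
    by (cases f, cases g) (simp add: functor_category_def cpt_def [abs_def])
qed

lemma Comp_R: "g \<cdot>\<^bsub>R\<^esub> f = mk_nat (Dom R f) (\<lambda>j. cpt g j \<cdot> cpt f j) (Cod R g)"
  and Plus_R: "f \<oplus>\<^bsub>R\<^esub> g = mk_nat (Dom R f) (\<lambda>j. cpt f j \<oplus> cpt g j) (Cod R f)"
  by (cases f; cases g; simp add: functor_category_def cpt_def [abs_def] mk_nat_def)+

lemma Zero_R: "Zero R F G = mk_nat F (\<lambda>j. Zero A (obj_map F j) (obj_map G j)) G"
  and Ident_R: "Ident R F = mk_nat F (\<lambda>j. Ident A (obj_map F j)) F"
  by (simp_all add: functor_category_def mk_nat_def)

lemma R_comp_simps [simp]:
  assumes "f \<in> Ar R" "g \<in> Ar R" "Cod R f = Dom R g"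
  shows "g \<cdot>\<^bsub>R\<^esub> f \<in> Ar R" "Dom R (g \<cdot>\<^bsub>R\<^esub> f) = Dom R f" "Cod R (g \<cdot>\<^bsub>R\<^esub> f) = Cod R g"
    "j \<in> Ob J \<Longrightarrow> cpt (g \<cdot>\<^bsub>R\<^esub> f) j = cpt g j \<cdot> cpt f j"
proof -
  have "(cpt g (Cod J \<phi>) \<cdot> cpt f (Cod J \<phi>)) \<cdot> arr_map (Dom R f) \<phi> = arr_map (Cod R g) \<phi> \<cdot> (cpt g (Dom J \<phi>) \<cdot> cpt f (Dom J \<phi>))"
    if "\<phi> \<in> Ar J" for \<phi>
    using that assms natural [OF assms(1) that] reassoc [OF natural [OF assms(2) that], of "cpt f (Dom J \<phi>)"] by simp
  then show "g \<cdot>\<^bsub>R\<^esub> f \<in> Ar R" unfolding Comp_R using assms by (intro mk_nat_Ar) auto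
qed (simp_all add: Comp_R)

lemma R_Plus_simps [simp]:
  assumes "f \<in> Ar R" "g \<in> Ar R" "Dom R f = Dom R g" "Cod R f = Cod R g"
  shows "f \<oplus>\<^bsub>R\<^esub> g \<in> Ar R" "Dom R (f \<oplus>\<^bsub>R\<^esub> g) = Dom R g" "Cod R (f \<oplus>\<^bsub>R\<^esub> g) = Cod R g"
    "j \<in> Ob J \<Longrightarrow> cpt (f \<oplus>\<^bsub>R\<^esub> g) j = cpt f j \<oplus> cpt g j"
proof -
  show "f \<oplus>\<^bsub>R\<^esub> g \<in> Ar R" unfolding Plus_R using assms natural [OF assms(1)] natural [OF assms(2)] 
    by (intro mk_nat_Ar) (auto simp: additive)
qed (use assms in \<open>simp_all add: Plus_R\<close>)

lemma R_Zero_simps [simp]: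
  assumes "is_functor J A F" "is_functor J A G"
  shows "Zero R F G \<in> Ar R" "Dom R (Zero R F G) = F" "Cod R (Zero R F G) = G"
    "j \<in> Ob J \<Longrightarrow> cpt (Zero R F G) j = Zero A (obj_map F j) (obj_map G j)"
proof -
  show "Zero R F G \<in> Ar R" unfolding Zero_R using assms by (intro mk_nat_Ar) auto
qed (use assms in \<open>simp_all add: Zero_R\<close>)

lemma R_Ident_simps [simp]:
  assumes "is_functor J A F"
  shows "Ident R F \<in> Ar R" "Dom R (Ident R F) = F" "Cod R (Ident R F) = F"
    "j \<in> Ob J \<Longrightarrow> cpt (Ident R F) j = Ident A (obj_map F j)"
proof -
  show "Ident R F \<in> Ar R" unfolding Ident_R using assms by (intro mk_nat_Ar) auto
qed (use assms in \<open>simp_all add: Ident_R\<close>)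

lemma category_R: "category R"
  unfolding category_def by (auto simp: Hom_iff intro!: Ar_eqI)

lemma preadditive_R: "preadditive_category R"
  unfolding preadditive_category_def
proof (intro conjI ballI category_R)
  fix X Y assume "X \<in> Ob R" "Y \<in> Ob R"
  then have XY: "is_functor J A X" "is_functor J A Y" by auto
  show "comm_group (Hom_group R X Y)"
  proof (rule comm_groupI)
    fix f assume "f \<in> carrier (Hom_group R X Y)"
    then have f: "f \<in> Ar R" "Dom R f = X" "Cod R f = Y" by (auto simp: Hom_group_def Hom_iff)
    define g where "g = mk_nat X (\<lambda>j. Zero A (obj_map X j) (obj_map Y j) \<ominus> cpt f j) Y"
    have g: "g \<in> Ar R" "Dom R g = X" "Cod R g = Y" unfolding g_def using XY f natural [OF f(1)]
      by (auto intro!: mk_nat_Ar simp: additive)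
    have "g \<oplus>\<^bsub>R\<^esub> f = Zero R X Y" 
      by (rule Ar_eqI) (use f g XY in \<open>simp_all add: g_def\<close>)
    then show "\<exists>g \<in> carrier (Hom_group R X Y). g \<otimes>\<^bsub>Hom_group R X Y\<^esub> f = \<one>\<^bsub>Hom_group R X Y\<^esub>"
      using g by (intro bexI [of _ g]) (auto simp: Hom_group_def Hom_iff)
  next
    fix f g assume "f \<in> carrier (Hom_group R X Y)" "g \<in> carrier (Hom_group R X Y)"
    then have fg: "f \<in> Ar R" "Dom R f = X" "Cod R f = Y" "g \<in> Ar R" "Dom R g = X" "Cod R g = Y"
      by (auto simp: Hom_group_def Hom_iff)
    have "f \<oplus>\<^bsub>R\<^esub> g = g \<oplus>\<^bsub>R\<^esub> f" by (rule Ar_eqI) (use fg in \<open>simp_all add: Plus_comm\<close>)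
    then show "f \<otimes>\<^bsub>Hom_group R X Y\<^esub> g = g \<otimes>\<^bsub>Hom_group R X Y\<^esub> f" by (simp add: Hom_group_def)
  next
    fix f g h assume "f \<in> carrier (Hom_group R X Y)" "g \<in> carrier (Hom_group R X Y)" "h \<in> carrier (Hom_group R X Y)"
    then have fg: "f \<in> Ar R" "Dom R f = X" "Cod R f = Y" "g \<in> Ar R" "Dom R g = X" "Cod R g = Y" 
      "h \<in> Ar R" "Dom R h = X" "Cod R h = Y"
      by (auto simp: Hom_group_def Hom_iff)
    have "(f \<oplus>\<^bsub>R\<^esub> g) \<oplus>\<^bsub>R\<^esub> h = f \<oplus>\<^bsub>R\<^esub> (g \<oplus>\<^bsub>R\<^esub> h)" by (rule Ar_eqI) (use fg in \<open>simp_all add: Plus_assoc\<close>)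
    then show "(f \<otimes>\<^bsub>Hom_group R X Y\<^esub> g) \<otimes>\<^bsub>Hom_group R X Y\<^esub> h = f \<otimes>\<^bsub>Hom_group R X Y\<^esub> (g \<otimes>\<^bsub>Hom_group R X Y\<^esub> h)"
      by (simp add: Hom_group_def)
  next
    fix f assume "f \<in> carrier (Hom_group R X Y)"
    then have f: "f \<in> Ar R" "Dom R f = X" "Cod R f = Y" by (auto simp: Hom_group_def Hom_iff)
    have "Zero R X Y \<oplus>\<^bsub>R\<^esub> f = f" by (rule Ar_eqI) (use f XY in simp_all)
    then show "\<one>\<^bsub>Hom_group R X Y\<^esub> \<otimes>\<^bsub>Hom_group R X Y\<^esub> f = f" by (simp add: Hom_group_def)
  qed (use XY in \<open>auto simp: Hom_group_def Hom_iff\<close>)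
next
  fix X Y Z f f' g g' assume "f \<in> Hom R X Y" "f' \<in> Hom R X Y" "g \<in> Hom R Y Z" "g' \<in> Hom R Y Z"
  then show "g \<cdot>\<^bsub>R\<^esub> (f \<oplus>\<^bsub>R\<^esub> f') = (g \<cdot>\<^bsub>R\<^esub> f) \<oplus>\<^bsub>R\<^esub> (g \<cdot>\<^bsub>R\<^esub> f')"
     "(g \<oplus>\<^bsub>R\<^esub> g') \<cdot>\<^bsub>R\<^esub> f = (g \<cdot>\<^bsub>R\<^esub> f) \<oplus>\<^bsub>R\<^esub> (g' \<cdot>\<^bsub>R\<^esub> f)"
    by (auto simp: Hom_iff additive intro!: Ar_eqI)
qed

lemma zero_object_R:
  assumes Z: "is_functor J A Z" "\<And>j. j \<in> Ob J \<Longrightarrow> zero_object A (obj_map Z j)"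
  shows "zero_object R Z"
  unfolding zero_object_def
proof (intro conjI ballI)
  fix X assume "X \<in> Ob R"
  then have X: "is_functor J A X" by simp
  show "\<exists>!f. f \<in> Hom R Z X"
  proof (rule ex1I [of _ "Zero R Z X"])
    fix f assume "f \<in> Hom R Z X"
    then have f: "f \<in> Ar R" "Dom R f = Z" "Cod R f = X" by (auto simp: Hom_iff)
    show "f = Zero R Z X"
    proof (rule Ar_eqI)
      fix j assume j: "j \<in> Ob J"
      show "cpt f j = cpt (Zero R Z X) j" using from_zero [OF Z(2) [OF j], of "cpt f j"] f X Z j by simp
    qed (use X Z f in auto)
  qed (use X Z in \<open>simp add: Hom_iff\<close>)
  show "\<exists>!f. f \<in> Hom R X Z"
  proof (rule ex1I [of _ "Zero R X Z"])
    fix f assume "f \<in> Hom R X Z"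
    then have f: "f \<in> Ar R" "Dom R f = X" "Cod R f = Z" by (auto simp: Hom_iff)
    show "f = Zero R X Z"
    proof (rule Ar_eqI)
      fix j assume j: "j \<in> Ob J"
      show "cpt f j = cpt (Zero R X Z) j" using to_zero [OF Z(2) [OF j], of "cpt f j"] f X Z j by simp
    qed (use X Z f in auto)
  qed (use X Z in \<open>simp add: Hom_iff\<close>)
qed (use Z in simp)

lemma zero_functor_ex: "\<exists>Z. is_functor J A Z \<and> (\<forall>j \<in> Ob J. zero_object A (obj_map Z j))"
proof -
  obtain Z where Z: "zero_object A Z" using zero_ex by blast
  note Z' = zero_object_Ob [OF Z]
  have "is_functor J A (mk_functor (\<lambda>j. Z) (\<lambda>\<phi>. Ident A Z))"
    by (rule mk_functor) (use Z' in auto)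
  then show ?thesis using Z by (intro exI [of _ "mk_functor (\<lambda>j. Z) (\<lambda>\<phi>. Ident A Z)"]) simp
qed

lemma biproduct_R:
  assumes X: "is_functor J A X" and Y: "is_functor J A Y"
  shows "\<exists>S i j p q. is_biproduct R X Y S i j p q"
proof -
  have "\<forall>v \<in> Ob J. \<exists>S i j p q. is_biproduct A (obj_map X v) (obj_map Y v) S i j p q"
    using biproduct_ex X Y by simp
  then obtain S i j p q where b: "\<And>v. v \<in> Ob J \<Longrightarrow> is_biproduct A (obj_map X v) (obj_map Y v) (S v) (i v) (j v) (p v) (q v)"
    by metis
  note b' = biproductD [OF b]
  have "\<exists>s. s \<in> Ar A \<and> Dom A s = S (Dom J \<phi>) \<and> Cod A s = S (Cod J \<phi>) \<and>
     s \<cdot> i (Dom J \<phi>) = i (Cod J \<phi>) \<cdot> arr_map X \<phi> \<and> s \<cdot> j (Dom J \<phi>) = j (Cod J \<phi>) \<cdot> arr_map Y \<phi>"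
    if \<phi>: "\<phi> \<in> Ar J" for \<phi>
    using biproduct_copair [OF b, of "Dom J \<phi>" "i (Cod J \<phi>) \<cdot> arr_map X \<phi>" "j (Cod J \<phi>) \<cdot> arr_map Y \<phi>"] \<phi> X Y b' [of "Cod J \<phi>"]
    by auto
  then obtain s where s: "\<And>\<phi>. \<phi> \<in> Ar J \<Longrightarrow> s \<phi> \<in> Ar A \<and> Dom A (s \<phi>) = S (Dom J \<phi>) \<and> Cod A (s \<phi>) = S (Cod J \<phi>)"
     "\<And>\<phi>. \<phi> \<in> Ar J \<Longrightarrow> s \<phi> \<cdot> i (Dom J \<phi>) = i (Cod J \<phi>) \<cdot> arr_map X \<phi>" 
     "\<And>\<phi>. \<phi> \<in> Ar J \<Longrightarrow> s \<phi> \<cdot> j (Dom J \<phi>) = j (Cod J \<phi>) \<cdot> arr_map Y \<phi>"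
    by metis
  define T where "T = mk_functor S s"
  have T: "is_functor J A T"
    unfolding T_def
  proof (rule mk_functor)
    show "S v \<in> Ob A" if "v \<in> Ob J" for v using b' that by auto
    show "s (Ident J v) = Ident A (S v)" if v: "v \<in> Ob J" for v
      by (rule biproduct_ext [OF b [OF v]]) (use v b' [OF v] X Y s [of "Ident J v"] in simp_all)
    show "s (\<psi> \<cdot>\<^bsub>J\<^esub> \<phi>) = s \<psi> \<cdot> s \<phi>" if \<phi>: "\<phi> \<in> Ar J" "\<psi> \<in> Ar J" "Cod J \<phi> = Dom J \<psi>" for \<phi> \<psi>
    proof (rule biproduct_ext [OF b [OF J_simps(1) [OF \<phi>(1)]]])
      note t = s(1) [OF \<phi>(1)] s(1) [OF \<phi>(2)] s(1) [of "\<psi> \<cdot>\<^bsub>J\<^esub> \<phi>"] 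
      show "s (\<psi> \<cdot>\<^bsub>J\<^esub> \<phi>) \<in> Ar A" "s \<psi> \<cdot> s \<phi> \<in> Ar A" "Dom A (s (\<psi> \<cdot>\<^bsub>J\<^esub> \<phi>)) = S (Dom J \<phi>)" 
        "Dom A (s \<psi> \<cdot> s \<phi>) = S (Dom J \<phi>)" "Cod A (s (\<psi> \<cdot>\<^bsub>J\<^esub> \<phi>)) = Cod A (s \<psi> \<cdot> s \<phi>)"
        using t \<phi> by simp_all
      note b1 = b'(4-9) [OF J_simps(1) [OF \<phi>(1)]] b'(4-9) [OF J_simps(1) [OF \<phi>(2)]] b'(4-9) [OF J_simps(2) [OF \<phi>(2)]]
      show "s (\<psi> \<cdot>\<^bsub>J\<^esub> \<phi>) \<cdot> i (Dom J \<phi>) = (s \<psi> \<cdot> s \<phi>) \<cdot> i (Dom J \<phi>)"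
        using t b1 \<phi> X s(2) [OF \<phi>(1)] s(2) [of "\<psi> \<cdot>\<^bsub>J\<^esub> \<phi>"] reassoc [OF s(2) [OF \<phi>(2)], of "arr_map X \<phi>"] by simp
      show "s (\<psi> \<cdot>\<^bsub>J\<^esub> \<phi>) \<cdot> j (Dom J \<phi>) = (s \<psi> \<cdot> s \<phi>) \<cdot> j (Dom J \<phi>)"
        using t b1 \<phi> Y s(3) [OF \<phi>(1)] s(3) [of "\<psi> \<cdot>\<^bsub>J\<^esub> \<phi>"] reassoc [OF s(3) [OF \<phi>(2)], of "arr_map Y \<phi>"] by simp
    qed
  qed (use s in auto)
  have T_simps: "v \<in> Ob J \<Longrightarrow> obj_map T v = S v" "\<phi> \<in> Ar J \<Longrightarrow> arr_map T \<phi> = s \<phi>" for v \<phi> by (auto simp: T_def)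
  have i: "mk_nat X i T \<in> Ar R" and j: "mk_nat Y j T \<in> Ar R"
    by (rule mk_nat_Ar; use X Y T T_simps b' s in simp)+
  have p: "mk_nat T p X \<in> Ar R"
  proof (rule mk_nat_Ar)
    fix \<phi> assume \<phi>: "\<phi> \<in> Ar J"
    note t = s [OF \<phi>] b' [OF J_simps(1) [OF \<phi>]] b' [OF J_simps(2) [OF \<phi>]]
    show "p (Cod J \<phi>) \<cdot> arr_map T \<phi> = arr_map X \<phi> \<cdot> p (Dom J \<phi>)"
      by (rule biproduct_ext [OF b [OF J_simps(1) [OF \<phi>]]])
        (use \<phi> T_simps t X Y reassoc [OF t(19), of "arr_map X \<phi>"] reassoc [OF b'(16) [OF J_simps(2) [OF \<phi>]], of "arr_map X \<phi>"]
           reassoc [OF b'(19) [OF J_simps(2) [OF \<phi>]], of "arr_map Y \<phi>"] in simp_all)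
  qed (use X Y T T_simps b' in simp_all)
  have q: "mk_nat T q Y \<in> Ar R"
  proof (rule mk_nat_Ar)
    fix \<phi> assume \<phi>: "\<phi> \<in> Ar J"
    note t = s [OF \<phi>] b' [OF J_simps(1) [OF \<phi>]] b' [OF J_simps(2) [OF \<phi>]]
    show "q (Cod J \<phi>) \<cdot> arr_map T \<phi> = arr_map Y \<phi> \<cdot> q (Dom J \<phi>)"
      by (rule biproduct_ext [OF b [OF J_simps(1) [OF \<phi>]]])
        (use \<phi> T_simps t X Y reassoc [OF b'(17) [OF J_simps(2) [OF \<phi>]], of "arr_map Y \<phi>"]
           reassoc [OF b'(18) [OF J_simps(2) [OF \<phi>]], of "arr_map X \<phi>"] in simp_all)
  qed (use X Y T T_simps b' in simp_all)
  have "is_biproduct R X Y T (mk_nat X i T) (mk_nat Y j T) (mk_nat T p X) (mk_nat T q Y)"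
    unfolding is_biproduct_def Hom_iff using X Y T i j p q b' T_simps
    by (auto intro!: Ar_eqI)
  then show ?thesis by blast
qed

text \<open>
  Chosen kernels at the single objects become a functor through the maps induced between them.
\<close>

lemma nat_trans_kernel:
  assumes f: "is_nat_trans J A F \<tau> G"
  shows "\<exists>K \<kappa>. is_nat_trans J A K \<kappa> F \<and> (\<forall>j \<in> Ob J. is_kernel A (\<kappa> j) (\<tau> j))"
proof -
  have F: "is_functor J A F" "is_functor J A G" 
    and \<tau>: "\<And>j. j \<in> Ob J \<Longrightarrow> \<tau> j \<in> Ar A \<and> Dom A (\<tau> j) = obj_map F j \<and> Cod A (\<tau> j) = obj_map G j"
      "\<And>\<phi>. \<phi> \<in> Ar J \<Longrightarrow> \<tau> (Cod J \<phi>) \<cdot> arr_map F \<phi> = arr_map G \<phi> \<cdot> \<tau> (Dom J \<phi>)"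
    using f unfolding is_nat_trans_def Hom_iff by auto
  have "\<forall>j \<in> Ob J. \<exists>k. is_kernel A k (\<tau> j)" using \<tau> kernel_ex by blast
  then obtain k where k: "\<And>j. j \<in> Ob J \<Longrightarrow> is_kernel A (k j) (\<tau> j)" by metis
  note k' = kernelD [OF k]
  have km: "monic A (k j)" if "j \<in> Ob J" for j using kernel_monic k that by blast
  have "\<exists>u. u \<in> Ar A \<and> Dom A u = Dom A (k (Dom J \<phi>)) \<and> Cod A u = Dom A (k (Cod J \<phi>)) \<and>
      k (Cod J \<phi>) \<cdot> u = arr_map F \<phi> \<cdot> k (Dom J \<phi>)" if \<phi>: "\<phi> \<in> Ar J" for \<phi>
  proof -
    note t = \<tau>(1) [OF J_simps(1) [OF \<phi>]] \<tau>(1) [OF J_simps(2) [OF \<phi>]] k' [OF J_simps(1) [OF \<phi>]] k' [OF J_simps(2) [OF \<phi>]] 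
    have "\<tau> (Cod J \<phi>) \<cdot> (arr_map F \<phi> \<cdot> k (Dom J \<phi>)) = Zero A (Dom A (k (Dom J \<phi>))) (Cod A (\<tau> (Cod J \<phi>)))"
      using reassoc [OF \<tau>(2) [OF \<phi>], of "k (Dom J \<phi>)"] t \<phi> F by simp
    then show ?thesis
      using kernel_lift [OF k [OF J_simps(2) [OF \<phi>]], of "arr_map F \<phi> \<cdot> k (Dom J \<phi>)" "Dom A (k (Dom J \<phi>))"] t \<phi> F by simp metis
  qed
  then obtain s where s: "\<And>\<phi>. \<phi> \<in> Ar J \<Longrightarrow> s \<phi> \<in> Ar A \<and> Dom A (s \<phi>) = Dom A (k (Dom J \<phi>)) \<and> Cod A (s \<phi>) = Dom A (k (Cod J \<phi>))"
      "\<And>\<phi>. \<phi> \<in> Ar J \<Longrightarrow> k (Cod J \<phi>) \<cdot> s \<phi> = arr_map F \<phi> \<cdot> k (Dom J \<phi>)" by metis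
  define K where "K = mk_functor (\<lambda>j. Dom A (k j)) s"
  have K: "is_functor J A K"
    unfolding K_def
  proof (rule mk_functor)
    show "Dom A (k j) \<in> Ob A" if "j \<in> Ob J" for j using k' that by auto
    show "s (Ident J j) = Ident A (Dom A (k j))" if j: "j \<in> Ob J" for j
      by (rule monicD [OF km [OF j]]) (use j s [of "Ident J j"] k' [OF j] \<tau>(1) [OF j] F in simp_all)
    show "s (\<psi> \<cdot>\<^bsub>J\<^esub> \<phi>) = s \<psi> \<cdot> s \<phi>" if \<phi>: "\<phi> \<in> Ar J" "\<psi> \<in> Ar J" "Cod J \<phi> = Dom J \<psi>" for \<phi> \<psi>
      by (rule monicD [OF km [OF J_simps(2) [OF \<phi>(2)]]])
        (use \<phi> s [OF \<phi>(1)] s [OF \<phi>(2)] s [of "\<psi> \<cdot>\<^bsub>J\<^esub> \<phi>"] k' [OF J_simps(2) [OF \<phi>(2)]] \<tau>(1) [OF J_simps(2) [OF \<phi>(2)]]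
          k' [OF J_simps(1) [OF \<phi>(1)]] \<tau>(1) [OF J_simps(1) [OF \<phi>(1)]] k' [OF J_simps(1) [OF \<phi>(2)]] \<tau>(1) [OF J_simps(1) [OF \<phi>(2)]]
          F reassoc [OF s(2) [OF \<phi>(2)], of "s \<phi>"] in simp_all)
  qed (use s in auto)
  have "is_nat_trans J A K (restrict k (Ob J)) F"
    unfolding is_nat_trans_cong using K F k' \<tau> s by (auto simp: K_def)
  then show ?thesis using k by (intro exI [of _ K] exI [of _ "restrict k (Ob J)"]) simp
qed

lemma nat_trans_cokernel:
  assumes f: "is_nat_trans J A F \<tau> G"
  shows "\<exists>K \<kappa>. is_nat_trans J A G \<kappa> K \<and> (\<forall>j \<in> Ob J. is_cokernel A (\<kappa> j) (\<tau> j))"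
proof -
  interpret op: functor_cat "op_cat A" "op_index J" by (rule op)
  show ?thesis using op.nat_trans_kernel [of G \<tau> F] f by (simp add: is_nat_trans_op)
qed

lemma kernel_R_ex:
  assumes f: "f \<in> Ar R"
  shows "\<exists>k \<in> Ar R. Cod R k = Dom R f \<and> (\<forall>j \<in> Ob J. is_kernel A (cpt k j) (cpt f j))"
proof -
  obtain K \<kappa> where k: "is_nat_trans J A K \<kappa> (Dom R f)" "\<forall>j \<in> Ob J. is_kernel A (\<kappa> j) (cpt f j)"
    using nat_trans_kernel f unfolding Ar_R by blast
  then have "(K, \<kappa>, Dom R f) \<in> Ar R" by (simp add: functor_category_def)
  with k show ?thesis by (intro bexI [of _ "(K, \<kappa>, Dom R f)"]) (simp_all add: functor_category_def cpt_def)
qed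

lemma cokernel_R_ex:
  assumes f: "f \<in> Ar R"
  shows "\<exists>p \<in> Ar R. Dom R p = Cod R f \<and> (\<forall>j \<in> Ob J. is_cokernel A (cpt p j) (cpt f j))"
proof -
  obtain K \<kappa> where k: "is_nat_trans J A (Cod R f) \<kappa> K" "\<forall>j \<in> Ob J. is_cokernel A (\<kappa> j) (cpt f j)"
    using nat_trans_cokernel f unfolding Ar_R by blast
  then have "(Cod R f, \<kappa>, K) \<in> Ar R" by (simp add: functor_category_def)
  with k show ?thesis by (intro bexI [of _ "(Cod R f, \<kappa>, K)"]) (simp_all add: functor_category_def cpt_def)
qed

lemma is_kernel_R:
  assumes k: "k \<in> Ar R" "f \<in> Ar R" "Cod R k = Dom R f" "\<And>j. j \<in> Ob J \<Longrightarrow> is_kernel A (cpt k j) (cpt f j)"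
  shows "is_kernel R k f"
  unfolding is_kernel_def
proof (intro conjI ballI impI k(1-3))
  note k' = kernelD [OF k(4)] and km = kernel_monic [OF k(4)]
  show "f \<cdot>\<^bsub>R\<^esub> k = Zero R (Dom R k) (Cod R f)"
    by (rule Ar_eqI) (use k k' in simp_all)
  fix h assume h: "h \<in> Ar R" and e: "Cod R h = Dom R f \<and> f \<cdot>\<^bsub>R\<^esub> h = Zero R (Dom R h) (Cod R f)"
  have "cpt f j \<cdot> cpt h j = Zero A (obj_map (Dom R h) j) (Cod A (cpt f j))" if "j \<in> Ob J" for j
    using R_comp_simps(4) [OF h k(2) conjunct1 [OF e] that] e h k that by simp
  then have "\<forall>j \<in> Ob J. \<exists>u. u \<in> Ar A \<and> Dom A u = obj_map (Dom R h) j \<and> Cod A u = Dom A (cpt k j) \<and> cpt k j \<cdot> u = cpt h j"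
    using kernel_lift [OF k(4)] h e k by (smt (verit, best) Ar_simps)
  then obtain u where u: "\<And>j. j \<in> Ob J \<Longrightarrow> u j \<in> Ar A \<and> Dom A (u j) = obj_map (Dom R h) j \<and> Cod A (u j) = obj_map (Dom R k) j"
      "\<And>j. j \<in> Ob J \<Longrightarrow> cpt k j \<cdot> u j = cpt h j" using k by simp metis
  have U: "mk_nat (Dom R h) u (Dom R k) \<in> Ar R"
  proof (rule mk_nat_Ar)
    fix \<phi> assume \<phi>: "\<phi> \<in> Ar J"
    note t = u [OF J_simps(1) [OF \<phi>]] u [OF J_simps(2) [OF \<phi>]]
    show "u (Cod J \<phi>) \<cdot> arr_map (Dom R h) \<phi> = arr_map (Dom R k) \<phi> \<cdot> u (Dom J \<phi>)"
      by (rule monicD [OF km [OF J_simps(2) [OF \<phi>]]])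
        (use t \<phi> h k e natural [OF h \<phi>] reassoc [OF natural [OF k(1) \<phi>], of "u (Dom J \<phi>)"]
          reassoc [OF u(2) [OF J_simps(2) [OF \<phi>]], of "arr_map (Dom R h) \<phi>"] in simp_all)
  qed (use h k u in simp_all)
  show "\<exists>!u. u \<in> Hom R (Dom R h) (Dom R k) \<and> k \<cdot>\<^bsub>R\<^esub> u = h"
  proof (rule ex1I [of _ "mk_nat (Dom R h) u (Dom R k)"])
    have "k \<cdot>\<^bsub>R\<^esub> mk_nat (Dom R h) u (Dom R k) = h"
      by (rule Ar_eqI) (use U h k e u in simp_all)
    then show "mk_nat (Dom R h) u (Dom R k) \<in> Hom R (Dom R h) (Dom R k) \<and> k \<cdot>\<^bsub>R\<^esub> mk_nat (Dom R h) u (Dom R k) = h"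
      using U by (simp add: Hom_iff)
    fix v assume v: "v \<in> Hom R (Dom R h) (Dom R k) \<and> k \<cdot>\<^bsub>R\<^esub> v = h"
    show "v = mk_nat (Dom R h) u (Dom R k)"
    proof (rule Ar_eqI)
      fix j assume j: "j \<in> Ob J"
      have "cpt k j \<cdot> cpt v j = cpt h j" using v k(1) j R_comp_simps(4) [of v k j] by (auto simp: Hom_iff)
      then show "cpt v j = cpt (mk_nat (Dom R h) u (Dom R k)) j" 
        using monicD [OF km [OF j], of "cpt v j" "u j"] v u [OF j] j k(1-3) by (auto simp: Hom_iff)
    qed (use v U in \<open>auto simp: Hom_iff\<close>)
  qed
qed

lemma is_cokernel_R:
  assumes k: "p \<in> Ar R" "f \<in> Ar R" "Dom R p = Cod R f" "\<And>j. j \<in> Ob J \<Longrightarrow> is_cokernel A (cpt p j) (cpt f j)"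
  shows "is_cokernel R p f"
  unfolding is_cokernel_def
proof (intro conjI ballI impI k(1-3))
  note k' = cokernelD [OF k(4)] and ke = cokernel_epic [OF k(4)]
  show "p \<cdot>\<^bsub>R\<^esub> f = Zero R (Dom R f) (Cod R p)"
    by (rule Ar_eqI) (use k k' in simp_all)
  fix h assume h: "h \<in> Ar R" and e: "Dom R h = Cod R f \<and> h \<cdot>\<^bsub>R\<^esub> f = Zero R (Dom R f) (Cod R h)"
  have "cpt h j \<cdot> cpt f j = Zero A (Dom A (cpt f j)) (obj_map (Cod R h) j)" if "j \<in> Ob J" for j
    using R_comp_simps(4) [OF k(2) h conjunct1 [OF e, symmetric] that] e h k that by simp
  then have "\<forall>j \<in> Ob J. \<exists>u. u \<in> Ar A \<and> Cod A u = obj_map (Cod R h) j \<and> Dom A u = Cod A (cpt p j) \<and> u \<cdot> cpt p j = cpt h j"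
    using cokernel_lift [OF k(4)] h e k by (smt (verit, best) Ar_simps)
  then obtain u where u: "\<And>j. j \<in> Ob J \<Longrightarrow> u j \<in> Ar A \<and> Dom A (u j) = obj_map (Cod R p) j \<and> Cod A (u j) = obj_map (Cod R h) j"
      "\<And>j. j \<in> Ob J \<Longrightarrow> u j \<cdot> cpt p j = cpt h j" using k by simp metis
  have U: "mk_nat (Cod R p) u (Cod R h) \<in> Ar R"
  proof (rule mk_nat_Ar)
    fix \<phi> assume \<phi>: "\<phi> \<in> Ar J"
    note t = u [OF J_simps(1) [OF \<phi>]] u [OF J_simps(2) [OF \<phi>]]
    show "u (Cod J \<phi>) \<cdot> arr_map (Cod R p) \<phi> = arr_map (Cod R h) \<phi> \<cdot> u (Dom J \<phi>)"
      by (rule epicD [OF ke [OF J_simps(1) [OF \<phi>]]])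
        (use t \<phi> h k e natural [OF h \<phi>] natural [OF k(1) \<phi>, symmetric]
          reassoc [OF u(2) [OF J_simps(2) [OF \<phi>]], of "arr_map (Dom R p) \<phi>"] in simp_all)
  qed (use h k u in simp_all)
  show "\<exists>!u. u \<in> Hom R (Cod R p) (Cod R h) \<and> u \<cdot>\<^bsub>R\<^esub> p = h"
  proof (rule ex1I [of _ "mk_nat (Cod R p) u (Cod R h)"])
    have "mk_nat (Cod R p) u (Cod R h) \<cdot>\<^bsub>R\<^esub> p = h"
      by (rule Ar_eqI) (use U h k e u in simp_all)
    then show "mk_nat (Cod R p) u (Cod R h) \<in> Hom R (Cod R p) (Cod R h) \<and> mk_nat (Cod R p) u (Cod R h) \<cdot>\<^bsub>R\<^esub> p = h"
      using U by (simp add: Hom_iff)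
    fix v assume v: "v \<in> Hom R (Cod R p) (Cod R h) \<and> v \<cdot>\<^bsub>R\<^esub> p = h"
    show "v = mk_nat (Cod R p) u (Cod R h)"
    proof (rule Ar_eqI)
      fix j assume j: "j \<in> Ob J"
      have "cpt v j \<cdot> cpt p j = cpt h j" using v k(1) j R_comp_simps(4) [of p v j] by (auto simp: Hom_iff)
      then show "cpt v j = cpt (mk_nat (Cod R p) u (Cod R h)) j" 
        using epicD [OF ke [OF j], of "cpt v j" "u j"] v u [OF j] j k(1-3) by (auto simp: Hom_iff)
    qed (use v U in \<open>auto simp: Hom_iff\<close>)
  qed
qed

text \<open>
  The pointwise kernel of a monomorphism is a kernel in \<open>R\<close>, hence zero.
\<close>

lemma monic_R_pointwise: assumes f: "monic R f" and j: "j \<in> Ob J" shows "monic A (cpt f j)"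
proof -
  have f': "f \<in> Ar R" using f by (simp add: monic_def)
  obtain k where k: "k \<in> Ar R" "Cod R k = Dom R f" "\<And>j. j \<in> Ob J \<Longrightarrow> is_kernel A (cpt k j) (cpt f j)"
    using kernel_R_ex [OF f'] by blast
  have "f \<cdot>\<^bsub>R\<^esub> k = f \<cdot>\<^bsub>R\<^esub> Zero R (Dom R k) (Dom R f)"
    by (rule Ar_eqI) (use f' k kernelD [OF k(3)] in simp_all)
  then have "k = Zero R (Dom R k) (Dom R f)"
    using f f' k unfolding monic_def by simp
  then have k0: "cpt k j = Zero A (obj_map (Dom R k) j) (obj_map (Dom R f) j)"
    using f' k j R_Zero_simps(4) [of "Dom R k" "Dom R f" j] by simp
  show ?thesis
  proof (rule monicI)
    show "cpt f j \<in> Ar A" using f' j by simp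
    fix h assume h: "h \<in> Ar A" "Cod A h = Dom A (cpt f j)" "cpt f j \<cdot> h = Zero A (Dom A h) (Cod A (cpt f j))"
    then obtain u where "u \<in> Ar A" "Dom A u = Dom A h" "Cod A u = Dom A (cpt k j)" "cpt k j \<cdot> u = h"
      using kernel_lift [OF k(3) [OF j]] by metis
    then show "h = Zero A (Dom A h) (Dom A (cpt f j))" using k0 f' k j by auto
  qed
qed

lemma epic_R_pointwise: assumes f: "epic R f" and j: "j \<in> Ob J" shows "epic A (cpt f j)"
proof -
  have f': "f \<in> Ar R" using f by (simp add: epic_def)
  obtain p where p: "p \<in> Ar R" "Dom R p = Cod R f" "\<And>j. j \<in> Ob J \<Longrightarrow> is_cokernel A (cpt p j) (cpt f j)"
    using cokernel_R_ex [OF f'] by blast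
  have "p \<cdot>\<^bsub>R\<^esub> f = Zero R (Cod R f) (Cod R p) \<cdot>\<^bsub>R\<^esub> f"
    by (rule Ar_eqI) (use f' p cokernelD [OF p(3)] in simp_all)
  then have "p = Zero R (Cod R f) (Cod R p)"
    using f f' p unfolding epic_def by simp
  then have p0: "cpt p j = Zero A (obj_map (Cod R f) j) (obj_map (Cod R p) j)"
    using f' p j R_Zero_simps(4) [of "Cod R f" "Cod R p" j] by simp
  show ?thesis
  proof (rule epicI)
    show "cpt f j \<in> Ar A" using f' j by simp
    fix h assume h: "h \<in> Ar A" "Dom A h = Cod A (cpt f j)" "h \<cdot> cpt f j = Zero A (Dom A (cpt f j)) (Cod A h)"
    then obtain u where "u \<in> Ar A" "Cod A u = Cod A h" "Dom A u = Cod A (cpt p j)" "u \<cdot> cpt p j = h"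
      using cokernel_lift [OF p(3) [OF j]] by metis
    then show "h = Zero A (Cod A (cpt f j)) (Cod A h)" using p0 f' p j by auto
  qed
qed

lemma monic_RI:
  assumes f: "f \<in> Ar R" and m: "\<And>j. j \<in> Ob J \<Longrightarrow> monic A (cpt f j)" shows "monic R f"
  unfolding monic_def
proof (intro conjI ballI impI f)
  fix g h assume gh: "g \<in> Ar R" "h \<in> Ar R" "Dom R g = Dom R h \<and> Cod R g = Dom R f \<and> Cod R h = Dom R f \<and> f \<cdot>\<^bsub>R\<^esub> g = f \<cdot>\<^bsub>R\<^esub> h"
  show "g = h"
  proof (rule Ar_eqI)
    fix j assume j: "j \<in> Ob J"
    have "cpt f j \<cdot> cpt g j = cpt f j \<cdot> cpt h j" 
      using gh f j R_comp_simps(4) [of g f j] R_comp_simps(4) [of h f j] by simp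
    then show "cpt g j = cpt h j" using monicD [OF m [OF j]] gh f j by simp
  qed (use gh in auto)
qed

lemma epic_RI:
  assumes f: "f \<in> Ar R" and m: "\<And>j. j \<in> Ob J \<Longrightarrow> epic A (cpt f j)" shows "epic R f"
  unfolding epic_def
proof (intro conjI ballI impI f)
  fix g h assume gh: "g \<in> Ar R" "h \<in> Ar R" "Cod R g = Cod R h \<and> Dom R g = Cod R f \<and> Dom R h = Cod R f \<and> g \<cdot>\<^bsub>R\<^esub> f = h \<cdot>\<^bsub>R\<^esub> f"
  show "g = h"
  proof (rule Ar_eqI)
    fix j assume j: "j \<in> Ob J"
    have "cpt g j \<cdot> cpt f j = cpt h j \<cdot> cpt f j" 
      using gh f j R_comp_simps(4) [of f g j] R_comp_simps(4) [of f h j] by simp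
    then show "cpt g j = cpt h j" using epicD [OF m [OF j]] gh f j by simp
  qed (use gh in auto)
qed

lemma abelian_R: "abelian R"
proof
  show "abelian_category R"
    unfolding abelian_category_def
  proof (intro conjI ballI allI impI preadditive_R)
    show "\<exists>Z. zero_object R Z" using zero_functor_ex zero_object_R by blast
    show "\<exists>S i j p q. is_biproduct R X Y S i j p q" if "X \<in> Ob R" "Y \<in> Ob R" for X Y
      using biproduct_R that by simp
    show "\<exists>k. is_kernel R k f" if "f \<in> Ar R" for f
      using kernel_R_ex [OF that] is_kernel_R that by blast
    show "\<exists>p. is_cokernel R p f" if "f \<in> Ar R" for f
      using cokernel_R_ex [OF that] is_cokernel_R that by blast
    show "\<exists>g. is_kernel R f g" if f: "monic R f" for f
    proof -
      have f': "f \<in> Ar R" using f by (simp add: monic_def)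
      obtain p where p: "p \<in> Ar R" "Dom R p = Cod R f" "\<And>j. j \<in> Ob J \<Longrightarrow> is_cokernel A (cpt p j) (cpt f j)"
        using cokernel_R_ex [OF f'] by blast
      have "is_kernel R f p"
        by (rule is_kernel_R) (use f' p monic_is_kernel [OF monic_R_pointwise [OF f] p(3)] in auto)
      then show ?thesis ..
    qed
    show "\<exists>g. is_cokernel R f g" if f: "epic R f" for f
    proof -
      have f': "f \<in> Ar R" using f by (simp add: epic_def)
      obtain k where k: "k \<in> Ar R" "Cod R k = Dom R f" "\<And>j. j \<in> Ob J \<Longrightarrow> is_kernel A (cpt k j) (cpt f j)"
        using kernel_R_ex [OF f'] by blast
      have "is_cokernel R f k"
        by (rule is_cokernel_R) (use f' k epic_is_cokernel [OF epic_R_pointwise [OF f] k(3)] in auto)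
      then show ?thesis ..
    qed
  qed
qed

sublocale R: abelian R by (rule abelian_R)

lemma short_exact_R_pointwise:
  assumes fg: "short_exact R f g" and j: "j \<in> Ob J"
  shows "short_exact A (cpt f j) (cpt g j)"
  unfolding short_exact_kernel
proof
  note s = R.short_exactD [OF fg]
  show "epic A (cpt g j)" using epic_R_pointwise s j by blast
  obtain k where k: "k \<in> Ar R" "Cod R k = Dom R g" "\<And>j. j \<in> Ob J \<Longrightarrow> is_kernel A (cpt k j) (cpt g j)"
    using kernel_R_ex [OF s(2)] by blast
  obtain u where u: "u \<in> Ar R" "Dom R u = Dom R k" "Cod R u = Dom R f" "f \<cdot>\<^bsub>R\<^esub> u = k"
    using R.kernel_lift [OF s(7), of k "Dom R k"] k R.kernelD(4) [OF is_kernel_R [OF k(1) s(2) k(2,3)]] by auto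
  have fu: "cpt f j \<cdot> cpt u j = cpt k j" using R_comp_simps(4) [of u f j] u s j by simp
  show "is_kernel A (cpt f j) (cpt g j)"
  proof (rule is_kernelI)
    show "monic A (cpt f j)" using monic_R_pointwise s j by blast
    show "cpt g j \<in> Ar A" "Cod A (cpt f j) = Dom A (cpt g j)" using s j by auto
    show "cpt g j \<cdot> cpt f j = Zero A (Dom A (cpt f j)) (Cod A (cpt g j))"
      using R_comp_simps(4) [OF s(1-3) j] s j by simp
    fix h assume h: "h \<in> Ar A" "Cod A h = Dom A (cpt g j)" "cpt g j \<cdot> h = Zero A (Dom A h) (Cod A (cpt g j))"
    then obtain v where v: "v \<in> Ar A" "Dom A v = Dom A h" "Cod A v = Dom A (cpt k j)" "cpt k j \<cdot> v = h"
      using kernel_lift [OF k(3) [OF j]] by metis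
    have "cpt f j \<cdot> (cpt u j \<cdot> v) = h" using reassoc [OF fu, of v] v u s k j by simp
    then show "\<exists>u. u \<in> Hom A (Dom A h) (Dom A (cpt f j)) \<and> cpt f j \<cdot> u = h"
      using v u s k j by (intro exI [of _ "cpt u j \<cdot> v"]) (simp add: Hom_iff)
  qed
qed

end

section \<open>Coproducts\<close>

context abelian
begin

lemma ex1_unique: "\<exists>!x. P x \<Longrightarrow> P a \<Longrightarrow> P b \<Longrightarrow> a = b"
  by blast

lemma coproductD:
  assumes "is_coproduct A I X S \<iota>"
  shows "S \<in> Ob A" "i \<in> I \<Longrightarrow> X i \<in> Ob A" "i \<in> I \<Longrightarrow> \<iota> i \<in> Ar A" "i \<in> I \<Longrightarrow> Dom A (\<iota> i) = X i" "i \<in> I \<Longrightarrow> Cod A (\<iota> i) = S"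
  using assms unfolding is_coproduct_def Hom_iff by auto

lemma coproduct_ex1:
  assumes c: "is_coproduct A I X S \<iota>" and T: "T \<in> Ob A" and t: "\<forall>i \<in> I. t i \<in> Hom A (X i) T"
  shows "\<exists>!u. u \<in> Hom A S T \<and> (\<forall>i \<in> I. u \<cdot> \<iota> i = t i)"
proof -
  have "\<forall>T \<in> Ob A. \<forall>t. (\<forall>i \<in> I. t i \<in> Hom A (X i) T) \<longrightarrow> (\<exists>!u. u \<in> Hom A S T \<and> (\<forall>i \<in> I. u \<cdot> \<iota> i = t i))"
    using c unfolding is_coproduct_def by (elim conjE)
  from bspec [OF this T] show ?thesis by (elim allE impE) (rule t)
qed

lemma coproduct_desc:
  assumes c: "is_coproduct A I X S \<iota>" and t: "T \<in> Ob A" "\<And>i. i \<in> I \<Longrightarrow> t i \<in> Ar A \<and> Dom A (t i) = X i \<and> Cod A (t i) = T"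
  obtains u where "u \<in> Ar A" "Dom A u = S" "Cod A u = T" "\<And>i. i \<in> I \<Longrightarrow> u \<cdot> \<iota> i = t i"
proof -
  have "\<forall>i \<in> I. t i \<in> Hom A (X i) T" using t by (auto simp: Hom_iff)
  then have "\<exists>!u. u \<in> Hom A S T \<and> (\<forall>i \<in> I. u \<cdot> \<iota> i = t i)" by (rule coproduct_ex1 [OF c t(1)])
  then obtain u where "u \<in> Hom A S T \<and> (\<forall>i \<in> I. u \<cdot> \<iota> i = t i)" by (blast dest: ex1_implies_ex)
  then show thesis using that [of u] by (simp add: Hom_iff)
qed

lemma coproduct_ext:
  assumes c: "is_coproduct A I X S \<iota>" and u: "u \<in> Ar A" "u' \<in> Ar A" "Dom A u = S" "Dom A u' = S" "Cod A u = Cod A u'"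
    and e: "\<And>i. i \<in> I \<Longrightarrow> u \<cdot> \<iota> i = u' \<cdot> \<iota> i"
  shows "u = u'"
proof -
  note c' = coproductD [OF c]
  have "\<forall>i \<in> I. u' \<cdot> \<iota> i \<in> Hom A (X i) (Cod A u')" using c' u by (auto simp: Hom_iff)
  then have "\<exists>!v. v \<in> Hom A S (Cod A u') \<and> (\<forall>i \<in> I. v \<cdot> \<iota> i = u' \<cdot> \<iota> i)" 
    by (rule coproduct_ex1 [OF c Cod_Ob [OF u(2)]])
  moreover have "u \<in> Hom A S (Cod A u') \<and> (\<forall>i \<in> I. u \<cdot> \<iota> i = u' \<cdot> \<iota> i)"
    "u' \<in> Hom A S (Cod A u') \<and> (\<forall>i \<in> I. u' \<cdot> \<iota> i = u' \<cdot> \<iota> i)" using u e by (simp_all add: Hom_iff)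
  ultimately show ?thesis by (rule ex1_unique)
qed

text \<open>
  Coproducts preserve cokernels, both being colimits.
\<close>

lemma coproduct_cokernel:
  assumes X: "is_coproduct A I X SX \<iota>" and Z: "is_coproduct A I Z SZ \<kappa>" and D: "is_coproduct A I D SD \<nu>"
    and m: "\<And>i. i \<in> I \<Longrightarrow> m i \<in> Ar A \<and> Dom A (m i) = X i \<and> Cod A (m i) = Z i"
    and c: "\<And>i. i \<in> I \<Longrightarrow> is_cokernel A (c i) (m i)" "\<And>i. i \<in> I \<Longrightarrow> Cod A (c i) = D i"
    and \<sigma>: "\<sigma> \<in> Ar A" "Dom A \<sigma> = SX" "Cod A \<sigma> = SZ" "\<And>i. i \<in> I \<Longrightarrow> \<sigma> \<cdot> \<iota> i = \<kappa> i \<cdot> m i"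
    and \<tau>: "\<tau> \<in> Ar A" "Dom A \<tau> = SZ" "Cod A \<tau> = SD" "\<And>i. i \<in> I \<Longrightarrow> \<tau> \<cdot> \<kappa> i = \<nu> i \<cdot> c i"
  shows "is_cokernel A \<tau> \<sigma>"
proof (rule is_cokernelI)
  note X' = coproductD [OF X] and Z' = coproductD [OF Z] and D' = coproductD [OF D]
  have c': "c i \<in> Ar A" "Dom A (c i) = Z i" "c i \<cdot> m i = Zero A (X i) (D i)" if "i \<in> I" for i
    using cokernelD [OF c(1) [OF that]] m [OF that] c(2) [OF that] by auto
  show "epic A \<tau>"
  proof (rule epicI [OF \<tau>(1)])
    fix h assume h: "h \<in> Ar A" "Dom A h = Cod A \<tau>" "h \<cdot> \<tau> = Zero A (Dom A \<tau>) (Cod A h)"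
    show "h = Zero A (Cod A \<tau>) (Cod A h)"
    proof (rule coproduct_ext [OF D])
      fix i assume i: "i \<in> I"
      have "(h \<cdot> \<nu> i) \<cdot> c i = h \<cdot> (\<tau> \<cdot> \<kappa> i)" using \<tau>(4) [OF i] c' [OF i] D' i h(1,2) \<tau>(3) c(2) [OF i] by simp
      also have "\<dots> = Zero A (Dom A (c i)) (Cod A h)" using reassoc [OF h(3), of "\<kappa> i"] h(1,2) \<tau> i c' [OF i] Z' by simp
      finally have "h \<cdot> \<nu> i = Zero A (Cod A (c i)) (Cod A h)"
        using epic_Zero [OF cokernel_epic [OF c(1) [OF i]], of "h \<cdot> \<nu> i"] c(2) [OF i] D' i h(1,2) \<tau>(3) by simp
      then show "h \<cdot> \<nu> i = Zero A (Cod A \<tau>) (Cod A h) \<cdot> \<nu> i" using D' i h(1,2) \<tau>(3) c(2) [OF i] by simp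
    qed (use h \<tau> D' in auto)
  qed
  show "\<tau> \<cdot> \<sigma> = Zero A (Dom A \<sigma>) (Cod A \<tau>)"
  proof (rule coproduct_ext [OF X])
    fix i assume i: "i \<in> I"
    have "\<tau> \<cdot> (\<kappa> i \<cdot> m i) = \<nu> i \<cdot> (c i \<cdot> m i)" 
      using reassoc [OF \<tau>(4) [OF i], of "m i"] \<tau>(1-3) m [OF i] Z' i c' [OF i] D' c(2) [OF i] by simp
    then show "(\<tau> \<cdot> \<sigma>) \<cdot> \<iota> i = Zero A (Dom A \<sigma>) (Cod A \<tau>) \<cdot> \<iota> i"
      using c' [OF i] i X' Z' D' \<sigma> \<tau>(1-3) by simp
  qed (use \<sigma> \<tau> X' in auto)
  fix h assume h: "h \<in> Ar A" "Dom A h = Cod A \<sigma>" "h \<cdot> \<sigma> = Zero A (Dom A \<sigma>) (Cod A h)"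
  have "\<exists>t. t \<in> Ar A \<and> Dom A t = D i \<and> Cod A t = Cod A h \<and> t \<cdot> c i = h \<cdot> \<kappa> i" if i: "i \<in> I" for i
  proof -
    have "h \<cdot> (\<kappa> i \<cdot> m i) = (h \<cdot> \<sigma>) \<cdot> \<iota> i" using \<sigma> h(1,2) X' i by simp
    also have "\<dots> = Zero A (X i) (Cod A h)" unfolding h(3) using X' i h(1) \<sigma> by simp
    finally show ?thesis
      using cokernel_lift [OF c(1) [OF i], of "h \<cdot> \<kappa> i"] m [OF i] c(2) [OF i] h(1,2) \<sigma>(3) Z' i by simp metis
  qed
  then obtain t where t: "\<And>i. i \<in> I \<Longrightarrow> t i \<in> Ar A \<and> Dom A (t i) = D i \<and> Cod A (t i) = Cod A h \<and> t i \<cdot> c i = h \<cdot> \<kappa> i"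
    by metis
  obtain u where u: "u \<in> Ar A" "Dom A u = SD" "Cod A u = Cod A h" "\<And>i. i \<in> I \<Longrightarrow> u \<cdot> \<nu> i = t i"
    using coproduct_desc [OF D, of "Cod A h" t] t h by auto
  have "u \<cdot> \<tau> = h"
  proof (rule coproduct_ext [OF Z])
    fix i assume i: "i \<in> I"
    have "(u \<cdot> \<tau>) \<cdot> \<kappa> i = (u \<cdot> \<nu> i) \<cdot> c i" using u(1-3) \<tau> i Z' D' c' [OF i] c(2) [OF i] by simp
    also have "\<dots> = h \<cdot> \<kappa> i" using u(4) [OF i] t [OF i] by simp
    finally show "(u \<cdot> \<tau>) \<cdot> \<kappa> i = h \<cdot> \<kappa> i" .
  qed (use u \<tau> h \<sigma> in auto)
  then show "\<exists>u. u \<in> Hom A (Cod A \<tau>) (Cod A h) \<and> u \<cdot> \<tau> = h" using u \<tau> by (auto simp: Hom_iff)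
qed (use \<sigma> \<tau> in auto)

end

section \<open>Extending a factorization by one vertex\<close>

definition has_coproducts :: "'e itself \<Rightarrow> ('o, 'm) preadd \<Rightarrow> bool" where
  "has_coproducts _ A \<longleftrightarrow> (\<forall>(I :: 'e set) X. (\<forall>i \<in> I. X i \<in> Ob A) \<longrightarrow> (\<exists>S \<iota>. is_coproduct A I X S \<iota>))"

locale cotorsion_coproducts = cotorsion A C W for A :: "('o, 'm) preadd" (structure) and C W +
  fixes E :: "'e itself"
  assumes enough: "enough_projectives A"
    and coproducts: "has_coproducts TYPE('e) A"
    and coproducts_monic: "coproducts_of_monics_monic TYPE('e) A"
begin

lemma coproduct_ex:
  assumes "\<And>i. i \<in> (I :: 'e set) \<Longrightarrow> X i \<in> Ob A"
  obtains S \<iota> where "is_coproduct A I X S \<iota>"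
  using coproducts assms unfolding has_coproducts_def by blast

text \<open>
  This is the construction at one vertex. The index set \<open>I\<close> stands for the arrows ending there; \<open>m a\<close> and
  \<open>c a\<close> are the embedding and its cokernel at the source of \<open>a\<close>, \<open>x a\<close> and \<open>y a\<close> the maps induced by \<open>a\<close>, and
  \<open>f\<close> is the map to be factored. Let \<open>L\<close> be the pushout of \<open>Dom f\<close> and \<open>\<Oplus> Cod (m a)\<close> over
  \<open>\<Oplus> Dom (m a)\<close>, and factor \<open>L \<rightarrow> Cod f\<close> as a cofibration \<open>l\<close> followed by \<open>p\<close>. The pushout of a
  monomorphism with cokernel \<open>\<Oplus> Cod (c a)\<close> gives a monomorphism \<open>j : Dom f \<rightarrow> L\<close> with the same cokernel.
  The embedding at the new vertex is \<open>n = l j\<close>, and the map \<open>\<phi>\<close> from the cokernel of \<open>j\<close> to the cokernel of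
  \<open>l j\<close> inherits the lifting property of \<open>l\<close>. The last two clauses of the conclusion thus say that the
  cokernels form a representation that satisfies the condition defining \<open>\<Phi>(C)\<close> at this vertex.
\<close>

lemma factorization_step:
  fixes I :: "'e set"
  assumes m: "\<And>a. a \<in> I \<Longrightarrow> monic A (m a)" and c: "\<And>a. a \<in> I \<Longrightarrow> is_cokernel A (c a) (m a)"
    and x: "\<And>a. a \<in> I \<Longrightarrow> x a \<in> Ar A \<and> Dom A (x a) = Dom A (m a) \<and> Cod A (x a) = Dom A f"
    and y: "\<And>a. a \<in> I \<Longrightarrow> y a \<in> Ar A \<and> Dom A (y a) = Cod A (m a) \<and> Cod A (y a) = Cod A f \<and> y a \<cdot> m a = f \<cdot> x a"
    and f: "f \<in> Ar A" and C: "\<And>a. a \<in> I \<Longrightarrow> Cod A (c a) \<in> C"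
  shows "\<exists>n p \<zeta> d S \<kappa> \<phi>. monic A n \<and> Dom A n = Dom A f \<and> p \<in> tfib \<and> Dom A p = Cod A n \<and> Cod A p = Cod A f \<and>
    p \<cdot> n = f \<and> is_cokernel A d n \<and> Cod A d \<in> C \<and>
    (\<forall>a \<in> I. \<zeta> a \<in> Ar A \<and> Dom A (\<zeta> a) = Cod A (m a) \<and> Cod A (\<zeta> a) = Cod A n \<and> 
       \<zeta> a \<cdot> m a = n \<cdot> x a \<and> p \<cdot> \<zeta> a = y a) \<and>
    is_coproduct A I (\<lambda>a. Cod A (c a)) S \<kappa> \<and> \<phi> \<in> cof \<and> Dom A \<phi> = S \<and> Cod A \<phi> = Cod A d \<and>
    (\<forall>a \<in> I. \<phi> \<cdot> (\<kappa> a \<cdot> c a) = d \<cdot> \<zeta> a)"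
proof -
  have m': "m a \<in> Ar A \<and> Dom A (m a) = Dom A (m a) \<and> Cod A (m a) = Cod A (m a)" if "a \<in> I" for a using m that by simp
  note c' = cokernelD [OF c]
  obtain SX \<iota> where X: "is_coproduct A I (\<lambda>a. Dom A (m a)) SX \<iota>" using coproduct_ex [of I "\<lambda>a. Dom A (m a)"] m' by auto
  obtain SZ \<mu> where Z: "is_coproduct A I (\<lambda>a. Cod A (m a)) SZ \<mu>" using coproduct_ex [of I "\<lambda>a. Cod A (m a)"] m' by auto
  obtain S \<kappa> where D: "is_coproduct A I (\<lambda>a. Cod A (c a)) S \<kappa>" using coproduct_ex [of I "\<lambda>a. Cod A (c a)"] c' by auto
  note X' = coproductD [OF X] and Z' = coproductD [OF Z] and D' = coproductD [OF D]
  obtain \<sigma> where \<sigma>: "\<sigma> \<in> Ar A" "Dom A \<sigma> = SX" "Cod A \<sigma> = SZ" "\<And>a. a \<in> I \<Longrightarrow> \<sigma> \<cdot> \<iota> a = \<mu> a \<cdot> m a"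
    using coproduct_desc [OF X, of SZ "\<lambda>a. \<mu> a \<cdot> m a"] Z' m' by auto
  obtain \<tau> where \<tau>: "\<tau> \<in> Ar A" "Dom A \<tau> = SZ" "Cod A \<tau> = S" "\<And>a. a \<in> I \<Longrightarrow> \<tau> \<cdot> \<mu> a = \<kappa> a \<cdot> c a"
    using coproduct_desc [OF Z, of S "\<lambda>a. \<kappa> a \<cdot> c a"] D' c' m' by auto
  have "is_cokernel A \<tau> \<sigma>"
    by (rule coproduct_cokernel [OF X Z D m' c _ \<sigma> \<tau>]) auto
  moreover have "monic A \<sigma>"
  proof -
    have "\<forall>a \<in> I. m a \<in> Hom A (Dom A (m a)) (Cod A (m a)) \<and> monic A (m a)" using m m' by (simp add: Hom_iff)
    moreover have "\<sigma> \<in> Hom A SX SZ" "\<forall>a \<in> I. \<sigma> \<cdot> \<iota> a = \<mu> a \<cdot> m a" using \<sigma> by (auto simp: Hom_iff)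
    ultimately show ?thesis using coproducts_monic X Z unfolding coproducts_of_monics_monic_def by blast
  qed
  ultimately have \<sigma>\<tau>: "short_exact A \<sigma> \<tau>" using short_exact_cokernel by simp
  obtain \<xi> where \<xi>: "\<xi> \<in> Ar A" "Dom A \<xi> = SX" "Cod A \<xi> = Dom A f" "\<And>a. a \<in> I \<Longrightarrow> \<xi> \<cdot> \<iota> a = x a"
    using coproduct_desc [OF X, of "Dom A f" x] x f by auto
  obtain \<eta> where \<eta>: "\<eta> \<in> Ar A" "Dom A \<eta> = SZ" "Cod A \<eta> = Cod A f" "\<And>a. a \<in> I \<Longrightarrow> \<eta> \<cdot> \<mu> a = y a"
    using coproduct_desc [OF Z, of "Cod A f" y] y f by auto
  have fe: "f \<cdot> \<xi> = \<eta> \<cdot> \<sigma>"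
  proof (rule coproduct_ext [OF X])
    fix a assume a: "a \<in> I"
    have "(\<eta> \<cdot> \<sigma>) \<cdot> \<iota> a = (\<eta> \<cdot> \<mu> a) \<cdot> m a" using \<eta>(1-3) \<sigma> X' Z' m' a by simp
    also have "\<dots> = (f \<cdot> \<xi>) \<cdot> \<iota> a" using \<eta>(4) [OF a] y [OF a] \<xi> f X' a by simp
    finally show "(f \<cdot> \<xi>) \<cdot> \<iota> a = (\<eta> \<cdot> \<sigma>) \<cdot> \<iota> a" by simp
  qed (use f \<xi> \<eta> \<sigma> in auto)
  obtain L j w \<gamma> where L: "short_exact A j \<gamma>" "Dom A j = Cod A \<xi>" "Cod A j = L" "Cod A \<gamma> = Cod A \<tau>"
    "w \<in> Ar A" "Dom A w = Cod A \<sigma>" "Cod A w = L" "j \<cdot> \<xi> = w \<cdot> \<sigma>" "\<gamma> \<cdot> w = \<tau>"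
    and ex: "\<And>s t. s \<in> Ar A \<Longrightarrow> t \<in> Ar A \<Longrightarrow> Dom A s = Cod A \<xi> \<Longrightarrow> Dom A t = Cod A \<sigma> \<Longrightarrow> Cod A s = Cod A t \<Longrightarrow>
       s \<cdot> \<xi> = t \<cdot> \<sigma> \<Longrightarrow> \<exists>h. h \<in> Ar A \<and> Dom A h = L \<and> Cod A h = Cod A t \<and> h \<cdot> j = s \<and> h \<cdot> w = t"
    using pushout_short_exact [OF \<sigma>\<tau>, of \<xi>] \<xi>(1,2) \<sigma>(2) by metis
  note j = short_exactD [OF L(1)]
  obtain g where g: "g \<in> Ar A" "Dom A g = L" "Cod A g = Cod A f" "g \<cdot> j = f" "g \<cdot> w = \<eta>"
    using ex [OF f \<eta>(1)] fe \<xi> \<eta> \<sigma> by auto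
  obtain l p where l: "l \<in> cof" "p \<in> tfib" "Cod A l = Dom A p" "g = p \<cdot> l"
    using factorization [OF enough g(1)] by blast
  have lm: "monic A l" and l': "l \<in> Ar A" using cof_monic l by auto
  have p': "p \<in> Ar A" using tfib_epic l by auto
  have dl: "Dom A l = L" "Cod A p = Cod A f"
    using g(1-3) l(3) l' p' arg_cong [OF l(4), of "Dom A"] arg_cong [OF l(4), of "Cod A"] by simp_all
  define n where "n = l \<cdot> j"
  have n: "n \<in> Ar A" "Dom A n = Dom A f" "Cod A n = Dom A p" using l' dl j L \<xi> l(3) by (auto simp: n_def)
  have nm: "monic A n" unfolding n_def using monic_comp [OF j(4) lm] L dl by simp
  have pn: "p \<cdot> n = f"
  proof -
    have "p \<cdot> n = (p \<cdot> l) \<cdot> j" unfolding n_def using l' p' l(3) dl j L by simp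
    then show ?thesis using l(4) g(4) by simp
  qed
  obtain d where d: "is_cokernel A d n" using cokernel_ex n by blast
  note d' = cokernelD [OF d]
  have nd: "is_kernel A n d" by (rule monic_is_kernel [OF nm d])
  define \<zeta> where "\<zeta> = (\<lambda>a. l \<cdot> (w \<cdot> \<mu> a))"
  have \<zeta>: "\<zeta> a \<in> Ar A \<and> Dom A (\<zeta> a) = Cod A (m a) \<and> Cod A (\<zeta> a) = Cod A n \<and> \<zeta> a \<cdot> m a = n \<cdot> x a \<and> p \<cdot> \<zeta> a = y a"
    if a: "a \<in> I" for a
  proof (intro conjI)
    show "\<zeta> a \<in> Ar A" "Dom A (\<zeta> a) = Cod A (m a)" "Cod A (\<zeta> a) = Cod A n"
      unfolding \<zeta>_def using l' dl L Z' a n l(3) \<sigma> by auto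
    have "\<zeta> a \<cdot> m a = l \<cdot> (w \<cdot> (\<sigma> \<cdot> \<iota> a))" unfolding \<zeta>_def using \<sigma>(4) [OF a] l' dl L Z' a m' \<sigma>(3) by simp
    also have "\<dots> = l \<cdot> (j \<cdot> (\<xi> \<cdot> \<iota> a))" using reassoc [OF L(8) [symmetric], of "\<iota> a"] L(5-7) \<sigma>(1-3) X' a \<xi>(1-3) j L(2) by simp
    also have "\<dots> = n \<cdot> x a" unfolding n_def using \<xi>(4) [OF a] l' dl j L x [OF a] \<xi> by simp
    finally show "\<zeta> a \<cdot> m a = n \<cdot> x a" .
    have "p \<cdot> \<zeta> a = g \<cdot> (w \<cdot> \<mu> a)" unfolding \<zeta>_def l(4) using l' p' l(3) dl L Z' a \<sigma>(3) by simp
    also have "\<dots> = y a" using reassoc [OF g(5), of "\<mu> a"] g(1-3) L Z' a \<sigma>(3) \<eta>(4) [OF a] by simp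
    finally show "p \<cdot> \<zeta> a = y a" .
  qed
  have "(d \<cdot> l) \<cdot> j = Zero A (Dom A j) (Cod A d)" using d' n l' dl j L l(3) by (simp add: n_def)
  then obtain \<phi> where \<phi>: "\<phi> \<in> Ar A" "Cod A \<phi> = Cod A d" "Dom A \<phi> = Cod A \<gamma>" "\<phi> \<cdot> \<gamma> = d \<cdot> l"
    using cokernel_lift [OF j(8), of "d \<cdot> l" "Cod A d"] d' n l' dl l(3) L by auto
  have Dg: "Dom A \<gamma> = L" using j L by simp
  \<comment> \<open>A test map into the domain of \<open>\<phi>\<close> lifts along \<open>\<gamma>\<close> after its source is covered by a projective.\<close>
  have "monic A \<phi>"
  proof (rule monicI [OF \<phi>(1)])
    fix h assume h: "h \<in> Ar A" "Cod A h = Dom A \<phi>" "\<phi> \<cdot> h = Zero A (Dom A h) (Cod A \<phi>)"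
    obtain \<pi> where \<pi>: "projective A (Dom A \<pi>)" "epic A \<pi>" "Cod A \<pi> = Dom A h"
      using enough h unfolding enough_projectives_def by auto
    have \<pi>': "\<pi> \<in> Ar A" using \<pi> by simp
    obtain b where b: "b \<in> Ar A" "Dom A b = Dom A \<pi>" "Cod A b = L" "\<gamma> \<cdot> b = h \<cdot> \<pi>"
      using projectiveE [OF \<pi>(1) j(5), of "h \<cdot> \<pi>"] h \<pi> \<pi>' \<phi> Dg by auto
    have "d \<cdot> (l \<cdot> b) = \<phi> \<cdot> (h \<cdot> \<pi>)" 
      using reassoc [OF \<phi>(4), of b] b(1-3) b(4) \<phi>(1-3) j Dg d' n l' dl l(3) by simp
    also have "\<dots> = Zero A (Dom A \<pi>) (Cod A d)" using reassoc [OF h(3), of \<pi>] h(1,2) \<phi>(1-3) \<pi> \<pi>' d' by simp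
    finally obtain t where t: "t \<in> Ar A" "Dom A t = Dom A \<pi>" "Cod A t = Dom A n" "n \<cdot> t = l \<cdot> b"
      using kernel_lift [OF nd, of "l \<cdot> b" "Dom A \<pi>"] b l' dl l(3) d' n by auto
    have "l \<cdot> (j \<cdot> t) = l \<cdot> b" using t l' dl j L n \<xi> by (simp add: n_def)
    then have "j \<cdot> t = b" using monicD [OF lm, of "j \<cdot> t" b] t b dl j L n \<xi> by simp
    then have "h \<cdot> \<pi> = \<gamma> \<cdot> (j \<cdot> t)" using b by simp
    also have "\<dots> = Zero A (Dom A \<pi>) (Cod A h)" using reassoc [OF j(6), of t] t j L n \<xi> h \<phi> \<tau>(1) by simp
    finally show "h = Zero A (Dom A h) (Dom A \<phi>)" using epic_Zero [OF \<pi>(2), of h] h \<pi> by simp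
  qed
  moreover have "has_lift A \<phi> q" if q: "q \<in> tfib" for q
  proof (rule has_liftI)
    have q': "q \<in> Ar A" using tfib_epic [OF q] by simp
    fix u v assume u: "u \<in> Ar A" "v \<in> Ar A" "Dom A u = Dom A \<phi>" "Cod A u = Dom A q" "Dom A v = Cod A \<phi>"
      "Cod A v = Cod A q" "q \<cdot> u = v \<cdot> \<phi>"
    have "q \<cdot> (u \<cdot> \<gamma>) = (v \<cdot> d) \<cdot> l" 
      using reassoc [OF u(7), of \<gamma>] u(1-6) \<phi> q' j d' n l' dl l(3) by simp
    then obtain h where h: "h \<in> Ar A" "Dom A h = Cod A l" "Cod A h = Dom A q" "h \<cdot> l = u \<cdot> \<gamma>" "q \<cdot> h = v \<cdot> d"
      using has_liftE [OF cof_has_lift [OF l(1) q], of "u \<cdot> \<gamma>" "v \<cdot> d"] u(1-6) \<phi> j d' n l' dl l(3) Dg by auto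
    have "h \<cdot> n = (u \<cdot> \<gamma>) \<cdot> j" unfolding n_def using reassoc [OF h(4), of j] h(1-3) l' dl j L by simp
    also have "\<dots> = Zero A (Dom A n) (Dom A q)" using u(1-6) \<phi> j L n \<xi> f by simp
    finally obtain k where k: "k \<in> Ar A" "Cod A k = Dom A q" "Dom A k = Cod A d" "k \<cdot> d = h"
      using cokernel_lift [OF d, of h] h n l(3) by auto
    have "(k \<cdot> \<phi>) \<cdot> \<gamma> = u \<cdot> \<gamma>" using \<phi> k(1-3) j d' l' dl n l(3) reassoc [OF k(4), of l] h by simp
    then have 1: "k \<cdot> \<phi> = u" using epicD [OF j(5), of "k \<cdot> \<phi>" u] \<phi> k u by simp
    have "(q \<cdot> k) \<cdot> d = v \<cdot> d" using k h d' q' by simp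
    then have 2: "q \<cdot> k = v" using epicD [OF cokernel_epic [OF d], of "q \<cdot> k" v] k q' u \<phi> by simp
    show "\<exists>h. h \<in> Ar A \<and> Dom A h = Cod A \<phi> \<and> Cod A h = Dom A q \<and> h \<cdot> \<phi> = u \<and> q \<cdot> h = v"
      using 1 2 k \<phi> by (intro exI [of _ k]) simp
  qed
  ultimately have \<phi>c: "\<phi> \<in> cof" by (rule cofI)
  have D\<phi>: "Dom A \<phi> = S" using \<phi> L \<tau> by simp
  have "S \<in> C" by (rule C_coproduct [OF D]) (rule C)
  then have "Cod A d \<in> C" using C_of_cof [OF \<phi>c] D\<phi> \<phi> by simp
  moreover have "\<phi> \<cdot> (\<kappa> a \<cdot> c a) = d \<cdot> \<zeta> a" if a: "a \<in> I" for a
  proof -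
    have "\<phi> \<cdot> (\<kappa> a \<cdot> c a) = \<phi> \<cdot> ((\<gamma> \<cdot> w) \<cdot> \<mu> a)" using \<tau>(4) [OF a] L(9) by simp
    also have "\<dots> = d \<cdot> (l \<cdot> (w \<cdot> \<mu> a))" 
      using reassoc [OF \<phi>(4), of "w \<cdot> \<mu> a"] \<phi>(1-3) j L(2-7) Z' a \<sigma>(3) d' n l' dl l(3) by simp
    finally show ?thesis by (simp add: \<zeta>_def)
  qed
  ultimately show ?thesis
    using nm n l(2) dl(2) pn d \<zeta> D \<phi>c D\<phi> \<phi>(2)
    by (intro exI [of _ n] exI [of _ p] exI [of _ \<zeta>] exI [of _ d] exI [of _ S] exI [of _ \<kappa>] exI [of _ \<phi>]) simp
qed

end

section \<open>Representations of a left rooted quiver\<close>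

text \<open>
  By transfinite induction, every vertex of \<open>V\<^sub>t\<close> is accessible for the relation ``source of an arrow
  to'': the sources of all arrows into a vertex of \<open>V\<^sub>b\<^sub>+\<^sub>1\<close> lie in \<open>V\<^sub>b\<close>.
\<close>

lemma left_rooted_wf:
  fixes Q :: "('v, 'e) quiver"
  assumes Q: "is_quiver Q" and l: "left_rooted Q"
  shows "wf {(source Q a, target Q a) |a. a \<in> arrows Q}"
proof -
  let ?S = "{(source Q a, target Q a) |a. a \<in> arrows Q}"
  obtain r :: "'v rel" and V t where r: "Well_order r" "V_sequence Q r V" "t \<in> Field r" "V t = verts Q"
    using l unfolding left_rooted_def by blast
  have wfr: "wf (r - Id)" using r(1) by (simp add: well_order_on_def)
  have "\<forall>i \<in> V t. i \<in> Wellfounded.acc ?S" if "t \<in> Field r" for t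
    using wfr that
  proof (induction t rule: wf_induct_rule)
    case (less t)
    have IH: "\<forall>i \<in> V b. i \<in> Wellfounded.acc ?S" if "b \<in> underS r t" for b
      using less.IH [of b] that by (auto simp: underS_def Field_def)
    have s: "underS r t = {} \<longrightarrow> V t = {}"
      "\<And>b. b \<in> Field r \<Longrightarrow> underS r t = under r b \<Longrightarrow> V t = V_step Q (V b)"
      "underS r t \<noteq> {} \<Longrightarrow> (\<nexists>b. b \<in> Field r \<and> underS r t = under r b) \<Longrightarrow> V t = (\<Union>b \<in> underS r t. V b)"
      using r(2) less.prems unfolding V_sequence_def by blast+
    consider "underS r t = {}" | b where "b \<in> Field r" "underS r t = under r b"
      | "underS r t \<noteq> {}" "\<nexists>b. b \<in> Field r \<and> underS r t = under r b" by blast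
    then show ?case
    proof cases
      case 1 then show ?thesis using s by simp
    next
      case 2
      have "refl_on (Field r) r" using r(1) by (simp add: order_on_defs)
      then have "b \<in> underS r t" using 2 by (auto simp: under_def refl_on_def)
      then have "\<forall>i \<in> V b. i \<in> Wellfounded.acc ?S" by (rule IH)
      moreover have "j \<in> V b" if "i \<in> V t" "(j, i) \<in> ?S" for i j
        using that unfolding s(2) [OF 2] V_step_def by blast
      ultimately show ?thesis by (blast intro: accI)
    next
      case 3 then show ?thesis using s(3) IH by auto
    qed
  qed
  then have a: "i \<in> Wellfounded.acc ?S" if "i \<in> verts Q" for i using that r by blast
  have "i \<in> Wellfounded.acc ?S" for i
  proof (rule accI)
    fix j assume "(j, i) \<in> ?S"
    then have "j \<in> verts Q" using Q unfolding is_quiver_def by auto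
    then show "j \<in> Wellfounded.acc ?S" by (rule a)
  qed
  then show ?thesis by (simp add: wf_iff_acc)
qed

lemma is_path_append: "is_path Q i p j \<Longrightarrow> is_path Q j q k \<Longrightarrow> is_path Q i (p @ q) k"
  by (induction p arbitrary: i) auto

lemma is_path_ends: "is_quiver Q \<Longrightarrow> is_path Q i p j \<Longrightarrow> i \<in> verts Q \<and> j \<in> verts Q"
proof (induction p arbitrary: i)
  case (Cons a p)
  then have a: "a \<in> arrows Q" "source Q a = i" "is_path Q (target Q a) p j" by auto
  then have "i \<in> verts Q" using Cons.prems(1) unfolding is_quiver_def by blast
  with Cons.IH [OF Cons.prems(1) a(3)] show ?case by simp
qed auto

lemma free_category_simps [simp]:
  "Ob (free_category Q) = verts Q" "(i, p, j) \<in> Ar (free_category Q) \<longleftrightarrow> is_path Q i p j"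
  "Dom (free_category Q) (i, p, j) = i" "Cod (free_category Q) (i, p, j) = j"
  "Ident (free_category Q) i = (i, [], i)" "Comp (free_category Q) (j, q, k) (i, p, j') = (i, p @ q, k)"
  by (simp_all add: free_category_def)

lemma category_free: "is_quiver Q \<Longrightarrow> category (free_category Q)"
  unfolding category_def
  by (auto simp: Hom_iff is_path_append dest: is_path_ends)

locale quiver_rep = abelian A for A :: "('o, 'm) preadd" (structure) +
  fixes Q :: "('v, 'e) quiver"
  assumes quiver: "is_quiver Q"

sublocale quiver_rep \<subseteq> functor_cat A "free_category Q"
  by unfold_locales (rule category_free [OF quiver])

context quiver_rep
begin

lemma Rep_R: "Rep Q A = R" by (simp add: Rep_def)

lemma arrow_simps [simp]:
  assumes "a \<in> arrows Q" 
  shows "source Q a \<in> verts Q" "target Q a \<in> verts Q"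
  using quiver assms unfolding is_quiver_def by auto

lemma arrow_map_simps [simp]:
  assumes "is_functor (free_category Q) A X" "a \<in> arrows Q"
  shows "arrow_map Q X a \<in> Ar A" "Dom A (arrow_map Q X a) = obj_map X (source Q a)" 
    "Cod A (arrow_map Q X a) = obj_map X (target Q a)"
  using functor_simps(2-4) [OF assms(1), of "(source Q a, [a], target Q a)"] assms(2)
  unfolding arrow_map_def by simp_all

lemma rep_Ob [simp]: "is_functor (free_category Q) A X \<Longrightarrow> v \<in> verts Q \<Longrightarrow> obj_map X v \<in> Ob A"
  using functor_simps(1) [of X v] by simp

lemma arr_map_Cons:
  assumes X: "is_functor (free_category Q) A X" and p: "is_path Q i (a # p) j"
  shows "arr_map X (i, a # p, j) = arr_map X (target Q a, p, j) \<cdot> arrow_map Q X a"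
  using functor_simps(6) [OF X, of "(source Q a, [a], target Q a)" "(target Q a, p, j)"] p
  by (simp add: arrow_map_def)

lemma arrow_natural:
  assumes "f \<in> Ar R" "a \<in> arrows Q"
  shows "cpt f (target Q a) \<cdot> arrow_map Q (Dom R f) a = arrow_map Q (Cod R f) a \<cdot> cpt f (source Q a)"
  using natural [OF assms(1), of "(source Q a, [a], target Q a)"] assms(2) by (simp add: arrow_map_def)

lemma cpt_simps [simp]:
  assumes "f \<in> Ar R" "v \<in> verts Q"
  shows "cpt f v \<in> Ar A" "Dom A (cpt f v) = obj_map (Dom R f) v" "Cod A (cpt f v) = obj_map (Cod R f) v"
  using Ar_simps [OF assms(1)] assms(2) by simp_all

text \<open>
  Every path is a composite of arrows, so naturality has to be checked for arrows only.
\<close>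

lemma mk_rep_nat:
  assumes F: "is_functor (free_category Q) A F" and G: "is_functor (free_category Q) A G"
    and \<tau>: "\<And>v. v \<in> verts Q \<Longrightarrow> \<tau> v \<in> Ar A \<and> Dom A (\<tau> v) = obj_map F v \<and> Cod A (\<tau> v) = obj_map G v"
    and n: "\<And>a. a \<in> arrows Q \<Longrightarrow> \<tau> (target Q a) \<cdot> arrow_map Q F a = arrow_map Q G a \<cdot> \<tau> (source Q a)"
  shows "mk_nat F \<tau> G \<in> Ar R"
proof (rule mk_nat_Ar [OF F G])
  show "\<tau> v \<in> Ar A \<and> Dom A (\<tau> v) = obj_map F v \<and> Cod A (\<tau> v) = obj_map G v" if "v \<in> Ob (free_category Q)" for v
    using \<tau> that by simp
  have "\<tau> j \<cdot> arr_map F (i, p, j) = arr_map G (i, p, j) \<cdot> \<tau> i" if "is_path Q i p j" for i p j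
    using that
  proof (induction p arbitrary: i)
    case Nil
    then have "i \<in> verts Q" "j = i" by auto
    then show ?case using \<tau> [of i] functor_simps(5) [OF F, of i] functor_simps(5) [OF G, of i] by simp
  next
    case (Cons a p)
    then have a: "a \<in> arrows Q" "source Q a = i" "is_path Q (target Q a) p j" by auto
    note e = is_path_ends [OF quiver a(3)]
    note t = functor_simps(2-4) [OF F, of "(target Q a, p, j)"] functor_simps(2-4) [OF G, of "(target Q a, p, j)"]
    have "\<tau> j \<cdot> arr_map F (i, a # p, j) = \<tau> j \<cdot> (arr_map F (target Q a, p, j) \<cdot> arrow_map Q F a)"
      by (subst arr_map_Cons [OF F Cons.prems]) simp
    also have "\<dots> = arr_map G (target Q a, p, j) \<cdot> (\<tau> (target Q a) \<cdot> arrow_map Q F a)"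
      using reassoc [OF Cons.IH [OF a(3)], of "arrow_map Q F a"] t a \<tau> e F G by simp
    also have "\<dots> = arr_map G (target Q a, p, j) \<cdot> (arrow_map Q G a \<cdot> \<tau> i)"
      using n [OF a(1)] a by simp
    also have "\<dots> = arr_map G (i, a # p, j) \<cdot> \<tau> i"
      unfolding arr_map_Cons [OF G Cons.prems] using t a \<tau> [of i] arrow_simps [OF a(1)] e F G by simp
    finally show ?case .
  qed
  then show "\<tau> (Cod (free_category Q) \<phi>) \<cdot> arr_map F \<phi> = arr_map G \<phi> \<cdot> \<tau> (Dom (free_category Q) \<phi>)"
    if "\<phi> \<in> Ar (free_category Q)" for \<phi> using that by (cases \<phi>) simp
qed

fun path_map :: "('v \<Rightarrow> 'o) \<Rightarrow> ('e \<Rightarrow> 'm) \<Rightarrow> 'v \<Rightarrow> 'e list \<Rightarrow> 'm" where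
  "path_map X \<xi> i [] = Ident A (X i)"
| "path_map X \<xi> i (a # p) = path_map X \<xi> (target Q a) p \<cdot> \<xi> a"

definition rep :: "('v \<Rightarrow> 'o) \<Rightarrow> ('e \<Rightarrow> 'm) \<Rightarrow> ('v, 'e, 'o, 'm) rep" where
  "rep X \<xi> = mk_functor X (\<lambda>(i, p, j). path_map X \<xi> i p)"

lemma rep:
  assumes X: "\<And>v. v \<in> verts Q \<Longrightarrow> X v \<in> Ob A"
    and \<xi>: "\<And>a. a \<in> arrows Q \<Longrightarrow> \<xi> a \<in> Ar A \<and> Dom A (\<xi> a) = X (source Q a) \<and> Cod A (\<xi> a) = X (target Q a)"
  shows "is_functor (free_category Q) A (rep X \<xi>)"
    and "v \<in> verts Q \<Longrightarrow> obj_map (rep X \<xi>) v = X v"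
    and "a \<in> arrows Q \<Longrightarrow> arrow_map Q (rep X \<xi>) a = \<xi> a"
proof -
  have p: "path_map X \<xi> i p \<in> Ar A \<and> Dom A (path_map X \<xi> i p) = X i \<and> Cod A (path_map X \<xi> i p) = X j"
    if "is_path Q i p j" for i p j
    using that X \<xi> by (induction p arbitrary: i) auto
  have c: "path_map X \<xi> i (p @ q) = path_map X \<xi> j q \<cdot> path_map X \<xi> i p"
    if "is_path Q i p j" "is_path Q j q k" for i p j q k
    using that
  proof (induction p arbitrary: i)
    case Nil
    then show ?case using p [of j q k] by simp
  next
    case (Cons a p)
    then have a: "a \<in> arrows Q" "source Q a = i" "is_path Q (target Q a) p j" by auto
    then show ?case using Cons.IH [OF a(3) Cons.prems(2)] p [OF a(3)] p [OF Cons.prems(2)] \<xi> [OF a(1)] by simp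
  qed
  show "is_functor (free_category Q) A (rep X \<xi>)"
    unfolding rep_def
  proof (rule mk_functor)
    show "X v \<in> Ob A" if "v \<in> Ob (free_category Q)" for v using X that by simp
    show "(case \<phi> of (i, p, j) \<Rightarrow> path_map X \<xi> i p) \<in> Ar A \<and>
      Dom A (case \<phi> of (i, p, j) \<Rightarrow> path_map X \<xi> i p) = X (Dom (free_category Q) \<phi>) \<and>
      Cod A (case \<phi> of (i, p, j) \<Rightarrow> path_map X \<xi> i p) = X (Cod (free_category Q) \<phi>)" 
      if "\<phi> \<in> Ar (free_category Q)" for \<phi>
      using that p by (cases \<phi>) simp
    show "(case \<psi> \<cdot>\<^bsub>free_category Q\<^esub> \<phi> of (i, p, j) \<Rightarrow> path_map X \<xi> i p) = 
      (case \<psi> of (i, p, j) \<Rightarrow> path_map X \<xi> i p) \<cdot> (case \<phi> of (i, p, j) \<Rightarrow> path_map X \<xi> i p)"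
      if "\<phi> \<in> Ar (free_category Q)" "\<psi> \<in> Ar (free_category Q)" 
        "Cod (free_category Q) \<phi> = Dom (free_category Q) \<psi>" for \<phi> \<psi>
      using that c by (cases \<phi>; cases \<psi>) simp
  qed simp
  show "v \<in> verts Q \<Longrightarrow> obj_map (rep X \<xi>) v = X v" by (simp add: rep_def)
  show "a \<in> arrows Q \<Longrightarrow> arrow_map Q (rep X \<xi>) a = \<xi> a" 
    using X \<xi> by (simp add: rep_def arrow_map_def)
qed

end

section \<open>The induced cotorsion pair of representations\<close>

locale quiver_cotorsion = cotorsion_coproducts A C W "TYPE('e)" for A :: "('o, 'm) preadd" (structure) and C W +
  fixes Q :: "('v, 'e) quiver"
  assumes quiver: "is_quiver Q"
    and wf: "wf {(source Q a, target Q a) |a. a \<in> arrows Q}"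

sublocale quiver_cotorsion \<subseteq> quiver_rep A Q
  by unfold_locales (rule quiver)

context quiver_cotorsion
begin

abbreviation into :: "'v \<Rightarrow> 'e set" where "into v \<equiv> {a \<in> arrows Q. target Q a = v}"

abbreviation "RC \<equiv> Phi Q A C"
abbreviation "RW \<equiv> Rep_class Q A W"

lemma RW_iff: "X \<in> RW \<longleftrightarrow> is_functor (free_category Q) A X \<and> (\<forall>v \<in> verts Q. obj_map X v \<in> W)"
  unfolding Rep_class_def Rep_R by simp

lemma RC_iff: "X \<in> RC \<longleftrightarrow> is_functor (free_category Q) A X \<and> (\<forall>v \<in> verts Q. obj_map X v \<in> C \<and>
    (\<exists>\<phi> \<in> cof. is_phi Q A X v \<phi>))"
proof -
  have "(\<exists>f p. is_phi Q A X v f \<and> monic A f \<and> is_cokernel A p f \<and> Cod A p \<in> C) \<longleftrightarrow> (\<exists>\<phi> \<in> cof. is_phi Q A X v \<phi>)" for v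
    unfolding monics_with_cokernel_in_def by auto
  then show ?thesis unfolding Phi_def Rep_R by simp
qed

lemma is_phiE:
  assumes "is_phi Q A X v \<phi>"
  obtains S \<iota> where "is_coproduct A (into v) (\<lambda>a. obj_map X (source Q a)) S \<iota>" "\<phi> \<in> Ar A" "Dom A \<phi> = S" 
    "Cod A \<phi> = obj_map X v" "\<forall>a \<in> into v. \<phi> \<cdot> \<iota> a = arrow_map Q X a"
proof -
  obtain S \<iota> where "is_coproduct A (into v) (\<lambda>a. obj_map X (source Q a)) S \<iota>" "\<phi> \<in> Ar A \<and> Dom A \<phi> = S \<and> Cod A \<phi> = obj_map X v"
    "\<forall>a \<in> arrows Q. target Q a = v \<longrightarrow> \<phi> \<cdot> \<iota> a = arrow_map Q X a"
    using assms unfolding is_phi_def Hom_iff by blast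
  then show thesis using that [of S \<iota>] by simp
qed

text \<open>
  The lift \<open>s\<close> is chosen vertex by vertex. At \<open>v\<close>, the values at the sources of the arrows into \<open>v\<close> combine to a
  map \<open>t\<close> from \<open>\<Oplus> X(j)\<close>, and \<open>s(v)\<close> has to extend \<open>t\<close> along \<open>\<phi>\<close> and to lift \<open>u\<close> along \<open>g\<close>: this is a lifting
  problem of a cofibration against an epimorphism with kernel in \<open>W\<close>.
\<close>

lemma RC_lift:
  assumes X: "X \<in> RC" and g: "g \<in> Ar R" "\<And>v. v \<in> verts Q \<Longrightarrow> cpt g v \<in> tfib"
    and u: "u \<in> Ar R" "Dom R u = X" "Cod R u = Cod R g"
  shows "\<exists>s \<in> Ar R. Dom R s = X \<and> Cod R s = Dom R g \<and> g \<cdot>\<^bsub>R\<^esub> s = u"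
proof -
  let ?P = "\<lambda>s v r. v \<in> verts Q \<longrightarrow> r \<in> Ar A \<and> Dom A r = obj_map X v \<and> Cod A r = obj_map (Dom R g) v \<and>
     cpt g v \<cdot> r = cpt u v \<and> (\<forall>a \<in> into v. r \<cdot> arrow_map Q X a = arrow_map Q (Dom R g) a \<cdot> s (source Q a))"
  have Xf: "is_functor (free_category Q) A X" using X RC_iff by simp
  have Gf: "is_functor (free_category Q) A (Dom R g)" "is_functor (free_category Q) A (Cod R g)" using g by auto
  have "\<exists>s. \<forall>v. ?P s v (s v)"
  proof (rule dependent_wf_choice [OF wf])
    fix s s' :: "'v \<Rightarrow> 'm" and v r
    assume "\<And>z. (z, v) \<in> {(source Q a, target Q a) |a. a \<in> arrows Q} \<Longrightarrow> s z = s' z"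
    then have "\<And>a. a \<in> into v \<Longrightarrow> s (source Q a) = s' (source Q a)" by blast
    then show "?P s v r = ?P s' v r" by simp
  next
    fix v s assume IH: "\<And>y. (y, v) \<in> {(source Q a, target Q a) |a. a \<in> arrows Q} \<Longrightarrow> ?P s y (s y)"
    show "\<exists>r. ?P s v r"
    proof (cases "v \<in> verts Q")
      case v: True
      have s: "s (source Q a) \<in> Ar A" "Dom A (s (source Q a)) = obj_map X (source Q a)" 
        "Cod A (s (source Q a)) = obj_map (Dom R g) (source Q a)" 
        "cpt g (source Q a) \<cdot> s (source Q a) = cpt u (source Q a)" if "a \<in> into v" for a
      proof -
        have "(source Q a, v) \<in> {(source Q a, target Q a) |a. a \<in> arrows Q}" "source Q a \<in> verts Q" using that by auto
        from IH [OF this(1)] this(2)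
        show "s (source Q a) \<in> Ar A" "Dom A (s (source Q a)) = obj_map X (source Q a)" 
          "Cod A (s (source Q a)) = obj_map (Dom R g) (source Q a)" 
          "cpt g (source Q a) \<cdot> s (source Q a) = cpt u (source Q a)" by blast+
      qed
      obtain \<phi> where \<phi>: "\<phi> \<in> cof" "is_phi Q A X v \<phi>" using X v unfolding RC_iff by blast
      obtain S \<iota> where S: "is_coproduct A (into v) (\<lambda>a. obj_map X (source Q a)) S \<iota>" "\<phi> \<in> Ar A" "Dom A \<phi> = S" 
        "Cod A \<phi> = obj_map X v" "\<forall>a \<in> into v. \<phi> \<cdot> \<iota> a = arrow_map Q X a"
        by (rule is_phiE [OF \<phi>(2)]) (rule that)
      note S' = coproductD [OF S(1)]
      obtain t where t: "t \<in> Ar A" "Dom A t = S" "Cod A t = obj_map (Dom R g) v" 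
        "\<And>a. a \<in> into v \<Longrightarrow> t \<cdot> \<iota> a = arrow_map Q (Dom R g) a \<cdot> s (source Q a)"
        using coproduct_desc [OF S(1), of "obj_map (Dom R g) v" "\<lambda>a. arrow_map Q (Dom R g) a \<cdot> s (source Q a)"] s Gf v by auto
      have "cpt g v \<cdot> t = cpt u v \<cdot> \<phi>"
      proof (rule coproduct_ext [OF S(1)])
        fix a assume a: "a \<in> into v"
        then have a': "a \<in> arrows Q" "target Q a = v" by auto
        have "(cpt g v \<cdot> t) \<cdot> \<iota> a = cpt g v \<cdot> (arrow_map Q (Dom R g) a \<cdot> s (source Q a))"
          using t S' a g(1) v by simp
        also have "\<dots> = arrow_map Q (Cod R g) a \<cdot> (cpt g (source Q a) \<cdot> s (source Q a))"
          using reassoc [OF arrow_natural [OF g(1) a'(1)], of "s (source Q a)"] a' s [OF a] g(1) Gf v by simp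
        also have "\<dots> = (cpt u v \<cdot> \<phi>) \<cdot> \<iota> a"
          using arrow_natural [OF u(1) a'(1)] s(4) [OF a] u S(2-4) bspec [OF S(5) a] S' a a' v by simp
        finally show "(cpt g v \<cdot> t) \<cdot> \<iota> a = (cpt u v \<cdot> \<phi>) \<cdot> \<iota> a" .
      qed (use t S u g(1) v in simp_all)
      then obtain r where r: "r \<in> Ar A" "Dom A r = Cod A \<phi>" "Cod A r = Dom A (cpt g v)" "r \<cdot> \<phi> = t" "cpt g v \<cdot> r = cpt u v"
        using has_liftE [OF cof_has_lift [OF \<phi>(1) g(2) [OF v]], of t "cpt u v"] t S u g(1) v by auto
      have "r \<cdot> arrow_map Q X a = arrow_map Q (Dom R g) a \<cdot> s (source Q a)" if a: "a \<in> into v" for a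
        using reassoc [OF r(4), of "\<iota> a"] bspec [OF S(5) a] t(4) [OF a] r S S' a by simp
      then have "?P s v r" using r S g(1) v by simp
      then show ?thesis ..
    qed simp
  qed
  then obtain s where s: "\<And>v. ?P s v (s v)" by blast
  have m: "mk_nat X s (Dom R g) \<in> Ar R"
    by (rule mk_rep_nat [OF Xf Gf(1)]) (use s in auto)
  have "g \<cdot>\<^bsub>R\<^esub> mk_nat X s (Dom R g) = u"
    by (rule Ar_eqI) (use m g u s in simp_all)
  then show ?thesis using m by (intro bexI [of _ "mk_nat X s (Dom R g)"]) simp_all
qed

lemma RC_splits: assumes X: "X \<in> RC" and Y: "Y \<in> RW" shows "splits R X Y"
  unfolding splits_def
proof (intro allI impI)
  fix f g assume "short_exact R f g \<and> Dom R f = Y \<and> Cod R g = X"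
  then have fg: "short_exact R f g" "Dom R f = Y" "Cod R g = X" by auto
  note s = R.short_exactD [OF fg(1)]
  have "cpt g v \<in> tfib" if v: "v \<in> verts Q" for v
  proof -
    have "short_exact A (cpt f v) (cpt g v)" using short_exact_R_pointwise [OF fg(1)] v by simp
    from short_exactD [OF this] show ?thesis
      using Y v fg(2) s(1) unfolding RW_iff epics_with_kernel_in_def by auto
  qed
  moreover have Xf: "is_functor (free_category Q) A X" using X RC_iff by simp
  ultimately obtain t where "t \<in> Ar R" "Dom R t = X" "Cod R t = Dom R g" "g \<cdot>\<^bsub>R\<^esub> t = Ident R X"
    using RC_lift [OF X s(2), of "Ident R X"] fg by auto
  then show "\<exists>s\<in>Hom R X (Cod R f). g \<cdot>\<^bsub>R\<^esub> s = Ident R X" using s by (auto simp: Hom_iff)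
qed

text \<open>
  The map \<open>\<phi>\<^sub>v\<close> of \<open>X\<close> is a retract of that of \<open>S\<close>, and cofibrations are closed under retracts.
\<close>

lemma RC_retract:
  assumes S: "S \<in> RC" and i: "i \<in> Ar R" "Dom R i = X" "Cod R i = S" and r: "r \<in> Ar R" "Dom R r = S" "Cod R r = X"
    and ri: "r \<cdot>\<^bsub>R\<^esub> i = Ident R X"
  shows "X \<in> RC"
  unfolding RC_iff
proof (intro conjI ballI)
  show Xf: "is_functor (free_category Q) A X" using i by auto
  have Sf: "is_functor (free_category Q) A S" using i by auto
  have riv: "cpt r v \<cdot> cpt i v = Ident A (obj_map X v)" if "v \<in> verts Q" for v
    using R_comp_simps(4) [of i r v] ri i r that Xf by simp
  fix v assume v: "v \<in> verts Q"
  show "obj_map X v \<in> C"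
    by (rule C_retract [of "obj_map S v" "cpt i v" _ "cpt r v"]) (use S i r v riv RC_iff in \<open>auto simp: Hom_iff\<close>)
  obtain \<phi> where \<phi>: "\<phi> \<in> cof" "is_phi Q A S v \<phi>" using S v unfolding RC_iff by blast
  obtain T \<iota> where T: "is_coproduct A (into v) (\<lambda>a. obj_map S (source Q a)) T \<iota>" "\<phi> \<in> Ar A" "Dom A \<phi> = T" 
    "Cod A \<phi> = obj_map S v" "\<forall>a \<in> into v. \<phi> \<cdot> \<iota> a = arrow_map Q S a"
    by (rule is_phiE [OF \<phi>(2)]) (rule that)
  note T' = coproductD [OF T(1)]
  obtain U \<kappa> where U: "is_coproduct A (into v) (\<lambda>a. obj_map X (source Q a)) U \<kappa>"
    using coproduct_ex [of "into v" "\<lambda>a. obj_map X (source Q a)"] Xf by auto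
  note U' = coproductD [OF U]
  obtain \<psi> where \<psi>: "\<psi> \<in> Ar A" "Dom A \<psi> = U" "Cod A \<psi> = obj_map X v" "\<And>a. a \<in> into v \<Longrightarrow> \<psi> \<cdot> \<kappa> a = arrow_map Q X a"
    using coproduct_desc [OF U, of "obj_map X v" "arrow_map Q X"] Xf v by auto
  obtain \<alpha> where \<alpha>: "\<alpha> \<in> Ar A" "Dom A \<alpha> = U" "Cod A \<alpha> = T" "\<And>a. a \<in> into v \<Longrightarrow> \<alpha> \<cdot> \<kappa> a = \<iota> a \<cdot> cpt i (source Q a)"
    using coproduct_desc [OF U, of T "\<lambda>a. \<iota> a \<cdot> cpt i (source Q a)"] T' i by auto
  obtain \<beta> where \<beta>: "\<beta> \<in> Ar A" "Dom A \<beta> = T" "Cod A \<beta> = U" "\<And>a. a \<in> into v \<Longrightarrow> \<beta> \<cdot> \<iota> a = \<kappa> a \<cdot> cpt r (source Q a)"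
    using coproduct_desc [OF T(1), of U "\<lambda>a. \<kappa> a \<cdot> cpt r (source Q a)"] U' r by auto
  have "\<beta> \<cdot> \<alpha> = Ident A U"
  proof (rule coproduct_ext [OF U])
    fix a assume a: "a \<in> into v"
    have "(\<beta> \<cdot> \<alpha>) \<cdot> \<kappa> a = (\<beta> \<cdot> \<iota> a) \<cdot> cpt i (source Q a)" using \<alpha>(1-3) \<alpha>(4) [OF a] \<beta>(1-3) T' U' a i by simp
    also have "\<dots> = \<kappa> a" using \<beta>(4) [OF a] riv [of "source Q a"] U' a i r by simp
    finally show "(\<beta> \<cdot> \<alpha>) \<cdot> \<kappa> a = Ident A U \<cdot> \<kappa> a" using U' a by simp
  qed (use \<alpha> \<beta> U' in auto)
  moreover have "\<phi> \<cdot> \<alpha> = cpt i v \<cdot> \<psi>"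
  proof (rule coproduct_ext [OF U])
    fix a assume a: "a \<in> into v"
    then have a': "a \<in> arrows Q" "target Q a = v" by auto
    have "(\<phi> \<cdot> \<alpha>) \<cdot> \<kappa> a = (\<phi> \<cdot> \<iota> a) \<cdot> cpt i (source Q a)" using \<alpha>(1-3) \<alpha>(4) [OF a] T(2-4) T' U' a i by simp
    also have "\<dots> = cpt i v \<cdot> arrow_map Q X a" using bspec [OF T(5) a] arrow_natural [OF i(1) a'(1)] i a' by simp
    finally show "(\<phi> \<cdot> \<alpha>) \<cdot> \<kappa> a = (cpt i v \<cdot> \<psi>) \<cdot> \<kappa> a" using \<psi>(1-3) \<psi>(4) [OF a] U' a i v by simp
  qed (use \<alpha> T \<psi> i v in simp_all)
  moreover have "\<psi> \<cdot> \<beta> = cpt r v \<cdot> \<phi>"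
  proof (rule coproduct_ext [OF T(1)])
    fix a assume a: "a \<in> into v"
    then have a': "a \<in> arrows Q" "target Q a = v" by auto
    have "(\<psi> \<cdot> \<beta>) \<cdot> \<iota> a = (\<psi> \<cdot> \<kappa> a) \<cdot> cpt r (source Q a)" using \<beta>(1-3) \<beta>(4) [OF a] \<psi>(1-3) T' U' a r by simp
    also have "\<dots> = cpt r v \<cdot> arrow_map Q S a" using \<psi>(4) [OF a] arrow_natural [OF r(1) a'(1)] r a' by simp
    finally show "(\<psi> \<cdot> \<beta>) \<cdot> \<iota> a = (cpt r v \<cdot> \<phi>) \<cdot> \<iota> a" using T(2-4) bspec [OF T(5) a] T' a r v by simp
  qed (use \<beta> T \<psi> r v in simp_all)
  ultimately have eq: "\<beta> \<cdot> \<alpha> = Ident A U" "\<phi> \<cdot> \<alpha> = cpt i v \<cdot> \<psi>" "\<psi> \<cdot> \<beta> = cpt r v \<cdot> \<phi>" by simp_all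
  have "retract_of A \<psi> \<phi>"
    unfolding retract_of_def Hom_iff using \<psi>(1-3) T(2-4) \<alpha>(1-3) \<beta>(1-3) i r v riv [OF v]
    by (intro conjI) (simp, simp, rule exI [of _ \<alpha>], rule exI [of _ \<beta>], rule exI [of _ "cpt i v"], rule exI [of _ "cpt r v"], simp add: eq)
  then have "\<psi> \<in> cof" using cof_retract \<phi>(1) by blast
  moreover have "is_phi Q A X v \<psi>" unfolding is_phi_def using U \<psi> by (auto simp: Hom_iff)
  ultimately show "\<exists>\<phi> \<in> cof. is_phi Q A X v \<phi>" by blast
qed

text \<open>
  The well-founded recursion over \<open>factorization_step\<close>. It also chooses the cokernel \<open>d\<close> at every vertex,
  since the cofibration at a vertex is a statement about the cokernels at the preceding ones.
\<close>

lemma factorization_R: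
  assumes f: "f \<in> Ar R"
  shows "\<exists>n p d. n \<in> Ar R \<and> p \<in> Ar R \<and> Cod R n = Dom R p \<and> f = p \<cdot>\<^bsub>R\<^esub> n \<and> 
    (\<forall>v \<in> verts Q. cpt p v \<in> tfib) \<and> short_exact R n d \<and> Cod R d \<in> RC"
proof -
  let ?X = "Dom R f" and ?Y = "Cod R f"
  have XY: "is_functor (free_category Q) A ?X" "is_functor (free_category Q) A ?Y" using f by auto
  \<comment> \<open>The data \<open>r\<close> at a vertex: the embedding \<open>n\<close>, the projection \<open>p\<close>, the cokernel \<open>d\<close> of \<open>n\<close>, and for
    each arrow into the vertex the map \<open>z\<close> of the new representation.\<close>
  let ?n = "\<lambda>r. fst r" and ?p = "\<lambda>r. fst (snd r)" and ?d = "\<lambda>r. fst (snd (snd r))" and ?z = "\<lambda>r. snd (snd (snd r))"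
  let ?B = "\<lambda>v r. monic A (?n r) \<and> Dom A (?n r) = obj_map ?X v \<and> ?p r \<in> tfib \<and> Dom A (?p r) = Cod A (?n r) \<and>
     Cod A (?p r) = obj_map ?Y v \<and> ?p r \<cdot> ?n r = cpt f v \<and> is_cokernel A (?d r) (?n r) \<and> Cod A (?d r) \<in> C"
  let ?P = "\<lambda>g v (r :: 'm \<times> 'm \<times> 'm \<times> ('e \<Rightarrow> 'm)). v \<in> verts Q \<longrightarrow> ?B v r \<and>
     (\<forall>a \<in> into v. ?z r a \<in> Ar A \<and> Dom A (?z r a) = Cod A (?n (g (source Q a))) \<and> Cod A (?z r a) = Cod A (?n r) \<and>
        ?z r a \<cdot> ?n (g (source Q a)) = ?n r \<cdot> arrow_map Q ?X a \<and>
        ?p r \<cdot> ?z r a = arrow_map Q ?Y a \<cdot> ?p (g (source Q a))) \<and>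
     (\<exists>S \<kappa> \<phi>. is_coproduct A (into v) (\<lambda>a. Cod A (?d (g (source Q a)))) S \<kappa> \<and> \<phi> \<in> cof \<and> Dom A \<phi> = S \<and> 
        Cod A \<phi> = Cod A (?d r) \<and> (\<forall>a \<in> into v. \<phi> \<cdot> (\<kappa> a \<cdot> ?d (g (source Q a))) = ?d r \<cdot> ?z r a))"
  have "\<exists>g. \<forall>v. ?P g v (g v)"
  proof (rule dependent_wf_choice [OF wf])
    fix g g' :: "'v \<Rightarrow> 'm \<times> 'm \<times> 'm \<times> ('e \<Rightarrow> 'm)" and v r
    assume "\<And>z. (z, v) \<in> {(source Q a, target Q a) |a. a \<in> arrows Q} \<Longrightarrow> g z = g' z"
    then have e: "g (source Q a) = g' (source Q a)" if "a \<in> into v" for a using that by blast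
    have c: "is_coproduct A (into v) (\<lambda>a. Cod A (?d (g (source Q a)))) S \<kappa> = 
        is_coproduct A (into v) (\<lambda>a. Cod A (?d (g' (source Q a)))) S \<kappa>" for S \<kappa>
      unfolding is_coproduct_def using e by simp
    show "?P g v r = ?P g' v r" using e c by simp
  next
    fix v and g :: "'v \<Rightarrow> 'm \<times> 'm \<times> 'm \<times> ('e \<Rightarrow> 'm)"
    assume IH: "\<And>y. (y, v) \<in> {(source Q a, target Q a) |a. a \<in> arrows Q} \<Longrightarrow> ?P g y (g y)"
    show "\<exists>r. ?P g v r"
    proof (cases "v \<in> verts Q")
      case v: True
      have B: "?B (source Q a) (g (source Q a))" if "a \<in> into v" for a
      proof -
        have "(source Q a, v) \<in> {(source Q a, target Q a) |a. a \<in> arrows Q}" "source Q a \<in> verts Q" using that by auto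
        from IH [OF this(1)] this(2) show ?thesis by blast
      qed
      define M where "M a = ?n (g (source Q a))" for a
      define D where "D a = ?d (g (source Q a))" for a
      define P where "P a = ?p (g (source Q a))" for a
      have B': "monic A (M a)" "Dom A (M a) = obj_map ?X (source Q a)" "P a \<in> tfib" "Dom A (P a) = Cod A (M a)"
        "Cod A (P a) = obj_map ?Y (source Q a)" "P a \<cdot> M a = cpt f (source Q a)" "is_cokernel A (D a) (M a)" "Cod A (D a) \<in> C"
        if "a \<in> into v" for a
        using B [OF that] unfolding M_def D_def P_def by blast+
      have PAr: "P a \<in> Ar A" if "a \<in> into v" for a using tfib_epic [OF B'(3) [OF that]] by simp
      have x: "arrow_map Q ?X a \<in> Ar A \<and> Dom A (arrow_map Q ?X a) = Dom A (M a) \<and> Cod A (arrow_map Q ?X a) = Dom A (cpt f v)"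
        if "a \<in> into v" for a using that B'(2) [OF that] XY f v by auto
      have y: "arrow_map Q ?Y a \<cdot> P a \<in> Ar A \<and> Dom A (arrow_map Q ?Y a \<cdot> P a) = Cod A (M a) \<and> 
           Cod A (arrow_map Q ?Y a \<cdot> P a) = Cod A (cpt f v) \<and> (arrow_map Q ?Y a \<cdot> P a) \<cdot> M a = cpt f v \<cdot> arrow_map Q ?X a"
        if a: "a \<in> into v" for a
        using a B' [OF a] PAr [OF a] XY f v arrow_natural [OF f, of a] by auto
      have "\<exists>n p \<zeta> d S \<kappa> \<phi>. monic A n \<and> Dom A n = Dom A (cpt f v) \<and> p \<in> tfib \<and> Dom A p = Cod A n \<and> 
        Cod A p = Cod A (cpt f v) \<and> p \<cdot> n = cpt f v \<and> is_cokernel A d n \<and> Cod A d \<in> C \<and>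
        (\<forall>a \<in> into v. \<zeta> a \<in> Ar A \<and> Dom A (\<zeta> a) = Cod A (M a) \<and> Cod A (\<zeta> a) = Cod A n \<and> 
          \<zeta> a \<cdot> M a = n \<cdot> arrow_map Q ?X a \<and> p \<cdot> \<zeta> a = arrow_map Q ?Y a \<cdot> P a) \<and>
        is_coproduct A (into v) (\<lambda>a. Cod A (D a)) S \<kappa> \<and> \<phi> \<in> cof \<and> Dom A \<phi> = S \<and> Cod A \<phi> = Cod A d \<and>
        (\<forall>a \<in> into v. \<phi> \<cdot> (\<kappa> a \<cdot> D a) = d \<cdot> \<zeta> a)"
        by (rule factorization_step [OF B'(1) B'(7) x y _ B'(8)]) (use f v in simp_all)
      then obtain n p \<zeta> d S \<kappa> \<phi> where "monic A n \<and> Dom A n = Dom A (cpt f v) \<and> p \<in> tfib \<and> Dom A p = Cod A n \<and> 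
        Cod A p = Cod A (cpt f v) \<and> p \<cdot> n = cpt f v \<and> is_cokernel A d n \<and> Cod A d \<in> C \<and>
        (\<forall>a \<in> into v. \<zeta> a \<in> Ar A \<and> Dom A (\<zeta> a) = Cod A (M a) \<and> Cod A (\<zeta> a) = Cod A n \<and> 
          \<zeta> a \<cdot> M a = n \<cdot> arrow_map Q ?X a \<and> p \<cdot> \<zeta> a = arrow_map Q ?Y a \<cdot> P a) \<and>
        is_coproduct A (into v) (\<lambda>a. Cod A (D a)) S \<kappa> \<and> \<phi> \<in> cof \<and> Dom A \<phi> = S \<and> Cod A \<phi> = Cod A d \<and>
        (\<forall>a \<in> into v. \<phi> \<cdot> (\<kappa> a \<cdot> D a) = d \<cdot> \<zeta> a)" by (elim exE)
      then have "?P g v (n, p, d, \<zeta>)"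
        unfolding M_def D_def P_def fst_conv snd_conv cpt_simps(2,3) [OF f v] by blast
      then show ?thesis by (rule exI [where P = "?P g v" and x = "(n, p, d, \<zeta>)"])
    qed simp
  qed
  then obtain g where g: "\<And>v. ?P g v (g v)" by blast
  define N where "N v = ?n (g v)" for v
  define P where "P v = ?p (g v)" for v
  define D where "D v = ?d (g v)" for v
  define Z where "Z v = Cod A (N v)" for v
  define \<zeta> where "\<zeta> a = ?z (g (target Q a)) a" for a
  have B: "monic A (N v)" "Dom A (N v) = obj_map ?X v" "P v \<in> tfib" "Dom A (P v) = Z v"
    "Cod A (P v) = obj_map ?Y v" "P v \<cdot> N v = cpt f v" "is_cokernel A (D v) (N v)" "Cod A (D v) \<in> C"
    if "v \<in> verts Q" for v
    using g [of v] that unfolding N_def P_def D_def Z_def by blast+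
  have zz: "\<zeta> a \<in> Ar A" "Dom A (\<zeta> a) = Z (source Q a)" "Cod A (\<zeta> a) = Z (target Q a)"
    "\<zeta> a \<cdot> N (source Q a) = N (target Q a) \<cdot> arrow_map Q ?X a" 
    "P (target Q a) \<cdot> \<zeta> a = arrow_map Q ?Y a \<cdot> P (source Q a)" if a: "a \<in> arrows Q" for a
  proof -
    have "a \<in> into (target Q a)" using a by simp
    then show "\<zeta> a \<in> Ar A" "Dom A (\<zeta> a) = Z (source Q a)" "Cod A (\<zeta> a) = Z (target Q a)"
      "\<zeta> a \<cdot> N (source Q a) = N (target Q a) \<cdot> arrow_map Q ?X a" 
      "P (target Q a) \<cdot> \<zeta> a = arrow_map Q ?Y a \<cdot> P (source Q a)"
      using g [of "target Q a"] arrow_simps(2) [OF a] unfolding N_def P_def Z_def \<zeta>_def by blast+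
  qed
  have \<phi>: "\<exists>S \<kappa> \<phi>. is_coproduct A (into v) (\<lambda>a. Cod A (D (source Q a))) S \<kappa> \<and> \<phi> \<in> cof \<and> Dom A \<phi> = S \<and> 
        Cod A \<phi> = Cod A (D v) \<and> (\<forall>a \<in> into v. \<phi> \<cdot> (\<kappa> a \<cdot> D (source Q a)) = D v \<cdot> \<zeta> a)" if v: "v \<in> verts Q" for v
  proof -
    obtain S \<kappa> \<phi> where a: "is_coproduct A (into v) (\<lambda>a. Cod A (D (source Q a))) S \<kappa>" "\<phi> \<in> cof" "Dom A \<phi> = S"
        "Cod A \<phi> = Cod A (D v)" "\<forall>a \<in> into v. \<phi> \<cdot> (\<kappa> a \<cdot> D (source Q a)) = D v \<cdot> ?z (g v) a"
      using g [of v] v unfolding D_def by blast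
    have "\<forall>a \<in> into v. \<phi> \<cdot> (\<kappa> a \<cdot> D (source Q a)) = D v \<cdot> \<zeta> a" using a(5) unfolding \<zeta>_def by simp
    with a show ?thesis by blast
  qed
  note D' = cokernelD [OF B(7)]
  have PAr: "P v \<in> Ar A" and NAr: "N v \<in> Ar A" if "v \<in> verts Q" for v 
    using tfib_epic [OF B(3) [OF that]] B(1) [OF that] by simp_all
  have ZO: "Z v \<in> Ob A" if "v \<in> verts Q" for v using NAr that unfolding Z_def by simp
  note zrep = rep [of Z \<zeta>, OF ZO]
  have zr: "is_functor (free_category Q) A (rep Z \<zeta>)" "\<And>v. v \<in> verts Q \<Longrightarrow> obj_map (rep Z \<zeta>) v = Z v"
    "\<And>a. a \<in> arrows Q \<Longrightarrow> arrow_map Q (rep Z \<zeta>) a = \<zeta> a" using zz by (intro zrep; simp)+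
  have "\<exists>e. e \<in> Ar A \<and> Dom A e = Cod A (D (source Q a)) \<and> Cod A e = Cod A (D (target Q a)) \<and> 
     e \<cdot> D (source Q a) = D (target Q a) \<cdot> \<zeta> a" if a: "a \<in> arrows Q" for a
  proof -
    note s = arrow_simps [OF a]
    have "(D (target Q a) \<cdot> \<zeta> a) \<cdot> N (source Q a) = D (target Q a) \<cdot> (N (target Q a) \<cdot> arrow_map Q ?X a)"
      using zz [OF a] D' [OF s(2)] NAr [OF s(1)] Z_def by simp
    also have "\<dots> = Zero A (Dom A (N (source Q a))) (Cod A (D (target Q a)))"
      using reassoc [OF D'(4) [OF s(2)], of "arrow_map Q ?X a"] D' [OF s(2)] B(2) [OF s(1)] B(2) [OF s(2)] XY a by simp
    finally show ?thesis
      using cokernel_lift [OF B(7) [OF s(1)], of "D (target Q a) \<cdot> \<zeta> a"] zz [OF a] D' [OF s(2)] Z_def by simp metis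
  qed
  then obtain \<delta> where \<delta>: "\<And>a. a \<in> arrows Q \<Longrightarrow> \<delta> a \<in> Ar A \<and> Dom A (\<delta> a) = Cod A (D (source Q a)) \<and> 
      Cod A (\<delta> a) = Cod A (D (target Q a))" "\<And>a. a \<in> arrows Q \<Longrightarrow> \<delta> a \<cdot> D (source Q a) = D (target Q a) \<cdot> \<zeta> a"
    by metis
  let ?D = "rep (\<lambda>v. Cod A (D v)) \<delta>"
  have dr: "is_functor (free_category Q) A ?D" "\<And>v. v \<in> verts Q \<Longrightarrow> obj_map ?D v = Cod A (D v)"
    "\<And>a. a \<in> arrows Q \<Longrightarrow> arrow_map Q ?D a = \<delta> a" using \<delta> D' by (intro rep; simp)+
  let ?N = "mk_nat ?X N (rep Z \<zeta>)" and ?p = "mk_nat (rep Z \<zeta>) P ?Y" and ?c = "mk_nat (rep Z \<zeta>) D ?D"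
  have N: "?N \<in> Ar R"
    by (rule mk_rep_nat [OF XY(1) zr(1)]) (use NAr B(2) zr Z_def zz in simp_all)
  have p: "?p \<in> Ar R"
    by (rule mk_rep_nat [OF zr(1) XY(2)]) (use PAr B(4,5) zr zz in simp_all)
  have c: "?c \<in> Ar R"
    by (rule mk_rep_nat [OF zr(1) dr(1)]) (use D' \<delta> zr dr Z_def in simp_all)
  have "f = ?p \<cdot>\<^bsub>R\<^esub> ?N"
    by (rule Ar_eqI) (use f N p B(6) in simp_all)
  moreover have "is_cokernel R ?c ?N"
    by (rule is_cokernel_R) (use c N B(7) in simp_all)
  moreover have "monic R ?N"
    by (rule monic_RI) (use N B(1) in simp_all)
  ultimately have 1: "f = ?p \<cdot>\<^bsub>R\<^esub> ?N" "short_exact R ?N ?c" using R.short_exact_cokernel by auto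
  have "?D \<in> RC"
    unfolding RC_iff
  proof (intro conjI ballI dr(1))
    fix v assume v: "v \<in> verts Q"
    show "obj_map ?D v \<in> C" using dr(2) B(8) v by simp
    obtain S \<kappa> \<phi> where \<phi>: "is_coproduct A (into v) (\<lambda>a. Cod A (D (source Q a))) S \<kappa>" "\<phi> \<in> cof" "Dom A \<phi> = S"
        "Cod A \<phi> = Cod A (D v)" "\<forall>a \<in> into v. \<phi> \<cdot> (\<kappa> a \<cdot> D (source Q a)) = D v \<cdot> \<zeta> a" using \<phi> [OF v] by blast
    note S = coproductD [OF \<phi>(1)]
    have \<phi>A: "\<phi> \<in> Ar A" using cof_monic [OF \<phi>(2)] by simp
    have e: "\<phi> \<cdot> \<kappa> a = \<delta> a" if a: "a \<in> into v" for a
    proof -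
      have s: "source Q a \<in> verts Q" "a \<in> arrows Q" "target Q a = v" using a by auto
      have "(\<phi> \<cdot> \<kappa> a) \<cdot> D (source Q a) = \<delta> a \<cdot> D (source Q a)"
        using \<delta>(2) [OF s(2)] s \<phi>(3-5) \<phi>A S a D' [OF s(1)] by simp
      then show ?thesis using epicD [OF cokernel_epic [OF B(7) [OF s(1)]], of "\<phi> \<cdot> \<kappa> a" "\<delta> a"]
        \<delta>(1) [OF s(2)] s \<phi>(3,4) \<phi>A S a by simp
    qed
    have "is_coproduct A (into v) (\<lambda>a. obj_map ?D (source Q a)) S \<kappa>"
      using \<phi>(1) dr(2) unfolding is_coproduct_def by simp
    then have "is_phi Q A ?D v \<phi>" unfolding is_phi_def Hom_iff using e \<phi>(3,4) \<phi>A dr(2,3) v by auto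
    then show "\<exists>\<phi> \<in> cof. is_phi Q A ?D v \<phi>" using \<phi>(2) by blast
  qed
  then show ?thesis using 1 N p B(3) by (intro exI [of _ ?N] exI [of _ ?p] exI [of _ ?c]) simp
qed

lemma tfib_kernel_pointwise:
  assumes p: "p \<in> Ar R" "\<And>v. v \<in> verts Q \<Longrightarrow> cpt p v \<in> tfib" and k: "short_exact R k p"
  shows "Dom R k \<in> RW"
  unfolding RW_iff
proof (intro conjI ballI)
  note s = R.short_exactD [OF k]
  show "is_functor (free_category Q) A (Dom R k)" using s by auto
  fix v assume v: "v \<in> verts Q"
  have "short_exact A (cpt k v) (cpt p v)" using short_exact_R_pointwise [OF k] v by simp
  then have "is_kernel A (cpt k v) (cpt p v)" by (rule short_exactD)
  from tfib_kernel [OF p(2) [OF v] this] show "obj_map (Dom R k) v \<in> W" using s v by simp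
qed

text \<open>
  Factor \<open>0 \<rightarrow> X\<close>. The cokernel of the first factor is its target up to isomorphism.
\<close>

lemma RC_precover:
  assumes X: "X \<in> Ob R"
  obtains f g where "short_exact R f g" "Dom R f \<in> RW" "Cod R f \<in> RC" "Cod R g = X"
proof -
  obtain B where B: "zero_object R B" using R.zero_ex by blast
  note B' = R.zero_object_Ob [OF B]
  have z: "Zero R B X \<in> Ar R" "Dom R (Zero R B X) = B" "Cod R (Zero R B X) = X"
    using R.Zero_simps [OF B' X] by auto
  obtain n p d where n: "n \<in> Ar R" "p \<in> Ar R" "Cod R n = Dom R p" "Zero R B X = p \<cdot>\<^bsub>R\<^esub> n"
    "\<forall>v \<in> verts Q. cpt p v \<in> tfib" "short_exact R n d" "Cod R d \<in> RC"
    using factorization_R [OF z(1)] by blast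
  note s = R.short_exactD [OF n(6)]
  have "Dom R n = B" using z(2) n(1-3) unfolding n(4) by simp
  then have n0: "n = Zero R B (Dom R p)" using R.from_zero [OF B n(1)] n(3) by simp
  have PO: "Dom R p \<in> Ob R" using R.Dom_Ob [OF n(2)] .
  have "is_cokernel R (Ident R (Dom R p)) n" unfolding n0 by (rule R.cokernel_from_zero(1) [OF B PO])
  moreover have "d \<cdot>\<^bsub>R\<^esub> n = Zero R (Dom R n) (Cod R d)" by (rule s(6))
  moreover have dn: "Ident R (Dom R p) \<cdot>\<^bsub>R\<^esub> n = Zero R (Dom R n) (Dom R p)"
    using n0 \<open>Dom R n = B\<close> R.comp_Ident(2) [OF n(1,3)] by simp
  obtain r where r: "r \<in> Ar R" "Cod R r = Dom R p" "Dom R r = Cod R d" "r \<cdot>\<^bsub>R\<^esub> d = Ident R (Dom R p)"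
    using R.cokernel_lift [OF s(8), of "Ident R (Dom R p)" "Dom R p"] dn PO n(3) by auto
  have dd: "Dom R d = Dom R p" using s(3) n(3) by simp
  have "Dom R p \<in> RC"
    by (rule RC_retract [OF n(7) s(2) dd refl r(1) r(3,2,4)])
  moreover obtain k where k: "is_kernel R k p" using R.kernel_ex [OF n(2)] by blast
  have "epic R p" by (rule epic_RI [OF n(2)]) (use n(5) tfib_epic in simp)
  then have kp: "short_exact R k p" using k R.short_exact_kernel by simp
  moreover have "Dom R k \<in> RW" by (rule tfib_kernel_pointwise [OF n(2) _ kp]) (use n(5) in simp)
  moreover have "Cod R p = X" using z(3) n(1-3) unfolding n(4) by simp
  moreover have "Cod R k = Dom R p" using R.short_exactD(3) [OF kp] .
  ultimately show thesis using that [of k p] by simp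
qed

text \<open>
  Factor \<open>X \<rightarrow> 0\<close>. The kernel of the second factor is its source.
\<close>

lemma RC_preenvelope:
  assumes X: "X \<in> Ob R"
  obtains f g where "short_exact R f g" "Dom R f = X" "Cod R f \<in> RW" "Cod R g \<in> RC"
proof -
  obtain B where B: "zero_object R B" using R.zero_ex by blast
  note B' = R.zero_object_Ob [OF B]
  have z: "Zero R X B \<in> Ar R" "Dom R (Zero R X B) = X" "Cod R (Zero R X B) = B"
    using R.Zero_simps [OF X B'] by auto
  obtain n p d where n: "n \<in> Ar R" "p \<in> Ar R" "Cod R n = Dom R p" "Zero R X B = p \<cdot>\<^bsub>R\<^esub> n"
    "\<forall>v \<in> verts Q. cpt p v \<in> tfib" "short_exact R n d" "Cod R d \<in> RC"
    using factorization_R [OF z(1)] by blast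
  have e: "Dom R n = X" "Cod R p = B" using z(2,3) n(1-3) unfolding n(4) by simp_all
  have PO: "Dom R p \<in> Ob R" using R.Dom_Ob [OF n(2)] .
  have "p = Zero R (Dom R p) B" using R.to_zero [OF B n(2) e(2)] .
  then have "short_exact R (Ident R (Dom R p)) p"
    using R.kernel_to_zero [OF B PO] R.short_exact_kernel by simp
  from tfib_kernel_pointwise [OF n(2) _ this] have "Dom R p \<in> RW" using n(5) R.Ident_simps(2) [OF PO] by simp
  then show thesis using that [OF n(6) e(1)] n(3,7) by simp
qed

text \<open>
  By \<open>RC_splits\<close> the classes are orthogonal. Conversely, an object that is orthogonal to one class is a
  retract of an object of the other, because its approximation splits.
\<close>

theorem complete_cotorsion_pair_R: "complete_cotorsion_pair R RC RW"
proof -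
  have ob: "X \<in> Ob R" if "X \<in> RC \<or> X \<in> RW" for X using that RC_iff RW_iff by auto
  have ext: "Ext_vanishes R 1 X Y" if "X \<in> RC" "Y \<in> RW" for X Y
    using RC_splits [OF that] R.Ext_vanishes_1_iff_splits ob that by blast
  have L: "X \<in> RC" if X: "X \<in> Ob R" "\<forall>Y \<in> RW. Ext_vanishes R 1 X Y" for X
  proof -
    obtain f g where fg: "short_exact R f g" "Dom R f \<in> RW" "Cod R f \<in> RC" "Cod R g = X" by (rule RC_precover [OF X(1)])
    note s = R.short_exactD [OF fg(1)]
    have "splits R X (Dom R f)" using X fg(2) R.Ext_vanishes_1_iff_splits ob by blast
    then obtain t where t: "t \<in> Ar R" "Dom R t = X" "Cod R t = Cod R f" "g \<cdot>\<^bsub>R\<^esub> t = Ident R X"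
      by (rule splitsE [OF _ fg(1) refl fg(4)])
    show ?thesis by (rule RC_retract [OF fg(3) t(1-3) s(2) s(3) [symmetric] fg(4) t(4)])
  qed
  have Rr: "Y \<in> RW" if Y: "Y \<in> Ob R" "\<forall>X \<in> RC. Ext_vanishes R 1 X Y" for Y
  proof -
    obtain f g where fg: "short_exact R f g" "Dom R f = Y" "Cod R f \<in> RW" "Cod R g \<in> RC" by (rule RC_preenvelope [OF Y(1)])
    note s = R.short_exactD [OF fg(1)]
    have "splits R (Cod R g) Y" using Y fg(4) R.Ext_vanishes_1_iff_splits ob by blast
    then obtain r where r: "r \<in> Ar R" "Cod R r = Y" "Dom R r = Cod R f" "r \<cdot>\<^bsub>R\<^esub> f = Ident R Y"
      using R.splits_extend [of "Cod R g" Y f g "Ident R Y"] fg Y(1) R.Ident_simps [OF Y(1)] by auto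
    have Yf: "is_functor (free_category Q) A Y" using Y by simp
    have "obj_map Y v \<in> W" if v: "v \<in> verts Q" for v
    proof (rule W_retract)
      show "obj_map (Cod R f) v \<in> W" using fg(3) v RW_iff by simp
      show "cpt f v \<in> Hom A (obj_map Y v) (obj_map (Cod R f) v)" "cpt r v \<in> Hom A (obj_map (Cod R f) v) (obj_map Y v)"
        using s(1) r fg v by (auto simp: Hom_iff)
      show "cpt r v \<cdot> cpt f v = Ident A (obj_map Y v)"
        using R_comp_simps(4) [of f r v] s(1) r v Yf by simp
    qed
    then show ?thesis using Yf RW_iff by simp
  qed
  have "RC = left_perp R RW" unfolding left_perp_def using L ext ob by blast
  moreover have "RW = right_perp R RC" unfolding right_perp_def using Rr ext ob by blast
  ultimately have "cotorsion_pair R RC RW" unfolding cotorsion_pair_def by blast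
  moreover have "\<exists>f g. short_exact R f g \<and> Dom R f \<in> RW \<and> Cod R f \<in> RC \<and> Cod R g = X" if "X \<in> Ob R" for X
    by (rule RC_precover [OF that]) blast
  moreover have "\<exists>f g. short_exact R f g \<and> Dom R f = X \<and> Cod R f \<in> RW \<and> Cod R g \<in> RC" if "X \<in> Ob R" for X
    by (rule RC_preenvelope [OF that]) blast
  ultimately show ?thesis unfolding complete_cotorsion_pair_def by blast
qed

lemma thick_RW: assumes W: "thick A W" shows "thick R RW"
  unfolding thick_def
proof (intro conjI allI impI)
  show "RW \<subseteq> Ob R" using RW_iff by auto
  show "X \<in> RW" if S: "S \<in> RW \<and> direct_summand R X S" for X S
  proof -
    obtain Y i j p q where "is_biproduct R X Y S i j p q" using S unfolding direct_summand_def by blast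
    note b = R.biproductD [OF this]
    have Xf: "is_functor (free_category Q) A X" using b(1) by simp
    have "obj_map X v \<in> W" if v: "v \<in> verts Q" for v
    proof (rule W_retract)
      show "obj_map S v \<in> W" using \<open>S \<in> RW \<and> direct_summand R X S\<close> v RW_iff by simp
      show "cpt i v \<in> Hom A (obj_map X v) (obj_map S v)" "cpt p v \<in> Hom A (obj_map S v) (obj_map X v)"
        using b(4-6,10-12) v by (auto simp: Hom_iff)
      show "cpt p v \<cdot> cpt i v = Ident A (obj_map X v)"
        using R_comp_simps(4) [of i p v] b(4-6,10-12) b(16) v Xf by simp
    qed
    then show ?thesis using Xf RW_iff by simp
  qed
  fix f g assume fg: "short_exact R f g"
  note s = R.short_exactD [OF fg]
  have e: "short_exact A (cpt f v) (cpt g v)" "Dom A (cpt f v) = obj_map (Dom R f) v" 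
    "Cod A (cpt f v) = obj_map (Cod R f) v" "Cod A (cpt g v) = obj_map (Cod R g) v" if "v \<in> verts Q" for v
    using short_exact_R_pointwise [OF fg] s that by auto
  have w: "obj_map (Dom R f) v \<in> W \<and> obj_map (Cod R f) v \<in> W \<longrightarrow> obj_map (Cod R g) v \<in> W"
    "obj_map (Dom R f) v \<in> W \<and> obj_map (Cod R g) v \<in> W \<longrightarrow> obj_map (Cod R f) v \<in> W"
    "obj_map (Cod R f) v \<in> W \<and> obj_map (Cod R g) v \<in> W \<longrightarrow> obj_map (Dom R f) v \<in> W" if v: "v \<in> verts Q" for v
    using W e(1) [OF v] unfolding thick_def e(2-4) [OF v, symmetric] by blast+
  have F: "is_functor (free_category Q) A (Dom R f)" "is_functor (free_category Q) A (Cod R f)" 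
    "is_functor (free_category Q) A (Cod R g)" using s by auto
  show "Cod R g \<in> RW" if "Dom R f \<in> RW \<and> Cod R f \<in> RW" using that w F unfolding RW_iff by blast
  show "Cod R f \<in> RW" if "Dom R f \<in> RW \<and> Cod R g \<in> RW" using that w F unfolding RW_iff by blast
  show "Dom R f \<in> RW" if "Cod R f \<in> RW \<and> Cod R g \<in> RW" using that w F unfolding RW_iff by blast
qed

end

text \<open>
  Coproducts are colimits over discrete categories.
\<close>

lemma bicomplete_has_coproducts:
  assumes A: "abelian A" and b: "bicomplete TYPE('k) A"
  shows "has_coproducts TYPE('k) A"
  unfolding has_coproducts_def
proof (intro allI impI)
  interpret abelian A by (rule A)
  fix I :: "'k set" and X assume X: "\<forall>i \<in> I. X i \<in> Ob A"
  define J where "J = \<lparr>Ob = I, Ar = I, Dom = (\<lambda>i. i), Cod = (\<lambda>i. i), Ident = (\<lambda>i. i), Comp = (\<lambda>g f. f)\<rparr>"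
  define F where "F = \<lparr>obj_map = restrict X I, arr_map = restrict (\<lambda>i. Ident A (X i)) I\<rparr>"
  have J: "Ob J = I" "Ar J = I" "Dom J i = i" "Cod J i = i" "Ident J i = i" "Comp J f g = g" for i f g
    by (auto simp: J_def)
  have F: "obj_map F i = X i" "arr_map F i = Ident A (X i)" if "i \<in> I" for i using that by (auto simp: F_def)
  have "category J" unfolding category_def by (auto simp: J Hom_iff)
  moreover have "is_functor J A F" unfolding is_functor_def using X by (auto simp: J F Hom_iff) (auto simp: F_def)
  ultimately obtain L \<iota> where L: "is_colimit J A F L \<iota>" using b unfolding bicomplete_def by blast
  have cocone: "is_cocone J A F T t \<longleftrightarrow> T \<in> Ob A \<and> (\<forall>i \<in> I. t i \<in> Hom A (X i) T)" for T t
    unfolding is_cocone_def using X by (auto simp: J F Hom_iff)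
  have "is_coproduct A I X L \<iota>"
    using L X unfolding is_colimit_def cocone is_coproduct_def J by blast
  then show "\<exists>S \<iota>. is_coproduct A I X S \<iota>" by blast
qed

theorem theorem3p5:
  fixes M :: "('o, 'm) preadd"
    and Q :: "('k, 'k) quiver"
    and \<C> \<W> :: "'o set"
  assumes "infinite (UNIV :: 'k set)"
    and "abelian_category M"
    and "bicomplete TYPE('k) M"
    and "enough_projectives M"
    and "enough_injectives M"
    and "coproducts_of_monics_monic TYPE('k) M"
    and "products_of_epics_epic TYPE('k) M"
    and "is_quiver Q"
    and "left_rooted Q"
    and "projective_cotorsion_pair M \<C> \<W>"
    and "hereditary M \<C> \<W>"
    and "closed_under_small_coproducts TYPE('k) M \<W>"
  shows "\<exists>S. projective_model_structure (Rep Q M) S \<and>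
           Hovey_triple_of (Rep Q M) S = (Phi Q M \<C>, Rep_class Q M \<W>, Ob (Rep Q M)) \<and>
           hereditary_Hovey_triple (Rep Q M) (Hovey_triple_of (Rep Q M) S)"
proof -
  have M: "abelian M" by (rule abelian.intro [OF assms(2)])
  interpret M: abelian M by (rule M)
  have cp: "complete_cotorsion_pair M \<C> \<W>" and CW: "\<C> \<inter> \<W> = Proj M" and W: "thick M \<W>"
    using assms(10) unfolding projective_cotorsion_pair_def by auto
  have co: "has_coproducts TYPE('k) M" by (rule bicomplete_has_coproducts [OF M assms(3)])
  have wf: "wf {(source Q a, target Q a) |a. a \<in> arrows Q}" by (rule left_rooted_wf [OF assms(8,9)])
  interpret C: quiver_cotorsion M \<C> \<W> Q
    by unfold_locales (rule cp assms(4) co assms(6,8) wf)+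
  \<comment> \<open>The induced pair for the projective objects determines the projective representations.\<close>
  interpret P: quiver_cotorsion M "Proj M" "Ob M" Q
    by unfold_locales (rule M.Proj_complete [OF assms(4)] assms(4) co assms(6,8) wf)+
  have Ob: "Rep_class Q M (Ob M) = Ob C.R" using P.RW_iff by auto
  interpret PR: cotorsion C.R "Phi Q M (Proj M)" "Ob C.R"
    by unfold_locales (use P.complete_cotorsion_pair_R Ob in simp)
  have Phi_Proj: "Phi Q M (Proj M) = Proj C.R"
  proof
    show "Proj C.R \<subseteq> Phi Q M (Proj M)" by (rule PR.Proj_subset)
    show "Phi Q M (Proj M) \<subseteq> Proj C.R"
    proof
      fix X assume X: "X \<in> Phi Q M (Proj M)"
      then show "X \<in> Proj C.R" unfolding Proj_def
        using C.R.projective_iff_splits [OF PR.C_Ob [OF X]] PR.C_splits [OF X] by simp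
    qed
  qed
  have ep: "enough_projectives C.R"
    unfolding enough_projectives_def
  proof
    fix X assume "X \<in> Ob C.R"
    then obtain f g where fg: "short_exact C.R f g" "Cod C.R f \<in> Phi Q M (Proj M)" "Cod C.R g = X"
      using PR.precover by metis
    note s = C.R.short_exactD [OF fg(1)]
    have "Dom C.R g \<in> Proj C.R" using fg(2) s(3) unfolding Phi_Proj by simp
    then show "\<exists>e. projective C.R (Dom C.R e) \<and> epic C.R e \<and> Cod C.R e = X"
      using fg(3) s(5) by (intro exI [of _ g]) (simp add: Proj_def)
  qed
  have "Phi Q M \<C> \<inter> Rep_class Q M \<W> = Phi Q M (Proj M)"
  proof (intro equalityI subsetI IntI)
    fix X assume "X \<in> Phi Q M \<C> \<inter> Rep_class Q M \<W>"
    then have X: "X \<in> Phi Q M \<C>" "X \<in> Rep_class Q M \<W>" by auto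
    show "X \<in> Phi Q M (Proj M)"
      unfolding P.RC_iff
    proof (intro conjI ballI)
      show "is_functor (free_category Q) M X" using X C.RC_iff by simp
      fix v assume v: "v \<in> verts Q"
      show Xv: "obj_map X v \<in> Proj M" using X v unfolding C.RC_iff C.RW_iff CW [symmetric] by simp
      obtain \<phi> where \<phi>: "\<phi> \<in> C.cof" "is_phi Q M X v \<phi>" using X(1) v unfolding C.RC_iff by blast
      obtain S \<iota> where S: "is_coproduct M (C.into v) (\<lambda>a. obj_map X (source Q a)) S \<iota>" "\<phi> \<in> Ar M" "Dom M \<phi> = S" 
        "Cod M \<phi> = obj_map X v" by (rule C.is_phiE [OF \<phi>(2)])
      obtain c where c: "monic M \<phi>" "is_cokernel M c \<phi>" "Cod M c \<in> \<C>"
        using \<phi>(1) unfolding monics_with_cokernel_in_def by blast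
      \<comment> \<open>Closure of \<open>W\<close> under coproducts puts the domain of \<open>\<phi>\<close>, and with it the cokernel, into \<open>W\<close>.\<close>
      have "\<forall>a \<in> C.into v. obj_map X (source Q a) \<in> \<W>" using X(2) unfolding C.RW_iff by auto
      then have "S \<in> \<W>" using assms(12) S(1) unfolding closed_under_small_coproducts_def by blast
      moreover have "obj_map X v \<in> \<W>" using X(2) v unfolding C.RW_iff by simp
      moreover have "short_exact M \<phi> c" using c M.short_exact_cokernel by simp
      ultimately have "Cod M c \<in> \<W>" using thick_cokernel [OF W] S(3,4) by simp
      then have "\<phi> \<in> P.cof" using c CW unfolding monics_with_cokernel_in_def by blast
      then show "\<exists>\<phi> \<in> P.cof. is_phi Q M X v \<phi>" using \<phi>(2) by blast
    qed
  next
    fix X assume X: "X \<in> Phi Q M (Proj M)"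
    have "P.cof \<subseteq> C.cof" using CW unfolding monics_with_cokernel_in_def by auto
    then show "X \<in> Phi Q M \<C>" using X CW unfolding C.RC_iff P.RC_iff by blast
    show "X \<in> Rep_class Q M \<W>" using X CW unfolding C.RW_iff P.RC_iff by blast
  qed
  then interpret PC: projective_cotorsion C.R "Phi Q M \<C>" "Rep_class Q M \<W>"
    by unfold_locales (simp_all add: C.complete_cotorsion_pair_R ep C.thick_RW [OF W] Phi_Proj)
  show ?thesis unfolding C.Rep_R using PC.projective_model_structure_exists by metis
qed

end
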